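(* (Quantum modularity conjecture for the figure-eight knot $4_1$.) For $x\in\mathbb Q$ let $J(x)=\sum_{n=0}^{\infty}|(q;q)_n|^2$ with $q=e^{2\pi i x}$. Let $V=\mathrm{Vol}(S^3\smallsetminus 4_1)=2.02988\ldots$. For every $\alpha\in\mathbb Q/\mathbb Z$ there exists a formal power series $\Phi_\alpha(h)\in\overline{\mathbb Q}[[h]]$ such that, for every matrix $\begin{pmatrix}a&b\\c&d\end{pmatrix}\in \mathrm{SL}_2(\mathbb Z)$ with $c>0$, $$J\Bigl(\frac{aX+b}{cX+d}\Bigr)\;\sim\;(cX+d)^{3/2}\,J(X)\,e^{\frac{V}{2\pi}\left(X+\frac dc\right)}\,\Phi_{a/c}\Bigl(\frac{2\pi i}{c(cX+d)}\Bigr)$$ to all orders in $1/X$ as $X$ tends to $+\infty$ through rational numbers with bounded denominator. That is, writing $\Phi_{a/c}(h)=\sum_{k\ge0}A_kh^k$, for every $D\ge1$ and every $K\ge0$ one has $$\frac{J\bigl(\frac{aX+b}{cX+d}\bigr)}{(cX+d)^{3/2}\,J(X)\,e^{\frac{V}{2\pi}(X+d/c)}}=\sum_{k=0}^{K}A_k\Bigl(\frac{2\pi i}{c(cX+d)}\Bigr)^k+O\bigl(X^{-K-1}\bigr)$$ as $X\to+\infty$ in $\mathbb Q$ with denominator at most $D$.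
   Context: $(q;q)_n=\prod_{j=1}^n(1-q^j)$. For $x\in\mathbb Q$ and $q=e^{2\pi i x}$ one has $(q;q)_n=0$ for all $n\ge\mathrm{den}(x)$, so the sum defining $J(x)$ is finite. The term $n=0$ equals $1$ and all terms are non-negative, so $J(x)\ge1$. The function $J$ is $1$-periodic; it is the Galois-equivariant extension of the Kashaev invariant of the figure-eight knot. $V$ denotes the hyperbolic volume of the complement of the figure-eight knot, $V=2\,\mathrm{Im}\,\mathrm{Li}_2(e^{\pi i/3})$. $\overline{\mathbb Q}$ is the field of algebraic numbers in $\mathbb C$. The denominator of a rational number is the positive denominator in lowest terms. *)

theory Defs
  imports
    "HOL-Analysis.Analysis"
    "HOL-Computational_Algebra.Computational_Algebra"
    "HOL-Library.Landau_Symbols"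
begin

text \<open>The finite q-Pochhammer symbol \<open>(q;q)\<^sub>n\<close>.\<close>

definition qpoch :: "complex \<Rightarrow> nat \<Rightarrow> complex" where
  "qpoch q n = (\<Prod>j=1..n. 1 - q ^ j)"

definition rat_denom :: "rat \<Rightarrow> int" where
  "rat_denom x = snd (quotient_of x)"

definition root_of_unity_at :: "rat \<Rightarrow> complex" where
  "root_of_unity_at x = exp (2 * of_real pi * \<i> * of_rat x)"

definition J :: "rat \<Rightarrow> real" where
  "J x = (\<Sum>n. (cmod (qpoch (root_of_unity_at x) n))\<^sup>2)"

text \<open>
  The dilogarithm on the closed unit disc, where its defining power series converges
  absolutely; outside the disc the series diverges and the value is meaningless.
\<close>

definition Li2 :: "complex \<Rightarrow> complex" where
  "Li2 z = (\<Sum>n. z ^ Suc n / of_nat (Suc n) ^ 2)"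

text \<open>
  The hyperbolic volume of the complement of the figure-eight knot, given by its classical
  value in terms of the dilogarithm.
\<close>

definition vol_figure_eight :: real where
  "vol_figure_eight = 2 * Im (Li2 (exp (of_real pi * \<i> / 3)))"

text \<open>Divergence to \<open>+\<infinity>\<close> through the rationals of denominator at most \<open>D\<close>.\<close>

definition at_top_denom_le :: "nat \<Rightarrow> rat filter" where
  "at_top_denom_le D = inf at_top (principal {X. rat_denom X \<le> int D})"

text \<open>The series defining \<open>J\<close> is a finite sum, and the series of \<open>Li2\<close> converges where it is used.\<close>

lemma root_of_unity_at_power_denom:
  "root_of_unity_at x ^ nat (rat_denom x) = 1"
proof -
  obtain p r where pr: "quotient_of x = (p, r)" by (cases "quotient_of x")
  have r: "r > 0" and x: "x = of_int p / of_int r"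
    using quotient_of_denom_pos[OF pr] quotient_of_div[OF pr] by auto
  have eq: "(of_nat (nat r) :: complex) = of_int r" using r by simp
  have "root_of_unity_at x ^ nat r = exp (of_nat (nat r) * (2 * of_real pi * \<i> * of_rat x))"
    unfolding root_of_unity_at_def by (rule exp_of_nat_mult [symmetric])
  also have "of_nat (nat r) * (2 * of_real pi * \<i> * of_rat x)
      = (2 * of_int p * of_real pi) * \<i>"
    unfolding eq using r by (simp add: x of_rat_divide)
  also have "exp \<dots> = 1"
    by (subst exp_eq_1) auto
  finally show ?thesis by (simp add: rat_denom_def pr)
qed

lemma qpoch_root_of_unity_eq_0:
  assumes "n \<ge> nat (rat_denom x)"
  shows "qpoch (root_of_unity_at x) n = 0"
proof -
  have "rat_denom x > 0"
    using quotient_of_denom_pos' by (simp add: rat_denom_def)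
  then have "nat (rat_denom x) \<in> {1..n}" using assms by auto
  then show ?thesis
    unfolding qpoch_def
    by (intro prod_zero) (auto intro!: bexI[of _ "nat (rat_denom x)"] simp: root_of_unity_at_power_denom)
qed

lemma J_finite_sum:
  "J x = (\<Sum>n<nat (rat_denom x). (cmod (qpoch (root_of_unity_at x) n))\<^sup>2)"
  unfolding J_def by (rule suminf_finite) (auto simp: qpoch_root_of_unity_eq_0)

lemma summable_Li2:
  assumes "norm z \<le> 1"
  shows "summable (\<lambda>n. z ^ Suc n / of_nat (Suc n) ^ 2 :: complex)"
proof (rule summable_comparison_test')
  show "summable (\<lambda>n. inverse (of_nat (Suc n) ^ 2 :: real))"
    by (subst summable_Suc_iff) (rule inverse_power_summable, simp)
  show "norm (z ^ Suc n / of_nat (Suc n) ^ 2) \<le> inverse (of_nat (Suc n) ^ 2)" if "n \<ge> 0" for n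
  proof -
    have "norm z ^ Suc n \<le> 1" using assms by (rule power_le_one[OF norm_ge_zero])
    then have "norm z ^ Suc n * inverse (of_nat (Suc n) ^ 2) \<le> 1 * inverse (of_nat (Suc n) ^ 2 :: real)"
      by (intro mult_right_mono) auto
    then show ?thesis
      unfolding norm_divide norm_power norm_of_nat by (simp only: divide_inverse mult_1_left)
  qed
qed

end

theory Submission
  imports Defs "HOL-Complex_Analysis.Complex_Analysis" "HOL-Probability.Distributions" "HOL-Real_Asymp.Real_Asymp"
begin

text \<open>
  Write \<open>M = c X + d\<close>. The image \<open>a X + b\<close> over \<open>c X + d\<close> equals \<open>a / c - 1 / (c M)\<close>, so the
  \<open>n\<close>-th summand of \<open>J\<close> there is the product over \<open>j \<le> n\<close> of \<open>(2 sin (\<pi> \<xi>\<^sub>j))\<^sup>2\<close> with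
  \<open>\<xi>\<^sub>j = j / (c M) - j a / c\<close>. Within one residue class of \<open>j\<close> modulo \<open>c\<close> these arguments move,
  modulo integers, in steps of \<open>1 / M\<close>. As long as they stay away from integers, Euler--Maclaurin
  summation evaluates the logarithm of the product to all orders in \<open>1 / M\<close>. They come close to
  an integer only when \<open>j / M\<close> is close to an integer \<open>m\<close>, and then only in one class,
  \<open>j \<equiv> m d\<close> modulo \<open>c\<close>, along which \<open>\<xi>\<^sub>j\<close> is congruent to \<open>(l - m X) / M\<close> with integral \<open>l\<close>.
  The product formula for \<open>2 sin (\<pi> L x)\<close> shows that such a passage multiplies the term by
  \<open>(2 sin (\<pi> m X))\<^sup>2\<close>, and by \<open>M\<close> at the start \<open>m = 0\<close> (\<open>crossing_unit\<close>, \<open>crossing\<close>, \<open>bulk\<close>).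
  Hence, for \<open>n / M\<close> between \<open>m\<close> and \<open>m + 1\<close>, the \<open>n\<close>-th term at the image is \<open>M\<close> times the
  \<open>m\<close>-th term of \<open>J X\<close> times \<open>exp (log_amplitude M K n)\<close>, up to a factor \<open>1 + O(M powr (1 - K))\<close>: the finite
  sum \<open>J X\<close> appears inside \<open>J\<close> of the image.

  The leading part of \<open>log_amplitude M K n\<close> is \<open>(2 M / c) lob (n / M - m)\<close>, where \<open>lob\<close> is a primitive of
  \<open>ln \<bar>2 sin (\<pi> x)\<bar>\<close>, namely \<open>- 1 / (2 \<pi>)\<close> times the imaginary part of the dilogarithm on the unit circle. On a
  period it has its only maximum at \<open>5/6\<close>, with \<open>4 \<pi> lob (5/6)\<close> equal to the hyperbolic volume of
  the figure-eight knot; this is the exponential factor of the theorem. Near the peak the terms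
  form Gaussian sums of width \<open>sqrt M\<close> over the residue classes modulo \<open>c\<close>. Such a sum agrees with the
  Gaussian integral to all orders (\<open>gauss_lattice\<close>), so each of the \<open>s\<close> peaks contributes
  \<open>sqrt M\<close> times the same polynomial in \<open>\<pi> / M\<close> (\<open>peak_sum_expansion\<close>), whose coefficients are built
  from \<open>sqrt 3\<close>, Bernoulli numbers and values of \<open>cot\<close> and roots of values of \<open>2 sin\<close> at rational
  multiples of \<open>\<pi>\<close>; they are algebraic. Away from the peaks the terms are exponentially smaller
  (\<open>lob_peak_bound\<close>, \<open>log_amplitude_crude\<close>). Adding everything up gives \<open>total_expansion\<close>, with the power
  \<open>3/2\<close> of \<open>M\<close> made of one factor \<open>M\<close> from the start of the product and \<open>sqrt M\<close> from the
  Gaussian sum.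

  The polynomials depend on \<open>a\<close> and \<open>c\<close> but not on \<open>b\<close>, \<open>d\<close> or the denominator bound, and an
  asymptotic expansion determines its coefficients (\<open>expands_unique\<close>). So the polynomials for
  different orders are truncations of one power series, and since \<open>J\<close> has period 1, that series may
  be chosen to depend only on \<open>a / c\<close> modulo 1.
\<close>

section \<open>Sums and products of algebraic numbers\<close>

interpretation ratvs: vector_space "\<lambda>(q::rat) (x::'a::field_char_0). of_rat q * x"
  by unfold_locales (simp_all add: algebra_simps of_rat_add of_rat_mult)

text \<open>A number is algebraic exactly if its powers span a finite-dimensional rational vector space. Stated with
  a finite spanning set, this gives closure under sums and products without resultants: the powers of
  \<open>x + y\<close> and \<open>x y\<close> lie in the span of the products of two generators.\<close>
lemma algebraic_if_powers_in_span:
  fixes x :: "'a::field_char_0"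
  assumes "finite B" and sp: "\<And>k. x ^ k \<in> ratvs.span B"
  shows "algebraic x"
proof -
  define N where "N = card B"
  show ?thesis
  proof (cases "inj_on (\<lambda>k. x ^ k) {..N}")
    case False
    then obtain i j where ij: "x ^ i = x ^ j" "i \<noteq> j" by (auto simp: inj_on_def)
    show ?thesis
    proof (rule algebraicI')
      show "monom 1 i - monom 1 j \<noteq> (0 :: 'a poly)"
        using ij(2) by (metis coeff_monom eq_iff_diff_eq_0 zero_neq_one)
      show "poly (monom 1 i - monom 1 j) x = 0" using ij by (simp add: poly_monom)
    qed auto
  next
    case True
    define S where "S = (\<lambda>k. x ^ k) ` {..N}"
    have cS: "card S = Suc N" unfolding S_def by (simp add: card_image True)
    have "S \<subseteq> ratvs.span B" using sp by (auto simp: S_def)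
    then have "ratvs.dependent S"
      using ratvs.independent_span_bound[OF \<open>finite B\<close>, of S] cS N_def by auto
    then obtain u where u: "\<exists>v\<in>S. u v \<noteq> (0::rat)" "(\<Sum>v\<in>S. of_rat (u v) * v) = 0"
      using ratvs.dependent_finite[of S] by (auto simp: S_def)
    from u(1) obtain k0 where k0: "k0 \<le> N" "u (x ^ k0) \<noteq> 0" by (auto simp: S_def)
    define p :: "'a poly" where "p = (\<Sum>k\<le>N. monom (of_rat (u (x ^ k))) k)"
    have cf: "coeff p i = (if i \<le> N then of_rat (u (x ^ i)) else 0)" for i
      by (simp add: p_def coeff_sum)
    show ?thesis
    proof (rule algebraicI')
      show "coeff p i \<in> \<rat>" for i by (simp add: cf)
      show "p \<noteq> 0" using cf[of k0] k0 by auto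
      show "poly p x = 0"
        using u(2) True by (simp add: p_def poly_sum poly_monom S_def sum.reindex)
    qed
  qed
qed

text \<open>Conversely, a rational polynomial of degree \<open>n\<close> with root \<open>x\<close> rewrites \<open>x ^ n\<close>, and hence every higher
  power, in terms of the lower ones.\<close>
lemma algebraic_powers_in_span:
  fixes x :: "'a::field_char_0"
  assumes "algebraic x"
  obtains A where "finite A" "\<And>k. x ^ k \<in> ratvs.span A"
proof -
  from assms obtain p :: "'a poly" where p: "\<And>i. coeff p i \<in> \<rat>" "p \<noteq> 0" "poly p x = 0"
    unfolding algebraic_altdef by auto
  define n where "n = degree p"
  have "\<forall>i. \<exists>q. coeff p i = of_rat q" using p(1) by (auto simp: Rats_def)
  then obtain q where q: "\<And>i. coeff p i = of_rat (q i)" by metis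
  have qn: "q n \<noteq> 0" using p(2) q[of n] by (auto simp: n_def)
  define A where "A = (\<lambda>i. x ^ i) ` {..<n}"
  have red: "x ^ n = (\<Sum>i<n. of_rat (- q i / q n) * x ^ i)"
  proof -
    have "0 = (\<Sum>i\<le>n. of_rat (q i) * x ^ i)"
      using p(3) by (simp add: poly_altdef n_def q)
    also have "\<dots> = of_rat (q n) * x ^ n + (\<Sum>i<n. of_rat (q i) * x ^ i)"
      by (simp add: lessThan_Suc_atMost [symmetric])
    finally have "of_rat (q n) * x ^ n = - (\<Sum>i<n. of_rat (q i) * x ^ i)"
      by (simp add: eq_neg_iff_add_eq_0)
    then have "x ^ n = - (\<Sum>i<n. of_rat (q i) * x ^ i) / of_rat (q n)"
      using qn by (simp add: field_simps)
    also have "\<dots> = (\<Sum>i<n. of_rat (- q i / q n) * x ^ i)"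
      by (simp add: sum_divide_distrib sum_negf of_rat_divide of_rat_minus)
    finally show ?thesis .
  qed
  have "x ^ k \<in> ratvs.span A" for k
  proof (induction k rule: less_induct)
    case (less k)
    show ?case
    proof (cases "k < n")
      case True
      then show ?thesis by (intro ratvs.span_base) (auto simp: A_def)
    next
      case False
      then have "x ^ k = x ^ (k - n) * x ^ n" by (simp flip: power_add)
      also have "\<dots> = (\<Sum>i<n. of_rat (- q i / q n) * x ^ (k - n + i))"
        unfolding red by (simp add: sum_distrib_left power_add mult_ac)
      also have "\<dots> \<in> ratvs.span A"
        using False by (intro ratvs.span_sum ratvs.span_scale less) auto
      finally show ?thesis .
    qed
  qed
  then show ?thesis using that[of A] by (auto simp: A_def)
qed

lemma span_mult:
  fixes x y :: "'a::field_char_0"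
  assumes "x \<in> ratvs.span A" "y \<in> ratvs.span B"
  shows "x * y \<in> ratvs.span ((\<lambda>(a, b). a * b) ` (A \<times> B))"
  using assms(1)
proof (induction rule: ratvs.span_induct_alt)
  case base
  then show ?case by (simp add: ratvs.span_zero)
next
  case (step c a x)
  have "a * y \<in> ratvs.span ((\<lambda>(a, b). a * b) ` (A \<times> B))"
    using assms(2)
  proof (induction rule: ratvs.span_induct_alt)
    case base
    then show ?case by (simp add: ratvs.span_zero)
  next
    case (step c' b y)
    have "of_rat c' * (a * b) + a * y \<in> ratvs.span ((\<lambda>(a, b). a * b) ` (A \<times> B))"
      by (rule ratvs.span_add[OF ratvs.span_scale[OF ratvs.span_base]]) (use step \<open>a \<in> A\<close> in auto)
    then show ?case by (simp add: algebra_simps)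
  qed
  then have "of_rat c * (a * y) + x * y \<in> ratvs.span ((\<lambda>(a, b). a * b) ` (A \<times> B))"
    using step by (intro ratvs.span_add[OF ratvs.span_scale]) auto
  then show ?case by (simp add: algebra_simps)
qed

lemma
  fixes x y :: "'a::field_char_0"
  assumes x: "algebraic x" and y: "algebraic y"
  shows algebraic_add: "algebraic (x + y)" and algebraic_mult: "algebraic (x * y)"
proof -
  obtain A where A: "finite A" "\<And>k. x ^ k \<in> ratvs.span A" using algebraic_powers_in_span[OF x] by blast
  obtain B where B: "finite B" "\<And>k. y ^ k \<in> ratvs.span B" using algebraic_powers_in_span[OF y] by blast
  define P where "P = (\<lambda>(a, b). a * b) ` (A \<times> B)"
  have fin: "finite P" using A B by (auto simp: P_def)
  have xy: "x ^ i * y ^ j \<in> ratvs.span P" for i j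
    unfolding P_def by (intro span_mult A B)
  show "algebraic (x * y)"
    by (rule algebraic_if_powers_in_span[OF fin]) (simp add: power_mult_distrib xy)
  show "algebraic (x + y)"
  proof (rule algebraic_if_powers_in_span[OF fin])
    fix k
    have "(x + y) ^ k = (\<Sum>i\<le>k. of_rat (of_nat (k choose i)) * (x ^ i * y ^ (k - i)))"
      by (simp add: binomial_ring mult.assoc)
    also have "\<dots> \<in> ratvs.span P" by (intro ratvs.span_sum ratvs.span_scale xy)
    finally show "(x + y) ^ k \<in> ratvs.span P" .
  qed
qed

lemma algebraic_diff: "algebraic x \<Longrightarrow> algebraic y \<Longrightarrow> algebraic (x - y)"
  using algebraic_add[of x "-y"] by simp

lemma algebraic_divide: "algebraic x \<Longrightarrow> algebraic y \<Longrightarrow> algebraic (x / y)"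
  unfolding divide_inverse by (intro algebraic_mult algebraic_inverse)

lemma algebraic_power: "algebraic x \<Longrightarrow> algebraic (x ^ n)"
  by (induction n) (auto intro: algebraic_mult)

lemma algebraic_sum: "(\<And>i. i \<in> I \<Longrightarrow> algebraic (f i)) \<Longrightarrow> algebraic (sum f I)"
  by (induction I rule: infinite_finite_induct) (auto intro: algebraic_add)

lemma algebraic_prod: "(\<And>i. i \<in> I \<Longrightarrow> algebraic (f i)) \<Longrightarrow> algebraic (prod f I)"
  by (induction I rule: infinite_finite_induct) (auto intro: algebraic_mult)

section \<open>Euler--Maclaurin summation\<close>

text \<open>The Bernoulli number \<open>B\<^sub>n\<close> divided by \<open>n!\<close>, with \<open>B\<^sub>1 = 1/2\<close>: the generating function is
  \<open>t / (1 - exp (- t))\<close>. The sign of \<open>B\<^sub>1\<close> suits sums over half-open intervals that contain their right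
  end.\<close>
fun bern_coeff :: "nat \<Rightarrow> real" where
  "bern_coeff n = 1 / fact n - (\<Sum>p<n. bern_coeff p / fact (n + 1 - p))"

declare bern_coeff.simps [simp del]

lemma bern_coeff_rat: "bern_coeff n \<in> \<rat>"
proof (induction n rule: less_induct)
  case (less n)
  have f: "fact k \<in> (\<rat> :: real set)" for k by (metis Rats_of_nat of_nat_fact)
  show ?case by (subst bern_coeff.simps) (intro Rats_diff Rats_divide Rats_sum f; use less in simp)
qed

lemma bern_coeff_0: "bern_coeff 0 = 1" by (subst bern_coeff.simps) simp

lemma bern_coeff_1: "bern_coeff 1 = 1/2" using bern_coeff_0 by (subst bern_coeff.simps) (simp add: numeral_2_eq_2)

lemma bern_coeff_identity:
  assumes "n \<ge> 1"
  shows "(\<Sum>p<n. bern_coeff p / fact (n - p)) = 1 / fact (n - 1)"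
proof -
  from assms obtain k where k: "n = Suc k" by (cases n) auto
  have "(\<Sum>p<n. bern_coeff p / fact (n - p)) = (\<Sum>p<k. bern_coeff p / fact (k + 1 - p)) + bern_coeff k"
    by (simp add: k)
  then show ?thesis by (simp add: bern_coeff.simps[of k] k)
qed

text \<open>The Bernoulli polynomial \<open>B\<^sub>n (1 + s)\<close> divided by \<open>n!\<close>.\<close>
definition bern_poly :: "nat \<Rightarrow> real \<Rightarrow> real" where
  "bern_poly n s = (\<Sum>p\<le>n. bern_coeff p * s ^ (n - p) / fact (n - p))"

text \<open>The formal solution \<open>F\<close> of \<open>F x - F (x - h) = D 1 x\<close>, cut off after the \<open>K\<close>-th derivative; \<open>D 0\<close> is a
  primitive of the function \<open>D 1\<close> that is to be summed.\<close>
definition em_primitive :: "(nat \<Rightarrow> real \<Rightarrow> real) \<Rightarrow> real \<Rightarrow> nat \<Rightarrow> real \<Rightarrow> real" where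
  "em_primitive D h K x = (\<Sum>p\<le>K. bern_coeff p * h ^ p * D p x / h)"

text \<open>Storing a function together with all its derivatives in one family, with a primitive in
  position 0, avoids iterated derivative operators throughout.\<close>
definition deriv_chain :: "(nat \<Rightarrow> real \<Rightarrow> real) \<Rightarrow> real set \<Rightarrow> bool" where
  "deriv_chain D S \<longleftrightarrow> (\<forall>p. \<forall>t\<in>S. (D p has_real_derivative D (Suc p) t) (at t))"

lemma deriv_chain_subset: "deriv_chain D S \<Longrightarrow> T \<subseteq> S \<Longrightarrow> deriv_chain D T"
  by (auto simp: deriv_chain_def)

lemma taylor_bound:
  assumes ch: "deriv_chain D (closed_segment x y)"
    and B: "\<And>t. t \<in> closed_segment x y \<Longrightarrow> \<bar>D (p + n) t\<bar> \<le> B"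
  shows "\<bar>D p y - (\<Sum>m<n. D (p + m) x * (y - x) ^ m / fact m)\<bar> \<le> B * \<bar>y - x\<bar> ^ n / fact n"
proof (cases "n = 0 \<or> x = y")
  case True
  then show ?thesis
  proof
    assume "n = 0"
    then show ?thesis using B[of y] by simp
  next
    assume [simp]: "x = y"
    show ?thesis
    proof (cases n)
      case 0
      then show ?thesis using B[of y] by simp
    next
      case (Suc k)
      have "(\<Sum>m<n. D (p + m) x * (y - x) ^ m / fact m) = D p y"
        unfolding Suc sum.lessThan_Suc_shift by simp
      then show ?thesis using Suc by simp
    qed
  qed
next
  case False
  have seg: "closed_segment x y = {min x y..max x y}"
    by (auto simp: closed_segment_eq_real_ivl min_def max_def)
  have "\<exists>t. (if y < x then y < t \<and> t < x else x < t \<and> t < y) \<and>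
    D p y = (\<Sum>m<n. (D (p + m) x / fact m) * (y - x)^m) + (D (p + n) t / fact n) * (y - x)^n"
    by (rule Taylor[where diff = "\<lambda>m. D (p + m)" and a = "min x y" and b = "max x y"])
       (use False ch seg in \<open>auto simp: deriv_chain_def\<close>)
  then obtain t where t: "if y < x then y < t \<and> t < x else x < t \<and> t < y"
    "D p y = (\<Sum>m<n. (D (p + m) x / fact m) * (y - x)^m) + (D (p + n) t / fact n) * (y - x)^n"
    by blast
  have "t \<in> closed_segment x y" using t(1) by (auto simp: seg split: if_splits)
  then have "\<bar>D (p + n) t\<bar> \<le> B" by (rule B)
  then have "\<bar>(D (p + n) t / fact n) * (y - x)^n\<bar> \<le> B * \<bar>y - x\<bar> ^ n / fact n"
    by (simp add: abs_mult power_abs divide_right_mono mult_right_mono)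
  then show ?thesis using t(2) by simp
qed

text \<open>Expanding every derivative around \<open>x\<close> and collecting powers of \<open>h\<close> turns the Bernoulli numbers into
  Bernoulli polynomials, as the generating functions multiply.\<close>
lemma em_primitive_taylor:
  assumes h: "h > 0"
    and ch: "deriv_chain D (closed_segment x (x + s * h))"
    and B: "\<And>t. t \<in> closed_segment x (x + s * h) \<Longrightarrow> \<bar>D (Suc K) t\<bar> \<le> B"
  shows "\<bar>em_primitive D h K (x + s * h) - (\<Sum>n\<le>K. h ^ n / h * D n x * bern_poly n s)\<bar>
     \<le> B * h ^ K * (\<Sum>p\<le>K. \<bar>bern_coeff p\<bar> * \<bar>s\<bar> ^ (Suc K - p) / fact (Suc K - p))"
proof -
  define R where "R p = D p (x + s * h) - (\<Sum>m<Suc K - p. D (p + m) x * (s * h) ^ m / fact m)" for p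
  have R: "\<bar>R p\<bar> \<le> B * (\<bar>s\<bar> * h) ^ (Suc K - p) / fact (Suc K - p)" if "p \<le> K" for p
    using taylor_bound[OF ch, of p "Suc K - p" B] B that h by (simp add: R_def abs_mult)
  have "em_primitive D h K (x + s * h)
      = (\<Sum>p\<le>K. bern_coeff p * h ^ p / h * (\<Sum>m<Suc K - p. D (p + m) x * (s * h) ^ m / fact m))
        + (\<Sum>p\<le>K. bern_coeff p * h ^ p / h * R p)"
    unfolding em_primitive_def R_def by (simp add: sum.distrib[symmetric] algebra_simps)
  also have "(\<Sum>p\<le>K. bern_coeff p * h ^ p / h * (\<Sum>m<Suc K - p. D (p + m) x * (s * h) ^ m / fact m))
     = (\<Sum>p\<le>K. \<Sum>m\<le>K - p. h ^ (p + m) / h * D (p + m) x * (bern_coeff p * s ^ m / fact m))"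
  proof (intro sum.cong refl)
    fix p assume "p \<in> {..K}"
    then have "{..<Suc K - p} = {..K - p}" by auto
    then show "bern_coeff p * h ^ p / h * (\<Sum>m<Suc K - p. D (p + m) x * (s * h) ^ m / fact m)
       = (\<Sum>m\<le>K - p. h ^ (p + m) / h * D (p + m) x * (bern_coeff p * s ^ m / fact m))"
      by (simp add: sum_distrib_left power_add power_mult_distrib mult_ac)
  qed
  also have "\<dots> = (\<Sum>(p, m)\<in>{(i, j). i + j \<le> K}. h ^ (p + m) / h * D (p + m) x * (bern_coeff p * s ^ m / fact m))"
    by (subst sum.Sigma) (auto intro!: sum.cong)
  also have "\<dots> = (\<Sum>n\<le>K. \<Sum>p\<le>n. h ^ n / h * D n x * (bern_coeff p * s ^ (n - p) / fact (n - p)))"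
    unfolding sum.triangle_reindex_eq by (auto intro!: sum.cong)
  also have "\<dots> = (\<Sum>n\<le>K. h ^ n / h * D n x * bern_poly n s)"
    by (simp add: bern_poly_def sum_distrib_left)
  finally have "em_primitive D h K (x + s * h) - (\<Sum>n\<le>K. h ^ n / h * D n x * bern_poly n s)
      = (\<Sum>p\<le>K. bern_coeff p * h ^ p / h * R p)" by simp
  also have "\<bar>\<dots>\<bar> \<le> (\<Sum>p\<le>K. \<bar>bern_coeff p * h ^ p / h * R p\<bar>)" by (rule sum_abs)
  also have "\<dots> \<le> (\<Sum>p\<le>K. B * h ^ K * (\<bar>bern_coeff p\<bar> * \<bar>s\<bar> ^ (Suc K - p) / fact (Suc K - p)))"
  proof (rule sum_mono)
    fix p assume p: "p \<in> {..K}"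
    have "\<bar>bern_coeff p * h ^ p / h * R p\<bar> \<le> \<bar>bern_coeff p\<bar> * (h ^ p / h) * (B * (\<bar>s\<bar> * h) ^ (Suc K - p) / fact (Suc K - p))"
    proof -
      have "\<bar>bern_coeff p * h ^ p / h * R p\<bar> = \<bar>bern_coeff p\<bar> * (h ^ p / h) * \<bar>R p\<bar>"
        using h by (simp add: abs_mult)
      then show ?thesis using R[of p] p h by (simp only:) (intro mult_left_mono, auto)
    qed
    also have "\<dots> = (h ^ p * h ^ (Suc K - p) / h) * (B * (\<bar>bern_coeff p\<bar> * \<bar>s\<bar> ^ (Suc K - p) / fact (Suc K - p)))"
      by (simp add: power_mult_distrib mult_ac)
    also have "h ^ p * h ^ (Suc K - p) / h = h ^ K"
      using p h by (simp flip: power_add)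
    finally show "\<bar>bern_coeff p * h ^ p / h * R p\<bar> \<le> B * h ^ K * (\<bar>bern_coeff p\<bar> * \<bar>s\<bar> ^ (Suc K - p) / fact (Suc K - p))"
      by (simp add: mult_ac)
  qed
  finally show ?thesis by (simp add: sum_distrib_left)
qed

lemma bern_poly_1_right: "bern_poly n 1 = bern_coeff n + (if n \<ge> 1 then 1 / fact (n - 1) else 0)"
proof -
  have "bern_poly n 1 = bern_coeff n + (\<Sum>p<n. bern_coeff p / fact (n - p))"
    by (simp add: bern_poly_def lessThan_Suc_atMost[symmetric])
  then show ?thesis using bern_coeff_identity[of n] by (cases n) auto
qed

definition em_const :: "nat \<Rightarrow> real" where
  "em_const K = (\<Sum>p\<le>K. \<bar>bern_coeff p\<bar> / fact (Suc K - p)) + 1 / fact K"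

lemma em_const_nonneg: "em_const K \<ge> 0"
  by (auto simp: em_const_def intro!: add_nonneg_nonneg sum_nonneg)

text \<open>At \<open>s = 1\<close> the Bernoulli polynomials of the previous lemma exceed the Bernoulli numbers by \<open>1 / (n - 1)!\<close>, so the
  difference of the two primitives is the Taylor expansion of \<open>D 1 (x + h)\<close> around \<open>x\<close>.\<close>
lemma em_step:
  assumes h: "h > 0" and K: "K \<ge> 1"
    and ch: "deriv_chain D {x..x + h}"
    and B: "\<And>t. t \<in> {x..x + h} \<Longrightarrow> \<bar>D (Suc K) t\<bar> \<le> B"
  shows "\<bar>D 1 (x + h) - (em_primitive D h K (x + h) - em_primitive D h K x)\<bar> \<le> em_const K * B * h ^ K"
proof -
  have seg: "closed_segment x (x + h) = {x..x + h}" using h by (simp add: closed_segment_eq_real_ivl)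
  have 1: "\<bar>em_primitive D h K (x + h) - (\<Sum>n\<le>K. h ^ n / h * D n x * bern_poly n 1)\<bar>
     \<le> B * h ^ K * (\<Sum>p\<le>K. \<bar>bern_coeff p\<bar> / fact (Suc K - p))"
    using em_primitive_taylor[OF h, of D x 1 K B] ch B seg by simp
  have "\<bar>D 1 (x + h) - (\<Sum>m<K. D (1 + m) x * h ^ m / fact m)\<bar> \<le> B * h ^ K / fact K"
    using taylor_bound[of D x "x + h" 1 K B] ch B seg h by simp
  moreover have "(\<Sum>n\<le>K. h ^ n / h * D n x * bern_poly n 1)
      = em_primitive D h K x + (\<Sum>m<K. D (1 + m) x * h ^ m / fact m)"
  proof -
    have "(\<Sum>n\<le>K. h ^ n / h * D n x * bern_poly n 1)
       = em_primitive D h K x + (\<Sum>n\<le>K. h ^ n / h * D n x * (if n \<ge> 1 then 1 / fact (n - 1) else 0))"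
      by (simp add: bern_poly_1_right em_primitive_def sum.distrib algebra_simps)
    also have "(\<Sum>n\<le>K. h ^ n / h * D n x * (if n \<ge> 1 then 1 / fact (n - 1) else 0))
        = (\<Sum>n<Suc K. h ^ n / h * D n x * (if n \<ge> 1 then 1 / fact (n - 1) else 0))"
      by (simp only: lessThan_Suc_atMost)
    also have "\<dots> = (\<Sum>m<K. D (1 + m) x * h ^ m / fact m)"
      unfolding sum.lessThan_Suc_shift using h by (simp add: mult_ac)
    finally show ?thesis .
  qed
  ultimately show ?thesis using 1 unfolding em_const_def by (simp add: algebra_simps)
qed

lemma em_sum:
  assumes h: "h > 0" and K: "K \<ge> 1" and l: "l1 \<le> l2"
    and ch: "deriv_chain D {(of_int l1 - \<theta>) * h..(of_int l2 - \<theta>) * h}"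
    and B: "\<And>t. t \<in> {(of_int l1 - \<theta>) * h..(of_int l2 - \<theta>) * h} \<Longrightarrow> \<bar>D (Suc K) t\<bar> \<le> B"
  shows "\<bar>(\<Sum>l\<in>{l1<..l2}. D 1 ((of_int l - \<theta>) * h))
     - (em_primitive D h K ((of_int l2 - \<theta>) * h) - em_primitive D h K ((of_int l1 - \<theta>) * h))\<bar>
     \<le> of_int (l2 - l1) * (em_const K * B * h ^ K)"
  using l ch B
proof (induction l2 rule: int_ge_induct)
  case base
  then show ?case by simp
next
  case (step l)
  define x where "x = (of_int l - \<theta>) * h"
  have x: "(of_int (l + 1) - \<theta>) * h = x + h" by (simp add: x_def algebra_simps)
  have lx: "(of_int l1 - \<theta>) * h \<le> x" using step.hyps h by (simp add: x_def)
  have s: "{l1<..l + 1} = insert (l + 1) {l1<..l}" using step.hyps by auto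
  have 1: "\<bar>D 1 (x + h) - (em_primitive D h K (x + h) - em_primitive D h K x)\<bar> \<le> em_const K * B * h ^ K"
  proof (rule em_step[OF h K])
    show "deriv_chain D {x..x + h}"
      using step.prems(1) lx unfolding x by (rule_tac deriv_chain_subset) auto
    show "\<bar>D (Suc K) t\<bar> \<le> B" if "t \<in> {x..x + h}" for t
      by (rule step.prems(2)) (use that lx x in auto)
  qed
  have 2: "\<bar>(\<Sum>l\<in>{l1<..l}. D 1 ((of_int l - \<theta>) * h)) - (em_primitive D h K x - em_primitive D h K ((of_int l1 - \<theta>) * h))\<bar>
     \<le> of_int (l - l1) * (em_const K * B * h ^ K)"
    unfolding x_def
  proof (rule step.IH)
    have sub: "{(of_int l1 - \<theta>) * h..(of_int l - \<theta>) * h} \<subseteq> {(of_int l1 - \<theta>) * h..(of_int (l + 1) - \<theta>) * h}"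
      unfolding x using h by (auto simp: x_def)
    show "deriv_chain D {(of_int l1 - \<theta>) * h..(of_int l - \<theta>) * h}"
      by (rule deriv_chain_subset[OF step.prems(1) sub])
    show "\<bar>D (Suc K) t\<bar> \<le> B" if "t \<in> {(of_int l1 - \<theta>) * h..(of_int l - \<theta>) * h}" for t
      by (rule step.prems(2)) (use that sub in blast)
  qed
  have "(\<Sum>l\<in>{l1<..l + 1}. D 1 ((of_int l - \<theta>) * h)) = D 1 (x + h) + (\<Sum>l\<in>{l1<..l}. D 1 ((of_int l - \<theta>) * h))"
    unfolding s x[symmetric] by (subst sum.insert) auto
  then show ?case using 1 2 unfolding x by (simp add: algebra_simps)
qed

section \<open>The dilogarithm on the unit circle\<close>

definition lsin :: "real \<Rightarrow> real" where "lsin x = ln \<bar>2 * sin (pi * x)\<bar>"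

text \<open>Up to the factor \<open>- 1 / \<pi>\<close> and the scaling of its argument this is the Lobachevsky function. The
  normalisation makes it a primitive of \<open>lsin\<close>.\<close>
definition lob :: "real \<Rightarrow> real" where "lob x = - Im (Li2 (cis (2 * pi * x))) / (2 * pi)"

text \<open>The derivatives of \<open>cot\<close> as polynomials in \<open>cot\<close>, from \<open>cot' = - (1 + cot\<^sup>2)\<close>.\<close>
primrec cotp :: "nat \<Rightarrow> real poly" where
  "cotp 0 = [:0, 1:]"
| "cotp (Suc p) = - ([:1, 0, 1:] * pderiv (cotp p))"

fun lsinD :: "nat \<Rightarrow> real \<Rightarrow> real" where
  "lsinD 0 x = lob x"
| "lsinD (Suc 0) x = lsin x"
| "lsinD (Suc (Suc p)) x = pi ^ Suc p * poly (cotp p) (cot (pi * x))"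

lemma continuous_on_Li2: "continuous_on (cball 0 1) Li2"
proof -
  have "uniform_limit (cball 0 1) (\<lambda>n z. \<Sum>i<n. z ^ Suc i / of_nat (Suc i) ^ 2 :: complex)
          (\<lambda>z. \<Sum>i. z ^ Suc i / of_nat (Suc i) ^ 2) sequentially"
  proof (rule Weierstrass_m_test)
    show "summable (\<lambda>n. inverse (of_nat (Suc n) ^ 2 :: real))"
      by (subst summable_Suc_iff) (rule inverse_power_summable, simp)
    fix n and z :: complex assume "z \<in> cball 0 1"
    then have "norm z ^ Suc n \<le> 1" by (intro power_le_one) auto
    then have "norm z ^ Suc n * inverse (of_nat (Suc n) ^ 2) \<le> 1 * inverse (of_nat (Suc n) ^ 2 :: real)"
      by (intro mult_right_mono) auto
    then show "norm (z ^ Suc n / of_nat (Suc n) ^ 2) \<le> inverse (of_nat (Suc n) ^ 2)"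
      unfolding norm_divide norm_power norm_of_nat by (simp only: divide_inverse mult_1_left)
  qed
  then have "continuous_on (cball 0 1) (\<lambda>z::complex. \<Sum>i. z ^ Suc i / of_nat (Suc i) ^ 2)"
    by (rule uniform_limit_theorem[rotated])
       (auto intro!: always_eventually continuous_intros simp del: of_nat_Suc)
  then show ?thesis unfolding Li2_def .
qed

definition Li2' :: "complex \<Rightarrow> complex" where
  "Li2' z = (if z = 0 then 1 else - Ln (1 - z) / z)"

text \<open>The radius of convergence is 1, so this covers the open disc only. The unit circle is reached in
  \<open>Li2_primitive\<close>.\<close>
lemma Li2_deriv:
  assumes "norm z < 1"
  shows "(Li2 has_field_derivative Li2' z) (at z)"
proof -
  define c :: "nat \<Rightarrow> complex" where "c n = (if n = 0 then 0 else 1 / of_nat n ^ 2)" for n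
  have sm: "summable (\<lambda>n. c n * w ^ n)" if "norm w \<le> 1" for w :: complex
  proof (subst summable_Suc_iff[symmetric])
    show "summable (\<lambda>n. c (Suc n) * w ^ Suc n)"
      using summable_Li2[OF that] by (simp add: c_def)
  qed
  have Li2_eq: "Li2 w = (\<Sum>n. c n * w ^ n)" if "norm w \<le> 1" for w
    using suminf_split_head[OF sm[OF that]] by (simp add: c_def Li2_def)
  have "((\<lambda>x. \<Sum>n. c n * x ^ n) has_field_derivative (\<Sum>n. diffs c n * z ^ n)) (at z)"
    by (rule termdiffs_strong[of c 1]) (use sm[of 1] assms in auto)
  then have "(Li2 has_field_derivative (\<Sum>n. diffs c n * z ^ n)) (at z)"
  proof (rule has_field_derivative_transform_within_open[of _ _ _ "ball 0 1"])
    show "(\<Sum>n. c n * w ^ n) = Li2 w" if "w \<in> ball 0 1" for w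
      using Li2_eq[of w] that by simp
  qed (use assms in auto)
  moreover have "(\<lambda>n. diffs c n * z ^ n) sums Li2' z"
  proof (cases "z = 0")
    case True
    have "(\<lambda>n. diffs c n * 0 ^ n) sums diffs c 0" by (rule powser_sums_zero)
    then show ?thesis by (simp add: True Li2'_def diffs_def c_def)
  next
    case False
    have "(\<lambda>n. - (z ^ n) / of_nat n) sums Ln (1 - z)"
      using Ln_series'[of "-z"] assms by simp
    then have "(\<lambda>n. - (z ^ Suc n) / of_nat (Suc n)) sums Ln (1 - z)"
      by (subst sums_Suc_iff) simp
    then have "(\<lambda>n. - (- (z ^ Suc n) / of_nat (Suc n) / z)) sums - (Ln (1 - z) / z)"
      by (intro sums_minus sums_divide)
    moreover have "- (- (z ^ Suc n) / of_nat (Suc n) / z) = diffs c n * z ^ n" for n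
    proof -
      have "diffs c n = 1 / of_nat (Suc n)" unfolding diffs_def c_def
        by (simp add: power2_eq_square del: of_nat_Suc)
      then show ?thesis using False by (simp del: of_nat_Suc)
    qed
    ultimately show ?thesis using False by (simp add: Li2'_def)
  qed
  ultimately show ?thesis by (simp add: sums_iff)
qed

text \<open>The derivative extends holomorphically to the half plane \<open>Re z < 1\<close>, where it has a primitive. The
  primitive and the dilogarithm differ by a constant inside the disc, hence by continuity also on the
  circle apart from the point 1. This makes the dilogarithm differentiable along the circle.\<close>
lemma Li2_primitive:
  obtains H k where "\<And>z. Re z < 1 \<Longrightarrow> (H has_field_derivative Li2' z) (at z)"
    "\<And>z. norm z \<le> 1 \<Longrightarrow> z \<noteq> 1 \<Longrightarrow> Li2 z = H z + k"
proof -
  define S where "S = {z. Re z < 1}"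
  have S: "open S" "convex S" by (auto simp: S_def open_halfspace_Re_lt convex_halfspace_Re_lt)
  have nz: "1 - z \<notin> \<real>\<^sub>\<le>\<^sub>0" if "z \<in> S" for z
    using that by (auto simp: S_def complex_nonpos_Reals_iff)
  have hol: "(\<lambda>z. - Ln (1 - z) / z) holomorphic_on (S - {0})"
    using nz by (auto intro!: holomorphic_intros)
  then have hol': "Li2' holomorphic_on (S - {0})"
    by (rule holomorphic_transform) (auto simp: Li2'_def)
  have lim0: "(Li2' \<longlongrightarrow> Li2' 0) (at 0)"
  proof -
    have "((\<lambda>z. - Ln (1 - z)) has_field_derivative 1) (at 0)"
      by (auto intro!: derivative_eq_intros)
    then have "((\<lambda>z. (- Ln (1 - z) - (- Ln (1 - 0))) / (z - 0)) \<longlongrightarrow> 1) (at 0)"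
      by (simp add: has_field_derivative_iff)
    moreover have "((\<lambda>z. (- Ln (1 - z) - (- Ln (1 - 0))) / (z - 0)) \<longlongrightarrow> 1) (at 0)
        \<longleftrightarrow> (Li2' \<longlongrightarrow> 1) (at 0)"
      by (intro filterlim_cong refl) (auto simp: Li2'_def eventually_at intro!: exI[of _ 1])
    ultimately show ?thesis by (simp add: Li2'_def)
  qed
  have cont: "continuous_on S Li2'"
  proof (subst continuous_on_eq_continuous_at[OF S(1)], intro ballI)
    fix z assume z: "z \<in> S"
    show "isCont Li2' z"
    proof (cases "z = 0")
      case True then show ?thesis using lim0 by (simp add: isCont_def)
    next
      case False
      have "open (S - {0})" using S by auto
      then show ?thesis using holomorphic_on_imp_continuous_on[OF hol'] z False
        by (simp add: continuous_on_eq_continuous_at)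
    qed
  qed
  have fd: "Li2' field_differentiable at z" if "z \<in> interior S - {0}" for z
    using hol' that S by (auto simp: interior_open intro!: holomorphic_on_imp_differentiable_at[of _ "S - {0}"])
  obtain H where H: "\<And>z. z \<in> S \<Longrightarrow> (H has_field_derivative Li2' z) (at z within S)"
    using holomorphic_convex_primitive[OF S(2) _ cont fd, of "{0}"] by blast
  then have H': "\<And>z. z \<in> S \<Longrightarrow> (H has_field_derivative Li2' z) (at z)"
    by (metis S(1) at_within_open)
  have "\<exists>k. \<forall>z\<in>ball 0 1. Li2 z - H z = k"
  proof (rule has_field_derivative_zero_constant)
    fix z :: complex assume z: "z \<in> ball 0 1"
    then have "z \<in> S" using complex_Re_le_cmod[of z] by (auto simp: S_def)
    then have "((\<lambda>z. Li2 z - H z) has_field_derivative 0) (at z)"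
      using Li2_deriv[of z] H'[of z] z by (auto intro!: derivative_eq_intros)
    then show "((\<lambda>z. Li2 z - H z) has_field_derivative 0) (at z within ball 0 1)"
      by (rule has_field_derivative_at_within)
  qed auto
  then obtain k where k: "\<And>z. z \<in> ball 0 1 \<Longrightarrow> Li2 z - H z = k" by blast
  have "Li2 z = H z + k" if z: "norm z \<le> 1" "z \<noteq> 1" for z
  proof -
    have zS: "z \<in> S"
    proof (rule ccontr)
      assume "z \<notin> S"
      then have "Re z \<ge> 1" by (simp add: S_def)
      moreover have "(Re z)\<^sup>2 + (Im z)\<^sup>2 \<le> 1" using z(1) by (simp add: cmod_def)
      moreover have "(Re z)\<^sup>2 \<ge> Re z" using \<open>Re z \<ge> 1\<close> by (simp add: power2_eq_square)
      ultimately have "Re z = 1 \<and> (Im z)\<^sup>2 \<le> 0" by (smt (verit) zero_le_power2)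
      then show False using z(2) by (simp add: complex_eq_iff)
    qed
    define r where "r n = (1 - 1 / of_nat (Suc n) :: real)" for n
    have r: "0 \<le> r n" "r n < 1" for n by (auto simp: r_def field_simps)
    have rl: "r \<longlonglongrightarrow> 1"
    proof -
      have "r \<longlonglongrightarrow> 1 - 0" unfolding r_def
        by (intro tendsto_diff tendsto_const) (rule LIMSEQ_Suc, rule lim_1_over_n)
      then show ?thesis by simp
    qed
    have lim: "(\<lambda>n. of_real (r n) * z) \<longlonglongrightarrow> z"
      using tendsto_mult[OF tendsto_of_real[OF rl] tendsto_const[of z]] by simp
    have inb: "norm (of_real (r n) * z) < 1" for n
      using r[of n] z(1) mult_left_le[of "norm z" "r n"] by (simp add: norm_mult)
    have 1: "(\<lambda>n. Li2 (of_real (r n) * z)) \<longlonglongrightarrow> Li2 z"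
      by (rule continuous_on_tendsto_compose[OF continuous_on_Li2 lim])
         (use z inb less_imp_le in \<open>auto intro!: always_eventually\<close>)
    have 2: "(\<lambda>n. H (of_real (r n) * z)) \<longlonglongrightarrow> H z"
      by (rule isCont_tendsto_compose[OF DERIV_isCont[OF H'[OF zS]] lim])
    have "(\<lambda>n. Li2 (of_real (r n) * z) - H (of_real (r n) * z)) \<longlonglongrightarrow> Li2 z - H z"
      by (intro tendsto_diff 1 2)
    moreover have "Li2 (of_real (r n) * z) - H (of_real (r n) * z) = k" for n
      using k inb by auto
    ultimately have "Li2 z - H z = k" by (simp add: LIMSEQ_const_iff)
    then show ?thesis by (auto simp: algebra_simps)
  qed
  then show ?thesis using that[of H k] H' by (auto simp: S_def)
qed

lemma cmod_one_minus_cis: "cmod (1 - cis (2 * pi * x)) = \<bar>2 * sin (pi * x)\<bar>"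
proof -
  have c: "cos (2 * pi * x) = 1 - 2 * (sin (pi * x))\<^sup>2" using cos_double_sin[of "pi * x"] by (simp add: mult_ac)
  have "(cmod (1 - cis (2 * pi * x)))\<^sup>2 = (1 - cos (2 * pi * x))\<^sup>2 + (sin (2 * pi * x))\<^sup>2"
    by (simp add: cmod_power2)
  also have "\<dots> = 2 - 2 * cos (2 * pi * x)"
    using sin_cos_squared_add[of "2 * pi * x"] by (simp add: power2_eq_square algebra_simps)
  also have "\<dots> = \<bar>2 * sin (pi * x)\<bar>\<^sup>2" by (simp add: c power_mult_distrib)
  finally show ?thesis by (subst (asm) power2_eq_iff_nonneg) auto
qed

lemma cis_eq_1_imp: "cis (2 * pi * x) = 1 \<Longrightarrow> sin (pi * x) = 0"
  using cmod_one_minus_cis[of x] by simp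

lemma cis_shift_int: "cis (2 * pi * (x + of_int k)) = cis (2 * pi * x)"
proof -
  have "cis (2 * pi * of_int k) = 1" by (rule cis_multiple_2pi) auto
  then show ?thesis by (simp add: distrib_left cis_mult[symmetric])
qed

lemma sin_pi_shift_int: "\<bar>sin (pi * (x + of_int k))\<bar> = \<bar>sin (pi * x)\<bar>"
proof -
  have "cis (2 * pi * (x + of_int k)) = cis (2 * pi * x)" by (rule cis_shift_int)
  then show ?thesis using cmod_one_minus_cis[of "x + of_int k"] cmod_one_minus_cis[of x] by simp
qed

lemma lsin_shift_int: "lsin (x + of_int k) = lsin x"
  using sin_pi_shift_int[of x k] by (simp add: lsin_def abs_mult)

lemma lob_shift_int: "lob (x + of_int k) = lob x"
  by (simp add: lob_def cis_shift_int)

lemma cot_shift_int: "cot (pi * (x + of_int k)) = cot (pi * x)"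
proof -
  have *: "cot (pi * (x + of_nat n)) = cot (pi * x)" for x n
  proof (induction n)
    case (Suc n)
    have "cot (pi * (x + of_nat n) + pi) = cot (pi * (x + of_nat n))"
      by (simp add: cot_def)
    then show ?case using Suc by (simp add: algebra_simps)
  qed simp
  show ?thesis
  proof (cases "k \<ge> 0")
    case True
    then obtain n where "k = int n" using nonneg_int_cases by blast
    then show ?thesis using * by simp
  next
    case False
    then obtain n where "k = - int n" using that[of "nat (- k)"] by auto
    then show ?thesis using *[of "x + of_int k" n] by simp
  qed
qed

lemma lsinD_shift_int: "lsinD p (x + of_int k) = lsinD p x"
  by (cases "(p, x)" rule: lsinD.cases) (simp_all add: lsin_shift_int lob_shift_int cot_shift_int)

lemma lsin_minus: "lsin (- x) = lsin x" by (simp add: lsin_def)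

lemma Li2_cnj:
  assumes "norm z \<le> 1"
  shows "Li2 (cnj z) = cnj (Li2 z)"
  unfolding Li2_def bounded_linear.suminf[OF bounded_linear_cnj summable_Li2[OF assms]] by simp

lemma lob_minus: "lob (- x) = - lob x"
proof -
  have "cis (2 * pi * (- x)) = cnj (cis (2 * pi * x))" by (simp add: cis_cnj)
  then show ?thesis using Li2_cnj[of "cis (2 * pi * x)"] by (simp add: lob_def)
qed

text \<open>The value \<open>exp (\<i> \<pi> / 3)\<close> in the definition of the volume is the point \<open>1/6\<close> of the circle; since
  \<open>lob\<close> is odd and periodic, its maximum at \<open>5/6\<close> is minus its value at \<open>1/6\<close>.\<close>
lemma lob_peak: "lob (5 / 6) = vol_figure_eight / (4 * pi)"
proof -
  have "lob (5 / 6) = lob (- (1 / 6) + of_int 1)" by simp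
  also have "\<dots> = - lob (1 / 6)" by (simp only: lob_shift_int lob_minus)
  also have "cis (2 * pi * (1 / 6)) = exp (of_real pi * \<i> / 3)" by (simp add: cis_conv_exp mult_ac)
  then have "- lob (1 / 6) = vol_figure_eight / (4 * pi)"
    unfolding lob_def vol_figure_eight_def by simp
  finally show ?thesis .
qed

lemma continuous_on_lob: "continuous_on A lob"
  unfolding lob_def
  by (intro continuous_intros continuous_on_compose2[OF continuous_on_Li2]) (auto simp: cis_conv_exp intro!: continuous_intros)

text \<open>Along \<open>z = cis (2 \<pi> x)\<close> the derivative of the dilogarithm is \<open>- 2 \<pi> \<i> Ln (1 - z)\<close>, and the real part of
  the logarithm is \<open>ln \<bar>1 - z\<bar>\<close>.\<close>
lemma lob_deriv:
  assumes x: "sin (pi * x) \<noteq> 0"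
  shows "(lob has_real_derivative lsin x) (at x)"
proof -
  obtain H k where H: "\<And>z. Re z < 1 \<Longrightarrow> (H has_field_derivative Li2' z) (at z)"
    "\<And>z. norm z \<le> 1 \<Longrightarrow> z \<noteq> 1 \<Longrightarrow> Li2 z = H z + k" using Li2_primitive by blast
  define z where "z = cis (2 * pi * x)"
  have z1: "z \<noteq> 1" using x cis_eq_1_imp[of x] by (auto simp: z_def)
  have Rez: "Re z < 1"
  proof -
    have "Re z = 1 - 2 * (sin (pi * x))\<^sup>2" using cos_double_sin[of "pi * x"] by (simp add: z_def mult_ac)
    then show ?thesis using x by simp
  qed
  have z0: "z \<noteq> 0" by (simp add: z_def)
  have "((\<lambda>y. exp (\<i> * of_real (2 * pi * y))) has_vector_derivative (2 * pi * \<i> * z)) (at x)"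
  proof -
    have "((\<lambda>w. exp (\<i> * (2 * of_real pi * w))) has_field_derivative (2 * pi * \<i> * z)) (at (of_real x))"
      by (auto intro!: derivative_eq_intros simp: z_def cis_conv_exp)
    from has_vector_derivative_real_field[OF this, of UNIV] show ?thesis by simp
  qed
  then have "((\<lambda>y. cis (2 * pi * y)) has_vector_derivative (2 * pi * \<i> * z)) (at x)"
    by (simp add: cis_conv_exp)
  from field_vector_diff_chain_at[OF this, of H "Li2' z"] H(1)[OF Rez]
  have "((\<lambda>y. H (cis (2 * pi * y))) has_vector_derivative (2 * pi * \<i> * z * Li2' z)) (at x)"
    by (simp add: o_def z_def)
  then have "((\<lambda>y. Im (H (cis (2 * pi * y)))) has_vector_derivative Im (2 * pi * \<i> * z * Li2' z)) (at x)"
    by (rule bounded_linear.has_vector_derivative[OF bounded_linear_Im])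
  then have "((\<lambda>y. Im (H (cis (2 * pi * y)))) has_real_derivative Im (2 * pi * \<i> * z * Li2' z)) (at x)"
    by (simp add: has_real_derivative_iff_has_vector_derivative)
  then have "((\<lambda>y. - (Im (H (cis (2 * pi * y))) + Im k) / (2 * pi)) has_real_derivative - (Im (2 * pi * \<i> * z * Li2' z)) / (2 * pi)) (at x)"
    by (rule DERIV_cdivide[OF DERIV_minus[OF DERIV_add[OF _ DERIV_const[of "Im k"]]], THEN DERIV_cong]) simp
  then have "(lob has_real_derivative - (Im (2 * pi * \<i> * z * Li2' z)) / (2 * pi)) (at x)"
  proof (rule has_field_derivative_transform_within_open)
    show "open {y::real. sin (pi * y) \<noteq> 0}" by (intro open_Collect_neq continuous_intros)
    fix y :: real assume "y \<in> {y. sin (pi * y) \<noteq> 0}"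
    then have "Li2 (cis (2 * pi * y)) = H (cis (2 * pi * y)) + k"
      by (intro H(2)) (auto dest: cis_eq_1_imp)
    then show "- (Im (H (cis (2 * pi * y))) + Im k) / (2 * pi) = lob y" by (simp add: lob_def)
  qed (use x in auto)
  moreover have "- (Im (2 * pi * \<i> * z * Li2' z)) / (2 * pi) = lsin x"
  proof -
    have "2 * pi * \<i> * z * Li2' z = - (2 * pi * \<i> * Ln (1 - z))"
      using z0 by (simp add: Li2'_def)
    then have "Im (2 * pi * \<i> * z * Li2' z) = Im (- (2 * pi * \<i> * Ln (1 - z)))" by (rule arg_cong)
    moreover have "Im (- (2 * pi * \<i> * w)) = - (2 * pi * Re w)" for w by simp
    ultimately have "Im (2 * pi * \<i> * z * Li2' z) = - (2 * pi * Re (Ln (1 - z)))" by simp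
    moreover have "Re (Ln (1 - z)) = ln (cmod (1 - z))" using z1 by simp
    ultimately have "- (Im (2 * pi * \<i> * z * Li2' z)) / (2 * pi) = ln (cmod (1 - z))" by simp
    then show ?thesis unfolding lsin_def z_def cmod_one_minus_cis .
  qed
  ultimately show ?thesis by simp
qed

lemma lsin_deriv:
  assumes x: "sin (pi * x) \<noteq> 0"
  shows "(lsin has_real_derivative pi * cot (pi * x)) (at x)"
proof -
  have eq: "lsin = (\<lambda>x. ln ((2 * sin (pi * x))\<^sup>2) / 2)"
  proof
    fix x show "lsin x = ln ((2 * sin (pi * x))\<^sup>2) / 2"
      using ln_realpow[of "\<bar>2 * sin (pi * x)\<bar>" 2]
      by (cases "sin (pi * x) = 0") (simp_all add: lsin_def power_mult_distrib)
  qed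
  have "0 < sin (pi * x) * sin (pi * x)" using x by (metis not_real_square_gt_zero)
  then show ?thesis unfolding eq using x
    by (auto intro!: derivative_eq_intros simp: cot_def power2_eq_square field_simps)
qed

lemma lsinD_chain: "deriv_chain lsinD {x. sin (pi * x) \<noteq> 0}"
  unfolding deriv_chain_def
proof (intro allI ballI)
  fix p x assume "x \<in> {x. sin (pi * x) \<noteq> 0}"
  then have x: "sin (pi * x) \<noteq> 0" by simp
  consider "p = 0" | "p = 1" | q where "p = Suc (Suc q)" by (metis One_nat_def not0_implies_Suc)
  then show "(lsinD p has_real_derivative lsinD (Suc p) x) (at x)"
  proof cases
    case 1
    have "lsinD 0 = lob" by auto
    then show ?thesis using lob_deriv[OF x] 1 by simp
  next
    case 2
    have "lsinD (Suc 0) = lsin" by auto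
    then show ?thesis using lsin_deriv[OF x] 2 by simp
  next
    case 3
    have "lsinD p = (\<lambda>x. pi ^ Suc q * poly (cotp q) (cot (pi * x)))" using 3 by auto
    moreover have i: "inverse ((sin (pi * x))\<^sup>2) = 1 + (cot (pi * x))\<^sup>2"
      using x sin_cos_squared_add[of "pi * x"] unfolding cot_def power_divide
      by (simp add: field_simps del: sin_cos_squared_add sin_cos_squared_add2)
    have "((\<lambda>x. cot (pi * x)) has_real_derivative - pi * (1 + (cot (pi * x))\<^sup>2)) (at x)"
      unfolding i[symmetric]
      by (rule DERIV_chain2[where f = cot and g = "(*) pi", OF DERIV_cot[OF x], THEN DERIV_cong]) (auto intro!: derivative_eq_intros)
    then have "((\<lambda>x. pi ^ Suc q * poly (cotp q) (cot (pi * x))) has_real_derivative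
       pi ^ Suc q * (poly (pderiv (cotp q)) (cot (pi * x)) * (- pi * (1 + (cot (pi * x))\<^sup>2)))) (at x)"
      by (intro DERIV_cmult DERIV_chain2[OF poly_DERIV])
    moreover have "pi ^ Suc q * (poly (pderiv (cotp q)) (cot (pi * x)) * (- pi * (1 + (cot (pi * x))\<^sup>2))) = lsinD (Suc p) x"
      using 3 by (simp add: power2_eq_square algebra_simps)
    ultimately show ?thesis by simp
  qed
qed

text \<open>The derivatives are polynomials in the cotangent, which is bounded where the sine is bounded below; the
  functions in positions 0 and 1 are bounded separately.\<close>
lemma lsinD_bound:
  assumes s: "\<sigma> > 0"
  shows "\<exists>B\<ge>0. \<forall>x. \<bar>sin (pi * x)\<bar> \<ge> \<sigma> \<longrightarrow> \<bar>lsinD p x\<bar> \<le> B"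
proof -
  consider "p = 0" | "p = 1" | q where "p = Suc (Suc q)" by (metis One_nat_def not0_implies_Suc)
  then show ?thesis
  proof cases
    case 1
    have "compact (lob ` {0..1})" by (intro compact_continuous_image continuous_on_lob) auto
    then obtain B where B: "\<And>x. x \<in> {0..1} \<Longrightarrow> \<bar>lob x\<bar> \<le> B"
      using compact_imp_bounded bounded_iff by (metis image_eqI real_norm_def)
    have "\<bar>lob x\<bar> \<le> B" for x
    proof -
      have "lob x = lob (frac x + of_int \<lfloor>x\<rfloor>)" by (simp add: frac_def)
      also have "\<dots> = lob (frac x)" by (rule lob_shift_int)
      finally show ?thesis using B[of "frac x"] by (simp add: frac_lt_1 less_imp_le)
    qed
    moreover have "B \<ge> 0" using B[of 0] by force
    ultimately show ?thesis using 1 by auto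
  next
    case 2
    have "\<bar>lsin x\<bar> \<le> ln 2 + \<bar>ln (2 * \<sigma>)\<bar>" if "\<bar>sin (pi * x)\<bar> \<ge> \<sigma>" for x
    proof -
      have "lsin x \<le> ln 2" unfolding lsin_def using that s
        by (subst ln_le_cancel_iff) (auto simp: abs_mult)
      moreover have "lsin x \<ge> ln (2 * \<sigma>)" unfolding lsin_def using that s
        by (subst ln_le_cancel_iff) (auto simp: abs_mult)
      moreover have "ln (2::real) \<ge> 0" by simp
      ultimately show ?thesis by linarith
    qed
    then show ?thesis using 2 by (intro exI[of _ "ln 2 + \<bar>ln (2 * \<sigma>)\<bar>"]) auto
  next
    case 3
    have "compact (poly (cotp q) ` {-(1/\<sigma>)..1/\<sigma>})" by (intro compact_continuous_image continuous_intros) auto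
    then obtain B where B: "\<And>t. t \<in> {-(1/\<sigma>)..1/\<sigma>} \<Longrightarrow> \<bar>poly (cotp q) t\<bar> \<le> B"
      using compact_imp_bounded bounded_iff by (metis image_eqI real_norm_def)
    have B0: "B \<ge> 0" using B[of 0] s by force
    have "\<bar>lsinD p x\<bar> \<le> pi ^ Suc q * B" if "\<bar>sin (pi * x)\<bar> \<ge> \<sigma>" for x
    proof -
      have "\<bar>cot (pi * x)\<bar> = \<bar>cos (pi * x)\<bar> / \<bar>sin (pi * x)\<bar>" by (simp add: cot_def)
      also have "\<dots> \<le> 1 / \<sigma>" using that s by (intro frac_le) auto
      finally have "\<bar>poly (cotp q) (cot (pi * x))\<bar> \<le> B" by (intro B) auto
      then show ?thesis using 3 by (simp add: abs_mult mult_left_mono)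
    qed
    then show ?thesis using B0 by (intro exI[of _ "pi ^ Suc q * B"]) auto
  qed
qed

section \<open>Distribution relations\<close>

lemma sum_residues:
  fixes F :: "int \<Rightarrow> real"
  assumes per: "\<And>k. F (k + int L) = F k" and L: "L > 0"
    and I: "finite I" "card I = L" and inj: "inj_on (\<lambda>i. g i mod int L) I"
  shows "(\<Sum>i\<in>I. F (g i)) = (\<Sum>k<L. F (int k))"
proof -
  have per_nat: "F (k + int n * int L) = F k" for k n
  proof (induction n)
    case (Suc n)
    show ?case using per[of "k + int n * int L"] Suc by (simp add: algebra_simps)
  qed simp
  have per': "F (k mod int L) = F k" for k
  proof (cases "k div int L \<ge> 0")
    case True
    then obtain n where "k div int L = int n" using nonneg_int_cases by blast
    then show ?thesis using per_nat[of "k mod int L" n] mod_div_mult_eq[of k "int L"] by simp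
  next
    case False
    then obtain n where "k div int L = - int n" using that[of "nat (- (k div int L))"] by auto
    then have "k mod int L = k + int n * int L" using mod_div_mult_eq[of k "int L"] by simp
    then show ?thesis using per_nat[of k n] by simp
  qed
  have sub: "(\<lambda>i. g i mod int L) ` I \<subseteq> {0..<int L}" using L by auto
  have "(\<lambda>i. g i mod int L) ` I = {0..<int L}"
    by (rule card_subset_eq) (use sub inj I in \<open>auto simp: card_image\<close>)
  then have "bij_betw (\<lambda>i. g i mod int L) I {0..<int L}" using inj by (simp add: bij_betw_def)
  then have "(\<Sum>k\<in>{0..<int L}. F k) = (\<Sum>i\<in>I. F (g i mod int L))"
    by (rule sum.reindex_bij_betw[symmetric])
  moreover have "(\<Sum>k\<in>{0..<int L}. F k) = (\<Sum>k<L. F (int k))"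
    by (rule sum.reindex_bij_witness[of _ int nat]) auto
  ultimately show ?thesis by (simp add: per')
qed

lemma prod_minus_roots_unity:
  assumes L: "L > 0"
  shows "(\<Prod>k<L. w - cis (2 * pi * real k / real L)) = w ^ L - 1"
proof -
  define p :: "complex poly" where "p = monom 1 L - 1"
  have pz: "poly p z = z ^ L - 1" for z by (simp add: p_def poly_monom)
  have lc: "degree p = L" "lead_coeff p = 1"
  proof -
    have "degree (monom 1 L - 1 :: complex poly) = degree (monom 1 L :: complex poly)"
      using degree_add_eq_left[of "- 1" "monom 1 L :: complex poly"] L by (simp add: degree_monom_eq)
    then show "degree p = L" by (simp add: p_def degree_monom_eq)
    then show "lead_coeff p = 1" using L by (simp add: p_def)
  qed
  have "rsquarefree p" unfolding rsquarefree_roots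
  proof (intro allI notI)
    fix z assume z: "poly p z = 0 \<and> poly (pderiv p) z = 0"
    then have "of_nat L * z ^ (L - 1) = 0" by (simp add: p_def pderiv_diff pderiv_monom poly_monom)
    then have "z = 0" using L by (cases "L - 1") auto
    then show False using z L by (simp add: pz zero_power)
  qed
  from complex_poly_decompose_rsquarefree[OF this] lc
  have "p = (\<Prod>z | z ^ L = 1. [:- z, 1:])" by (simp add: pz)
  then have "poly p w = (\<Prod>z | z ^ L = 1. w - z)" by (simp add: poly_prod)
  also have "\<dots> = (\<Prod>k<L. w - cis (2 * pi * real k / real L))"
    by (rule prod.reindex_bij_betw[OF Complex.bij_betw_roots_unity[OF L], symmetric])
  finally show ?thesis by (simp add: pz)
qed

text \<open>The logarithm of the factorisation of \<open>w ^ L - 1\<close> over the roots of unity, on the unit circle.\<close>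
lemma lsin_distribution:
  assumes L: "L > 0" and y: "sin (pi * (real L * y)) \<noteq> 0"
  shows "(\<Sum>k<L. lsin (y - real k / real L)) = lsin (real L * y)"
proof -
  have "cmod (\<Prod>k<L. cis (2 * pi * y) - cis (2 * pi * real k / real L)) = cmod (cis (2 * pi * y) ^ L - 1)"
    using prod_minus_roots_unity[OF L] by simp
  also have "cis (2 * pi * y) ^ L = cis (2 * pi * (real L * y))" by (subst Complex.DeMoivre) (simp add: mult_ac)
  also have "cmod (cis (2 * pi * (real L * y)) - 1) = \<bar>2 * sin (pi * (real L * y))\<bar>"
    using cmod_one_minus_cis[of "real L * y"] by (simp add: norm_minus_commute)
  also have "cmod (\<Prod>k<L. cis (2 * pi * y) - cis (2 * pi * real k / real L))
     = (\<Prod>k<L. \<bar>2 * sin (pi * (y - real k / real L))\<bar>)"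
    unfolding prod_norm[symmetric]
  proof (rule prod.cong)
    fix k
    have "cis (2 * pi * y) - cis (2 * pi * real k / real L)
       = - cis (2 * pi * real k / real L) * (1 - cis (2 * pi * (y - real k / real L)))"
    proof -
      have "cis (2 * pi * y) = cis (2 * pi * real k / real L) * cis (2 * pi * (y - real k / real L))"
        unfolding cis_mult by (rule arg_cong[of _ _ cis]) (simp add: algebra_simps)
      then show ?thesis by (simp add: algebra_simps)
    qed
    then show "cmod (cis (2 * pi * y) - cis (2 * pi * real k / real L)) = \<bar>2 * sin (pi * (y - real k / real L))\<bar>"
      using cmod_one_minus_cis[of "y - real k / real L"] by (simp add: norm_mult)
  qed simp
  finally have eq: "(\<Prod>k<L. \<bar>2 * sin (pi * (y - real k / real L))\<bar>) = \<bar>2 * sin (pi * (real L * y))\<bar>" .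
  with y have "(\<Prod>k<L. \<bar>2 * sin (pi * (y - real k / real L))\<bar>) \<noteq> 0" by simp
  then have "ln (\<Prod>k<L. \<bar>2 * sin (pi * (y - real k / real L))\<bar>) = (\<Sum>k<L. lsin (y - real k / real L))"
    unfolding lsin_def by (intro ln_prod) (auto simp: prod_zero_iff)
  then show ?thesis by (simp add: eq lsin_def)
qed

text \<open>The exact evaluation behind the passage through a singularity: summing over a whole period with step
  \<open>1 / L\<close> leaves only \<open>lsin \<theta>\<close>.\<close>
lemma lsin_full_period:
  assumes L: "L > 0" and th: "sin (pi * \<theta>) \<noteq> 0"
  shows "(\<Sum>l\<in>{l1<..l1 + int L}. lsin ((of_int l - \<theta>) / real L)) = lsin \<theta>"
proof -
  have L0: "real L \<noteq> 0" using L by simp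
  have "(\<Sum>l\<in>{l1<..l1 + int L}. lsin ((of_int l - \<theta>) / real L)) = (\<Sum>k<L. lsin ((of_int (int k) - \<theta>) / real L))"
  proof (rule sum_residues[where F = "\<lambda>l. lsin ((of_int l - \<theta>) / real L)" and g = "\<lambda>l. l"])
    show "lsin ((of_int (k + int L) - \<theta>) / real L) = lsin ((of_int k - \<theta>) / real L)" for k
    proof -
      have "(of_int (k + int L) - \<theta>) / real L = (of_int k - \<theta>) / real L + of_int 1"
        using L0 by (simp add: field_simps)
      then show ?thesis by (simp only: lsin_shift_int)
    qed
    show "inj_on (\<lambda>i. i mod int L) {l1<..l1 + int L}"
    proof (rule inj_onI)
      fix x y assume *: "x \<in> {l1<..l1 + int L}" "y \<in> {l1<..l1 + int L}" "x mod int L = y mod int L"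
      then have "int L dvd x - y" by (simp add: mod_eq_dvd_iff)
      moreover have "\<bar>x - y\<bar> < int L" using * by auto
      ultimately show "x = y" using dvd_imp_le_int[of "x - y" "int L"] by fastforce
    qed
  qed (use L in auto)
  also have "\<dots> = (\<Sum>k<L. lsin (\<theta> / real L - real k / real L))"
  proof (rule sum.cong)
    fix k
    have "(of_int (int k) - \<theta>) / real L = - (\<theta> / real L - real k / real L)" by (simp add: diff_divide_distrib)
    then show "lsin ((of_int (int k) - \<theta>) / real L) = lsin (\<theta> / real L - real k / real L)"
      by (simp only: lsin_minus)
  qed simp
  also have "\<dots> = lsin \<theta>" using lsin_distribution[OF L, of "\<theta> / real L"] th L0 by simp
  finally show ?thesis .
qed

lemma lsin_distribution_plus:
  assumes L: "L > 0" and v: "sin (pi * v) \<noteq> 0"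
  shows "(\<Sum>k<L. lsin ((v + real k) / real L)) = lsin v"
proof -
  have L0: "real L \<noteq> 0" using L by simp
  have "(\<Sum>k<L. lsin ((v + real k) / real L)) = (\<Sum>k<L. lsin ((- v) / real L - real k / real L))"
  proof (rule sum.cong)
    fix k
    have "(v + real k) / real L = - ((- v) / real L - real k / real L)" by (simp add: add_divide_distrib)
    then show "lsin ((v + real k) / real L) = lsin ((- v) / real L - real k / real L)"
      by (simp only: lsin_minus)
  qed simp
  then show ?thesis using lsin_distribution[OF L, of "- v / real L"] v L0 by (simp add: lsin_minus)
qed

text \<open>The two sides are continuous and have the same derivative where \<open>lsin_distribution_plus\<close> applies, so their
  difference is constant; oddness of \<open>lob\<close> removes the constant.\<close>
lemma lob_distribution:
  assumes L: "L > 0"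
  shows "(\<Sum>k<L. lob ((v + real k) / real L)) = lob v / real L"
proof -
  have L0: "real L \<noteq> 0" using L by simp
  define E where "E v = (\<Sum>k<L. lob ((v + real k) / real L)) - lob v / real L" for v
  have contE: "continuous_on A E" for A unfolding E_def
    by (intro continuous_intros continuous_on_compose2[OF continuous_on_lob[of UNIV]]) (use L0 in auto)
  have perS: "lob ((of_int (k + int L) + v) / real L) = lob ((of_int k + v) / real L)" for k v
  proof -
    have "(of_int (k + int L) + v) / real L = (of_int k + v) / real L + of_int 1"
      using L0 by (simp add: field_simps)
    then show ?thesis by (simp only: lob_shift_int)
  qed
  have inj1: "inj_on (\<lambda>i. (int i + 1) mod int L) {..<L}" "inj_on (\<lambda>i. (- int i) mod int L) {..<L}"
  proof -
    have a: "x = y" if "x < L" "y < L" "int L dvd int x - int y" for x y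
    proof -
      have "\<bar>int x - int y\<bar> < int L" using that by auto
      then have "int x - int y = 0" using that(3) dvd_imp_le_int[of "int x - int y" "int L"] by fastforce
      then show ?thesis by simp
    qed
    show "inj_on (\<lambda>i. (int i + 1) mod int L) {..<L}"
      by (rule inj_onI) (use a in \<open>auto simp: mod_eq_dvd_iff\<close>)
    show "inj_on (\<lambda>i. (- int i) mod int L) {..<L}"
    proof (rule inj_onI)
      fix x y assume *: "x \<in> {..<L}" "y \<in> {..<L}" "(- int x) mod int L = (- int y) mod int L"
      then have "int L dvd int y - int x" by (simp add: mod_eq_dvd_iff)
      then show "x = y" using a[of y x] * by auto
    qed
  qed
  have per: "E (v + 1) = E v" for v
  proof -
    have "(\<Sum>k<L. lob ((of_int (int k + 1) + v) / real L)) = (\<Sum>k<L. lob ((of_int (int k) + v) / real L))"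
      by (rule sum_residues[where F = "\<lambda>k. lob ((of_int k + v) / real L)" and g = "\<lambda>k. int k + 1"])
         (use perS L inj1 in \<open>auto simp del: of_int_add\<close>)
    then show ?thesis using lob_shift_int[of v 1] by (simp add: E_def algebra_simps)
  qed
  have odd: "E (- v) = - E v" for v
  proof -
    have "(\<Sum>k<L. lob ((of_int (- int k) + (- v)) / real L)) = (\<Sum>k<L. lob ((of_int (int k) + (- v)) / real L))"
      by (rule sum_residues[where F = "\<lambda>k. lob ((of_int k + (- v)) / real L)" and g = "\<lambda>k. - int k"])
         (use perS[of _ "- v"] L inj1 in \<open>auto simp del: of_int_add\<close>)
    moreover have "lob ((of_int (- int k) + (- v)) / real L) = - lob ((v + real k) / real L)" for k
    proof -
      have "(of_int (- int k) + (- v)) / real L = - ((v + real k) / real L)" unfolding minus_divide_left by simp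
      then show ?thesis by (simp only: lob_minus)
    qed
    ultimately have "(\<Sum>k<L. lob ((- v + real k) / real L)) = - (\<Sum>k<L. lob ((v + real k) / real L))"
      by (simp add: sum_negf add.commute)
    then show ?thesis by (simp add: E_def lob_minus)
  qed
  have E0: "E 0 = 0" using odd[of 0] by simp
  have "E u = 0" if u: "0 \<le> u" "u \<le> 1" for u
  proof -
    have "E u = E 0"
    proof (rule DERIV_isconst2[of 0 1])
      fix x :: real assume x: "0 < x" "x < 1"
      have sx: "sin (pi * x) \<noteq> 0" using x by (metis less_irrefl mult.right_neutral mult_less_cancel_left_pos mult_pos_pos pi_gt_zero sin_gt_zero)
      have sk: "sin (pi * ((x + real k) / real L)) \<noteq> 0" if "k < L" for k
      proof -
        have "0 < (x + real k) / real L" "(x + real k) / real L < 1"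
          using x that by (auto simp: field_simps)
        then show ?thesis by (metis less_irrefl mult.right_neutral mult_less_cancel_left_pos mult_pos_pos pi_gt_zero sin_gt_zero)
      qed
      have "(E has_real_derivative (\<Sum>k<L. lsin ((x + real k) / real L) * (1 / real L)) - lsin x / real L) (at x)"
        unfolding E_def
      proof (intro derivative_intros DERIV_sum)
        fix k assume "k \<in> {..<L}"
        then show "((\<lambda>v. lob ((v + real k) / real L)) has_real_derivative lsin ((x + real k) / real L) * (1 / real L)) (at x)"
          using L0 by (intro DERIV_chain2[OF lob_deriv] sk) (auto intro!: derivative_eq_intros)
      qed (rule DERIV_cdivide[OF lob_deriv[OF sx]])
      moreover have "(\<Sum>k<L. lsin ((x + real k) / real L) * (1 / real L)) - lsin x / real L = 0"
        using lsin_distribution_plus[OF L sx] by (simp add: sum_divide_distrib[symmetric])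
      ultimately show "(E has_real_derivative 0) (at x)" by simp
    qed (use u contE in auto)
    then show ?thesis using E0 by simp
  qed
  moreover have "E v = E (frac v)"
  proof -
    have pn: "E (u + real n) = E u" for u n
    proof (induction n)
      case (Suc n) then show ?case using per[of "u + real n"] by (simp add: algebra_simps)
    qed simp
    have "E (u + of_int k) = E u" for u k
    proof (cases "k \<ge> 0")
      case True
      then obtain n where "k = int n" using nonneg_int_cases by blast
      then show ?thesis using pn by simp
    next
      case False
      then obtain n where "k = - int n" using that[of "nat (- k)"] by auto
      then show ?thesis using pn[of "u + of_int k" n] by simp
    qed
    from this[of "frac v" "\<lfloor>v\<rfloor>"] show ?thesis by (simp add: frac_def)
  qed
  ultimately have "E v = 0" by (simp add: frac_lt_1 less_imp_le)
  then show ?thesis by (simp add: E_def)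
qed

section \<open>The regular part of the logarithmic sine\<close>

text \<open>The function \<open>sin (\<pi> z) / (\<pi> z)\<close> has no zero in the strip \<open>\<bar>Re z\<bar> < 1\<close> and so a holomorphic logarithm
  there. Splitting off \<open>ln \<bar>2 \<pi> x\<bar>\<close> therefore leaves a function that is smooth across 0.\<close>
lemma lsin_regular_part:
  obtains G where "deriv_chain G {-1<..<1}"
    "\<And>x. 0 < \<bar>x\<bar> \<Longrightarrow> \<bar>x\<bar> < 1 \<Longrightarrow> G 1 x = lsin x - ln \<bar>2 * pi * x\<bar>"
proof -
  define sinc :: "complex \<Rightarrow> complex" where "sinc z = (if z = 0 then 1 else sin (of_real pi * z) / (of_real pi * z))" for z
  define S where "S = {z. -1 < Re z \<and> Re z < 1}"
  have S: "open S" "convex S"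
  proof -
    have eq: "S = {z. -1 < Re z} \<inter> {z. Re z < 1}" by (auto simp: S_def)
    show "open S" "convex S" unfolding eq
      by (auto intro!: open_Int convex_Int open_halfspace_Re_lt open_halfspace_Re_gt convex_halfspace_Re_lt convex_halfspace_Re_gt)
  qed
  have hol: "sinc holomorphic_on S"
  proof (rule no_isolated_singularity'[where K = "{0}"])
    have "(\<lambda>z. sin (of_real pi * z) / (of_real pi * z)) holomorphic_on S - {0}" by (intro holomorphic_intros) auto
    then show "sinc holomorphic_on S - {0}"
      by (rule holomorphic_transform) (auto simp: sinc_def)
    fix z :: complex assume z: "z \<in> {0}"
    have "((\<lambda>z. sin (of_real pi * z)) has_field_derivative of_real pi) (at (0::complex))"
      by (auto intro!: derivative_eq_intros)
    then have "((\<lambda>z. (sin (of_real pi * z) - sin (of_real pi * 0)) / (z - 0)) \<longlongrightarrow> of_real pi) (at (0::complex))"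
      unfolding has_field_derivative_iff .
    then have "((\<lambda>z. (sin (of_real pi * z) - sin (of_real pi * 0)) / (z - 0) / of_real pi) \<longlongrightarrow> of_real pi / of_real pi) (at (0::complex))"
      by (intro tendsto_divide tendsto_const) auto
    moreover have "((\<lambda>z. (sin (of_real pi * z) - sin (of_real pi * 0)) / (z - 0) / of_real pi) \<longlongrightarrow> 1) (at (0::complex))
        \<longleftrightarrow> (sinc \<longlongrightarrow> 1) (at 0)"
      by (intro filterlim_cong refl) (auto simp: sinc_def eventually_at intro!: exI[of _ 1])
    ultimately have "(sinc \<longlongrightarrow> 1) (at 0)" by simp
    then show "(sinc \<longlongrightarrow> sinc z) (at z within S)"
      using z by (auto simp: sinc_def intro: tendsto_within_subset)
  qed (use S in auto)
  have nz: "sinc z \<noteq> 0" if z: "z \<in> S" for z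
  proof
    assume "sinc z = 0"
    then have z0: "z \<noteq> 0" "sin (of_real pi * z) = 0" by (auto simp: sinc_def split: if_splits)
    then obtain n :: int where "of_real pi * z = of_real (of_int n * pi)" by (auto simp: sin_eq_0)
    then have "z = of_int n" by (simp add: mult.commute)
    then have "n = 0" using z by (auto simp: S_def)
    then show False using z0 \<open>z = of_int n\<close> by simp
  qed
  have "0 \<in> S" by (simp add: S_def)
  obtain g where g: "g holomorphic_on S" "\<And>z. z \<in> S \<Longrightarrow> exp (g z) = sinc z"
    using holomorphic_logarithm_exists[OF S(2,1) hol nz \<open>0 \<in> S\<close>] by blast
  obtain H where "\<And>z. z \<in> S \<Longrightarrow> (H has_field_derivative g z) (at z within S)"
    using holomorphic_convex_primitive'[OF S(2,1) g(1)] by blast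
  then have H: "\<And>z. z \<in> S \<Longrightarrow> (H has_field_derivative g z) (at z)"
    by (metis S(1) at_within_open)
  have holH: "H holomorphic_on S" using H S(1) holomorphic_on_open by blast
  define G where "G p x = Re ((deriv ^^ p) H (of_real x))" for p and x :: real
  have "deriv_chain G {-1<..<1}" unfolding deriv_chain_def
  proof (intro allI ballI)
    fix p and x :: real assume "x \<in> {-1<..<1}"
    then have xS: "of_real x \<in> S" by (simp add: S_def)
    have "((deriv ^^ p) H has_field_derivative (deriv ^^ Suc p) H (of_real x)) (at (of_real x))"
      using holomorphic_derivI[OF holomorphic_higher_deriv[OF holH S(1)] S(1) xS, of p UNIV] by simp
    then have "((\<lambda>x. (deriv ^^ p) H (of_real x)) has_vector_derivative (deriv ^^ Suc p) H (of_real x)) (at x)"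
      by (rule has_vector_derivative_real_field)
    then have "((\<lambda>x. Re ((deriv ^^ p) H (of_real x))) has_vector_derivative Re ((deriv ^^ Suc p) H (of_real x))) (at x)"
      by (rule bounded_linear.has_vector_derivative[OF bounded_linear_Re])
    then show "(G p has_real_derivative G (Suc p) x) (at x)"
      by (simp add: G_def[abs_def] has_real_derivative_iff_has_vector_derivative)
  qed
  moreover have "G 1 x = lsin x - ln \<bar>2 * pi * x\<bar>" if x: "0 < \<bar>x\<bar>" "\<bar>x\<bar> < 1" for x
  proof -
    have xS: "of_real x \<in> S" using x by (auto simp: S_def)
    have s: "sinc (of_real x) = of_real (sin (pi * x) / (pi * x))"
      using x by (simp add: sinc_def sin_of_real[symmetric])
    have n0: "sin (pi * x) \<noteq> 0" using nz[OF xS] s by auto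
    have "exp (Re (g (of_real x))) = \<bar>sin (pi * x) / (pi * x)\<bar>"
      using g(2)[OF xS] s by (metis norm_exp_eq_Re norm_of_real)
    then have "Re (g (of_real x)) = ln \<bar>sin (pi * x) / (pi * x)\<bar>" by (metis ln_exp)
    also have "\<dots> = lsin x - ln \<bar>2 * pi * x\<bar>"
      using x n0 by (simp add: lsin_def abs_mult abs_divide ln_div ln_mult)
    finally show ?thesis using H[OF xS] by (simp add: G_def DERIV_imp_deriv)
  qed
  ultimately show ?thesis using that by blast
qed

section \<open>Summation across a singularity\<close>

lemma sin_pi_lower:
  assumes "0 < \<eta>" "\<eta> \<le> x - of_int k" "x - of_int k \<le> 1 - \<eta>"
  shows "\<bar>sin (pi * x)\<bar> \<ge> sin (pi * \<eta>)"
proof -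
  define y where "y = x - of_int k"
  have y: "\<eta> \<le> y" "y \<le> 1 - \<eta>" using assms by (auto simp: y_def)
  have "sin (pi * y) \<ge> sin (pi * \<eta>)"
  proof (cases "y \<le> 1/2")
    case True
    have "0 \<le> pi * \<eta>" using assms(1) by simp
    then have "- (pi / 2) \<le> pi * \<eta>" using pi_gt_zero by linarith
    then show ?thesis using y assms(1) True by (intro sin_monotone_2pi_le) auto
  next
    case False
    have "pi * \<eta> \<le> pi * (1 - y)" using y by (intro mult_left_mono) auto
    then have "sin (pi * (1 - y)) \<ge> sin (pi * \<eta>)"
    proof (intro sin_monotone_2pi_le)
      have "0 \<le> pi * \<eta>" using assms(1) by simp
      then show "- (pi / 2) \<le> pi * \<eta>" using pi_gt_zero by linarith
      have "pi * (1 - y) \<le> pi * (1 / 2)" using False by (intro mult_left_mono) auto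
      then show "pi * (1 - y) \<le> pi / 2" by simp
    qed
    then show ?thesis by (simp add: algebra_simps)
  qed
  then show ?thesis using sin_pi_shift_int[of y k] by (simp add: y_def)
qed

lemma sin_pi_eta_pos: "0 < \<eta> \<Longrightarrow> \<eta> < 1 \<Longrightarrow> sin (pi * \<eta>) > 0"
  by (intro sin_gt_zero) auto

lemma sin_pi_nz: "0 < \<bar>x\<bar> \<Longrightarrow> \<bar>x\<bar> < 1 \<Longrightarrow> sin (pi * x) \<noteq> 0"
  using sin_pi_eta_pos[of "\<bar>x\<bar>"] by (cases "x \<ge> 0") auto

definition lsin_em :: "real \<Rightarrow> nat \<Rightarrow> real \<Rightarrow> real" where
  "lsin_em M K x = em_primitive lsinD (1 / M) K x"

lemma lsin_em_shift_int: "lsin_em M K (x + of_int k) = lsin_em M K x"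
  by (simp add: lsin_em_def em_primitive_def lsinD_shift_int)

text \<open>A single step of the summation, with an error uniform in the position as long as \<open>x\<close> keeps a fixed distance
  from the integers.\<close>
lemma lsin_em_step:
  assumes "0 < \<eta>" "\<eta> < 1" "K \<ge> 1"
  obtains C where "C \<ge> 0"
    "\<And>M x k. M > 0 \<Longrightarrow> \<eta> \<le> x - 1 / M - of_int k \<Longrightarrow> x - of_int k \<le> 1 - \<eta> \<Longrightarrow>
      \<bar>lsin x - (lsin_em M K x - lsin_em M K (x - 1 / M))\<bar> \<le> C * (1 / M) ^ K"
proof -
  define \<sigma> where "\<sigma> = sin (pi * \<eta>)"
  have s: "\<sigma> > 0" using assms sin_pi_eta_pos by (simp add: \<sigma>_def)
  obtain B where B: "B \<ge> 0" "\<And>x. \<bar>sin (pi * x)\<bar> \<ge> \<sigma> \<Longrightarrow> \<bar>lsinD (Suc K) x\<bar> \<le> B"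
    using lsinD_bound[OF s, of "Suc K"] by blast
  show ?thesis
  proof (rule that[of "em_const K * B"])
    show "em_const K * B \<ge> 0" using B em_const_nonneg by simp
    fix M x :: real and k :: int
    assume M: "M > 0" and x: "\<eta> \<le> x - 1 / M - of_int k" "x - of_int k \<le> 1 - \<eta>"
    have low: "\<bar>sin (pi * t)\<bar> \<ge> \<sigma>" if "t \<in> {x - 1/M..x - 1/M + 1/M}" for t
      unfolding \<sigma>_def by (rule sin_pi_lower[of _ _ k]) (use assms x that in auto)
    have "\<bar>lsinD 1 (x - 1/M + 1/M) - (em_primitive lsinD (1/M) K (x - 1/M + 1/M) - em_primitive lsinD (1/M) K (x - 1/M))\<bar>
        \<le> em_const K * B * (1/M) ^ K"
    proof (rule em_step)
      show "deriv_chain lsinD {x - 1/M..x - 1/M + 1/M}"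
        by (rule deriv_chain_subset[OF lsinD_chain]) (use low s in force)
    qed (use M assms B low in auto)
    then show "\<bar>lsin x - (lsin_em M K x - lsin_em M K (x - 1 / M))\<bar> \<le> em_const K * B * (1 / M) ^ K"
      by (simp add: lsin_em_def)
  qed
qed

lemma lsin_em_sum:
  assumes "0 < \<eta>" "\<eta> < 1" "K \<ge> 1"
  obtains C where "C \<ge> 0"
    "\<And>M \<theta> l1 l2. M > 0 \<Longrightarrow> l1 \<le> l2 \<Longrightarrow> \<eta> \<le> (of_int l1 - \<theta>) / M \<Longrightarrow> (of_int l2 - \<theta>) / M \<le> 1 - \<eta> \<Longrightarrow>
      \<bar>(\<Sum>l\<in>{l1<..l2}. lsin ((of_int l - \<theta>) / M))
        - (lsin_em M K ((of_int l2 - \<theta>) / M) - lsin_em M K ((of_int l1 - \<theta>) / M))\<bar> \<le> C * M * (1 / M) ^ K"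
proof -
  define \<sigma> where "\<sigma> = sin (pi * \<eta>)"
  have s: "\<sigma> > 0" using assms sin_pi_eta_pos by (simp add: \<sigma>_def)
  obtain B where B: "B \<ge> 0" "\<And>x. \<bar>sin (pi * x)\<bar> \<ge> \<sigma> \<Longrightarrow> \<bar>lsinD (Suc K) x\<bar> \<le> B"
    using lsinD_bound[OF s, of "Suc K"] by blast
  show ?thesis
  proof (rule that[of "em_const K * B"])
    show "em_const K * B \<ge> 0" using B em_const_nonneg by simp
    fix M \<theta> :: real and l1 l2 :: int
    assume M: "M > 0" and l: "l1 \<le> l2" and e: "\<eta> \<le> (of_int l1 - \<theta>) / M" "(of_int l2 - \<theta>) / M \<le> 1 - \<eta>"
    have low: "\<bar>sin (pi * t)\<bar> \<ge> \<sigma>" if "t \<in> {(of_int l1 - \<theta>) * (1/M)..(of_int l2 - \<theta>) * (1/M)}" for t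
      unfolding \<sigma>_def by (rule sin_pi_lower[of _ _ 0]) (use assms e that in auto)
    have "\<bar>(\<Sum>l\<in>{l1<..l2}. lsinD 1 ((of_int l - \<theta>) * (1/M)))
     - (em_primitive lsinD (1/M) K ((of_int l2 - \<theta>) * (1/M)) - em_primitive lsinD (1/M) K ((of_int l1 - \<theta>) * (1/M)))\<bar>
     \<le> of_int (l2 - l1) * (em_const K * B * (1/M) ^ K)"
    proof (rule em_sum)
      show "deriv_chain lsinD {(of_int l1 - \<theta>) * (1/M)..(of_int l2 - \<theta>) * (1/M)}"
        by (rule deriv_chain_subset[OF lsinD_chain]) (use low s in force)
    qed (use M assms l B low in auto)
    also have "\<dots> \<le> M * (em_const K * B * (1/M) ^ K)"
    proof (rule mult_right_mono)
      have "(of_int l2 - \<theta>) / M - (of_int l1 - \<theta>) / M \<le> 1" using e assms by linarith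
      then show "of_int (l2 - l1) \<le> M" using M by (simp add: field_simps)
      show "0 \<le> em_const K * B * (1/M) ^ K" using B em_const_nonneg M by simp
    qed
    finally show "\<bar>(\<Sum>l\<in>{l1<..l2}. lsin ((of_int l - \<theta>) / M))
        - (lsin_em M K ((of_int l2 - \<theta>) / M) - lsin_em M K ((of_int l1 - \<theta>) / M))\<bar> \<le> em_const K * B * M * (1 / M) ^ K"
      by (simp add: lsin_em_def mult_ac)
  qed
qed

text \<open>The contribution of a passage through an integer when the grid points are \<open>(l - \<theta>) / M\<close>. For \<open>\<theta> = 0\<close> the
  grid hits the singularity; that point carries the value \<open>ln 0 = 0\<close>, and what remains is \<open>ln M\<close>.\<close>
definition cross_val :: "real \<Rightarrow> real \<Rightarrow> real" where
  "cross_val M \<theta> = (if \<theta> = 0 then ln M else lsin \<theta>)"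

text \<open>The limit \<open>\<theta> \<rightarrow> 0\<close> of \<open>lsin_full_period\<close> after removal of the singular term, which is 0 by the
  convention \<open>ln 0 = 0\<close>; it amounts to the product of \<open>2 sin (\<pi> k / L)\<close> over \<open>0 < k < L\<close> being \<open>L\<close>.\<close>
lemma lsin_full_period_0:
  assumes l: "l1 < 0" "0 \<le> l1 + int L" "L > 0"
  shows "(\<Sum>l\<in>{l1<..l1 + int L}. lsin (of_int l / real L)) = ln (real L)"
proof -
  have L0: "real L > 0" using l by simp
  obtain G where G: "deriv_chain G {-1<..<1}"
    "\<And>x. 0 < \<bar>x\<bar> \<Longrightarrow> \<bar>x\<bar> < 1 \<Longrightarrow> G 1 x = lsin x - ln \<bar>2 * pi * x\<bar>" using lsin_regular_part by blast
  have "(G 1 has_real_derivative G (Suc 1) 0) (at 0)"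
    using G(1) unfolding deriv_chain_def by (elim allE[of _ 1] ballE[of _ _ 0]) auto
  then have G1: "isCont (G 1) 0" by (rule DERIV_isCont)
  define I where "I = {l1<..l1 + int L} - {0}"
  have fI: "finite I" by (simp add: I_def)
  have split: "(\<Sum>l\<in>{l1<..l1 + int L}. f l) = f 0 + (\<Sum>l\<in>I. f l)" for f :: "int \<Rightarrow> real"
    unfolding I_def by (rule sum.remove) (use l in auto)
  have clsin: "isCont lsin x" if "sin (pi * x) \<noteq> 0" for x
    using lsin_deriv[OF that] by (rule DERIV_isCont)
  have A: "((\<lambda>\<theta>. \<Sum>l\<in>I. lsin ((of_int l - \<theta>) / real L)) \<longlongrightarrow> (\<Sum>l\<in>I. lsin (of_int l / real L))) (at 0)"
  proof (rule tendsto_sum)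
    fix l assume "l \<in> I"
    then have "0 < \<bar>real_of_int l / real L\<bar>" "\<bar>real_of_int l / real L\<bar> < 1"
      using l by (auto simp: I_def abs_if field_simps)
    then have "isCont lsin (of_int l / real L)" by (intro clsin sin_pi_nz)
    moreover have "((\<lambda>\<theta>. (of_int l - \<theta>) / real L) \<longlongrightarrow> (of_int l - 0) / real L) (at 0)"
      using L0 by (intro tendsto_intros) auto
    ultimately show "((\<lambda>\<theta>. lsin ((of_int l - \<theta>) / real L)) \<longlongrightarrow> lsin (of_int l / real L)) (at 0)"
      by (intro isCont_tendsto_compose[of _ lsin]) auto
  qed
  have B: "((\<lambda>\<theta>. G 1 \<theta> - G 1 (\<theta> / real L) + ln (real L)) \<longlongrightarrow> G 1 0 - G 1 0 + ln (real L)) (at 0)"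
  proof (intro tendsto_intros)
    show "(G 1 \<longlongrightarrow> G 1 0) (at 0)" using G1 by (simp add: isCont_def)
    have "((\<lambda>\<theta>. \<theta> / real L) \<longlongrightarrow> 0 / real L) (at 0)" using L0 by (intro tendsto_intros) auto
    then show "((\<lambda>\<theta>. G 1 (\<theta> / real L)) \<longlongrightarrow> G 1 0) (at 0)"
      by (intro isCont_tendsto_compose[OF G1]) auto
  qed
  have "eventually (\<lambda>\<theta>. (\<Sum>l\<in>I. lsin ((of_int l - \<theta>) / real L)) = G 1 \<theta> - G 1 (\<theta> / real L) + ln (real L)) (at 0)"
    unfolding eventually_at
  proof (intro exI[of _ 1] conjI ballI impI)
    fix \<theta> :: real assume "\<theta> \<noteq> 0 \<and> dist \<theta> 0 < 1"
    then have th: "0 < \<bar>\<theta>\<bar>" "\<bar>\<theta>\<bar> < 1" by auto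
    have L1: "real L \<ge> 1" using l by simp
    have th': "0 < \<bar>\<theta> / real L\<bar>" "\<bar>\<theta> / real L\<bar> < 1" using th L0 L1 by (auto simp: field_simps)
    have "lsin \<theta> = (\<Sum>l\<in>{l1<..l1 + int L}. lsin ((of_int l - \<theta>) / real L))"
      by (rule lsin_full_period[symmetric]) (use l th sin_pi_nz in auto)
    also have "\<dots> = lsin (- (\<theta> / real L)) + (\<Sum>l\<in>I. lsin ((of_int l - \<theta>) / real L))"
      by (subst split) simp
    finally have "(\<Sum>l\<in>I. lsin ((of_int l - \<theta>) / real L)) = lsin \<theta> - lsin (\<theta> / real L)"
      by (simp add: lsin_minus)
    also have "\<dots> = G 1 \<theta> - G 1 (\<theta> / real L) + (ln \<bar>2 * pi * \<theta>\<bar> - ln \<bar>2 * pi * (\<theta> / real L)\<bar>)"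
      using G(2)[OF th] G(2)[OF th'] by simp
    also have "ln \<bar>2 * pi * \<theta>\<bar> - ln \<bar>2 * pi * (\<theta> / real L)\<bar> = ln (real L)"
      using th L0 by (simp add: abs_mult abs_divide ln_mult ln_div)
    finally show "(\<Sum>l\<in>I. lsin ((of_int l - \<theta>) / real L)) = G 1 \<theta> - G 1 (\<theta> / real L) + ln (real L)" .
  qed simp
  from Lim_transform_eventually[OF A this] have "(\<Sum>l\<in>I. lsin (of_int l / real L)) = ln (real L)"
    using tendsto_unique[OF _ _ B] by simp
  then show ?thesis by (subst split) (simp add: lsin_def)
qed

text \<open>In \<open>lsin x - lsin (\<kappa> x)\<close> the logarithmic singularities at 0 cancel up to the constant \<open>ln \<kappa>\<close>. With this
  difference Euler--Maclaurin summation may run straight across 0. The primitives agree only up to a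
  constant on punctured intervals, a constant that drops out of the differences in which they occur.\<close>
lemma lsin_rescaling_chain:
  assumes G: "deriv_chain G {-1<..<1}"
    "\<And>x. 0 < \<bar>x\<bar> \<Longrightarrow> \<bar>x\<bar> < 1 \<Longrightarrow> G 1 x = lsin x - ln \<bar>2 * pi * x\<bar>"
  assumes \<kappa>: "\<kappa> \<ge> 1"
  defines "E \<equiv> (\<lambda>p x. G p x - \<kappa> ^ p / \<kappa> * G p (\<kappa> * x)
     - (if p = 0 then x * ln \<kappa> else if p = 1 then ln \<kappa> else 0))"
  shows "deriv_chain E {x. \<kappa> * \<bar>x\<bar> < 1}"
    and "\<And>p x. p \<ge> 1 \<Longrightarrow> 0 < \<bar>x\<bar> \<Longrightarrow> \<kappa> * \<bar>x\<bar> < 1 \<Longrightarrow> E p x = lsinD p x - \<kappa> ^ p / \<kappa> * lsinD p (\<kappa> * x)"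
    and "\<exists>k. \<forall>x. 0 < \<bar>x\<bar> \<longrightarrow> \<kappa> * \<bar>x\<bar> < 1 \<longrightarrow> E 0 x + k = lsinD 0 x - \<kappa> ^ 0 / \<kappa> * lsinD 0 (\<kappa> * x)"
proof -
  have \<kappa>0: "\<kappa> > 0" using \<kappa> by simp
  have sm: "\<bar>x\<bar> < 1" "\<bar>\<kappa> * x\<bar> < 1" if "\<kappa> * \<bar>x\<bar> < 1" for x
  proof -
    have "1 * \<bar>x\<bar> \<le> \<kappa> * \<bar>x\<bar>" using \<kappa> by (intro mult_right_mono) auto
    then show "\<bar>x\<bar> < 1" using that by simp
    show "\<bar>\<kappa> * x\<bar> < 1" using that \<kappa>0 by (simp add: abs_mult)
  qed
  have resc: "((\<lambda>x. \<kappa> ^ p / \<kappa> * F p (\<kappa> * x)) has_real_derivative \<kappa> ^ Suc p / \<kappa> * F (Suc p) (\<kappa> * x)) (at x)"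
    if "(F p has_real_derivative F (Suc p) (\<kappa> * x)) (at (\<kappa> * x))" for F :: "nat \<Rightarrow> real \<Rightarrow> real" and p x
  proof -
    have d: "((\<lambda>x. F p (\<kappa> * x)) has_real_derivative F (Suc p) (\<kappa> * x) * \<kappa>) (at x)"
      by (rule DERIV_chain2[where f = "F p" and g = "(*) \<kappa>", OF that]) (auto intro!: derivative_eq_intros)
    show ?thesis by (rule DERIV_cong[OF DERIV_cmult[OF d]]) (use \<kappa>0 in auto)
  qed
  show chain: "deriv_chain E {x. \<kappa> * \<bar>x\<bar> < 1}"
    unfolding deriv_chain_def
  proof (intro allI ballI)
    fix p x assume "x \<in> {x. \<kappa> * \<bar>x\<bar> < 1}"
    then have x: "\<kappa> * \<bar>x\<bar> < 1" by simp
    have 1: "(G p has_real_derivative G (Suc p) x) (at x)"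
      and 2: "(G p has_real_derivative G (Suc p) (\<kappa> * x)) (at (\<kappa> * x))"
      using G(1) sm[OF x] by (auto simp: deriv_chain_def abs_less_iff)
    have 3: "((\<lambda>x. if p = 0 then x * ln \<kappa> else if p = 1 then ln \<kappa> else 0) has_real_derivative
        (if Suc p = 0 then x * ln \<kappa> else if Suc p = 1 then ln \<kappa> else 0)) (at x)"
      by (cases "p = 0"; cases "p = 1") (auto intro!: derivative_eq_intros)
    show "(E p has_real_derivative E (Suc p) x) (at x)"
      unfolding E_def by (intro DERIV_diff 1 resc[where F = G, OF 2] 3)
  qed
  define U where "U = {x. x \<noteq> 0 \<and> \<kappa> * \<bar>x\<bar> < 1}"
  have oU: "open U"
    unfolding U_def by (intro open_Collect_conj open_Collect_neq open_Collect_less continuous_intros)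
  define F where "F p x = lsinD p x - \<kappa> ^ p / \<kappa> * lsinD p (\<kappa> * x)" for p x
  have Fder: "(F p has_real_derivative F (Suc p) x) (at x)" if "x \<in> U" for p x
  proof -
    have x: "0 < \<bar>x\<bar>" "\<kappa> * \<bar>x\<bar> < 1" using that by (auto simp: U_def)
    have "sin (pi * x) \<noteq> 0" "sin (pi * (\<kappa> * x)) \<noteq> 0"
      using sin_pi_nz[of x] sin_pi_nz[of "\<kappa> * x"] sm[OF x(2)] x \<kappa>0 by auto
    then have 1: "(lsinD p has_real_derivative lsinD (Suc p) x) (at x)"
      and 2: "(lsinD p has_real_derivative lsinD (Suc p) (\<kappa> * x)) (at (\<kappa> * x))"
      using lsinD_chain by (auto simp: deriv_chain_def simp del: lsinD.simps)
    show ?thesis unfolding F_def by (intro DERIV_diff 1 resc[where F = lsinD, OF 2])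
  qed
  have EF: "E (Suc p) x = F (Suc p) x" if "x \<in> U" for p x
    using that
  proof (induction p arbitrary: x)
    case 0
    then have x: "0 < \<bar>x\<bar>" "\<kappa> * \<bar>x\<bar> < 1" by (auto simp: U_def)
    have "G 1 x = lsin x - ln \<bar>2 * pi * x\<bar>" "G 1 (\<kappa> * x) = lsin (\<kappa> * x) - ln \<bar>2 * pi * (\<kappa> * x)\<bar>"
      using x sm[OF x(2)] \<kappa>0 G(2)[of x] G(2)[of "\<kappa> * x"] by auto
    moreover have "ln \<bar>2 * pi * (\<kappa> * x)\<bar> = ln \<bar>2 * pi * x\<bar> + ln \<kappa>"
      using x \<kappa>0 by (simp add: abs_mult ln_mult)
    ultimately show ?case using \<kappa>0 by (simp add: E_def F_def)
  next
    case (Suc p)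
    have "(E (Suc p) has_real_derivative E (Suc (Suc p)) x) (at x)"
      using chain Suc.prems by (auto simp: deriv_chain_def U_def)
    then have "(F (Suc p) has_real_derivative E (Suc (Suc p)) x) (at x)"
      by (rule has_field_derivative_transform_within_open[OF _ oU Suc.prems]) (use Suc.IH in auto)
    then show ?case using DERIV_unique Fder[OF Suc.prems] by blast
  qed
  show "E p x = lsinD p x - \<kappa> ^ p / \<kappa> * lsinD p (\<kappa> * x)" if "p \<ge> 1" "0 < \<bar>x\<bar>" "\<kappa> * \<bar>x\<bar> < 1" for p x
    using EF[of x "p - 1"] that by (simp add: U_def F_def)
  show "\<exists>k. \<forall>x. 0 < \<bar>x\<bar> \<longrightarrow> \<kappa> * \<bar>x\<bar> < 1 \<longrightarrow> E 0 x + k = lsinD 0 x - \<kappa> ^ 0 / \<kappa> * lsinD 0 (\<kappa> * x)"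
  proof -
    define \<delta> where "\<delta> x = F 0 x - E 0 x" for x
    have F0: "F 0 = (\<lambda>x. lob x - 1 / \<kappa> * lob (\<kappa> * x))" by (auto simp: F_def)
    have contE: "continuous_on {x. \<kappa> * \<bar>x\<bar> < 1} (E 0)"
      using chain by (intro DERIV_continuous_on[where D = "E (Suc 0)"]) (auto simp: deriv_chain_def intro: has_field_derivative_at_within)
    have contd: "continuous_on {x. \<kappa> * \<bar>x\<bar> < 1} \<delta>"
      unfolding \<delta>_def[abs_def] F0
      by (intro continuous_on_diff contE continuous_on_mult continuous_on_const continuous_on_lob
            continuous_on_compose2[OF continuous_on_lob[of UNIV]] continuous_on_id) auto
    have dd: "(\<delta> has_real_derivative 0) (at x)" if "x \<in> U" for x
    proof -
      have "(\<delta> has_real_derivative F (Suc 0) x - E (Suc 0) x) (at x)"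
        unfolding \<delta>_def[abs_def] using that chain
        by (intro DERIV_diff Fder) (auto simp: deriv_chain_def U_def)
      then show ?thesis using EF[OF that, of 0] by simp
    qed
    have d0: "\<delta> x = \<delta> 0" if x: "0 < \<bar>x\<bar>" "\<kappa> * \<bar>x\<bar> < 1" for x
    proof (cases "x > 0")
      case True
      have sub: "{0..x} \<subseteq> {x. \<kappa> * \<bar>x\<bar> < 1}"
      proof
        fix y assume "y \<in> {0..x}"
        then have "\<kappa> * \<bar>y\<bar> \<le> \<kappa> * \<bar>x\<bar>" using \<kappa>0 by (intro mult_left_mono) auto
        then show "y \<in> {x. \<kappa> * \<bar>x\<bar> < 1}" using x by simp
      qed
      show ?thesis
      proof (rule DERIV_isconst2[of 0 x])
        fix y assume y: "0 < y" "y < x"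
        then have "y \<in> {0..x}" by simp
        then have "\<kappa> * \<bar>y\<bar> < 1" using sub by blast
        then have "y \<in> U" using y by (auto simp: U_def)
        then show "(\<delta> has_real_derivative 0) (at y)" by (rule dd)
      qed (use True in \<open>auto intro!: continuous_on_subset[OF contd sub]\<close>)
    next
      case False
      have sub: "{x..0} \<subseteq> {x. \<kappa> * \<bar>x\<bar> < 1}"
      proof
        fix y assume "y \<in> {x..0}"
        then have "\<kappa> * \<bar>y\<bar> \<le> \<kappa> * \<bar>x\<bar>" using \<kappa>0 by (intro mult_left_mono) auto
        then show "y \<in> {x. \<kappa> * \<bar>x\<bar> < 1}" using x by simp
      qed
      have "\<delta> 0 = \<delta> x"
      proof (rule DERIV_isconst2[of x 0])
        fix y assume y: "x < y" "y < 0"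
        then have "y \<in> {x..0}" by simp
        then have "\<kappa> * \<bar>y\<bar> < 1" using sub by blast
        then have "y \<in> U" using y by (auto simp: U_def)
        then show "(\<delta> has_real_derivative 0) (at y)" by (rule dd)
      qed (use False x in \<open>auto intro!: continuous_on_subset[OF contd sub]\<close>)
      then show ?thesis by simp
    qed
    then have "E 0 x + \<delta> 0 = F 0 x" if "0 < \<bar>x\<bar>" "\<kappa> * \<bar>x\<bar> < 1" for x
    proof -
      have "F 0 x - E 0 x = \<delta> x" by (simp only: \<delta>_def)
      also have "\<dots> = \<delta> 0" by (rule d0) fact+
      finally show ?thesis by linarith
    qed
    then show ?thesis unfolding F_def by blast
  qed
qed

text \<open>For integral \<open>M\<close> a full period is evaluated exactly by \<open>lsin_full_period\<close>. For general \<open>M\<close> the grid is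
  compared with the one of integral size \<open>L = \<lfloor>M\<rfloor>\<close>: with \<open>\<kappa> = M / L\<close> the difference of the two
  summands is smooth across 0 and its sum is given by Euler--Maclaurin summation. The remaining part of
  the period for step \<open>1 / L\<close> lies away from the integers, so that it is covered by \<open>lsin_em_sum\<close>. All
  boundary terms at step \<open>1 / L\<close> cancel by periodicity.\<close>
lemma crossing_unit:
  assumes \<eta>: "0 < \<eta>" "\<eta> < 1" and K: "K \<ge> 1"
  obtains C M0 where "C \<ge> 0" "M0 \<ge> 1"
    "\<And>M \<theta> l1 l2. M \<ge> M0 \<Longrightarrow> sin (pi * \<theta>) \<noteq> 0 \<or> \<theta> = 0 \<Longrightarrow>
      - (1 - \<eta>) \<le> (of_int l1 - \<theta>) / M \<Longrightarrow> (of_int l1 - \<theta>) / M \<le> - \<eta> \<Longrightarrow>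
      \<eta> \<le> (of_int l2 - \<theta>) / M \<Longrightarrow> (of_int l2 - \<theta>) / M \<le> 1 - \<eta> \<Longrightarrow>
      \<bar>(\<Sum>l\<in>{l1<..l2}. lsin ((of_int l - \<theta>) / M))
        - (lsin_em M K ((of_int l2 - \<theta>) / M) - lsin_em M K ((of_int l1 - \<theta>) / M)) - cross_val M \<theta>\<bar>
      \<le> C * M * (1 / M) ^ K"
proof -
  obtain G where G: "deriv_chain G {-1<..<1}"
    "\<And>x. 0 < \<bar>x\<bar> \<Longrightarrow> \<bar>x\<bar> < 1 \<Longrightarrow> G 1 x = lsin x - ln \<bar>2 * pi * x\<bar>" using lsin_regular_part by blast
  have "compact (G (Suc K) ` {-(1-\<eta>/2)..1-\<eta>/2})"
  proof (intro compact_continuous_image)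
    show "continuous_on {-(1-\<eta>/2)..1-\<eta>/2} (G (Suc K))"
      using G(1) \<eta> by (intro DERIV_continuous_on[where D = "G (Suc (Suc K))"]) (auto simp: deriv_chain_def intro: has_field_derivative_at_within)
  qed auto
  then obtain B where B: "\<And>t. t \<in> {-(1-\<eta>/2)..1-\<eta>/2} \<Longrightarrow> \<bar>G (Suc K) t\<bar> \<le> B"
    using compact_imp_bounded bounded_iff by (metis image_eqI real_norm_def)
  have B0: "B \<ge> 0" using B[of 0] \<eta> by force
  have \<eta>2: "0 < \<eta> / 2" "\<eta> / 2 < 1" using \<eta> by auto
  obtain C2 where C2: "C2 \<ge> 0" "\<And>M \<theta> l1 l2. M > 0 \<Longrightarrow> l1 \<le> l2 \<Longrightarrow> \<eta> / 2 \<le> (of_int l1 - \<theta>) / M \<Longrightarrow> (of_int l2 - \<theta>) / M \<le> 1 - \<eta> / 2 \<Longrightarrow>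
      \<bar>(\<Sum>l\<in>{l1<..l2}. lsin ((of_int l - \<theta>) / M))
        - (lsin_em M K ((of_int l2 - \<theta>) / M) - lsin_em M K ((of_int l1 - \<theta>) / M))\<bar> \<le> C2 * M * (1 / M) ^ K"
    using lsin_em_sum[OF \<eta>2 K] by blast
  define B' where "B' = B + 2 ^ K * B"
  have B'0: "B' \<ge> 0" using B0 by (simp add: B'_def)
  \<comment> \<open>\<open>B'\<close> bounds the derivative of the difference (with \<open>\<kappa> \<le> 2\<close>), and \<open>2 ^ K\<close> passes from powers of \<open>1 / L\<close> to
  powers of \<open>1 / M\<close>.\<close>
  define C where "C = 2 * (em_const K * B') + C2 * 2 ^ K"
  \<comment> \<open>\<open>M \<ge> 2 + 2 / \<eta>\<close> forces \<open>\<kappa> (1 - \<eta>) \<le> 1 - \<eta> / 2\<close>, so the rescaled grid stays off the next integers.\<close>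
  show ?thesis
  proof (rule that[of C "2 + 2 / \<eta>"])
    show "C \<ge> 0" using em_const_nonneg B'0 C2 by (simp add: C_def)
    show "1 \<le> 2 + 2 / \<eta>" using \<eta> by simp
    fix M \<theta> :: real and l1 l2 :: int
    assume M: "M \<ge> 2 + 2 / \<eta>" and th: "sin (pi * \<theta>) \<noteq> 0 \<or> \<theta> = 0"
      and l1: "- (1 - \<eta>) \<le> (of_int l1 - \<theta>) / M" "(of_int l1 - \<theta>) / M \<le> - \<eta>"
      and l2: "\<eta> \<le> (of_int l2 - \<theta>) / M" "(of_int l2 - \<theta>) / M \<le> 1 - \<eta>"
    have e2: "2 / \<eta> > 0" using \<eta> by simp
    have M2: "M > 2" using M e2 by linarith
    define L where "L = nat \<lfloor>M\<rfloor>"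
    have L: "real L \<le> M" "M < real L + 1" using M2 by (auto simp: L_def)
    have L1: "real L > 1" using L M2 by linarith
    define \<kappa> where "\<kappa> = M / real L"
    have \<kappa>1: "\<kappa> \<ge> 1" using L L1 by (simp add: \<kappa>_def)
    have \<kappa>2: "\<kappa> \<le> 2" using L L1 by (simp add: \<kappa>_def field_simps)
    have \<kappa>e: "\<kappa> * (1 - \<eta>) \<le> 1 - \<eta> / 2"
    proof -
      have "real L > 2 / \<eta>" using M L e2 by linarith
      then have "real L * \<eta> > 2" using \<eta> by (simp add: field_simps)
      have "M * (1 - \<eta>) \<le> (real L + 1) * (1 - \<eta>)" using L \<eta> by (intro mult_right_mono) auto
      also have "\<dots> \<le> real L * (1 - \<eta> / 2)" using \<open>real L * \<eta> > 2\<close> \<eta> by (simp add: algebra_simps)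
      finally show ?thesis using L1 by (simp add: \<kappa>_def field_simps)
    qed
    define h where "h = 1 / M"
    have h: "h > 0" using M2 by (simp add: h_def)
    have inv: "1 / real L = \<kappa> * h" using M2 L1 by (simp add: \<kappa>_def h_def)
    define x where "x l = (of_int l - \<theta>) * h" for l
    have xd: "(of_int l - \<theta>) / M = x l" for l by (simp add: x_def h_def)
    have kx: "(of_int l - \<theta>) / real L = \<kappa> * x l" for l
    proof -
      have "(of_int l - \<theta>) / real L = (of_int l - \<theta>) * (1 / real L)" by simp
      then show ?thesis unfolding inv by (simp add: x_def)
    qed
    have X1: "-(1-\<eta>) \<le> x l1" "x l1 \<le> -\<eta>" and X2: "\<eta> \<le> x l2" "x l2 \<le> 1 - \<eta>" using l1 l2 xd by auto
    have ll: "l1 \<le> l2"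
    proof -
      have "x l1 < x l2" using X1 X2 \<eta> by linarith
      then show ?thesis using h by (simp add: x_def)
    qed
    have dom: "\<kappa> * \<bar>t\<bar> \<le> 1 - \<eta> / 2" "\<kappa> * \<bar>t\<bar> < 1" if "t \<in> {x l1..x l2}" for t
    proof -
      have "\<bar>t\<bar> \<le> 1 - \<eta>" using that X1 X2 by auto
      then have "\<kappa> * \<bar>t\<bar> \<le> \<kappa> * (1 - \<eta>)" using \<kappa>1 by (intro mult_left_mono) auto
      then show "\<kappa> * \<bar>t\<bar> \<le> 1 - \<eta> / 2" "\<kappa> * \<bar>t\<bar> < 1" using \<kappa>e \<eta> by linarith+
    qed
    define E where "E = (\<lambda>p x. G p x - \<kappa> ^ p / \<kappa> * G p (\<kappa> * x)
       - (if p = 0 then x * ln \<kappa> else if p = 1 then ln \<kappa> else 0))"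
    have ER1: "deriv_chain E {x. \<kappa> * \<bar>x\<bar> < 1}"
      using lsin_rescaling_chain(1)[OF G \<kappa>1] unfolding E_def .
    have ER2: "E p x = lsinD p x - \<kappa> ^ p / \<kappa> * lsinD p (\<kappa> * x)"
      if "p \<ge> 1" "0 < \<bar>x\<bar>" "\<kappa> * \<bar>x\<bar> < 1" for p x
      using lsin_rescaling_chain(2)[OF G \<kappa>1 that] unfolding E_def .
    have "\<exists>k. \<forall>x. 0 < \<bar>x\<bar> \<longrightarrow> \<kappa> * \<bar>x\<bar> < 1 \<longrightarrow> E 0 x + k = lsinD 0 x - \<kappa> ^ 0 / \<kappa> * lsinD 0 (\<kappa> * x)"
      using lsin_rescaling_chain(3)[OF G \<kappa>1] unfolding E_def .
    then obtain k where "\<forall>x. 0 < \<bar>x\<bar> \<longrightarrow> \<kappa> * \<bar>x\<bar> < 1 \<longrightarrow> E 0 x + k = lsinD 0 x - \<kappa> ^ 0 / \<kappa> * lsinD 0 (\<kappa> * x)" ..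
    note k = this[rule_format]
    have EMrel: "em_primitive E h K t + k / h = lsin_em M K t - lsin_em (real L) K (\<kappa> * t)" if t: "0 < \<bar>t\<bar>" "\<kappa> * \<bar>t\<bar> < 1" for t
    proof -
      have "lsin_em M K t - lsin_em (real L) K (\<kappa> * t) = (\<Sum>p\<le>K. bern_coeff p * h ^ p * (lsinD p t - \<kappa> ^ p / \<kappa> * lsinD p (\<kappa> * t)) / h)"
        unfolding lsin_em_def em_primitive_def inv h_def[symmetric] sum_subtractf[symmetric]
      proof (intro sum.cong refl)
        fix p
        have "a * H * u / h - a * (k * H) * v / (\<kappa> * h) = a * H * (u - k / \<kappa> * v) / h" for a H u k v :: real
          using \<kappa>1 h by (simp add: field_simps)
        then show "bern_coeff p * h ^ p * lsinD p t / h - bern_coeff p * (\<kappa> * h) ^ p * lsinD p (\<kappa> * t) / (\<kappa> * h)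
            = bern_coeff p * h ^ p * (lsinD p t - \<kappa> ^ p / \<kappa> * lsinD p (\<kappa> * t)) / h"
          unfolding power_mult_distrib .
      qed
      also have "\<dots> = (\<Sum>p\<le>K. bern_coeff p * h ^ p * E p t / h + (if p = 0 then k / h else 0))"
      proof (intro sum.cong refl)
        fix p
        show "bern_coeff p * h ^ p * (lsinD p t - \<kappa> ^ p / \<kappa> * lsinD p (\<kappa> * t)) / h = bern_coeff p * h ^ p * E p t / h + (if p = 0 then k / h else 0)"
          by (cases "p = 0") (use k[OF t, symmetric] ER2[of p t] t in \<open>auto simp: bern_coeff_0 add_divide_distrib simp del: lsinD.simps\<close>)
      qed
      finally show ?thesis by (simp add: sum.distrib em_primitive_def)
    qed
    \<comment> \<open>If \<open>\<theta> = 0\<close>, the term \<open>l = 0\<close> is exceptional: \<open>lsin 0 = 0\<close> on both grids whereas \<open>E 1 0 = - ln \<kappa>\<close>.\<close>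
    have s1: "(\<Sum>l\<in>{l1<..l2}. lsin (x l)) = (\<Sum>l\<in>{l1<..l2}. E 1 (x l)) + (\<Sum>l\<in>{l1<..l2}. lsin (\<kappa> * x l)) + (if \<theta> = 0 then ln \<kappa> else 0)"
    proof -
      have "lsin (x l) = E 1 (x l) + lsin (\<kappa> * x l) + (if l = 0 then (if \<theta> = 0 then ln \<kappa> else 0) else 0)" if l: "l \<in> {l1<..l2}" for l
      proof (cases "x l = 0")
        case True
        then have "\<theta> = of_int l" using h by (simp add: x_def)
        then have "l = 0" "\<theta> = 0" using th by auto
        then show ?thesis using True \<kappa>1 by (simp add: E_def lsin_def)
      next
        case False
        then have c: "\<not> (l = 0 \<and> \<theta> = 0)" by (auto simp: x_def)
        have "x l \<in> {x l1..x l2}" using l h by (auto simp: x_def)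
        then have "E 1 (x l) = lsinD 1 (x l) - \<kappa> ^ 1 / \<kappa> * lsinD 1 (\<kappa> * x l)"
          using False dom by (intro ER2) auto
        then show ?thesis using c \<kappa>1 by auto
      qed
      then have "(\<Sum>l\<in>{l1<..l2}. lsin (x l)) = (\<Sum>l\<in>{l1<..l2}. E 1 (x l) + lsin (\<kappa> * x l) + (if l = 0 then (if \<theta> = 0 then ln \<kappa> else 0) else 0))"
        by (intro sum.cong) auto
      moreover have "\<theta> = 0 \<Longrightarrow> 0 \<in> {l1<..l2}"
      proof -
        assume "\<theta> = 0"
        then have "of_int l1 * h < 0" "of_int l2 * h > 0" using X1 X2 \<eta> by (auto simp: x_def)
        then show "0 \<in> {l1<..l2}" using h by (auto simp: zero_less_mult_iff mult_less_0_iff)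
      qed
      ultimately show ?thesis by (auto simp: sum.distrib)
    qed
    have e1: "\<bar>(\<Sum>l\<in>{l1<..l2}. E 1 (x l)) - (em_primitive E h K (x l2) - em_primitive E h K (x l1))\<bar> \<le> 2 * (em_const K * B') * M * h ^ K"
    proof -
      have "\<bar>(\<Sum>l\<in>{l1<..l2}. E 1 (x l)) - (em_primitive E h K (x l2) - em_primitive E h K (x l1))\<bar> \<le> of_int (l2 - l1) * (em_const K * B' * h ^ K)"
        unfolding x_def
      proof (rule em_sum[OF h K ll])
        show "deriv_chain E {(of_int l1 - \<theta>) * h..(of_int l2 - \<theta>) * h}"
          by (rule deriv_chain_subset[OF ER1]) (use dom in \<open>auto simp: x_def\<close>)
        fix t assume "t \<in> {(of_int l1 - \<theta>) * h..(of_int l2 - \<theta>) * h}"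
        then have t: "t \<in> {x l1..x l2}" by (simp add: x_def)
        have b1: "\<bar>G (Suc K) t\<bar> \<le> B" by (rule B) (use t X1 X2 \<eta> in auto)
        have "\<bar>\<kappa> * t\<bar> \<le> 1 - \<eta> / 2" using dom(1)[OF t] \<kappa>1 by (simp add: abs_mult)
        then have b2: "\<bar>G (Suc K) (\<kappa> * t)\<bar> \<le> B" by (intro B) auto
        have kp: "\<kappa> ^ Suc K / \<kappa> \<le> 2 ^ K" using \<kappa>1 \<kappa>2 by (simp add: power_mono)
        have "\<bar>E (Suc K) t\<bar> \<le> \<bar>G (Suc K) t\<bar> + \<bar>\<kappa> ^ Suc K / \<kappa> * G (Suc K) (\<kappa> * t)\<bar>"
          using K by (simp add: E_def abs_triangle_ineq4)
        also have "\<bar>\<kappa> ^ Suc K / \<kappa> * G (Suc K) (\<kappa> * t)\<bar> = (\<kappa> ^ Suc K / \<kappa>) * \<bar>G (Suc K) (\<kappa> * t)\<bar>"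
          using \<kappa>1 by (simp add: abs_mult)
        also have "\<dots> \<le> 2 ^ K * B" using kp b2 \<kappa>1 by (intro mult_mono) auto
        finally show "\<bar>E (Suc K) t\<bar> \<le> B'" using b1 by (simp add: B'_def)
      qed
      also have "\<dots> \<le> (2 * M) * (em_const K * B' * h ^ K)"
      proof (rule mult_right_mono)
        have "x l2 - x l1 \<le> 2" using X1 X2 \<eta> by linarith
        then have "of_int (l2 - l1) * h \<le> 2" by (simp add: x_def algebra_simps)
        then show "of_int (l2 - l1) \<le> 2 * M" using M2 by (simp add: h_def field_simps)
      qed (use em_const_nonneg B'0 h in auto)
      finally show ?thesis by (simp add: mult_ac)
    qed
    define l3 where "l3 = l1 + int L"
    have x3: "\<kappa> * x l3 = \<kappa> * x l1 + of_int 1"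
      using L1 unfolding kx[symmetric] by (simp add: l3_def field_simps)
    have kX1: "- (1 - \<eta>/2) \<le> \<kappa> * x l1" "\<kappa> * x l1 \<le> - \<eta>"
    proof -
      show "- (1 - \<eta>/2) \<le> \<kappa> * x l1" using dom(1)[of "x l1"] X1 X2 \<eta> by auto
      have "\<kappa> * x l1 \<le> 1 * x l1" using \<kappa>1 X1 \<eta> by (intro mult_right_mono_neg) auto
      then show "\<kappa> * x l1 \<le> - \<eta>" using X1 by simp
    qed
    have kX2: "\<eta> \<le> \<kappa> * x l2" "\<kappa> * x l2 \<le> 1 - \<eta>/2"
    proof -
      show "\<kappa> * x l2 \<le> 1 - \<eta>/2" using dom(1)[of "x l2"] X1 X2 \<eta> by auto
      have "1 * x l2 \<le> \<kappa> * x l2" using \<kappa>1 X2 \<eta> by (intro mult_right_mono) auto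
      then show "\<eta> \<le> \<kappa> * x l2" using X2 by simp
    qed
    have EM3: "lsin_em (real L) K (\<kappa> * x l3) = lsin_em (real L) K (\<kappa> * x l1)"
      unfolding x3 by (rule lsin_em_shift_int)
    have per: "(\<Sum>l\<in>{l1<..l3}. lsin (\<kappa> * x l)) = cross_val (real L) \<theta>"
    proof (cases "\<theta> = 0")
      case True
      have "of_int l1 * h < 0" using X1 \<eta> True by (auto simp: x_def)
      then have n1: "l1 < 0" using h by (auto simp: mult_less_0_iff)
      have "\<kappa> * x l3 \<ge> 0" using x3 kX1 \<eta> by simp
      then have "of_int l3 / real L \<ge> 0" using kx[of l3] True by simp
      then have n3: "0 \<le> l3" using L1 by (simp add: zero_le_divide_iff)
      show ?thesis
        using lsin_full_period_0[OF n1, of L] n3 L1 True by (simp add: kx[symmetric] l3_def cross_val_def)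
    next
      case False
      then show ?thesis using lsin_full_period[of L \<theta> l1] th L1 by (simp add: kx[symmetric] l3_def cross_val_def)
    qed
    have cv: "cross_val M \<theta> = cross_val (real L) \<theta> + (if \<theta> = 0 then ln \<kappa> else 0)"
      using M2 L1 by (simp add: cross_val_def \<kappa>_def ln_div)
    have e2: "\<bar>(\<Sum>l\<in>{l1<..l2}. lsin (\<kappa> * x l)) - cross_val (real L) \<theta>
        - (lsin_em (real L) K (\<kappa> * x l2) - lsin_em (real L) K (\<kappa> * x l1))\<bar> \<le> C2 * real L * (1 / real L) ^ K"
    proof (cases "l3 \<le> l2")
      case True
      have un: "{l1<..l2} = {l1<..l3} \<union> {l3<..l2}" using True by (auto simp: l3_def)
      have "(\<Sum>l\<in>{l1<..l2}. lsin (\<kappa> * x l)) = (\<Sum>l\<in>{l1<..l3}. lsin (\<kappa> * x l)) + (\<Sum>l\<in>{l3<..l2}. lsin (\<kappa> * x l))"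
        unfolding un by (rule sum.union_disjoint) auto
      moreover have "\<bar>(\<Sum>l\<in>{l3<..l2}. lsin (\<kappa> * x l)) - (lsin_em (real L) K (\<kappa> * x l2) - lsin_em (real L) K (\<kappa> * x l3))\<bar> \<le> C2 * real L * (1 / real L) ^ K"
        using C2(2)[of "real L" l3 l2 \<theta>] True L1 kX1 kX2 x3 by (simp add: kx)
      ultimately show ?thesis using per EM3 by simp
    next
      case False
      have un: "{l1<..l3} = {l1<..l2} \<union> {l2<..l3}" using False ll by auto
      have "(\<Sum>l\<in>{l1<..l3}. lsin (\<kappa> * x l)) = (\<Sum>l\<in>{l1<..l2}. lsin (\<kappa> * x l)) + (\<Sum>l\<in>{l2<..l3}. lsin (\<kappa> * x l))"
        unfolding un by (rule sum.union_disjoint) auto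
      moreover have "\<bar>(\<Sum>l\<in>{l2<..l3}. lsin (\<kappa> * x l)) - (lsin_em (real L) K (\<kappa> * x l3) - lsin_em (real L) K (\<kappa> * x l2))\<bar> \<le> C2 * real L * (1 / real L) ^ K"
        using C2(2)[of "real L" l2 l3 \<theta>] False L1 kX1 kX2 x3 \<eta> by (simp add: kx)
      ultimately show ?thesis using per EM3 by simp
    qed
    have e3: "C2 * real L * (1 / real L) ^ K \<le> C2 * 2 ^ K * M * h ^ K"
    proof -
      have "real L * (1 / real L) ^ K \<le> M * (2 * h) ^ K"
        unfolding inv using L \<kappa>1 \<kappa>2 h by (intro mult_mono power_mono mult_right_mono) auto
      from mult_left_mono[OF this C2(1)] show ?thesis by (simp add: power_mult_distrib mult_ac)
    qed
    have r1: "0 < \<bar>x l1\<bar>" "\<kappa> * \<bar>x l1\<bar> < 1" and r2: "0 < \<bar>x l2\<bar>" "\<kappa> * \<bar>x l2\<bar> < 1"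
      using dom[of "x l1"] dom[of "x l2"] X1 X2 \<eta> by auto
    have "(\<Sum>l\<in>{l1<..l2}. lsin (x l)) - (lsin_em M K (x l2) - lsin_em M K (x l1)) - cross_val M \<theta>
      = ((\<Sum>l\<in>{l1<..l2}. E 1 (x l)) - (em_primitive E h K (x l2) - em_primitive E h K (x l1)))
       + ((\<Sum>l\<in>{l1<..l2}. lsin (\<kappa> * x l)) - cross_val (real L) \<theta>
        - (lsin_em (real L) K (\<kappa> * x l2) - lsin_em (real L) K (\<kappa> * x l1)))"
      using EMrel[OF r1] EMrel[OF r2] s1 cv by simp
    then have "\<bar>(\<Sum>l\<in>{l1<..l2}. lsin (x l)) - (lsin_em M K (x l2) - lsin_em M K (x l1)) - cross_val M \<theta>\<bar>
       \<le> 2 * (em_const K * B') * M * h ^ K + C2 * 2 ^ K * M * h ^ K"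
      using e1 e2 e3 by linarith
    then show "\<bar>(\<Sum>l\<in>{l1<..l2}. lsin ((of_int l - \<theta>) / M))
        - (lsin_em M K ((of_int l2 - \<theta>) / M) - lsin_em M K ((of_int l1 - \<theta>) / M)) - cross_val M \<theta>\<bar>
      \<le> C * M * (1 / M) ^ K"
      unfolding xd h_def[symmetric] C_def by (simp add: algebra_simps)
  qed
qed

section \<open>The argument near a rational number\<close>

text \<open>The determinant enters through the congruences modulo \<open>c\<close>; the quantities \<open>xi\<close>, \<open>em_window\<close>, \<open>log_amplitude\<close> and
  \<open>peak_sum\<close> defined below are functions of \<open>a\<close> and \<open>c\<close> alone.\<close>
locale sl2_mat =
  fixes a b c d :: int
  assumes det: "a * d - b * c = 1" and c_pos: "c > 0"
begin

text \<open>Minus \<open>j\<close> times the image of \<open>X\<close>, with \<open>M = c X + d\<close>; the sign makes the argument increase along each residue class.\<close>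
definition xi :: "real \<Rightarrow> int \<Rightarrow> real" where
  "xi M j = of_int j / (of_int c * M) - of_int j * of_int a / of_int c"

text \<open>One Euler--Maclaurin primitive for each residue class modulo \<open>c\<close>. The window of \<open>c\<close> consecutive indices
  ending at \<open>n\<close> represents every class by its last member, so that telescoping over \<open>n\<close> sums all classes
  simultaneously.\<close>
definition em_window :: "real \<Rightarrow> nat \<Rightarrow> int \<Rightarrow> real" where
  "em_window M K n = (\<Sum>\<rho><nat c. lsin_em M K (xi M (n - int \<rho>)))"

lemma c_real: "real_of_int c > 0" "real_of_int c \<ge> 1"
  using c_pos by auto

lemma xi_minus: "xi M (- j) = - xi M j"
  by (simp add: xi_def)

lemma xi_sub_c:
  assumes "M > 0"
  shows "xi M (n - c) = xi M n - 1 / M + of_int a"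
  using assms c_real by (simp add: xi_def field_simps)

lemma em_window_step:
  assumes M: "M > 0"
  shows "em_window M K n - em_window M K (n - 1) = lsin_em M K (xi M n) - lsin_em M K (xi M n - 1 / M)"
proof -
  define F where "F j = lsin_em M K (xi M j)" for j
  have "(\<Sum>\<rho><Suc (nat c). F (n - int \<rho>)) = F n + (\<Sum>\<rho><nat c. F (n - 1 - int \<rho>))"
    unfolding sum.lessThan_Suc_shift by (simp add: algebra_simps)
  moreover have "(\<Sum>\<rho><Suc (nat c). F (n - int \<rho>)) = (\<Sum>\<rho><nat c. F (n - int \<rho>)) + F (n - c)"
    using c_pos by simp
  moreover have "F (n - c) = lsin_em M K (xi M n - 1 / M)"
    unfolding F_def xi_sub_c[OF M] by (rule lsin_em_shift_int)
  ultimately show ?thesis by (simp add: em_window_def F_def)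
qed

lemma sum_telescope_int:
  fixes f :: "int \<Rightarrow> real"
  assumes "n1 \<le> n2"
  shows "(\<Sum>j\<in>{n1<..n2}. f j - f (j - 1)) = f n2 - f n1"
  using assms
proof (induction n2 rule: int_ge_induct)
  case (step n)
  have "{n1<..n + 1} = insert (n + 1) {n1<..n}" using step.hyps by auto
  then show ?case using step.IH by simp
qed simp

text \<open>The class on which the arguments pass through integers near \<open>j = m M\<close>. By the determinant condition their
  offset is exactly \<open>m X\<close>, the quantity that enters the \<open>m\<close>-th factor of the summands of \<open>J X\<close>.\<close>
lemma xi_class:
  assumes "M = of_int c * X + of_int d" "M > 0"
  shows "xi M (m * d + c * l) = (of_int l - of_int m * X) / M + of_int (- (l * a + m * b))"
proof -
  have ad: "of_int a * of_int d = 1 + of_int b * (of_int c :: real)"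
    using det by (metis add_diff_cancel_left' diff_eq_eq of_int_1 of_int_add of_int_mult add.commute)
  have c0: "of_int c * M \<noteq> 0" "of_int c \<noteq> (0::real)" using assms c_real by auto
  have "xi M (m * d + c * l) = (of_int m * of_int d + of_int c * of_int l) / (of_int c * M)
      - (of_int m * (of_int a * of_int d) + of_int c * of_int l * of_int a) / of_int c"
    by (simp add: xi_def algebra_simps)
  also have "(of_int m * (of_int a * of_int d) + of_int c * of_int l * of_int a) / of_int c
      = of_int m / of_int c + of_int m * of_int b + of_int l * (of_int a :: real)"
    unfolding ad using c_real by (simp add: field_simps)
  also have "(of_int m * of_int d + of_int c * of_int l) / (of_int c * M)
     = of_int m / of_int c + (of_int l - of_int m * X) / M"
    using c0 by (simp add: divide_simps) (simp add: assms(1) algebra_simps)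
  finally show ?thesis by simp
qed

text \<open>In the other classes \<open>j a\<close> differs from \<open>m\<close> modulo \<open>c\<close>, so the argument lies, modulo
  integers, within \<open>1 / c\<close> of a point \<open>k / c\<close> with \<open>0 < k < c\<close> and reaches an integer only as \<open>j / M\<close> reaches \<open>m - 1\<close> or \<open>m + 1\<close>.\<close>
lemma xi_regular:
  assumes M: "M > 0" and nd: "\<not> c dvd j - m * d"
    and v: "-1 + \<eta> \<le> of_int j / M - of_int m" "of_int j / M - of_int m \<le> 1 - \<eta>"
  shows "\<exists>k. \<eta> / of_int c \<le> xi M j - of_int k \<and> xi M j - of_int k \<le> 1 - \<eta> / of_int c"
proof -
  define w where "w = m - j * a"
  have "\<not> c dvd w"
  proof
    assume "c dvd w"
    then have "c dvd w * d" by simp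
    also have "w * d = m * d - j * (a * d)" by (simp add: w_def algebra_simps)
    also have "a * d = 1 + b * c" using det by simp
    finally have "c dvd (m * d - j) - c * (j * b)" by (simp add: algebra_simps)
    then have "c dvd m * d - j" by (metis dvd_diff_left_iff dvd_triv_left dvd_add_right_iff diff_add_cancel)
    then show False using nd by (metis dvd_minus_iff minus_diff_eq)
  qed
  define r where "r = w mod c"
  have r: "1 \<le> r" "r \<le> c - 1"
  proof -
    have "0 \<le> r" "r < c" using c_pos by (auto simp: r_def)
    moreover have "r \<noteq> 0" using \<open>\<not> c dvd w\<close> by (auto simp: r_def dvd_eq_mod_eq_0)
    ultimately show "1 \<le> r" "r \<le> c - 1" by auto
  qed
  define u where "u = of_int j / M - of_int m"
  have w: "of_int w = of_int c * of_int (w div c) + (of_int r :: real)"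
    unfolding r_def by (metis mult_div_mod_eq of_int_add of_int_mult)
  have "xi M j = (of_int w + u) / of_int c"
    using M c_real by (simp add: xi_def w_def u_def field_simps)
  also have "\<dots> = of_int (w div c) + (of_int r + u) / of_int c"
    unfolding w using c_real by (simp add: field_simps)
  finally have e: "xi M j - of_int (w div c) = (of_int r + u) / of_int c" by simp
  have "real_of_int r \<ge> 1" "real_of_int r \<le> of_int c - 1" using r by linarith+
  then have "\<eta> / of_int c \<le> (of_int r + u) / of_int c" "(of_int r + u) / of_int c \<le> (of_int c - \<eta>) / of_int c"
    using v c_real by (auto simp: u_def intro!: divide_right_mono)
  then show ?thesis using c_real by (intro exI[of _ "w div c"]) (auto simp: e diff_divide_distrib)
qed

text \<open>Only the class of \<open>m d\<close> meets a singularity and is handled by \<open>crossing_unit\<close>; every other index costs one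
  regular step \<open>lsin_em_step\<close>.\<close>
lemma crossing:
  assumes \<eta>: "0 < \<eta>" "\<eta> < 1" and K: "K \<ge> 1"
  obtains C M0 where "C \<ge> 0" "M0 \<ge> 1"
    "\<And>M X m n1 n2. M \<ge> M0 \<Longrightarrow> M = of_int c * X + of_int d \<Longrightarrow> sin (pi * (of_int m * X)) \<noteq> 0 \<or> m = 0 \<Longrightarrow>
      of_int m - 1 + \<eta> \<le> of_int n1 / M \<Longrightarrow> of_int n1 / M \<le> of_int m - \<eta> \<Longrightarrow>
      of_int m + \<eta> \<le> of_int n2 / M \<Longrightarrow> of_int n2 / M \<le> of_int m + 1 - \<eta> \<Longrightarrow>
      \<bar>(\<Sum>j\<in>{n1<..n2}. lsin (xi M j)) - (em_window M K n2 - em_window M K n1) - cross_val M (of_int m * X)\<bar>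
      \<le> C * M * (1 / M) ^ K"
proof -
  \<comment> \<open>Half the distance \<open>\<eta> / c\<close> from the integers; the other half absorbs one step \<open>1 / M\<close>.\<close>
  define \<eta>' where "\<eta>' = \<eta> / (2 * of_int c)"
  have \<eta>': "0 < \<eta>'" "\<eta>' < 1" using \<eta> c_real by (auto simp: \<eta>'_def field_simps)
  have \<eta>c: "\<eta> / of_int c = 2 * \<eta>'" by (simp add: \<eta>'_def)
  obtain C1 where C1: "C1 \<ge> 0"
    "\<And>M x k. M > 0 \<Longrightarrow> \<eta>' \<le> x - 1 / M - of_int k \<Longrightarrow> x - of_int k \<le> 1 - \<eta>' \<Longrightarrow>
      \<bar>lsin x - (lsin_em M K x - lsin_em M K (x - 1 / M))\<bar> \<le> C1 * (1 / M) ^ K"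
    using lsin_em_step[OF \<eta>' K] by blast
  show ?thesis
  proof (rule crossing_unit[OF \<eta>' K], goal_cases)
  case (1 C2 M2)
  note C2 = this
  show ?thesis
  proof (rule that[of "2 * C1 + C2" "max M2 (1 / \<eta>')"])
    show "2 * C1 + C2 \<ge> 0" "max M2 (1 / \<eta>') \<ge> 1" using C1 C2 by auto
    fix M X :: real and m n1 n2 :: int
    assume M: "M \<ge> max M2 (1 / \<eta>')" and MX: "M = of_int c * X + of_int d"
      and ns: "sin (pi * (of_int m * X)) \<noteq> 0 \<or> m = 0"
      and n1: "of_int m - 1 + \<eta> \<le> of_int n1 / M" "of_int n1 / M \<le> of_int m - \<eta>"
      and n2: "of_int m + \<eta> \<le> of_int n2 / M" "of_int n2 / M \<le> of_int m + 1 - \<eta>"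
    have M0: "M > 0" "M \<ge> M2" using M C2 by auto
    have iM: "1 / M \<le> \<eta>'"
    proof -
      have "1 / \<eta>' \<le> M" using M by simp
      then show ?thesis using \<eta>' M0 by (simp add: field_simps)
    qed
    have nn: "n1 \<le> n2"
    proof -
      have "of_int n1 / M \<le> of_int n2 / M" using n1 n2 \<eta> by linarith
      then show ?thesis using M0 by (simp add: divide_le_cancel)
    qed
    have nlen: "of_int (n2 - n1) \<le> 2 * M"
    proof -
      have "of_int n2 / M - of_int n1 / M \<le> 2" using n1 n2 \<eta> by linarith
      then show ?thesis using M0 by (simp add: field_simps)
    qed
    \<comment> \<open>The defect of a single Euler--Maclaurin step. The primitives telescope, so the claim concerns the sum of
  the defects.\<close>
    define \<Delta> where "\<Delta> j = lsin (xi M j) - (lsin_em M K (xi M j) - lsin_em M K (xi M j - 1 / M))" for j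
    define S where "S = {n1<..n2}"
    define A where "A = {j\<in>S. c dvd j - m * d}"
    have AS: "A \<subseteq> S" by (auto simp: A_def)
    have fin: "finite S" by (auto simp: S_def)
    have fin: "finite S" "finite A" using fin finite_subset[OF AS fin] by auto
    have tot: "(\<Sum>j\<in>S. lsin (xi M j)) - (em_window M K n2 - em_window M K n1) = (\<Sum>j\<in>S. \<Delta> j)"
    proof -
      have "em_window M K n2 - em_window M K n1 = (\<Sum>j\<in>S. em_window M K j - em_window M K (j - 1))"
        unfolding S_def by (rule sum_telescope_int[OF nn, symmetric])
      then show ?thesis by (simp add: \<Delta>_def em_window_step[OF M0(1)] sum_subtractf)
    qed
    have split: "(\<Sum>j\<in>S. \<Delta> j) = (\<Sum>j\<in>A. \<Delta> j) + (\<Sum>j\<in>S - A. \<Delta> j)"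
      using sum.subset_diff[of A S \<Delta>] fin by (auto simp: A_def)
    have rest: "\<bar>\<Sum>j\<in>S - A. \<Delta> j\<bar> \<le> 2 * C1 * M * (1 / M) ^ K"
    proof -
      have "\<bar>\<Delta> j\<bar> \<le> C1 * (1 / M) ^ K" if j: "j \<in> S - A" for j
      proof -
        have jS: "n1 < j" "j \<le> n2" and nd: "\<not> c dvd j - m * d" using j by (auto simp: S_def A_def)
        have "of_int n1 / M \<le> of_int j / M" "of_int j / M \<le> of_int n2 / M"
          using jS M0 by (auto intro!: divide_right_mono)
        then have "-1 + \<eta> \<le> of_int j / M - of_int m" "of_int j / M - of_int m \<le> 1 - \<eta>"
          using n1 n2 by linarith+
        from xi_regular[OF M0(1) nd this] obtain k where
          k: "\<eta> / of_int c \<le> xi M j - of_int k" "xi M j - of_int k \<le> 1 - \<eta> / of_int c" by blast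
        show ?thesis unfolding \<Delta>_def
          by (rule C1(2)[of _ _ k]) (use k iM M0 \<eta>c \<eta>' in linarith)+
      qed
      then have "\<bar>\<Sum>j\<in>S - A. \<Delta> j\<bar> \<le> of_nat (card (S - A)) * (C1 * (1 / M) ^ K)"
        by (intro order.trans[OF sum_abs] sum_bounded_above)
      also have "\<dots> \<le> (2 * M) * (C1 * (1 / M) ^ K)"
      proof (rule mult_right_mono)
        have "card (S - A) \<le> card S" by (intro card_mono fin) auto
        also have "card S = nat (n2 - n1)" by (simp add: S_def)
        finally have "real (card (S - A)) \<le> of_int (n2 - n1)" using nn by linarith
        then show "real (card (S - A)) \<le> 2 * M" using nlen by linarith
      qed (use C1 M0 in auto)
      finally show ?thesis by (simp add: mult_ac)
    qed
    \<comment> \<open>The indices of the singular class are \<open>j = m d + c l\<close>.\<close>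
    define l1 where "l1 = (n1 - m * d) div c"
    define l2 where "l2 = (n2 - m * d) div c"
    define \<theta> where "\<theta> = of_int m * X"
    have cl: "(of_int l - \<theta>) / M = (of_int (m * d + c * l) / M - of_int m) / of_int c" for l
    proof -
      have "(of_int l - \<theta>) * of_int c = of_int (m * d + c * l) - of_int m * M"
        by (simp add: \<theta>_def MX algebra_simps)
      then have "(of_int l - \<theta>) = (of_int (m * d + c * l) - of_int m * M) / of_int c"
        using c_real by (simp add: field_simps)
      then show ?thesis using M0 c_real by (simp add: field_simps)
    qed
    have lb: "m * d + c * ((n - m * d) div c) \<le> n" "n - c < m * d + c * ((n - m * d) div c)" for n
      using c_pos mult_div_mod_eq[of c "n - m * d"] pos_mod_bound[of c "n - m * d"] pos_mod_sign[of c "n - m * d"]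
      by linarith+
    have pos: "(of_int n / M - of_int m) / of_int c - 1 / M \<le> (of_int ((n - m * d) div c) - \<theta>) / M"
      "(of_int ((n - m * d) div c) - \<theta>) / M \<le> (of_int n / M - of_int m) / of_int c" for n
    proof -
      have "of_int (m * d + c * ((n - m * d) div c)) \<le> (of_int n :: real)"
        "of_int n - of_int c \<le> (of_int (m * d + c * ((n - m * d) div c)) :: real)"
        using lb[of n] by linarith+
      then have "of_int (m * d + c * ((n - m * d) div c)) / M \<le> of_int n / M"
        "(of_int n - of_int c) / M \<le> of_int (m * d + c * ((n - m * d) div c)) / M"
        using M0 by (auto intro!: divide_right_mono)
      then have 1: "(of_int (m * d + c * ((n - m * d) div c)) / M - of_int m) / of_int c \<le> (of_int n / M - of_int m) / of_int c"
        "((of_int n - of_int c) / M - of_int m) / of_int c \<le> (of_int (m * d + c * ((n - m * d) div c)) / M - of_int m) / of_int c"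
        using c_real by (auto intro!: divide_right_mono)
      have 2: "((of_int n - of_int c) / M - of_int m) / of_int c = (of_int n / M - of_int m) / of_int c - 1 / M"
        using M0 c_real by (simp add: field_simps)
      show "(of_int n / M - of_int m) / of_int c - 1 / M \<le> (of_int ((n - m * d) div c) - \<theta>) / M"
        "(of_int ((n - m * d) div c) - \<theta>) / M \<le> (of_int n / M - of_int m) / of_int c"
        using 1 2 unfolding cl by auto
    qed
    have Aeq: "bij_betw (\<lambda>l. m * d + c * l) {l1<..l2} A"
    proof (rule bij_betw_imageI)
      show "inj_on (\<lambda>l. m * d + c * l) {l1<..l2}" using c_pos by (auto simp: inj_on_def)
      show "(\<lambda>l. m * d + c * l) ` {l1<..l2} = A"
      proof (intro equalityI subsetI)
        fix j assume "j \<in> (\<lambda>l. m * d + c * l) ` {l1<..l2}"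
        then obtain l where l: "l1 < l" "l \<le> l2" "j = m * d + c * l" by auto
        have "c * l \<le> c * l2" "c * (l1 + 1) \<le> c * l" using l c_pos by (auto intro!: mult_left_mono)
        then have "c * l \<le> c * l2" "c * l1 + c \<le> c * l" by (auto simp only: distrib_left mult_1_right)
        then have "j \<le> n2" "n1 < j" using lb[of n2, folded l2_def] lb[of n1, folded l1_def] l(3) by linarith+
        then show "j \<in> A" using l(3) by (simp add: A_def S_def)
      next
        fix j assume "j \<in> A"
        then have j: "n1 < j" "j \<le> n2" "c dvd j - m * d" by (auto simp: A_def S_def)
        then obtain l where l: "j = m * d + c * l" by (metis add.commute diff_add_cancel dvdE)
        have "l \<le> l2"
        proof -
          have "l = (j - m * d) div c" using l c_pos by simp
          then show ?thesis unfolding l2_def using j c_pos by (auto intro!: zdiv_mono1)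
        qed
        moreover have "l1 < l"
        proof (rule ccontr)
          assume "\<not> l1 < l"
          then have "c * l \<le> c * l1" using c_pos by (intro mult_left_mono) auto
          then show False using lb[of n1, folded l1_def] j l by linarith
        qed
        ultimately show "j \<in> (\<lambda>l. m * d + c * l) ` {l1<..l2}" using l by auto
      qed
    qed
    have x1: "- (1 - \<eta>') \<le> (of_int l1 - \<theta>) / M" "(of_int l1 - \<theta>) / M \<le> - \<eta>'"
    proof -
      have "(-1 + \<eta>) / of_int c \<le> (of_int n1 / M - of_int m) / of_int c"
        "(of_int n1 / M - of_int m) / of_int c \<le> (- \<eta>) / of_int c"
        by (rule divide_right_mono, use n1 c_real in linarith, use c_real in linarith)+
      moreover have "1 / of_int c \<le> (1::real)" using c_real by simp
      moreover have "(-1 + \<eta>) / of_int c = - (1 / of_int c) + 2 * \<eta>'" "(- \<eta>) / of_int c = - (2 * \<eta>')"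
        using \<eta>c by (auto simp: add_divide_distrib diff_divide_distrib)
      ultimately show "- (1 - \<eta>') \<le> (of_int l1 - \<theta>) / M" "(of_int l1 - \<theta>) / M \<le> - \<eta>'"
        using pos[of n1] iM \<eta>' unfolding l1_def by linarith+
    qed
    have x2: "\<eta>' \<le> (of_int l2 - \<theta>) / M" "(of_int l2 - \<theta>) / M \<le> 1 - \<eta>'"
    proof -
      have "\<eta> / of_int c \<le> (of_int n2 / M - of_int m) / of_int c"
        "(of_int n2 / M - of_int m) / of_int c \<le> (1 - \<eta>) / of_int c"
        by (rule divide_right_mono, use n2 c_real in linarith, use c_real in linarith)+
      moreover have "1 / of_int c \<le> (1::real)" using c_real by simp
      moreover have "(1 - \<eta>) / of_int c = (1 / of_int c) - 2 * \<eta>'"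
        using \<eta>c by (auto simp: diff_divide_distrib)
      ultimately show "\<eta>' \<le> (of_int l2 - \<theta>) / M" "(of_int l2 - \<theta>) / M \<le> 1 - \<eta>'"
        using pos[of n2] iM \<eta>' \<eta>c unfolding l2_def by linarith+
    qed
    have ll: "l1 \<le> l2"
    proof -
      have "(of_int l1 - \<theta>) / M \<le> (of_int l2 - \<theta>) / M" using x1 x2 \<eta>' by linarith
      then show ?thesis using M0 by (simp add: divide_le_cancel)
    qed
    have classA: "(\<Sum>j\<in>A. \<Delta> j) = (\<Sum>l\<in>{l1<..l2}. lsin ((of_int l - \<theta>) / M))
        - (lsin_em M K ((of_int l2 - \<theta>) / M) - lsin_em M K ((of_int l1 - \<theta>) / M))"
    proof -
      define f where "f l = lsin_em M K ((of_int l - \<theta>) / M)" for l :: int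
      have "(\<Sum>j\<in>A. \<Delta> j) = (\<Sum>l\<in>{l1<..l2}. \<Delta> (m * d + c * l))"
        by (rule sum.reindex_bij_betw[OF Aeq, symmetric])
      also have "\<dots> = (\<Sum>l\<in>{l1<..l2}. lsin ((of_int l - \<theta>) / M) - (f l - f (l - 1)))"
      proof (rule sum.cong)
        fix l
        have e: "xi M (m * d + c * l) = (of_int l - \<theta>) / M + of_int (- (l * a + m * b))"
          unfolding \<theta>_def by (rule xi_class[OF MX M0(1)])
        have e': "xi M (m * d + c * l) - 1 / M = (of_int (l - 1) - \<theta>) / M + of_int (- (l * a + m * b))"
          unfolding e using M0 by (simp add: field_simps)
        show "\<Delta> (m * d + c * l) = lsin ((of_int l - \<theta>) / M) - (f l - f (l - 1))"
          unfolding \<Delta>_def e' unfolding e unfolding lsin_shift_int lsin_em_shift_int f_def by simp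
      qed simp
      also have "\<dots> = (\<Sum>l\<in>{l1<..l2}. lsin ((of_int l - \<theta>) / M)) - (f l2 - f l1)"
        unfolding sum_subtractf[of _ "\<lambda>l. f l - f (l - 1)"] sum_telescope_int[OF ll] ..
      finally show ?thesis by (simp add: f_def)
    qed
    have "\<bar>(\<Sum>j\<in>A. \<Delta> j) - cross_val M \<theta>\<bar> \<le> C2 * M * (1 / M) ^ K"
      unfolding classA
      by (rule C2(3)[OF M0(2) _ x1 x2]) (use ns in \<open>auto simp: \<theta>_def\<close>)
    then show "\<bar>(\<Sum>j\<in>{n1<..n2}. lsin (xi M j)) - (em_window M K n2 - em_window M K n1) - cross_val M (of_int m * X)\<bar>
      \<le> (2 * C1 + C2) * M * (1 / M) ^ K"
      using tot split rest unfolding S_def[symmetric] \<theta>_def[symmetric] by (simp add: algebra_simps)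
  qed
qed
qed

text \<open>The exponent of the smooth factor. Passing to the interval from \<open>- n\<close> to \<open>n\<close> replaces the singular
  lower boundary at \<open>j = 0\<close> by a passage through 0.\<close>
definition log_amplitude :: "real \<Rightarrow> nat \<Rightarrow> int \<Rightarrow> real" where
  "log_amplitude M K n = em_window M K n - em_window M K (- n - 1)"

lemma sum_lsin_reflect:
  "(\<Sum>j\<in>{- n2 - 1<..- n1 - 1}. lsin (xi M j)) = (\<Sum>j\<in>{n1<..n2}. lsin (xi M j))"
  by (rule sum.reindex_bij_witness[of _ uminus uminus]) (auto simp: xi_minus lsin_minus)

text \<open>The interval \<open>- n \<le> j \<le> n\<close> is used because its lower end is regular; by symmetry it counts every term twice,
  and its middle term is \<open>lsin 0 = 0\<close> because \<open>ln 0 = 0\<close>. Induction on \<open>m\<close> then adds one passage on each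
  side. The two contribute equally, since \<open>lsin\<close> is even.\<close>
lemma bulk:
  assumes \<eta>: "0 < \<eta>" "\<eta> \<le> 1 / 4" and K: "K \<ge> 1"
  obtains C M0 where "C \<ge> 0" "M0 \<ge> 1"
    "\<And>M X m n. M \<ge> M0 \<Longrightarrow> M = of_int c * X + of_int d \<Longrightarrow> (\<And>k. k \<in> {1..m} \<Longrightarrow> sin (pi * (real k * X)) \<noteq> 0) \<Longrightarrow>
      real m + \<eta> \<le> real n / M \<Longrightarrow> real n / M \<le> real m + 1 - \<eta> \<Longrightarrow>
      \<bar>(\<Sum>j\<in>{0<..int n}. lsin (xi M j)) - log_amplitude M K (int n) / 2 - ln M / 2 - (\<Sum>k=1..m. lsin (real k * X))\<bar>
      \<le> real (m + 1) * C * M * (1 / M) ^ K"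
proof -
  have \<eta>2: "0 < \<eta> / 2" "\<eta> / 2 < 1" using \<eta> by auto
  show ?thesis
  proof (rule crossing[OF \<eta>2 K], goal_cases)
  case (1 C M0)
  note C = this
  show ?thesis
  proof (rule that[of C "max M0 (max 4 (2 / \<eta>))"])
    show "C \<ge> 0" "max M0 (max 4 (2 / \<eta>)) \<ge> 1" using C by auto
    fix M X :: real and m n :: nat
    assume M: "M \<ge> max M0 (max 4 (2 / \<eta>))" and MX: "M = of_int c * X + of_int d"
    have M0: "M \<ge> M0" "M > 0" "M \<ge> 4" "M \<ge> 2 / \<eta>" using M C by auto
    have iM: "1 / M \<le> \<eta> / 2" "1 / M \<le> 1 / 4" "1 / M > 0" using M0 \<eta> by (auto simp: field_simps)
    have neg1: "of_int (- n - 1) / M = - (of_int n / M) - 1 / M" for n :: int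
      by (simp add: diff_divide_distrib)
    define Q where "Q n = (\<Sum>j\<in>{0<..int n}. lsin (xi M j)) - log_amplitude M K (int n) / 2 - ln M / 2" for n
    define err where "err = C * M * (1 / M) ^ K"
    have err0: "err \<ge> 0" using C M0 by (simp add: err_def)
    have base: "\<bar>Q n\<bar> \<le> err" if n: "\<eta> \<le> real n / M" "real n / M \<le> 1 - \<eta>" for n
    proof -
      have "\<bar>(\<Sum>j\<in>{- int n - 1<..int n}. lsin (xi M j)) - (em_window M K (int n) - em_window M K (- int n - 1)) - cross_val M (of_int 0 * X)\<bar> \<le> err"
        unfolding err_def
      proof (rule C(3)[OF M0(1) MX])
        have e: "of_int (- int n - 1) / M = - (real n / M) - 1 / M" using neg1[of "int n"] by simp
        show "of_int 0 - 1 + \<eta> / 2 \<le> of_int (- int n - 1) / M" "of_int (- int n - 1) / M \<le> of_int 0 - \<eta> / 2"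
          unfolding e of_int_0 using n iM \<eta> by linarith+
        show "of_int 0 + \<eta> / 2 \<le> of_int (int n) / M" "of_int (int n) / M \<le> of_int 0 + 1 - \<eta> / 2"
          unfolding of_int_0 of_int_of_nat_eq using n iM \<eta> by linarith+
      qed simp
      moreover have "(\<Sum>j\<in>{- int n - 1<..int n}. lsin (xi M j)) = 2 * (\<Sum>j\<in>{0<..int n}. lsin (xi M j))"
      proof -
        have "{- int n - 1<..int n} = {- int n - 1<..- 0 - 1} \<union> ({0} \<union> {0<..int n})" by auto
        then have "(\<Sum>j\<in>{- int n - 1<..int n}. lsin (xi M j))
          = (\<Sum>j\<in>{- int n - 1<..- 0 - 1}. lsin (xi M j)) + (\<Sum>j\<in>{0} \<union> {0<..int n}. lsin (xi M j))"
          by (simp only:) (rule sum.union_disjoint, auto)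
        moreover have "(\<Sum>j\<in>{0} \<union> {0<..int n}. lsin (xi M j)) = lsin (xi M 0) + (\<Sum>j\<in>{0<..int n}. lsin (xi M j))"
          by (subst sum.union_disjoint) auto
        moreover have "lsin (xi M 0) = 0" by (simp add: xi_def lsin_def)
        ultimately show ?thesis using sum_lsin_reflect[where M = M and ?n2.0 = "int n" and ?n1.0 = 0] by simp
      qed
      ultimately have "\<bar>2 * (\<Sum>j\<in>{0<..int n}. lsin (xi M j)) - log_amplitude M K (int n) - ln M\<bar> \<le> err"
        by (simp add: log_amplitude_def cross_val_def)
      moreover have "Q n = (2 * (\<Sum>j\<in>{0<..int n}. lsin (xi M j)) - log_amplitude M K (int n) - ln M) / 2"
        by (simp add: Q_def diff_divide_distrib)
      ultimately show ?thesis using err0 by simp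
    qed
    have main: "\<bar>Q n - (\<Sum>k=1..m. lsin (real k * X))\<bar> \<le> real (m + 1) * err"
      if "\<And>k. k \<in> {1..m} \<Longrightarrow> sin (pi * (real k * X)) \<noteq> 0"
        "real m + \<eta> \<le> real n / M" "real n / M \<le> real m + 1 - \<eta>" for n
      using that
    proof (induction m arbitrary: n)
      case 0
      then show ?case using base[of n] by simp
    next
      case (Suc m)
      \<comment> \<open>A regular index before the next passage, to which the induction hypothesis applies.\<close>
      define n1 where "n1 = nat \<lfloor>(real m + 1 / 2) * M\<rfloor>"
      have "(real m + 1 / 2) * M \<ge> 0" using M0 by simp
      then have "real n1 \<le> (real m + 1 / 2) * M" "(real m + 1 / 2) * M - 1 \<le> real n1"
        unfolding n1_def by linarith+
      then have "real n1 / M \<le> (real m + 1 / 2) * M / M" "((real m + 1 / 2) * M - 1) / M \<le> real n1 / M" 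
        using M0(2) by (simp_all only: divide_le_cancel) auto
      then have n1: "real n1 / M \<le> real m + 1 / 2" "real m + 1 / 2 - 1 / M \<le> real n1 / M"
        using M0(2) by (auto simp: diff_divide_distrib)
      have IH: "\<bar>Q n1 - (\<Sum>k=1..m. lsin (real k * X))\<bar> \<le> real (m + 1) * err"
        by (rule Suc.IH) (use Suc.prems n1 iM \<eta> in auto)
      have ns: "sin (pi * (real (Suc m) * X)) \<noteq> 0" using Suc.prems(1)[of "Suc m"] by simp
      have X0: "real (Suc m) * X \<noteq> 0" using ns by auto
      have P: "\<bar>(\<Sum>j\<in>{int n1<..int n}. lsin (xi M j)) - (em_window M K (int n) - em_window M K (int n1)) - cross_val M (of_int (int (Suc m)) * X)\<bar> \<le> err"
        unfolding err_def
        by (rule C(3)[OF M0(1) MX]) (use Suc.prems n1 iM \<eta> ns in auto)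
      have N: "\<bar>(\<Sum>j\<in>{- int n - 1<..- int n1 - 1}. lsin (xi M j)) - (em_window M K (- int n1 - 1) - em_window M K (- int n - 1)) - cross_val M (of_int (- int (Suc m)) * X)\<bar> \<le> err"
        unfolding err_def
      proof (rule C(3)[OF M0(1) MX])
        have "sin (pi * (of_int (- int (Suc m)) * X)) = - sin (pi * (real (Suc m) * X))"
          by (metis mult_minus_left mult_minus_right of_int_minus of_int_of_nat_eq sin_minus)
        then show "sin (pi * (of_int (- int (Suc m)) * X)) \<noteq> 0 \<or> - int (Suc m) = 0" using ns by simp
      qed (use Suc.prems n1 iM \<eta> neg1[of "int n"] neg1[of "int n1"] in auto)
      have cv: "cross_val M (of_int (int (Suc m)) * X) = lsin (real (Suc m) * X)"
        "cross_val M (of_int (- int (Suc m)) * X) = lsin (real (Suc m) * X)"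
      proof -
        show "cross_val M (of_int (int (Suc m)) * X) = lsin (real (Suc m) * X)"
          using X0 unfolding cross_val_def by simp
        have "of_int (- int (Suc m)) * X = - (real (Suc m) * X)" by (simp add: algebra_simps)
        then show "cross_val M (of_int (- int (Suc m)) * X) = lsin (real (Suc m) * X)"
          unfolding cross_val_def using X0 lsin_minus by (metis neg_equal_0_iff_equal)
      qed
      have "real n1 / M \<le> real n / M" using n1 Suc.prems \<eta> by simp
      then have "n1 \<le> n" using M0 by (simp add: divide_le_cancel)
      then have un: "{0<..int n} = {0<..int n1} \<union> {int n1<..int n}" by auto
      have sm: "(\<Sum>j\<in>{0<..int n}. lsin (xi M j)) = (\<Sum>j\<in>{0<..int n1}. lsin (xi M j)) + (\<Sum>j\<in>{int n1<..int n}. lsin (xi M j))"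
        unfolding un by (rule sum.union_disjoint) auto
      have "\<bar>Q n - Q n1 - lsin (real (Suc m) * X)\<bar> \<le> err"
      proof -
        \<comment> \<open>The average of the estimates on the two sides.\<close>
        have avg: "\<bar>(s1 + s - (e - f) / 2 - q) - (s1 - (e' - f') / 2 - q) - l\<bar> \<le> r"
          if "\<bar>s - (e - e') - l\<bar> \<le> r" "\<bar>s - (f' - f) - l\<bar> \<le> r" for s1 s e f e' f' q l r :: real
          using that by (simp add: abs_le_iff field_simps)
        show ?thesis
          using avg[OF P[unfolded cv] N[unfolded cv sum_lsin_reflect]] unfolding Q_def log_amplitude_def sm .
      qed
      then show ?case using IH by (simp add: algebra_simps abs_le_iff)
    qed
    assume "\<And>k. k \<in> {1..m} \<Longrightarrow> sin (pi * (real k * X)) \<noteq> 0" "real m + \<eta> \<le> real n / M" "real n / M \<le> real m + 1 - \<eta>"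
    from main[OF this] show "\<bar>(\<Sum>j\<in>{0<..int n}. lsin (xi M j)) - log_amplitude M K (int n) / 2 - ln M / 2 - (\<Sum>k=1..m. lsin (real k * X))\<bar>
      \<le> real (m + 1) * C * M * (1 / M) ^ K" by (simp add: Q_def err_def mult_ac)
  qed
qed
qed

end

section \<open>Gaussian sums over shifted lattices\<close>

lemma power_le_fact_exp:
  assumes "(x::real) \<ge> 0"
  shows "x ^ n \<le> fact n * exp x"
proof -
  have "(\<Sum>i\<in>{n}. x ^ i /\<^sub>R fact i) \<le> exp x"
    using sum_le_suminf[OF sums_summable[OF exp_converges[of x]], of "{n}"] assms sums_unique[OF exp_converges[of x]] by auto
  then show ?thesis by (simp add: field_simps)
qed

lemma exp_decay:
  fixes \<beta> :: real
  assumes \<beta>: "\<beta> > 0"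
  obtains C where "C \<ge> 0" "\<And>M. M \<ge> 1 \<Longrightarrow> exp (- \<beta> * M powr (1/5)) \<le> C * (1 / M) ^ Q"
proof (rule that)
  define n where "n = 5 * Q"
  show "fact n / \<beta> ^ n \<ge> (0::real)" using \<beta> by simp
  fix M :: real assume M: "M \<ge> 1"
  define x where "x = \<beta> * M powr (1/5)"
  have x: "x > 0" using \<beta> M by (simp add: x_def)
  have "(M powr (1/5)) ^ n = M ^ Q"
    using M by (simp add: n_def powr_realpow[symmetric] powr_powr)
  then have xn: "x ^ n = \<beta> ^ n * M ^ Q" by (simp add: x_def power_mult_distrib)
  have "exp (- x) \<le> fact n / x ^ n"
    using power_le_fact_exp[of x n] x by (simp add: exp_minus field_simps)
  then show "exp (- \<beta> * M powr (1/5)) \<le> fact n / \<beta> ^ n * (1 / M) ^ Q"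
    by (simp add: xn power_divide flip: x_def)
qed

text \<open>Half of the exponential decay pays for the polynomial, which leaves a bound of uniform shape.\<close>
lemma poly_gauss_bound: "\<exists>B\<ge>0. \<forall>w::real. \<bar>poly q w\<bar> * exp (- w\<^sup>2) \<le> B * exp (- w\<^sup>2 / 2)"
proof -
  have mono: "\<bar>w\<bar> ^ n * exp (- w\<^sup>2 / 2) \<le> 1 + 2 ^ n * fact n" for n and w :: real
  proof (cases "\<bar>w\<bar> \<le> 1")
    case True
    then have "\<bar>w\<bar> ^ n * exp (- w\<^sup>2 / 2) \<le> 1 * 1" by (intro mult_mono power_le_one) auto
    moreover have "(0::real) \<le> 2 ^ n * fact n" by simp
    ultimately show ?thesis by linarith
  next
    case False
    then have "\<bar>w\<bar> ^ n \<le> \<bar>w\<bar> ^ (2 * n)" by (intro power_increasing) auto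
    also have "\<dots> = 2 ^ n * (w\<^sup>2 / 2) ^ n" by (simp add: power_mult power_divide)
    also have "\<dots> \<le> 2 ^ n * (fact n * exp (w\<^sup>2 / 2))"
      by (intro mult_left_mono power_le_fact_exp) auto
    finally have "\<bar>w\<bar> ^ n * exp (- w\<^sup>2 / 2) \<le> 2 ^ n * (fact n * exp (w\<^sup>2 / 2)) * exp (- w\<^sup>2 / 2)"
      by (rule mult_right_mono) auto
    also have "\<dots> = 2 ^ n * fact n" by (simp add: exp_minus)
    finally show ?thesis by simp
  qed
  define B where "B = (\<Sum>i\<le>degree q. \<bar>coeff q i\<bar> * (1 + 2 ^ i * fact i))"
  have "\<bar>poly q w\<bar> * exp (- w\<^sup>2) \<le> B * exp (- w\<^sup>2 / 2)" for w
  proof -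
    have "\<bar>poly q w\<bar> * exp (- w\<^sup>2 / 2) \<le> (\<Sum>i\<le>degree q. \<bar>coeff q i\<bar> * \<bar>w\<bar> ^ i) * exp (- w\<^sup>2 / 2)"
      unfolding poly_altdef by (intro mult_right_mono order.trans[OF sum_abs]) (auto simp: abs_mult power_abs)
    also have "\<dots> = (\<Sum>i\<le>degree q. \<bar>coeff q i\<bar> * (\<bar>w\<bar> ^ i * exp (- w\<^sup>2 / 2)))"
      by (simp add: sum_distrib_right mult.assoc)
    also have "\<dots> \<le> B" unfolding B_def by (intro sum_mono mult_left_mono mono) auto
    finally have "\<bar>poly q w\<bar> * exp (- w\<^sup>2 / 2) * exp (- w\<^sup>2 / 2) \<le> B * exp (- w\<^sup>2 / 2)"
      by (rule mult_right_mono) auto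
    then show ?thesis by (simp add: mult.assoc flip: exp_add)
  qed
  moreover have "B \<ge> 0" unfolding B_def by (intro sum_nonneg) auto
  ultimately show ?thesis by blast
qed

lemma gauss_primitive:
  obtains \<Psi> :: "real \<Rightarrow> real" where
    "\<And>w. (\<Psi> has_real_derivative exp (- w\<^sup>2)) (at w)" "\<And>w. \<Psi> (- w) = - \<Psi> w"
    "\<And>w. w \<ge> 1 \<Longrightarrow> \<bar>\<Psi> w - sqrt pi / 2\<bar> \<le> exp (- w\<^sup>2)"
proof -
  define \<Psi> where "\<Psi> u = (LBINT y=ereal 0..ereal u. exp (- y\<^sup>2))" for u :: real
  have d: "(\<Psi> has_real_derivative exp (- w\<^sup>2)) (at w)" for w
  proof -
    have "((\<lambda>u. LBINT y=ereal 0..ereal u. exp (- y\<^sup>2)) has_vector_derivative exp (- w\<^sup>2)) (at w within {- \<bar>w\<bar> - 1..\<bar>w\<bar> + 1})"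
      by (rule interval_integral_FTC2) (auto intro!: continuous_intros)
    moreover have "at w within {- \<bar>w\<bar> - 1..\<bar>w\<bar> + 1} = at w"
      by (rule at_within_interior) (auto simp: interior_atLeastAtMost_real abs_if)
    ultimately show ?thesis by (simp add: \<Psi>_def[abs_def] has_real_derivative_iff_has_vector_derivative)
  qed
  have "\<Psi> 0 = 0" by (simp add: \<Psi>_def)
  have odd: "\<Psi> (- w) = - \<Psi> w" for w
  proof -
    have "((\<lambda>w. \<Psi> w + \<Psi> (- w)) has_real_derivative 0) (at w)" for w
      by (rule DERIV_cong[OF DERIV_add[OF d DERIV_chain2[where f = \<Psi> and g = uminus, OF d]]])
         (auto intro!: derivative_eq_intros)
    then have "\<Psi> w + \<Psi> (- w) = \<Psi> 0 + \<Psi> (- 0)"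
      using DERIV_isconst_all[of "\<lambda>w. \<Psi> w + \<Psi> (- w)" w 0] by blast
    then show ?thesis using \<open>\<Psi> 0 = 0\<close> by simp
  qed
  have lim: "(\<Psi> \<longlongrightarrow> sqrt pi / 2) at_top"
  proof -
    have int: "set_integrable lborel {0..} (\<lambda>y::real. exp (- y\<^sup>2))"
      and val: "set_lebesgue_integral lborel {0..} (\<lambda>y::real. exp (- y\<^sup>2)) = sqrt pi / 2"
      using gaussian_moment_0 by (auto simp: has_bochner_integral_iff set_integrable_def set_lebesgue_integral_def)
    have "((\<lambda>b. set_lebesgue_integral lborel {0..b} (\<lambda>y::real. exp (- y\<^sup>2))) \<longlongrightarrow> sqrt pi / 2) at_top"
      using tendsto_set_lebesgue_integral_at_top[OF _ int] val by simp
    moreover have "eventually (\<lambda>b. set_lebesgue_integral lborel {0..b} (\<lambda>y::real. exp (- y\<^sup>2)) = \<Psi> b) at_top"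
      using eventually_ge_at_top[of "0::real"]
      by eventually_elim (simp add: \<Psi>_def interval_integral_Icc)
    ultimately show ?thesis by (rule Lim_transform_eventually)
  qed
  have "\<bar>\<Psi> w - sqrt pi / 2\<bar> \<le> exp (- w\<^sup>2)" if w: "w \<ge> 1" for w
  proof -
    have up: "\<Psi> w \<le> sqrt pi / 2"
    proof (rule tendsto_lowerbound[OF lim])
      show "eventually (\<lambda>v. \<Psi> w \<le> \<Psi> v) at_top"
        using eventually_ge_at_top[of w]
      proof eventually_elim
        case (elim v)
        show ?case by (rule DERIV_nonneg_imp_nondecreasing[OF elim]) (use d in \<open>auto intro!: exI\<close>)
      qed
    qed simp
    have "(\<lambda>v::real. exp (- v\<^sup>2)) \<in> o[at_top](\<lambda>_. 1)" by real_asymp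
    then have e0: "((\<lambda>v::real. exp (- v\<^sup>2)) \<longlongrightarrow> 0) at_top" by (auto dest: smalloD_tendsto)
    have "((\<lambda>v. \<Psi> v + exp (- v\<^sup>2)) \<longlongrightarrow> sqrt pi / 2 + 0) at_top"
      by (intro tendsto_add lim e0)
    then have "sqrt pi / 2 + 0 \<le> \<Psi> w + exp (- w\<^sup>2)"
    proof (rule tendsto_upperbound)
      show "eventually (\<lambda>v. \<Psi> v + exp (- v\<^sup>2) \<le> \<Psi> w + exp (- w\<^sup>2)) at_top"
        using eventually_ge_at_top[of w]
      proof eventually_elim
        case (elim v)
        show ?case
        proof (rule DERIV_nonpos_imp_nonincreasing[OF elim])
          fix x assume x: "w \<le> x" "x \<le> v"
          have "((\<lambda>v. \<Psi> v + exp (- v\<^sup>2)) has_real_derivative exp (- x\<^sup>2) + exp (- x\<^sup>2) * (- 2 * x)) (at x)"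
            by (intro DERIV_add d) (auto intro!: derivative_eq_intros)
          moreover have "exp (- x\<^sup>2) + exp (- x\<^sup>2) * (- 2 * x) = exp (- x\<^sup>2) * (1 - 2 * x)" by (simp add: algebra_simps)
          moreover have "\<dots> \<le> 0" using x w by (intro mult_nonneg_nonpos) auto
          ultimately show "\<exists>y. ((\<lambda>v. \<Psi> v + exp (- v\<^sup>2)) has_real_derivative y) (at x) \<and> y \<le> 0" by auto
        qed
      qed
    qed simp
    then show ?thesis using up by simp
  qed
  then show ?thesis using that[of \<Psi>] d odd by blast
qed

text \<open>The moments of the normalised Gaussian \<open>exp (- w\<^sup>2) / sqrt \<pi>\<close>.\<close>
fun gauss_moment :: "nat \<Rightarrow> real" where
  "gauss_moment 0 = 1" | "gauss_moment (Suc 0) = 0" | "gauss_moment (Suc (Suc j)) = (real j + 1) / 2 * gauss_moment j"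

lemma gauss_moment_rat: "gauss_moment j \<in> \<rat>"
  by (induction j rule: gauss_moment.induct) auto

lemma gauss_moment_odd: "odd j \<Longrightarrow> gauss_moment j = 0"
  by (induction j rule: gauss_moment.induct) auto

text \<open>Integration by parts: multiplied by \<open>exp (- w\<^sup>2)\<close>, the monomial becomes a derivative plus a multiple of
  the Gaussian itself.\<close>
lemma gauss_moment_reduction: "\<exists>r. monom 1 j = pderiv r - [:0, 2:] * r + [:gauss_moment j:]"
proof (induction j rule: gauss_moment.induct)
  case 1
  then show ?case by (intro exI[of _ 0]) (simp add: monom_0)
next
  case 2
  then show ?case by (intro exI[of _ "[:-(1/2):]"]) (simp add: monom_Suc monom_0)
next
  case (3 j)
  then obtain r where r: "monom 1 j = pderiv r - [:0, 2:] * r + [:gauss_moment j:]" by blast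
  define k where "k = (real j + 1) / 2"
  define r' where "r' = smult k r - monom (1/2) (Suc j)"
  have "pderiv r' - [:0, 2:] * r' + [:gauss_moment (Suc (Suc j)):]
    = smult k (pderiv r - [:0, 2:] * r + [:gauss_moment j:]) - pderiv (monom (1/2) (Suc j)) + [:0, 2:] * monom (1/2) (Suc j)"
    by (simp add: r'_def pderiv_diff pderiv_smult k_def algebra_simps smult_add_right smult_diff_right)
  also have "pderiv (monom (1/2) (Suc j)) = smult k (monom 1 j)"
    by (simp add: pderiv_monom k_def smult_monom algebra_simps)
  also have "[:0, 2:] * monom (1/2) (Suc j) = (monom 1 (Suc (Suc j)) :: real poly)"
    by (simp add: monom_Suc smult_monom)
  finally show ?case using r by (intro exI[of _ r']) simp
qed

text \<open>The polynomial factors of the derivatives of \<open>q(w) exp (- w\<^sup>2)\<close>.\<close>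
primrec gauss_deriv :: "nat \<Rightarrow> real poly \<Rightarrow> real poly" where
  "gauss_deriv 0 q = q" | "gauss_deriv (Suc p) q = pderiv (gauss_deriv p q) - [:0, 2:] * gauss_deriv p q"

text \<open>Euler--Maclaurin summation of \<open>w ^ j exp (- w\<^sup>2)\<close> along the lattice. The window reaches to distance
  \<open>M powr (3/5)\<close>, far beyond the width \<open>sqrt M\<close> of the Gaussian, so all boundary terms are smaller than any
  power of \<open>1 / M\<close>. Thus the sum equals the integral to all orders, whatever the shift \<open>\<theta>\<close>.\<close>
lemma gauss_lattice:
  assumes c: "c > 0" and \<beta>: "\<beta> > 0"
  obtains C M0 where "C \<ge> 0" "M0 \<ge> 1"
    "\<And>M \<theta>. M \<ge> M0 \<Longrightarrow>
      \<bar>(\<Sum>l\<in>{l::int. \<bar>\<theta> + c * of_int l\<bar> \<le> M powr (3/5)}.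
          (sqrt (\<beta> / M) * (\<theta> + c * of_int l)) ^ j * exp (- (sqrt (\<beta> / M) * (\<theta> + c * of_int l))\<^sup>2))
        - sqrt pi * gauss_moment j / (c * sqrt (\<beta> / M))\<bar> \<le> C * (1 / M) ^ Q"
proof -
  obtain \<Psi> where \<Psi>: "\<And>w. (\<Psi> has_real_derivative exp (- w\<^sup>2)) (at w)" "\<And>w. \<Psi> (- w) = - \<Psi> w"
    "\<And>w. w \<ge> 1 \<Longrightarrow> \<bar>\<Psi> w - sqrt pi / 2\<bar> \<le> exp (- w\<^sup>2)" using gauss_primitive by blast
  define q :: "real poly" where "q = monom 1 j"
  define \<kappa> where "\<kappa> = gauss_moment j"
  obtain r where r: "q = pderiv r - [:0, 2:] * r + [:\<kappa>:]" using gauss_moment_reduction[of j] by (auto simp: q_def \<kappa>_def)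
  \<comment> \<open>The scaled lattice has step of order \<open>M powr (- 1/2)\<close>, so twice as many Euler--Maclaurin terms as powers of \<open>1 / M\<close> are
  needed.\<close>
  define K where "K = 2 * (Q + 2)"
  have K1: "K \<ge> 1" by (simp add: K_def)
  have "\<forall>p. \<exists>B. B \<ge> 0 \<and> (\<forall>w. \<bar>poly (gauss_deriv p q) w\<bar> * exp (- w\<^sup>2) \<le> B * exp (- w\<^sup>2 / 2))"
    using poly_gauss_bound by blast
  then obtain B where B: "\<And>p. B p \<ge> 0" "\<And>p w. \<bar>poly (gauss_deriv p q) w\<bar> * exp (- w\<^sup>2) \<le> B p * exp (- w\<^sup>2 / 2)"
    by metis
  obtain Br where Br: "Br \<ge> 0" "\<And>w. \<bar>poly r w\<bar> * exp (- w\<^sup>2) \<le> Br * exp (- w\<^sup>2 / 2)"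
    using poly_gauss_bound by blast
  have "\<beta> / 8 > 0" using \<beta> by simp
  obtain Ce where Ce: "Ce \<ge> 0" "\<And>M. M \<ge> 1 \<Longrightarrow> exp (- (\<beta> / 8) * M powr (1/5)) \<le> Ce * (1 / M) ^ (Q + 1)"
    using exp_decay[OF \<open>\<beta> / 8 > 0\<close>] by blast
  define S1 where "S1 = (1 + sqrt \<beta>) ^ K"
  have S1: "S1 \<ge> 1" using \<beta> by (auto simp: S1_def intro: one_le_power)
  define A0 where "A0 = (2 * Br + 2 * \<bar>\<kappa>\<bar>) / (sqrt \<beta> * c)"
  define A1 where "A1 = (\<Sum>p<K. \<bar>bern_coeff (Suc p)\<bar> * c ^ Suc p / c * (2 * (S1 * B p)))"
  define A2 where "A2 = 3 / c * (em_const K * (\<beta> ^ (Q + 2) * B K) * c ^ K)"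
  have A: "A0 \<ge> 0" "A1 \<ge> 0" "A2 \<ge> 0"
    using Br c \<beta> B S1 em_const_nonneg by (auto simp: A0_def A1_def A2_def intro!: sum_nonneg)
  define M0 where "M0 = max 1 (max ((2 * c) powr (5/3)) ((2 / sqrt \<beta>) powr 10))"
  show ?thesis
  proof (rule that[of "A2 + (A0 + A1) * Ce" M0])
    show "A2 + (A0 + A1) * Ce \<ge> 0" using A Ce by simp
    show "M0 \<ge> 1" by (simp add: M0_def)
    fix M \<theta> :: real assume "M \<ge> M0"
    then have M: "M \<ge> 1" "M \<ge> (2 * c) powr (5/3)" "M \<ge> (2 / sqrt \<beta>) powr 10" by (auto simp: M0_def)
    define s where "s = sqrt (\<beta> / M)"
    define T where "T = M powr (3/5)"
    have s0: "s > 0" using \<beta> M by (simp add: s_def)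
    have s2: "s\<^sup>2 = \<beta> / M" using \<beta> M by (simp add: s_def)
    have T: "T \<ge> 2 * c" "T \<le> M" "T > 0"
    proof -
      have "((2 * c) powr (5/3)) powr (3/5) \<le> T" unfolding T_def using M by (intro powr_mono2) auto
      then show "T \<ge> 2 * c" using c by (simp add: powr_powr)
      have "M powr (3/5) \<le> M powr 1" using M by (intro powr_mono) auto
      then show "T \<le> M" using M by (simp add: T_def)
      show "T > 0" using M by (simp add: T_def)
    qed
    have sT2: "(s * T)\<^sup>2 = \<beta> * M powr (1/5)"
    proof -
      have "T\<^sup>2 = M powr (6/5)" using M unfolding T_def by (simp add: powr_power)
      also have "\<dots> = M * M powr (1/5)" using M by (simp add: powr_mult_base)
      finally show ?thesis using M by (simp add: power_mult_distrib s2)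
    qed
    have sT: "s * T \<ge> 2"
    proof -
      have "((2 / sqrt \<beta>) powr 10) powr (1/10) \<le> M powr (1/10)" using M by (intro powr_mono2) auto
      then have "2 / sqrt \<beta> \<le> M powr (1/10)" unfolding powr_powr using \<beta> by simp
      then have "2 \<le> sqrt \<beta> * M powr (1/10)" using \<beta> by (simp add: field_simps)
      then have "2\<^sup>2 \<le> (sqrt \<beta> * M powr (1/10))\<^sup>2" by (intro power_mono) auto
      also have "\<dots> = \<beta> * M powr (1/5)" using \<beta> M by (simp add: power_mult_distrib powr_power)
      finally have "2\<^sup>2 \<le> (s * T)\<^sup>2" using sT2 by simp
      then show ?thesis by (rule power2_le_imp_le) (use s0 T in auto)
    qed
    define \<epsilon> where "\<epsilon> = exp (- (\<beta> / 8) * M powr (1/5))"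
    have eps: "M * \<epsilon> \<le> Ce * (1 / M) ^ Q"
    proof -
      have "M * \<epsilon> \<le> M * (Ce * (1 / M) ^ (Q + 1))" unfolding \<epsilon>_def using Ce(2)[of M] M by (intro mult_left_mono) auto
      then show ?thesis using M by (simp add: field_simps)
    qed
    have small: "exp (- w\<^sup>2 / 2) \<le> \<epsilon>" if "\<bar>w\<bar> \<ge> s * T / 2" for w
    proof -
      have "(s * T / 2)\<^sup>2 \<le> \<bar>w\<bar>\<^sup>2" using that s0 T by (intro power_mono) auto
      then show ?thesis using sT2 by (simp add: \<epsilon>_def power_divide)
    qed
    define D :: "nat \<Rightarrow> real \<Rightarrow> real" where "D p t = (case p of 0 \<Rightarrow> (poly r (s * t) * exp (- (s * t)\<^sup>2) + \<kappa> * \<Psi> (s * t)) / s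
      | Suc p \<Rightarrow> s ^ p * (poly (gauss_deriv p q) (s * t) * exp (- (s * t)\<^sup>2)))" for p t
    have pg: "((\<lambda>t. poly g (s * t) * exp (- (s * t)\<^sup>2)) has_real_derivative
        s * (poly (pderiv g - [:0, 2:] * g) (s * t) * exp (- (s * t)\<^sup>2))) (at t)" for g t
      by (auto intro!: derivative_eq_intros simp: algebra_simps power2_eq_square)
    have chain: "deriv_chain D UNIV"
      unfolding deriv_chain_def
    proof (intro allI ballI)
      fix p t
      show "(D p has_real_derivative D (Suc p) t) (at t)"
      proof (cases p)
        case 0
        have "((\<lambda>t. \<Psi> (s * t)) has_real_derivative exp (- (s * t)\<^sup>2) * s) (at t)"
          by (rule DERIV_chain2[where f = \<Psi> and g = "(*) s", OF \<Psi>(1)]) (auto intro!: derivative_eq_intros)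
        from DERIV_cdivide[OF DERIV_add[OF pg[of r t] DERIV_cmult[OF this, of \<kappa>]], of s]
        have "((\<lambda>t. (poly r (s * t) * exp (- (s * t)\<^sup>2) + \<kappa> * \<Psi> (s * t)) / s) has_real_derivative
          (s * (poly (pderiv r - [:0, 2:] * r) (s * t) * exp (- (s * t)\<^sup>2)) + \<kappa> * (exp (- (s * t)\<^sup>2) * s)) / s) (at t)" .
        moreover have "(s * (poly (pderiv r - [:0, 2:] * r) (s * t) * exp (- (s * t)\<^sup>2)) + \<kappa> * (exp (- (s * t)\<^sup>2) * s)) / s = D (Suc 0) t"
          using s0 by (simp add: D_def r field_simps)
        ultimately show ?thesis using 0 by (simp add: D_def[abs_def])
      next
        case (Suc p')
        show ?thesis using DERIV_cmult[OF pg[of "gauss_deriv p' q" t], of "s ^ p'"] Suc by (simp add: D_def[abs_def] mult_ac)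
      qed
    qed
    define l1 where "l1 = \<lceil>(- T - \<theta>) / c\<rceil> - 1"
    define l2 where "l2 = \<lfloor>(T - \<theta>) / c\<rfloor>"
    define t where "t l = \<theta> + c * of_int l" for l :: int
    have t1: "- T - c \<le> t l1" "t l1 < - T"
    proof -
      define Y where "Y = (- T - \<theta>) / c"
      have cY: "c * Y = - T - \<theta>" using c by (simp add: Y_def)
      have *: "Y \<le> of_int l1 + 1" "of_int l1 < Y" unfolding l1_def Y_def[symmetric] by linarith+
      have "c * Y \<le> c * (of_int l1 + 1)" using * c by (intro mult_left_mono) auto
      moreover have "c * of_int l1 < c * Y" using * c by (intro mult_strict_left_mono) auto
      ultimately show "- T - c \<le> t l1" "t l1 < - T" by (auto simp: t_def cY distrib_left)
    qed
    have t2: "T - c \<le> t l2" "t l2 \<le> T"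
    proof -
      define Y where "Y = (T - \<theta>) / c"
      have cY: "c * Y = T - \<theta>" using c by (simp add: Y_def)
      have *: "Y \<le> of_int l2 + 1" "of_int l2 \<le> Y" unfolding l2_def Y_def[symmetric] by linarith+
      have "c * Y \<le> c * (of_int l2 + 1)" using * c by (intro mult_left_mono) auto
      moreover have "c * of_int l2 \<le> c * Y" using * c by (intro mult_left_mono) auto
      ultimately show "T - c \<le> t l2" "t l2 \<le> T" by (auto simp: t_def cY distrib_left)
    qed
    have ll: "l1 \<le> l2"
    proof -
      have "t l1 \<le> t l2" using t1 t2 T c by linarith
      then show ?thesis using c by (simp add: t_def)
    qed
    have setI: "{l::int. \<bar>\<theta> + c * of_int l\<bar> \<le> T} = {l1<..l2}"
    proof -
      have "\<bar>\<theta> + c * of_int l\<bar> \<le> T \<longleftrightarrow> (- T - \<theta>) / c \<le> of_int l \<and> of_int l \<le> (T - \<theta>) / c" for l :: int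
        using c by (auto simp: abs_le_iff field_simps)
      moreover have "(- T - \<theta>) / c \<le> of_int l \<longleftrightarrow> l1 < l" "of_int l \<le> (T - \<theta>) / c \<longleftrightarrow> l \<le> l2" for l :: int
        unfolding l1_def l2_def by linarith+
      ultimately show ?thesis by auto
    qed
    have tt: "(of_int l - (- \<theta> / c)) * c = t l" for l using c by (simp add: t_def field_simps)
    have e1: "\<bar>(\<Sum>l\<in>{l1<..l2}. D 1 (t l)) - (em_primitive D c K (t l2) - em_primitive D c K (t l1))\<bar> \<le> A2 * (1 / M) ^ Q"
    proof -
      have "\<bar>(\<Sum>l\<in>{l1<..l2}. D 1 (t l)) - (em_primitive D c K (t l2) - em_primitive D c K (t l1))\<bar> \<le> of_int (l2 - l1) * (em_const K * (s ^ K * B K) * c ^ K)"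
        unfolding tt[symmetric]
      proof (rule em_sum[OF c K1 ll])
        show "deriv_chain D {(of_int l1 - - \<theta> / c) * c..(of_int l2 - - \<theta> / c) * c}"
          by (rule deriv_chain_subset[OF chain]) auto
        fix x
        have "\<bar>poly (gauss_deriv K q) (s * x)\<bar> * exp (- (s * x)\<^sup>2) \<le> B K * exp (- (s * x)\<^sup>2 / 2)" by (rule B)
        also have "\<dots> \<le> B K * 1" using B by (intro mult_left_mono) auto
        finally show "\<bar>D (Suc K) x\<bar> \<le> s ^ K * B K"
          using s0 by (simp add: D_def abs_mult mult_left_mono)
      qed
      also have "\<dots> \<le> (3 * M / c) * (em_const K * (s ^ K * B K) * c ^ K)"
      proof (rule mult_right_mono)
        have "c * (of_int (l2 - l1)) \<le> 3 * M" using t1 t2 T by (simp add: t_def algebra_simps)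
        then show "of_int (l2 - l1) \<le> 3 * M / c" using c by (simp add: field_simps)
      qed (use em_const_nonneg B s0 c in auto)
      also have "s ^ K = \<beta> ^ (Q + 2) * (1 / M) ^ (Q + 2)"
        unfolding K_def power_mult s2 by (simp add: power_divide)
      also have "(3 * M / c) * (em_const K * (\<beta> ^ (Q + 2) * (1 / M) ^ (Q + 2) * B K) * c ^ K) = A2 * (M * (1 / M) ^ (Q + 2))"
      proof -
        have "(3 * M / c) * (e * (b * u * B') * k) = 3 / c * (e * (b * B') * k) * (M * u)" for e b u B' k :: real
          by simp
        then show ?thesis unfolding A2_def .
      qed
      also have "\<dots> \<le> A2 * (1 / M) ^ Q"
      proof (rule mult_left_mono[OF _ A(3)])
        have "M * (1 / M) ^ (Q + 2) = (1 / M) ^ (Q + 1)" using M by simp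
        also have "\<dots> \<le> (1 / M) ^ Q" using M by (intro power_decreasing) auto
        finally show "M * (1 / M) ^ (Q + 2) \<le> (1 / M) ^ Q" .
      qed
      finally show ?thesis .
    qed
    define w1 where "w1 = s * t l1"
    define w2 where "w2 = s * t l2"
    have w: "w1 \<le> - (s * T / 2)" "w2 \<ge> s * T / 2"
    proof -
      have "s * t l1 \<le> s * (- (T / 2))" by (rule mult_left_mono) (use t1 T s0 in linarith)+
      moreover have "s * (T / 2) \<le> s * t l2" by (rule mult_left_mono) (use t2 T s0 in linarith)+
      ultimately show "w1 \<le> - (s * T / 2)" "w2 \<ge> s * T / 2" by (auto simp: w1_def w2_def)
    qed
    have sm: "exp (- w1\<^sup>2 / 2) \<le> \<epsilon>" "exp (- w2\<^sup>2 / 2) \<le> \<epsilon>" using small[of w1] small[of w2] w by auto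
    have Dp: "\<bar>D (Suc p) (t l)\<bar> \<le> S1 * B p * \<epsilon>" if "l = l1 \<or> l = l2" "p < K" for l p
    proof -
      have "\<bar>poly (gauss_deriv p q) (s * t l)\<bar> * exp (- (s * t l)\<^sup>2) \<le> B p * exp (- (s * t l)\<^sup>2 / 2)" by (rule B)
      also have "\<dots> \<le> B p * \<epsilon>" using B sm that(1) by (intro mult_left_mono) (auto simp: w1_def w2_def)
      finally have bd: "\<bar>poly (gauss_deriv p q) (s * t l)\<bar> * exp (- (s * t l)\<^sup>2) \<le> B p * \<epsilon>" .
      have "s ^ p * (\<bar>poly (gauss_deriv p q) (s * t l)\<bar> * exp (- (s * t l)\<^sup>2)) \<le> S1 * (B p * \<epsilon>)"
      proof (rule mult_mono[OF _ bd])
        have "s \<le> sqrt \<beta>" unfolding s_def using M \<beta> by (intro real_sqrt_le_mono) (simp add: field_simps)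
        then have "s ^ p \<le> (1 + sqrt \<beta>) ^ p" using s0 by (intro power_mono) auto
        also have "\<dots> \<le> S1" unfolding S1_def using that \<beta> by (intro power_increasing) auto
        finally show "s ^ p \<le> S1" .
      qed (use S1 in auto)
      then show ?thesis using s0 by (simp add: D_def abs_mult mult_ac)
    qed
    have e2: "\<bar>em_primitive D c K (t l2) - em_primitive D c K (t l1) - (D 0 (t l2) - D 0 (t l1)) / c\<bar> \<le> A1 * \<epsilon>"
    proof -
      have EMs: "em_primitive D c K x = D 0 x / c + (\<Sum>p<K. bern_coeff (Suc p) * c ^ Suc p * D (Suc p) x / c)" for x
        unfolding em_primitive_def lessThan_Suc_atMost[symmetric] sum.lessThan_Suc_shift by (simp add: bern_coeff_0)
      have "em_primitive D c K (t l2) - em_primitive D c K (t l1) - (D 0 (t l2) - D 0 (t l1)) / c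
         = (\<Sum>p<K. bern_coeff (Suc p) * c ^ Suc p / c * (D (Suc p) (t l2) - D (Suc p) (t l1)))"
        unfolding EMs using c by (simp add: diff_divide_distrib sum_subtractf[symmetric] right_diff_distrib mult.assoc)
      also have "\<bar>\<dots>\<bar> \<le> (\<Sum>p<K. \<bar>bern_coeff (Suc p)\<bar> * c ^ Suc p / c * (2 * (S1 * B p)) * \<epsilon>)"
      proof (rule order.trans[OF sum_abs], rule sum_mono)
        fix p assume p: "p \<in> {..<K}"
        have "\<bar>D (Suc p) (t l2) - D (Suc p) (t l1)\<bar> \<le> 2 * (S1 * B p) * \<epsilon>"
          using Dp[of l1 p] Dp[of l2 p] p by auto
        then have "\<bar>bern_coeff (Suc p)\<bar> * c ^ Suc p / c * \<bar>D (Suc p) (t l2) - D (Suc p) (t l1)\<bar> \<le> \<bar>bern_coeff (Suc p)\<bar> * c ^ Suc p / c * (2 * (S1 * B p) * \<epsilon>)"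
          using c by (intro mult_left_mono) auto
        then show "\<bar>bern_coeff (Suc p) * c ^ Suc p / c * (D (Suc p) (t l2) - D (Suc p) (t l1))\<bar> \<le> \<bar>bern_coeff (Suc p)\<bar> * c ^ Suc p / c * (2 * (S1 * B p)) * \<epsilon>"
          using c by (simp add: abs_mult mult.assoc)
      qed
      finally show ?thesis by (simp add: A1_def sum_distrib_right)
    qed
    have e3: "\<bar>(D 0 (t l2) - D 0 (t l1)) / c - sqrt pi * \<kappa> / (c * s)\<bar> \<le> A0 * (M * \<epsilon>)"
    proof -
      have p2: "\<bar>\<Psi> w2 - sqrt pi / 2\<bar> \<le> \<epsilon>"
      proof -
        have "\<bar>\<Psi> w2 - sqrt pi / 2\<bar> \<le> exp (- w2\<^sup>2)" using w sT by (intro \<Psi>(3)) auto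
        also have "\<dots> \<le> exp (- w2\<^sup>2 / 2)" by simp
        finally show ?thesis using sm by simp
      qed
      have p1: "\<bar>- \<Psi> w1 - sqrt pi / 2\<bar> \<le> \<epsilon>"
      proof -
        have "\<bar>\<Psi> (- w1) - sqrt pi / 2\<bar> \<le> exp (- (- w1)\<^sup>2)" using w sT by (intro \<Psi>(3)) auto
        also have "\<dots> \<le> exp (- w1\<^sup>2 / 2)" by simp
        finally show ?thesis using sm \<Psi>(2) by simp
      qed
      have r12: "\<bar>poly r w2 * exp (- w2\<^sup>2)\<bar> \<le> Br * \<epsilon>" "\<bar>poly r w1 * exp (- w1\<^sup>2)\<bar> \<le> Br * \<epsilon>"
        using order.trans[OF Br(2) mult_left_mono[OF sm(1) Br(1)]] order.trans[OF Br(2) mult_left_mono[OF sm(2) Br(1)]]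
        by (auto simp: abs_mult)
      have k: "\<bar>\<kappa> * (\<Psi> w2 - sqrt pi / 2)\<bar> \<le> \<bar>\<kappa>\<bar> * \<epsilon>" "\<bar>\<kappa> * (- \<Psi> w1 - sqrt pi / 2)\<bar> \<le> \<bar>\<kappa>\<bar> * \<epsilon>"
        unfolding abs_mult using p1 p2 by (auto intro!: mult_left_mono)
      have "(D 0 (t l2) - D 0 (t l1)) / c - sqrt pi * \<kappa> / (c * s)
         = (poly r w2 * exp (- w2\<^sup>2) - poly r w1 * exp (- w1\<^sup>2) + \<kappa> * (\<Psi> w2 - sqrt pi / 2) + \<kappa> * (- \<Psi> w1 - sqrt pi / 2)) / (c * s)"
        using c s0 unfolding D_def w1_def[symmetric] w2_def[symmetric] by (simp add: field_simps)
      also have "\<bar>\<dots>\<bar> \<le> ((2 * Br + 2 * \<bar>\<kappa>\<bar>) * \<epsilon>) / (c * s)"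
      proof -
        have "\<bar>poly r w2 * exp (- w2\<^sup>2) - poly r w1 * exp (- w1\<^sup>2) + \<kappa> * (\<Psi> w2 - sqrt pi / 2) + \<kappa> * (- \<Psi> w1 - sqrt pi / 2)\<bar> \<le> (2 * Br + 2 * \<bar>\<kappa>\<bar>) * \<epsilon>"
          unfolding distrib_right mult.assoc using r12 k by linarith
        then show ?thesis using c s0 by (simp add: abs_divide divide_right_mono)
      qed
      also have "\<dots> = (2 * Br + 2 * \<bar>\<kappa>\<bar>) * \<epsilon> / c * (1 / s)" by simp
      also have "\<dots> \<le> (2 * Br + 2 * \<bar>\<kappa>\<bar>) * \<epsilon> / c * (M / sqrt \<beta>)"
      proof (rule mult_left_mono)
        have "sqrt M \<le> M" using M by (simp add: real_le_lsqrt power2_eq_square)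
        then show "1 / s \<le> M / sqrt \<beta>" using \<beta> M by (simp add: s_def real_sqrt_divide divide_right_mono)
        show "0 \<le> (2 * Br + 2 * \<bar>\<kappa>\<bar>) * \<epsilon> / c" using Br c by (simp add: \<epsilon>_def)
      qed
      finally show ?thesis by (simp add: A0_def mult_ac)
    qed
    have D1: "D 1 x = (s * x) ^ j * exp (- (s * x)\<^sup>2)" for x by (simp add: D_def q_def poly_monom)
    have "\<epsilon> \<le> M * \<epsilon>" using M by (simp add: \<epsilon>_def)
    then have "A1 * \<epsilon> \<le> A1 * (M * \<epsilon>)" using A by (intro mult_left_mono) auto
    then have "\<bar>(\<Sum>l\<in>{l1<..l2}. D 1 (t l)) - sqrt pi * \<kappa> / (c * s)\<bar> \<le> A2 * (1 / M) ^ Q + (A0 + A1) * (M * \<epsilon>)"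
      using e1 e2 e3 unfolding distrib_right by linarith
    also have "\<dots> \<le> A2 * (1 / M) ^ Q + (A0 + A1) * (Ce * (1 / M) ^ Q)"
      using eps A by (intro add_left_mono mult_left_mono) auto
    finally show "\<bar>(\<Sum>l\<in>{l::int. \<bar>\<theta> + c * of_int l\<bar> \<le> M powr (3/5)}.
          (sqrt (\<beta> / M) * (\<theta> + c * of_int l)) ^ j * exp (- (sqrt (\<beta> / M) * (\<theta> + c * of_int l))\<^sup>2))
        - sqrt pi * gauss_moment j / (c * sqrt (\<beta> / M))\<bar> \<le> (A2 + (A0 + A1) * Ce) * (1 / M) ^ Q"
      unfolding T_def[symmetric] setI s_def[symmetric] \<kappa>_def[symmetric] D1 t_def by (simp add: algebra_simps)
  qed
qed

section \<open>Weighted polynomials in the two expansion variables\<close>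

text \<open>Polynomials in \<open>z = \<pi> / M\<close> and \<open>t\<close>, the distance to the peak. As \<open>\<bar>t\<bar> \<le> M powr (3/5)\<close>, the monomial
  \<open>z ^ a * t ^ j\<close> is at most a constant times \<open>M powr ((3 j - 5 a) / 5)\<close>; weight \<open>w\<close> means
  that each monomial is bounded by a constant times \<open>M powr (- w / 5)\<close>.\<close>
inductive weighted :: "nat \<Rightarrow> (real \<Rightarrow> real \<Rightarrow> real) \<Rightarrow> bool" where
  weighted_zero: "weighted w (\<lambda>z t. 0)"
| weighted_add: "weighted w F \<Longrightarrow> algebraic \<alpha> \<Longrightarrow> 3 * j + w \<le> 5 * a \<Longrightarrow> weighted w (\<lambda>z t. F z t + \<alpha> * z ^ a * t ^ j)"

lemma weighted_monom: "algebraic \<alpha> \<Longrightarrow> 3 * j + w \<le> 5 * a \<Longrightarrow> weighted w (\<lambda>z t. \<alpha> * z ^ a * t ^ j)"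
  using weighted_add[OF weighted_zero, of \<alpha> j w a] by simp

lemma weighted_mono: "weighted w F \<Longrightarrow> w' \<le> w \<Longrightarrow> weighted w' F"
  by (induction rule: weighted.induct) (auto intro: weighted.intros)

lemma weighted_plus:
  assumes "weighted w G" "weighted w F"
  shows "weighted w (\<lambda>z t. F z t + G z t)"
  using assms
proof (induction rule: weighted.induct)
  case (weighted_zero w)
  then show ?case by simp
next
  case (weighted_add w G \<alpha> j a)
  then show ?case using weighted.weighted_add[OF weighted_add.IH[OF weighted_add.prems], of \<alpha> j a] by (simp add: add.assoc)
qed

lemma weighted_sum:
  assumes "\<And>i. i \<in> I \<Longrightarrow> weighted w (F i)"
  shows "weighted w (\<lambda>z t. \<Sum>i\<in>I. F i z t)"
  using assms
proof (induction I rule: infinite_finite_induct)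
  case (insert x I)
  then show ?case using weighted_plus[of w "\<lambda>z t. \<Sum>i\<in>I. F i z t" "F x"] by simp
qed (auto intro: weighted_zero)

lemma weighted_monom_times:
  assumes "weighted w' G" "algebraic \<alpha>" "3 * j + w \<le> 5 * a"
  shows "weighted (w + w') (\<lambda>z t. \<alpha> * z ^ a * t ^ j * G z t)"
  using assms
proof (induction rule: weighted.induct)
  case (weighted_zero w')
  then show ?case by (simp add: weighted.weighted_zero)
next
  case (weighted_add w' G \<beta> i b)
  have "weighted (w + w') (\<lambda>z t. \<alpha> * z ^ a * t ^ j * G z t + (\<alpha> * \<beta>) * z ^ (a + b) * t ^ (j + i))"
    by (rule weighted.weighted_add) (use weighted_add in \<open>auto intro: algebraic_mult\<close>)
  then show ?case by (simp add: algebra_simps power_add)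
qed

lemma weighted_times:
  assumes "weighted w F" "weighted w' G"
  shows "weighted (w + w') (\<lambda>z t. F z t * G z t)"
  using assms
proof (induction rule: weighted.induct)
  case (weighted_zero w)
  then show ?case by (simp add: weighted.weighted_zero)
next
  case (weighted_add w F \<alpha> j a)
  have "weighted (w + w') (\<lambda>z t. F z t * G z t + \<alpha> * z ^ a * t ^ j * G z t)"
    using weighted_plus[OF weighted_monom_times[OF weighted_add.prems weighted_add.hyps(2,3)] weighted_add.IH[OF weighted_add.prems]] .
  then show ?case by (simp add: algebra_simps)
qed

lemma weighted_scale: "weighted w F \<Longrightarrow> algebraic \<alpha> \<Longrightarrow> weighted w (\<lambda>z t. \<alpha> * F z t)"
  using weighted_monom_times[of w F \<alpha> 0 0 0] by simp

lemma weighted_power: "weighted w F \<Longrightarrow> weighted 0 (\<lambda>z t. F z t ^ k)"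
proof (induction k)
  case 0
  then show ?case using weighted_monom[of 1 0 0 0] by simp
next
  case (Suc k)
  then show ?case using weighted_mono[OF weighted_times[OF Suc.prems Suc.IH[OF Suc.prems]], of 0] by simp
qed

lemma weighted_bound:
  assumes "weighted w F"
  shows "\<exists>C\<ge>0. \<forall>M t. M \<ge> 1 \<longrightarrow> \<bar>t\<bar> \<le> M powr (3/5) \<longrightarrow> \<bar>F (pi / M) t\<bar> \<le> C * M powr (- real w / 5)"
  using assms
proof (induction rule: weighted.induct)
  case (weighted_zero w)
  then show ?case by (intro exI[of _ 0]) auto
next
  case (weighted_add w F \<alpha> j a)
  then obtain C where C: "C \<ge> 0" "\<And>M t. M \<ge> 1 \<Longrightarrow> \<bar>t\<bar> \<le> M powr (3/5) \<Longrightarrow> \<bar>F (pi / M) t\<bar> \<le> C * M powr (- real w / 5)"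
    by blast
  have "\<bar>F (pi / M) t + \<alpha> * (pi / M) ^ a * t ^ j\<bar> \<le> (C + \<bar>\<alpha>\<bar> * pi ^ a) * M powr (- real w / 5)"
    if M: "M \<ge> 1" "\<bar>t\<bar> \<le> M powr (3/5)" for M t
  proof -
    have "\<bar>t\<bar> ^ j \<le> (M powr (3/5)) ^ j" using M by (intro power_mono) auto
    also have "\<dots> = M powr (3/5 * real j)" using M by (simp add: powr_power mult.commute)
    finally have tj: "\<bar>t\<bar> ^ j \<le> M powr (3/5 * real j)" .
    have "(1 / M) ^ a = M powr (- real a)"
      using M powr_realpow[of M a] by (simp add: powr_minus power_divide inverse_eq_divide)
    then have "(1 / M) ^ a * \<bar>t\<bar> ^ j \<le> M powr (- real a) * M powr (3/5 * real j)"
      using mult_left_mono[OF tj, of "M powr (- real a)"] by simp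
    also have "\<dots> = M powr (- real a + 3/5 * real j)" by (simp only: powr_add)
    also have "\<dots> \<le> M powr (- real w / 5)"
    proof (rule powr_mono)
      have "3 * real j + real w \<le> 5 * real a" using weighted_add.hyps(3) by linarith
      then show "- real a + 3/5 * real j \<le> - real w / 5" by simp
    qed (use M in auto)
    finally have "\<bar>\<alpha>\<bar> * pi ^ a * ((1 / M) ^ a * \<bar>t\<bar> ^ j) \<le> \<bar>\<alpha>\<bar> * pi ^ a * M powr (- real w / 5)"
      by (intro mult_left_mono) auto
    moreover have "\<bar>\<alpha> * (pi / M) ^ a * t ^ j\<bar> = \<bar>\<alpha>\<bar> * pi ^ a * ((1 / M) ^ a * \<bar>t\<bar> ^ j)"
      using M by (simp add: abs_mult power_abs power_divide)
    ultimately show ?thesis using C(2)[OF M] unfolding distrib_right by linarith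
  qed
  then show ?case using C(1) by (intro exI[of _ "C + \<bar>\<alpha>\<bar> * pi ^ a"]) auto
qed

text \<open>A monomial \<open>z ^ a * t ^ j\<close> contributes nothing to any order for odd \<open>j\<close>. For even \<open>j\<close> the
  moment brings in \<open>M ^ (j / 2) sqrt M\<close> and the same power of \<open>1 / \<pi>\<close>, so the powers of \<open>\<pi>\<close> and \<open>M\<close> again combine to a
  power of \<open>z\<close>, of exponent \<open>a - j / 2\<close>. Nonnegative weight makes this exponent nonnegative.\<close>
lemma weighted_gauss:
  assumes "weighted w F" and c: "c > 0" "algebraic c"
  shows "\<exists>p::real poly. (\<forall>i. algebraic (coeff p i)) \<and> (\<forall>Q. \<exists>C\<ge>0. \<exists>M0\<ge>1. \<forall>M\<ge>M0. \<forall>\<theta>.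
     \<bar>(\<Sum>l\<in>{l::int. \<bar>\<theta> + c * of_int l\<bar> \<le> M powr (3/5)}.
        F (pi / M) (\<theta> + c * of_int l) * exp (- (sqrt 3 * pi / c / M) * (\<theta> + c * of_int l)\<^sup>2))
      - sqrt M * poly p (pi / M)\<bar> \<le> C * (1 / M) ^ Q)"
  using assms(1)
proof (induction rule: weighted.induct)
  case (weighted_zero w)
  show ?case by (intro exI[of _ 0]) (auto intro!: exI[of _ 0] exI[of _ "1::real"])
next
  case (weighted_add w F \<alpha> j a)
  then obtain p :: "real poly" where p: "\<And>i. algebraic (coeff p i)"
    "\<And>Q. \<exists>C\<ge>0. \<exists>M0\<ge>1. \<forall>M\<ge>M0. \<forall>\<theta>.
     \<bar>(\<Sum>l\<in>{l::int. \<bar>\<theta> + c * of_int l\<bar> \<le> M powr (3/5)}.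
        F (pi / M) (\<theta> + c * of_int l) * exp (- (sqrt 3 * pi / c / M) * (\<theta> + c * of_int l)\<^sup>2))
      - sqrt M * poly p (pi / M)\<bar> \<le> C * (1 / M) ^ Q" by blast
  define \<beta>0 where "\<beta>0 = sqrt 3 / c"
  define \<beta> where "\<beta> = \<beta>0 * pi"
  have \<beta>0: "\<beta>0 > 0" "algebraic \<beta>0" using c by (auto simp: \<beta>0_def intro: algebraic_divide)
  have \<beta>: "\<beta> > 0" using \<beta>0 by (simp add: \<beta>_def)
  define i where "i = j div 2"
  define p' where "p' = p + monom (\<alpha> * gauss_moment j / (\<beta>0 ^ i * (sqrt \<beta>0 * c))) (a - i)"
  have "algebraic (\<alpha> * gauss_moment j / (\<beta>0 ^ i * (sqrt \<beta>0 * c)))"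
    by (intro algebraic_divide algebraic_mult algebraic_power algebraic_sqrt rat_imp_algebraic[OF gauss_moment_rat]
        weighted_add.hyps(2) \<beta>0(2) c(2))
  then have "algebraic (coeff p' k)" for k
    unfolding p'_def using p(1) by (auto intro: algebraic_add)
  moreover have "\<exists>C\<ge>0. \<exists>M0\<ge>1. \<forall>M\<ge>M0. \<forall>\<theta>.
     \<bar>(\<Sum>l\<in>{l::int. \<bar>\<theta> + c * of_int l\<bar> \<le> M powr (3/5)}.
        (F (pi / M) (\<theta> + c * of_int l) + \<alpha> * (pi / M) ^ a * (\<theta> + c * of_int l) ^ j)
          * exp (- (sqrt 3 * pi / c / M) * (\<theta> + c * of_int l)\<^sup>2))
      - sqrt M * poly p' (pi / M)\<bar> \<le> C * (1 / M) ^ Q" for Q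
  proof -
    from p(2)[of Q] obtain C1 M1 where C1: "C1 \<ge> 0" "M1 \<ge> 1" "\<And>M \<theta>. M \<ge> M1 \<Longrightarrow>
     \<bar>(\<Sum>l\<in>{l::int. \<bar>\<theta> + c * of_int l\<bar> \<le> M powr (3/5)}.
        F (pi / M) (\<theta> + c * of_int l) * exp (- (sqrt 3 * pi / c / M) * (\<theta> + c * of_int l)\<^sup>2))
      - sqrt M * poly p (pi / M)\<bar> \<le> C1 * (1 / M) ^ Q" by blast
    show ?thesis
    proof (rule gauss_lattice[OF c(1) \<beta>, of j "Q + j"], goal_cases)
      case (1 C2 M2)
      define C where "C = C1 + \<bar>\<alpha>\<bar> * pi ^ a * (1 / sqrt \<beta>) ^ j * C2"
      show ?case
      proof (rule exI[of _ C], rule conjI[rotated], rule exI[of _ "max M1 M2"], intro conjI allI impI)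
        show "C \<ge> 0" using C1 1 \<beta> by (simp add: C_def)
        show "max M1 M2 \<ge> 1" using 1 by simp
        fix M \<theta> :: real assume "M \<ge> max M1 M2"
        then have M: "M \<ge> M1" "M \<ge> M2" "M \<ge> 1" using 1 by auto
        define s where "s = sqrt (\<beta> / M)"
        have s: "s > 0" "s\<^sup>2 = \<beta> / M" using M \<beta> by (auto simp: s_def)
        define I where "I = {l::int. \<bar>\<theta> + c * of_int l\<bar> \<le> M powr (3/5)}"
        define t where "t l = \<theta> + c * of_int l" for l :: int
        define g where "g l = exp (- (sqrt 3 * pi / c / M) * (t l)\<^sup>2)" for l
        have g: "g l = exp (- (s * t l)\<^sup>2)" for l
          unfolding g_def power_mult_distrib s(2) by (simp add: \<beta>_def \<beta>0_def)
        have S2: "\<bar>(\<Sum>l\<in>I. (s * t l) ^ j * g l) - sqrt pi * gauss_moment j / (c * s)\<bar> \<le> C2 * (1 / M) ^ (Q + j)"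
          unfolding g using 1(3)[OF M(2), of \<theta>] by (simp add: I_def t_def s_def)
        define A where "A = \<alpha> * (pi / M) ^ a / s ^ j"
        have lhs: "(\<Sum>l\<in>I. \<alpha> * (pi / M) ^ a * t l ^ j * g l) = A * (\<Sum>l\<in>I. (s * t l) ^ j * g l)"
          unfolding A_def sum_distrib_left power_mult_distrib using s by (intro sum.cong) auto
        have rhs: "A * (sqrt pi * gauss_moment j / (c * s)) = sqrt M * poly (monom (\<alpha> * gauss_moment j / (\<beta>0 ^ i * (sqrt \<beta>0 * c))) (a - i)) (pi / M)"
        proof (cases "even j")
          case False
          then show ?thesis by (simp add: gauss_moment_odd poly_monom)
        next
          case True
          then have j: "j = 2 * i" by (simp add: i_def)
          have ai: "i \<le> a" using weighted_add.hyps(3) j by linarith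
          have sj: "s ^ j = \<beta>0 ^ i * (pi / M) ^ i"
            unfolding j power_mult s(2) \<beta>_def by (simp add: power_mult_distrib power_divide)
          have sp: "sqrt pi / s = sqrt M / sqrt \<beta>0"
            using M \<beta>0 by (simp add: s_def \<beta>_def real_sqrt_divide real_sqrt_mult field_simps)
          have "A * (sqrt pi * gauss_moment j / (c * s)) = \<alpha> * gauss_moment j * ((pi / M) ^ a / (pi / M) ^ i) / (\<beta>0 ^ i * c) * (sqrt pi / s)"
            unfolding A_def sj by (simp add: mult_ac)
          also have "(pi / M) ^ a / (pi / M) ^ i = (pi / M) ^ (a - i)"
            using ai M by (simp add: power_diff)
          finally show ?thesis unfolding sp by (simp add: poly_monom mult_ac)
        qed
        have "\<bar>A\<bar> * (C2 * (1 / M) ^ (Q + j)) \<le> \<bar>\<alpha>\<bar> * pi ^ a * (1 / sqrt \<beta>) ^ j * C2 * (1 / M) ^ Q"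
        proof -
          have "1 / s \<le> M / sqrt \<beta>"
          proof -
            have "sqrt M \<le> M" using M by (simp add: real_le_lsqrt power2_eq_square)
            then show ?thesis using \<beta> M by (simp add: s_def real_sqrt_divide divide_right_mono)
          qed
          then have "(1 / s) ^ j \<le> (M / sqrt \<beta>) ^ j" using s by (intro power_mono) auto
          moreover have "(pi / M) ^ a \<le> pi ^ a" using M by (intro power_mono) (auto simp: field_simps)
          ultimately have "\<bar>\<alpha>\<bar> * (pi / M) ^ a * (1 / s) ^ j * (C2 * (1 / M) ^ (Q + j))
              \<le> \<bar>\<alpha>\<bar> * pi ^ a * (M / sqrt \<beta>) ^ j * (C2 * (1 / M) ^ (Q + j))"
            using M \<beta> s 1 by (intro mult_mono mult_right_mono) auto
          also have "\<dots> = \<bar>\<alpha>\<bar> * pi ^ a * (1 / sqrt \<beta>) ^ j * C2 * (1 / M) ^ Q * (M ^ j * (1 / M) ^ j)"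
            by (simp add: power_add power_divide)
          also have "M ^ j * (1 / M) ^ j = 1" using M by (simp flip: power_mult_distrib)
          finally show ?thesis using s M by (simp add: A_def abs_mult power_divide)
        qed
        then have "\<bar>(\<Sum>l\<in>I. \<alpha> * (pi / M) ^ a * t l ^ j * g l) - A * (sqrt pi * gauss_moment j / (c * s))\<bar> \<le> \<bar>\<alpha>\<bar> * pi ^ a * (1 / sqrt \<beta>) ^ j * C2 * (1 / M) ^ Q"
          unfolding lhs right_diff_distrib[symmetric] abs_mult
          using mult_left_mono[OF S2, of "\<bar>A\<bar>"] by simp
        moreover have "\<bar>(\<Sum>l\<in>I. F (pi / M) (t l) * g l) - sqrt M * poly p (pi / M)\<bar> \<le> C1 * (1 / M) ^ Q"
          using C1(3)[OF M(1), of \<theta>] by (simp add: I_def t_def g_def)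
        ultimately have "\<bar>(\<Sum>l\<in>I. (F (pi / M) (t l) + \<alpha> * (pi / M) ^ a * t l ^ j) * g l) - sqrt M * poly p' (pi / M)\<bar> \<le> C * (1 / M) ^ Q"
          unfolding rhs p'_def C_def by (simp add: distrib_right distrib_left sum.distrib abs_le_iff)
        then show "\<bar>(\<Sum>l\<in>{l::int. \<bar>\<theta> + c * of_int l\<bar> \<le> M powr (3/5)}.
            (F (pi / M) (\<theta> + c * of_int l) + \<alpha> * (pi / M) ^ a * (\<theta> + c * of_int l) ^ j)
              * exp (- (sqrt 3 * pi / c / M) * (\<theta> + c * of_int l)\<^sup>2))
          - sqrt M * poly p' (pi / M)\<bar> \<le> C * (1 / M) ^ Q" by (simp add: I_def t_def g_def)
      qed
    qed
  qed
  ultimately show ?case by blast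
qed

section \<open>Algebraicity of the local data\<close>

lemma algebraic_trig:
  assumes "x \<in> \<rat>"
  shows "algebraic (sin (pi * x))" "algebraic (cos (pi * x))"
proof -
  from assms obtain p :: int and q :: nat where q: "q > 0" "x = of_int p / of_nat q"
    by (metis Rats_cases' of_nat_0_less_iff zero_less_imp_eq_int of_int_of_nat_eq)
  define z where "z = cis (pi * x)"
  have "z ^ (2 * q) = cis (2 * pi * of_int p)"
    unfolding z_def Complex.DeMoivre by (rule arg_cong[of _ _ cis]) (use q in simp)
  also have "\<dots> = 1" by (rule cis_multiple_2pi) auto
  finally have z: "z ^ (2 * q) = 1" .
  have az: "algebraic z"
  proof (rule algebraicI')
    show "monom 1 (2 * q) - 1 \<noteq> (0 :: complex poly)"
    proof
      assume "monom 1 (2 * q) - 1 = (0 :: complex poly)"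
      then have "poly (monom 1 (2 * q) - 1) (0 :: complex) = 0" by simp
      then show False using q by (simp add: poly_monom zero_power)
    qed
    show "poly (monom 1 (2 * q) - 1) z = 0" using z by (simp add: poly_monom)
    show "coeff (monom 1 (2 * q) - 1) i \<in> \<rat>" for i by (auto simp: coeff_monom)
  qed
  have acn: "algebraic (cnj z)" using az by simp
  have "of_real (cos (pi * x)) = (z + cnj z) / 2" by (simp add: z_def complex_eq_iff)
  moreover have "of_real (sin (pi * x)) = (z - cnj z) / (2 * \<i>)" by (simp add: z_def complex_eq_iff)
  moreover have "algebraic ((z + cnj z) / 2)" "algebraic ((z - cnj z) / (2 * \<i>))"
    using az acn by (auto intro!: algebraic_divide algebraic_add algebraic_diff algebraic_mult simp del: complex_add_cnj complex_diff_cnj)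
  ultimately show "algebraic (sin (pi * x))" "algebraic (cos (pi * x))"
    by (metis algebraic_of_real_iff)+
qed

lemma algebraic_cot: "x \<in> \<rat> \<Longrightarrow> algebraic (cot (pi * x))"
  unfolding cot_def by (intro algebraic_divide algebraic_trig)

lemma algebraic_poly:
  assumes "\<And>i. algebraic (coeff p i)" "algebraic x"
  shows "algebraic (poly p x)"
  unfolding poly_altdef by (intro algebraic_sum algebraic_mult algebraic_power assms)

lemma algebraic_coeff_times:
  assumes "\<And>i. algebraic (coeff p i)" "\<And>i. algebraic (coeff q i)"
  shows "algebraic (coeff (p * q) i)"
  unfolding coeff_mult by (intro algebraic_sum algebraic_mult assms)

lemma algebraic_coeff_power:
  assumes "\<And>i. algebraic (coeff p i)"
  shows "algebraic (coeff (p ^ n) i)"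
proof (induction n arbitrary: i)
  case 0
  then show ?case by (auto simp: coeff_pCons split: nat.splits)
next
  case (Suc n)
  then show ?case using algebraic_coeff_times[OF assms Suc.IH] by simp
qed

lemma algebraic_coeff_cotp: "algebraic (coeff (cotp p) i)"
proof (induction p arbitrary: i)
  case 0
  then show ?case by (auto simp: coeff_pCons split: nat.splits)
next
  case (Suc p)
  have "algebraic (coeff ([:1, 0, 1:] * pderiv (cotp p)) i)"
  proof (rule algebraic_coeff_times)
    show "algebraic (coeff [:1, 0, 1::real:] i)" for i by (auto simp: coeff_pCons split: nat.splits)
    show "algebraic (coeff (pderiv (cotp p)) i)" for i
      unfolding coeff_pderiv by (intro algebraic_mult Suc.IH) (rule algebraic_of_nat)
  qed
  then show ?case by (simp only: cotp.simps coeff_minus algebraic_minus_iff)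
qed

text \<open>The exponential of \<open>lsin x\<close> is \<open>\<bar>2 sin (\<pi> x)\<bar>\<close>, and roots of algebraic numbers are algebraic.\<close>
lemma algebraic_exp_lsin:
  assumes x: "x \<in> \<rat>" "sin (pi * x) \<noteq> 0" and n: "n > 0"
  shows "algebraic (exp (real k * lsin x / real n))" "algebraic (exp (- (real k * lsin x / real n)))"
proof -
  define y where "y = \<bar>2 * sin (pi * x)\<bar>"
  have y: "y > 0" "algebraic y" using x algebraic_trig[OF x(1)] by (auto simp: y_def intro!: algebraic_mult)
  define w where "w = exp (real k * lsin x / real n)"
  have "w ^ n = exp (real k * lsin x)" using n by (simp add: w_def exp_of_nat_mult[symmetric])
  also have "\<dots> = y ^ k" using y by (simp add: lsin_def y_def[symmetric] exp_of_nat_mult)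
  finally have "root n (y ^ k) = w" using n by (metis real_root_power_cancel w_def exp_ge_zero)
  then show 1: "algebraic (exp (real k * lsin x / real n))"
    using algebraic_nth_root_real[OF algebraic_power[OF y(2)], of n k] by (simp add: w_def)
  then show "algebraic (exp (- (real k * lsin x / real n)))"
    unfolding exp_minus by (rule algebraic_inverse)
qed

text \<open>The Bernoulli polynomial at an affine argument, as an element of the polynomial ring: this gives access to its
  degree and coefficients.\<close>
definition bern_polynomial :: "nat \<Rightarrow> real \<Rightarrow> real \<Rightarrow> real poly" where
  "bern_polynomial n u v = (\<Sum>p\<le>n. smult (bern_coeff p / fact (n - p)) ([:u, v:] ^ (n - p)))"

lemma poly_embp: "poly (bern_polynomial n u v) t = bern_poly n (u + t * v)"
  by (simp add: bern_polynomial_def bern_poly_def poly_sum poly_power)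

lemma degree_embp: "degree (bern_polynomial n u v) \<le> n"
  unfolding bern_polynomial_def
proof (intro degree_sum_le)
  fix p assume "p \<in> {..n}"
  have "degree ([:u, v:] ^ (n - p)) \<le> degree [:u, v:] * (n - p)" by (rule degree_power_le)
  also have "\<dots> \<le> 1 * n" by (intro mult_mono) auto
  finally show "degree (smult (bern_coeff p / fact (n - p)) ([:u, v:] ^ (n - p))) \<le> n"
    using degree_smult_le order.trans by fastforce
qed simp

lemma algebraic_emc: "algebraic (bern_coeff n)"
  by (rule rat_imp_algebraic[OF bern_coeff_rat])

lemma algebraic_fact: "algebraic (fact n :: real)"
  by (metis algebraic_of_nat of_nat_fact)

lemma algebraic_coeff_embp:
  assumes "algebraic u" "algebraic v"
  shows "algebraic (coeff (bern_polynomial n u v) i)"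
  unfolding bern_polynomial_def coeff_sum coeff_smult
  using assms by (intro algebraic_sum algebraic_mult algebraic_divide algebraic_emc algebraic_fact algebraic_coeff_power)
    (auto simp: coeff_pCons split: nat.splits)

lemma weighted_poly:
  assumes "\<And>i. algebraic (coeff q i)" "3 * degree q + w \<le> 5 * e"
  shows "weighted w (\<lambda>z t. z ^ e * poly q t)"
proof -
  have "weighted w (\<lambda>z t. \<Sum>i\<le>degree q. coeff q i * z ^ e * t ^ i)"
    by (intro weighted_sum weighted_monom) (use assms in auto)
  then show ?thesis by (simp add: poly_altdef sum_distrib_left mult_ac)
qed

section \<open>Expansion at the peak\<close>

text \<open>The derivative of \<open>lsin_distribution_plus\<close>.\<close>
lemma cot_distribution:
  assumes L: "L > 0" and v: "sin (pi * v) \<noteq> 0"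
  shows "(\<Sum>k<L. cot (pi * ((v + real k) / real L))) = real L * cot (pi * v)"
proof -
  have L0: "real L \<noteq> 0" using L by simp
  have sk: "sin (pi * ((u + real k) / real L)) \<noteq> 0" if "sin (pi * u) \<noteq> 0" for u k
  proof
    assume "sin (pi * ((u + real k) / real L)) = 0"
    then obtain i :: int where "pi * ((u + real k) / real L) = of_int i * pi" by (auto simp: sin_zero_iff_int2)
    moreover have "y = of_int i" if "pi * y = of_int i * pi" for y using that by (simp add: mult.commute)
    ultimately have "(u + real k) / real L = of_int i" by blast
    then have "u = of_int (i * int L - int k)" using L0 by (simp add: field_simps)
    then have "sin (pi * u) = 0" using sin_pi_shift_int[of 0 "i * int L - int k"] by simp
    then show False using that by simp
  qed
  have "((\<lambda>u. \<Sum>k<L. lsin ((u + real k) / real L)) has_real_derivative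
      (\<Sum>k<L. pi * cot (pi * ((v + real k) / real L)) * (1 / real L))) (at v)"
  proof (rule DERIV_sum)
    fix k
    show "((\<lambda>u. lsin ((u + real k) / real L)) has_real_derivative pi * cot (pi * ((v + real k) / real L)) * (1 / real L)) (at v)"
      by (rule DERIV_chain2[where f = lsin and g = "\<lambda>u. (u + real k) / real L", OF lsin_deriv[OF sk[OF v]]])
         (use L0 in \<open>auto intro!: derivative_eq_intros\<close>)
  qed
  then have "(lsin has_real_derivative (\<Sum>k<L. pi * cot (pi * ((v + real k) / real L)) * (1 / real L))) (at v)"
  proof (rule has_field_derivative_transform_within_open)
    show "open {u::real. sin (pi * u) \<noteq> 0}" by (intro open_Collect_neq continuous_intros)
    show "(\<Sum>k<L. lsin ((u + real k) / real L)) = lsin u" if "u \<in> {u. sin (pi * u) \<noteq> 0}" for u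
      using lsin_distribution_plus[OF L, of u] that by simp
  qed (use v in auto)
  then have "(\<Sum>k<L. pi * cot (pi * ((v + real k) / real L)) * (1 / real L)) = pi * cot (pi * v)"
    using DERIV_unique lsin_deriv[OF v] by blast
  then show ?thesis using L0 by (simp add: sum_distrib_left[symmetric] sum_divide_distrib[symmetric] field_simps)
qed

lemma peak_values: "sin (pi * (5/6)) = 1/2" "lsin (5/6) = 0" "cot (pi * (5/6)) = - sqrt 3"
proof -
  have e: "pi * (5/6) = pi - pi / 6" by simp
  show s: "sin (pi * (5/6)) = 1/2" unfolding e sin_pi_minus by (rule sin_30)
  have "cos (pi * (5/6)) = - (sqrt 3 / 2)" unfolding e cos_pi_minus cos_30 ..
  then show "cot (pi * (5/6)) = - sqrt 3" unfolding cot_def s by simp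
  show "lsin (5/6) = 0" unfolding lsin_def s by simp
qed

context sl2_mat
begin

text \<open>Where the arguments of the \<open>c\<close> residue classes stand, modulo integers, when \<open>n / M\<close> is at its peak \<open>5/6\<close>.\<close>
definition peak_point :: "int \<Rightarrow> real" where "peak_point w = (5/6 + of_int w) / of_int c"

lemma peak_point_rat: "peak_point w \<in> \<rat>"
  unfolding peak_point_def by (intro Rats_divide Rats_add) auto

text \<open>The points keep distance at least \<open>1 / (6 c)\<close> from the integers; half of it is left after the shift by \<open>u\<close>.\<close>
lemma peak_point_away:
  assumes "\<bar>u\<bar> \<le> 1 / (12 * of_int c)"
  shows "\<bar>sin (pi * (peak_point w + u))\<bar> \<ge> sin (pi * (1 / (12 * of_int c)))"
    "\<bar>sin (pi * (- peak_point w + u))\<bar> \<ge> sin (pi * (1 / (12 * of_int c)))"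
proof -
  have A: "\<bar>sin (pi * (peak_point w + u))\<bar> \<ge> sin (pi * (1 / (12 * of_int c)))" if "\<bar>u\<bar> \<le> 1 / (12 * of_int c)" for u
  proof (rule sin_pi_lower[of _ _ "w div c"])
    define r where "r = w mod c"
    have r: "0 \<le> r" "r \<le> c - 1" using c_pos pos_mod_bound[of c w] by (auto simp: r_def)
    have r': "0 \<le> real_of_int r" "real_of_int r \<le> of_int c - 1" using r by linarith+
    have "of_int w = of_int c * of_int (w div c) + (of_int r :: real)"
      unfolding r_def by (metis mult_div_mod_eq of_int_add of_int_mult)
    then have e: "peak_point w - of_int (w div c) = (5/6 + of_int r) / of_int c"
      using c_real by (simp add: peak_point_def field_simps)
    have "(5/6) / of_int c \<le> peak_point w - of_int (w div c)" "peak_point w - of_int (w div c) \<le> (of_int c - 1/6) / of_int c"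
      unfolding e by (rule divide_right_mono, use r' c_real in linarith, use c_real in linarith)+
    moreover have "(5/6) / of_int c = 10 * (1 / (12 * of_int c :: real))" by simp
    moreover have "(of_int c - 1/6) / of_int c = 1 - 2 * (1 / (12 * of_int c :: real))" using c_real by (simp add: field_simps)
    moreover have "1 / (12 * of_int c) > (0::real)" using c_real by simp
    ultimately show "1 / (12 * of_int c) \<le> peak_point w + u - of_int (w div c)" "peak_point w + u - of_int (w div c) \<le> 1 - 1 / (12 * of_int c)"
      using that by linarith+
    show "0 < 1 / (12 * real_of_int c)" using c_real by simp
  qed
  show "\<bar>sin (pi * (peak_point w + u))\<bar> \<ge> sin (pi * (1 / (12 * of_int c)))" by (rule A[OF assms])
  have "sin (pi * (- peak_point w + u)) = - sin (pi * (peak_point w + - u))"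
    unfolding sin_minus[symmetric] by (simp add: algebra_simps)
  then show "\<bar>sin (pi * (- peak_point w + u))\<bar> \<ge> sin (pi * (1 / (12 * of_int c)))" using A[of "- u"] assms by simp
qed

lemma sin_eta_c: "sin (pi * (1 / (12 * of_int c))) > 0"
  using c_real by (intro sin_pi_eta_pos) (auto simp: field_simps)

lemma peak_point_nz: "sin (pi * peak_point w) \<noteq> 0"
  using peak_point_away(1)[of 0 w] sin_eta_c c_real by auto

lemma lsin_em_taylor_pk:
  obtains C where "C \<ge> 0"
    "\<And>M s w x. M > 0 \<Longrightarrow> \<bar>s\<bar> / M \<le> 1 / (12 * of_int c) \<Longrightarrow> x = peak_point w \<or> x = - peak_point w \<Longrightarrow>
      \<bar>lsin_em M K (x + s / M) - (\<Sum>n\<le>K. (1 / M) ^ n * M * lsinD n x * bern_poly n s)\<bar> \<le> C * (1 / M) ^ K * (1 + \<bar>s\<bar>) ^ Suc K"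
proof -
  obtain B where B: "B \<ge> 0" "\<And>x. \<bar>sin (pi * x)\<bar> \<ge> sin (pi * (1 / (12 * of_int c))) \<Longrightarrow> \<bar>lsinD (Suc K) x\<bar> \<le> B"
    using lsinD_bound[OF sin_eta_c, of "Suc K"] by blast
  define E where "E = (\<Sum>p\<le>K. \<bar>bern_coeff p\<bar>)"
  show ?thesis
  proof (rule that[of "B * E"])
    show "B * E \<ge> 0" using B by (auto simp: E_def intro!: mult_nonneg_nonneg sum_nonneg)
    fix M s x :: real and w
    assume M: "M > 0" and s: "\<bar>s\<bar> / M \<le> 1 / (12 * of_int c)" and x: "x = peak_point w \<or> x = - peak_point w"
    have low: "\<bar>sin (pi * t)\<bar> \<ge> sin (pi * (1 / (12 * of_int c)))" if t: "t \<in> closed_segment x (x + s * (1 / M))" for t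
    proof -
      from t obtain u where u: "0 \<le> u" "u \<le> 1" "t = x + u * (s / M)"
        unfolding closed_segment_def by (auto simp: algebra_simps)
      have "\<bar>u * (s / M)\<bar> \<le> 1 * (\<bar>s\<bar> / M)" unfolding abs_mult abs_divide using u M by (intro mult_mono) auto
      then have "\<bar>u * (s / M)\<bar> \<le> 1 / (12 * of_int c)" using s by simp
      from peak_point_away[OF this, of w] show ?thesis using x u(3) by auto
    qed
    have "\<bar>em_primitive lsinD (1/M) K (x + s * (1/M)) - (\<Sum>n\<le>K. (1/M) ^ n / (1/M) * lsinD n x * bern_poly n s)\<bar>
      \<le> B * (1/M) ^ K * (\<Sum>p\<le>K. \<bar>bern_coeff p\<bar> * \<bar>s\<bar> ^ (Suc K - p) / fact (Suc K - p))"
    proof (rule em_primitive_taylor)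
      show "deriv_chain lsinD (closed_segment x (x + s * (1 / M)))"
        by (rule deriv_chain_subset[OF lsinD_chain]) (use low sin_eta_c in force)
    qed (use M low B in auto)
    also have "\<dots> \<le> B * (1/M) ^ K * (\<Sum>p\<le>K. \<bar>bern_coeff p\<bar> * (1 + \<bar>s\<bar>) ^ Suc K)"
    proof (intro mult_left_mono sum_mono)
      fix p
      have "\<bar>s\<bar> ^ (Suc K - p) \<le> (1 + \<bar>s\<bar>) ^ (Suc K - p)" by (intro power_mono) auto
      also have "\<dots> \<le> (1 + \<bar>s\<bar>) ^ Suc K" by (intro power_increasing) auto
      finally have 1: "\<bar>s\<bar> ^ (Suc K - p) \<le> (1 + \<bar>s\<bar>) ^ Suc K" .
      have "\<bar>bern_coeff p\<bar> * \<bar>s\<bar> ^ (Suc K - p) / fact (Suc K - p) \<le> \<bar>bern_coeff p\<bar> * \<bar>s\<bar> ^ (Suc K - p) / 1"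
        by (intro divide_left_mono) (auto simp: fact_ge_1)
      also have "\<dots> \<le> \<bar>bern_coeff p\<bar> * (1 + \<bar>s\<bar>) ^ Suc K" using 1 by (simp add: mult_left_mono)
      finally show "\<bar>bern_coeff p\<bar> * \<bar>s\<bar> ^ (Suc K - p) / fact (Suc K - p) \<le> \<bar>bern_coeff p\<bar> * (1 + \<bar>s\<bar>) ^ Suc K" .
    qed (use B M in auto)
    finally show "\<bar>lsin_em M K (x + s / M) - (\<Sum>n\<le>K. (1 / M) ^ n * M * lsinD n x * bern_poly n s)\<bar> \<le> B * E * (1 / M) ^ K * (1 + \<bar>s\<bar>) ^ Suc K"
      by (simp add: lsin_em_def E_def sum_distrib_right[symmetric] mult_ac)
  qed
qed

text \<open>The class indices that occur in the windows ending at \<open>n\<close> and at \<open>- n - 1\<close>, if \<open>r\<close> is the residue of \<open>n a - m\<close>.\<close>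
definition class_upper :: "int \<Rightarrow> nat \<Rightarrow> int" where "class_upper r \<rho> = int \<rho> * a - r"
definition class_lower :: "int \<Rightarrow> nat \<Rightarrow> int" where "class_lower r \<rho> = - (int \<rho> + 1) * a - r"

text \<open>Apart from \<open>M\<close> and \<open>K\<close>, the exponent depends on \<open>n\<close> through the distance \<open>t\<close> from the peak and the residue \<open>r\<close> only. This is
  why all peaks \<open>m\<close> receive the same expansion.\<close>
lemma log_amplitude_peak:
  assumes M: "M > 0" and t: "t = of_int n - (of_int m + 5/6) * M" and r: "r = (n * a - m) mod c"
  shows "log_amplitude M K n = (\<Sum>\<rho><nat c. lsin_em M K (peak_point (class_upper r \<rho>) + ((t - real \<rho>) / of_int c) / M)
      - lsin_em M K (- peak_point (class_lower r \<rho>) + (- (t + 1 + real \<rho>) / of_int c) / M))"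
proof -
  define k where "k = (n * a - m) div c"
  have na: "of_int n * of_int a = of_int m + of_int r + of_int c * (of_int k :: real)"
  proof -
    have "n * a = m + r + c * k" using mult_div_mod_eq[of c "n * a - m"] by (simp add: r k_def)
    then show ?thesis by (metis of_int_add of_int_mult)
  qed
  have n: "of_int n = t + (of_int m + 5/6) * M" using t by simp
  have c0: "of_int c \<noteq> (0::real)" "M \<noteq> 0" using c_real M by auto
  have shift: "of_int (n + j) / (of_int c * M) - of_int (n + j) * of_int a / of_int c
     = (5/6 - of_int r - of_int j * of_int a) / of_int c + ((t + of_int j) / of_int c) / M - of_int k" for j
  proof -
    have "of_int (n + j) * of_int a = of_int m + of_int r + of_int c * of_int k + of_int j * (of_int a :: real)"
      using na by (simp add: distrib_right)
    moreover have "of_int (n + j) = t + of_int j + (of_int m + 5/6) * M" using n by simp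
    ultimately show ?thesis using c0 by (simp only:) (simp add: field_simps)
  qed
  have 1: "lsin_em M K (xi M (n - int \<rho>)) = lsin_em M K (peak_point (class_upper r \<rho>) + ((t - real \<rho>) / of_int c) / M)" for \<rho>
  proof -
    have "xi M (n - int \<rho>) = (peak_point (class_upper r \<rho>) + ((t - real \<rho>) / of_int c) / M) + of_int (- k)"
      using shift[of "- int \<rho>"] by (simp add: xi_def peak_point_def class_upper_def algebra_simps)
    then show ?thesis by (simp only: lsin_em_shift_int)
  qed
  have 2: "lsin_em M K (xi M (- n - 1 - int \<rho>)) = lsin_em M K (- peak_point (class_lower r \<rho>) + (- (t + 1 + real \<rho>) / of_int c) / M)" for \<rho>
  proof -
    have "- n - 1 - int \<rho> = - (n + (1 + int \<rho>))" by simp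
    then have "xi M (- n - 1 - int \<rho>) = - xi M (n + (1 + int \<rho>))" by (simp only: xi_minus)
    also have "xi M (n + (1 + int \<rho>)) = peak_point (class_lower r \<rho>) + ((t + (1 + real \<rho>)) / of_int c) / M - of_int k"
      using shift[of "1 + int \<rho>"] by (simp add: xi_def peak_point_def class_lower_def algebra_simps)
    finally have "xi M (- n - 1 - int \<rho>) = (- peak_point (class_lower r \<rho>) + (- (t + 1 + real \<rho>) / of_int c) / M) + of_int k"
    proof -
      have e: "(- (t + 1 + real \<rho>) / of_int c) / M = - (((t + (1 + real \<rho>)) / of_int c) / M)"
        unfolding minus_divide_left by (simp add: add.assoc)
      assume "xi M (- n - 1 - int \<rho>) = - (peak_point (class_lower r \<rho>) + ((t + (1 + real \<rho>)) / of_int c) / M - of_int k)"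
      then show ?thesis unfolding e by linarith
    qed
    then show ?thesis by (simp only: lsin_em_shift_int)
  qed
  show ?thesis unfolding log_amplitude_def em_window_def 1 2 sum_subtractf ..
qed

end

lemma bern_poly_2: "bern_poly 2 s = s\<^sup>2 / 2 + s / 2 + bern_coeff 2"
  by (simp add: bern_poly_def numeral_2_eq_2 bern_coeff_0 bern_coeff_1[simplified])

lemma bern_poly_01: "bern_poly 0 s = 1" "bern_poly 1 s = s + 1 / 2"
  by (simp_all add: bern_poly_def bern_coeff_0 bern_coeff_1[simplified])

context sl2_mat
begin

lemma peak_point_period: "peak_point (k + int (nat c)) = peak_point k + of_int 1"
  using c_real c_pos by (simp add: peak_point_def field_simps)

text \<open>Since \<open>a\<close> is invertible modulo \<open>c\<close>, each window runs through all residue classes.\<close>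
lemma inj_classes: "inj_on (\<lambda>\<rho>. class_upper r \<rho> mod int (nat c)) {..<nat c}" "inj_on (\<lambda>\<rho>. class_lower r \<rho> mod int (nat c)) {..<nat c}"
proof -
  have cop: "coprime c a"
  proof (rule coprimeI)
    fix e assume "e dvd c" "e dvd a"
    then have "e dvd a * d - b * c" by simp
    then show "is_unit e" using det by simp
  qed
  have key: "\<rho> = \<rho>'" if "\<rho> < nat c" "\<rho>' < nat c" "c dvd (int \<rho> - int \<rho>') * a" for \<rho> \<rho>'
  proof -
    have "c dvd int \<rho> - int \<rho>'" using that(3) cop by (simp add: coprime_dvd_mult_left_iff)
    moreover have "\<bar>int \<rho> - int \<rho>'\<bar> < c" using that c_pos by auto
    ultimately have "int \<rho> - int \<rho>' = 0" using dvd_imp_le_int[of "int \<rho> - int \<rho>'" c] by fastforce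
    then show ?thesis by simp
  qed
  show "inj_on (\<lambda>\<rho>. class_upper r \<rho> mod int (nat c)) {..<nat c}"
  proof (rule inj_onI)
    fix x y assume *: "x \<in> {..<nat c}" "y \<in> {..<nat c}" "class_upper r x mod int (nat c) = class_upper r y mod int (nat c)"
    then have "c dvd class_upper r x - class_upper r y" using c_pos by (simp add: mod_eq_dvd_iff)
    then show "x = y" using key[of x y] * by (simp add: class_upper_def algebra_simps)
  qed
  show "inj_on (\<lambda>\<rho>. class_lower r \<rho> mod int (nat c)) {..<nat c}"
  proof (rule inj_onI)
    fix x y assume *: "x \<in> {..<nat c}" "y \<in> {..<nat c}" "class_lower r x mod int (nat c) = class_lower r y mod int (nat c)"
    then have "c dvd class_lower r x - class_lower r y" using c_pos by (simp add: mod_eq_dvd_iff)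
    moreover have "class_lower r x - class_lower r y = (int y - int x) * a" by (simp add: class_lower_def algebra_simps)
    ultimately show "x = y" using key[of y x] * by simp
  qed
qed

text \<open>The class points form a full set of \<open>c\<close>-division points of \<open>5/6\<close>, so the distribution relations apply; they
  give the values at \<open>5/6\<close> in the three lemmas that follow.\<close>
lemma class_sums:
  fixes f :: "real \<Rightarrow> real"
  assumes "\<And>x. f (x + of_int 1) = f x"
  shows "(\<Sum>\<rho><nat c. f (peak_point (class_upper r \<rho>))) = (\<Sum>k<nat c. f ((5/6 + real k) / real (nat c)))"
    "(\<Sum>\<rho><nat c. f (peak_point (class_lower r \<rho>))) = (\<Sum>k<nat c. f ((5/6 + real k) / real (nat c)))"
proof -
  have peak_point: "peak_point (int k) = (5/6 + real k) / real (nat c)" for k using c_pos by (simp add: peak_point_def)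
  show "(\<Sum>\<rho><nat c. f (peak_point (class_upper r \<rho>))) = (\<Sum>k<nat c. f ((5/6 + real k) / real (nat c)))"
    unfolding peak_point[symmetric]
    by (rule sum_residues[where F = "\<lambda>w. f (peak_point w)"]) (use c_pos inj_classes assms in \<open>auto simp only: peak_point_period, auto\<close>)
  show "(\<Sum>\<rho><nat c. f (peak_point (class_lower r \<rho>))) = (\<Sum>k<nat c. f ((5/6 + real k) / real (nat c)))"
    unfolding peak_point[symmetric]
    by (rule sum_residues[where F = "\<lambda>w. f (peak_point w)"]) (use c_pos inj_classes assms in \<open>auto simp only: peak_point_period, auto\<close>)
qed

lemma sum_lob: "(\<Sum>\<rho><nat c. lob (peak_point (class_upper r \<rho>))) = lob (5/6) / of_int c" "(\<Sum>\<rho><nat c. lob (peak_point (class_lower r \<rho>))) = lob (5/6) / of_int c"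
  using lob_distribution[of "nat c" "5/6"] c_pos class_sums[of lob r, OF lob_shift_int] by auto

lemma sum_lsin: "(\<Sum>\<rho><nat c. lsin (peak_point (class_upper r \<rho>))) = 0" "(\<Sum>\<rho><nat c. lsin (peak_point (class_lower r \<rho>))) = 0"
  using lsin_distribution_plus[of "nat c" "5/6"] c_pos class_sums[of lsin r, OF lsin_shift_int] peak_values by auto

lemma sum_cot: "(\<Sum>\<rho><nat c. cot (pi * peak_point (class_upper r \<rho>))) = - sqrt 3 * of_int c" "(\<Sum>\<rho><nat c. cot (pi * peak_point (class_lower r \<rho>))) = - sqrt 3 * of_int c"
  using cot_distribution[of "nat c" "5/6"] c_pos class_sums[of "\<lambda>x. cot (pi * x)" r, OF cot_shift_int] peak_values by auto

text \<open>The coefficient of \<open>(1 / M) ^ n * M\<close> when the exponent is expanded around the peak.\<close>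
definition peak_coeff :: "int \<Rightarrow> nat \<Rightarrow> real \<Rightarrow> real" where
  "peak_coeff r n t = (\<Sum>\<rho><nat c. lsinD n (peak_point (class_upper r \<rho>)) * bern_poly n ((t - real \<rho>) / of_int c)
     - lsinD n (- peak_point (class_lower r \<rho>)) * bern_poly n (- (t + 1 + real \<rho>) / of_int c))"

text \<open>The constant term of the exponent at the peak, a rational combination of logarithms of algebraic numbers.\<close>
definition peak_const :: "int \<Rightarrow> real" where
  "peak_const r = (\<Sum>\<rho><nat c. real (\<rho> + 1) * lsin (peak_point (class_lower r \<rho>)) / real (nat c) - real \<rho> * lsin (peak_point (class_upper r \<rho>)) / real (nat c))"

lemma peak_coeff_0: "peak_coeff r 0 t = 2 * lob (5/6) / of_int c"
  by (simp add: peak_coeff_def bern_poly_01 lob_minus sum.distrib sum_lob)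

text \<open>The linear term in \<open>t\<close> drops out because \<open>2 sin (5 \<pi> / 6) = 1\<close>: the point \<open>5/6\<close> is critical.\<close>
lemma peak_coeff_1: "peak_coeff r 1 t = peak_const r"
proof -
  have "peak_coeff r 1 t = (\<Sum>\<rho><nat c. (real (\<rho> + 1) * lsin (peak_point (class_lower r \<rho>)) / real (nat c) - real \<rho> * lsin (peak_point (class_upper r \<rho>)) / real (nat c))
      + (t / of_int c + 1/2) * lsin (peak_point (class_upper r \<rho>)) + (t / of_int c - 1/2) * lsin (peak_point (class_lower r \<rho>)))"
    unfolding peak_coeff_def
  proof (rule sum.cong)
    fix \<rho>
    have e: "lsinD 1 x = lsin x" for x by simp
    show "lsinD 1 (peak_point (class_upper r \<rho>)) * bern_poly 1 ((t - real \<rho>) / of_int c) - lsinD 1 (- peak_point (class_lower r \<rho>)) * bern_poly 1 (- (t + 1 + real \<rho>) / of_int c)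
      = (real (\<rho> + 1) * lsin (peak_point (class_lower r \<rho>)) / real (nat c) - real \<rho> * lsin (peak_point (class_upper r \<rho>)) / real (nat c))
      + (t / of_int c + 1/2) * lsin (peak_point (class_upper r \<rho>)) + (t / of_int c - 1/2) * lsin (peak_point (class_lower r \<rho>))"
      unfolding e bern_poly_01 lsin_minus using c_pos by (simp add: field_simps)
  qed simp
  then show ?thesis by (simp add: sum.distrib sum_distrib_left[symmetric] sum_lsin peak_const_def)
qed

text \<open>The lower order parts of the quadratic coefficient \<open>peak_coeff r 2 t\<close>.\<close>
definition peak_quad_lin :: "int \<Rightarrow> real" where
  "peak_quad_lin r = (\<Sum>\<rho><nat c. cot (pi * peak_point (class_upper r \<rho>)) * (1 / (2 * of_int c) - real \<rho> / of_int c ^ 2)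
     + cot (pi * peak_point (class_lower r \<rho>)) * (real (\<rho> + 1) / of_int c ^ 2 - 1 / (2 * of_int c)))"

definition peak_quad_const :: "int \<Rightarrow> real" where
  "peak_quad_const r = (\<Sum>\<rho><nat c. cot (pi * peak_point (class_upper r \<rho>)) * (real \<rho> ^ 2 / (2 * of_int c ^ 2) - real \<rho> / (2 * of_int c) + bern_coeff 2)
     + cot (pi * peak_point (class_lower r \<rho>)) * (real (\<rho> + 1) ^ 2 / (2 * of_int c ^ 2) - real (\<rho> + 1) / (2 * of_int c) + bern_coeff 2))"

lemma cot_neg: "cot (- x) = - cot (x::real)" by (simp add: cot_def)

text \<open>The leading part is the second derivative of \<open>lob\<close> at the peak, \<open>\<pi> cot (5 \<pi> / 6) = - \<pi> sqrt 3\<close>, which sets the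
  width of the Gaussian.\<close>
lemma peak_coeff_2: "peak_coeff r 2 t = - (sqrt 3 * pi / of_int c) * t\<^sup>2 + pi * (peak_quad_lin r * t + peak_quad_const r)"
proof -
  have D2: "lsinD 2 x = pi * cot (pi * x)" for x by (simp add: numeral_2_eq_2)
  have "peak_coeff r 2 t = (\<Sum>\<rho><nat c. pi * t\<^sup>2 / (2 * of_int c ^ 2) * cot (pi * peak_point (class_upper r \<rho>)) + pi * t\<^sup>2 / (2 * of_int c ^ 2) * cot (pi * peak_point (class_lower r \<rho>))
     + pi * t * (cot (pi * peak_point (class_upper r \<rho>)) * (1 / (2 * of_int c) - real \<rho> / of_int c ^ 2)
        + cot (pi * peak_point (class_lower r \<rho>)) * (real (\<rho> + 1) / of_int c ^ 2 - 1 / (2 * of_int c)))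
     + pi * (cot (pi * peak_point (class_upper r \<rho>)) * (real \<rho> ^ 2 / (2 * of_int c ^ 2) - real \<rho> / (2 * of_int c) + bern_coeff 2)
        + cot (pi * peak_point (class_lower r \<rho>)) * (real (\<rho> + 1) ^ 2 / (2 * of_int c ^ 2) - real (\<rho> + 1) / (2 * of_int c) + bern_coeff 2)))"
    unfolding peak_coeff_def
  proof (rule sum.cong)
    fix \<rho> :: nat
    define u where "u = cot (pi * peak_point (class_upper r \<rho>))"
    define v where "v = cot (pi * peak_point (class_lower r \<rho>))"
    define g where "g = real_of_int c"
    define y where "y = real \<rho>"
    have g: "g \<noteq> 0" using c_real by (simp add: g_def)
    have "pi * u * (((t - y) / g)\<^sup>2 / 2 + ((t - y) / g) / 2 + bern_coeff 2) + pi * v * ((- (t + 1 + y) / g)\<^sup>2 / 2 + (- (t + 1 + y) / g) / 2 + bern_coeff 2)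
       = pi * t\<^sup>2 / (2 * g ^ 2) * u + pi * t\<^sup>2 / (2 * g ^ 2) * v
     + pi * t * (u * (1 / (2 * g) - y / g ^ 2) + v * ((y + 1) / g ^ 2 - 1 / (2 * g)))
     + pi * (u * (y ^ 2 / (2 * g ^ 2) - y / (2 * g) + bern_coeff 2) + v * ((y + 1) ^ 2 / (2 * g ^ 2) - (y + 1) / (2 * g) + bern_coeff 2))"
      using g by (simp add: divide_simps) (simp add: algebra_simps power2_eq_square)
    note main = this
    have cn: "cot (pi * - peak_point (class_lower r \<rho>)) = - v" using cot_neg[of "pi * peak_point (class_lower r \<rho>)"] by (simp add: v_def)
    have y1: "real (\<rho> + 1) = y + 1" by (simp add: y_def)
    show "lsinD 2 (peak_point (class_upper r \<rho>)) * bern_poly 2 ((t - real \<rho>) / of_int c) - lsinD 2 (- peak_point (class_lower r \<rho>)) * bern_poly 2 (- (t + 1 + real \<rho>) / of_int c)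
      = pi * t\<^sup>2 / (2 * of_int c ^ 2) * cot (pi * peak_point (class_upper r \<rho>)) + pi * t\<^sup>2 / (2 * of_int c ^ 2) * cot (pi * peak_point (class_lower r \<rho>))
     + pi * t * (cot (pi * peak_point (class_upper r \<rho>)) * (1 / (2 * of_int c) - real \<rho> / of_int c ^ 2)
        + cot (pi * peak_point (class_lower r \<rho>)) * (real (\<rho> + 1) / of_int c ^ 2 - 1 / (2 * of_int c)))
     + pi * (cot (pi * peak_point (class_upper r \<rho>)) * (real \<rho> ^ 2 / (2 * of_int c ^ 2) - real \<rho> / (2 * of_int c) + bern_coeff 2)
        + cot (pi * peak_point (class_lower r \<rho>)) * (real (\<rho> + 1) ^ 2 / (2 * of_int c ^ 2) - real (\<rho> + 1) / (2 * of_int c) + bern_coeff 2))"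
      unfolding D2 bern_poly_2 cn y1 u_def[symmetric] v_def[symmetric] g_def[symmetric] y_def[symmetric]
      using main by linarith
  qed simp
  also have "\<dots> = pi * t\<^sup>2 / (2 * of_int c ^ 2) * (- sqrt 3 * of_int c) + pi * t\<^sup>2 / (2 * of_int c ^ 2) * (- sqrt 3 * of_int c)
     + pi * t * peak_quad_lin r + pi * peak_quad_const r"
    unfolding sum.distrib sum_distrib_left[symmetric] sum_cot peak_quad_lin_def peak_quad_const_def by simp
  also have "\<dots> = - (sqrt 3 * pi / of_int c) * t\<^sup>2 + pi * (peak_quad_lin r * t + peak_quad_const r)"
    using c_real by (simp add: field_simps power2_eq_square)
  finally show ?thesis .
qed

text \<open>The derivatives of \<open>lsin\<close> without their powers of \<open>\<pi>\<close>. These powers are exactly what turns \<open>1 / M\<close> into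
  \<open>z = \<pi> / M\<close> and leaves algebraic coefficients.\<close>
definition lsin_alg_deriv :: "nat \<Rightarrow> real \<Rightarrow> real" where "lsin_alg_deriv n x = poly (cotp (n - 2)) (cot (pi * x))"

definition peak_remainder :: "nat \<Rightarrow> int \<Rightarrow> real \<Rightarrow> real \<Rightarrow> real" where
  "peak_remainder K r z t = z * (peak_quad_lin r * t + peak_quad_const r) + (\<Sum>n=3..K. z ^ (n - 1) * (\<Sum>\<rho><nat c.
     lsin_alg_deriv n (peak_point (class_upper r \<rho>)) * bern_poly n ((t - real \<rho>) / of_int c) - lsin_alg_deriv n (- peak_point (class_lower r \<rho>)) * bern_poly n (- (t + 1 + real \<rho>) / of_int c)))"

lemma peak_coeff_high: "n \<ge> 2 \<Longrightarrow> peak_coeff r n t = pi ^ (n - 1) * (\<Sum>\<rho><nat c.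
     lsin_alg_deriv n (peak_point (class_upper r \<rho>)) * bern_poly n ((t - real \<rho>) / of_int c) - lsin_alg_deriv n (- peak_point (class_lower r \<rho>)) * bern_poly n (- (t + 1 + real \<rho>) / of_int c))"
proof -
  assume "n \<ge> 2"
  then obtain k where k: "n = Suc (Suc k)" by (metis add_2_eq_Suc le_Suc_ex)
  have "lsinD n x = pi ^ (n - 1) * lsin_alg_deriv n x" for x by (simp add: k lsin_alg_deriv_def)
  then show ?thesis by (simp add: peak_coeff_def sum_distrib_left right_diff_distrib mult.assoc)
qed

lemma sum_Sn:
  assumes K: "K \<ge> 2" and M: "M > 0"
  shows "(\<Sum>n\<le>K. (1 / M) ^ n * M * peak_coeff r n t) = 2 * M * lob (5/6) / of_int c + peak_const r - (sqrt 3 * pi / of_int c / M) * t\<^sup>2 + peak_remainder K r (pi / M) t"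
proof -
  have "{..K} = {0, 1, 2} \<union> {3..K}" using K by auto
  then have "(\<Sum>n\<le>K. (1 / M) ^ n * M * peak_coeff r n t) = (\<Sum>n\<in>{0, 1, 2}. (1 / M) ^ n * M * peak_coeff r n t) + (\<Sum>n=3..K. (1 / M) ^ n * M * peak_coeff r n t)"
    by (simp only:) (rule sum.union_disjoint, auto)
  moreover have "(\<Sum>n\<in>{0, 1, 2}. (1 / M) ^ n * M * peak_coeff r n t) = M * peak_coeff r 0 t + peak_coeff r 1 t + peak_coeff r 2 t / M"
    using M by (simp add: power2_eq_square)
  moreover have "(\<Sum>n=3..K. (1 / M) ^ n * M * peak_coeff r n t) = (\<Sum>n=3..K. (pi / M) ^ (n - 1) * (\<Sum>\<rho><nat c.
     lsin_alg_deriv n (peak_point (class_upper r \<rho>)) * bern_poly n ((t - real \<rho>) / of_int c) - lsin_alg_deriv n (- peak_point (class_lower r \<rho>)) * bern_poly n (- (t + 1 + real \<rho>) / of_int c)))"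
  proof (rule sum.cong)
    fix n assume n: "n \<in> {3..K}"
    then obtain k where k: "n = Suc k" by (cases n) auto
    have "(1 / M) ^ n * M * pi ^ (n - 1) = (pi / M) ^ (n - 1)" using M by (simp add: k power_divide)
    then show "(1 / M) ^ n * M * peak_coeff r n t = (pi / M) ^ (n - 1) * (\<Sum>\<rho><nat c.
     lsin_alg_deriv n (peak_point (class_upper r \<rho>)) * bern_poly n ((t - real \<rho>) / of_int c) - lsin_alg_deriv n (- peak_point (class_lower r \<rho>)) * bern_poly n (- (t + 1 + real \<rho>) / of_int c))"
      using peak_coeff_high[of n r t] n by (simp add: mult.assoc[symmetric])
  qed simp
  moreover have "M * peak_coeff r 0 t = 2 * M * lob (5/6) / of_int c" by (simp add: peak_coeff_0)
  moreover have "peak_coeff r 2 t / M = - (sqrt 3 * pi / of_int c / M) * t\<^sup>2 + pi / M * (peak_quad_lin r * t + peak_quad_const r)"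
    unfolding peak_coeff_2 by (simp add: add_divide_distrib diff_divide_distrib)
  ultimately show ?thesis unfolding peak_remainder_def using peak_coeff_1[of r t] by linarith
qed

lemma algebraic_c: "algebraic (real_of_int c)" by (rule rat_imp_algebraic) simp

text \<open>The part of order \<open>n\<close> is \<open>z ^ (n - 1)\<close> times a polynomial of degree at most \<open>n\<close> in \<open>t\<close>, and
  \<open>3 n + 1 \<le> 5 (n - 1)\<close> for \<open>n \<ge> 3\<close>.\<close>
lemma weighted_peak_remainder: "weighted 1 (peak_remainder K r)"
proof -
  have alg: "algebraic (peak_quad_lin r)" "algebraic (peak_quad_const r)"
    unfolding peak_quad_lin_def peak_quad_const_def
    by (intro algebraic_sum algebraic_add algebraic_diff algebraic_mult algebraic_divide algebraic_power algebraic_cot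
         peak_point_rat algebraic_c algebraic_emc algebraic_of_nat algebraic_numeral algebraic_1)+
  have "weighted 1 (\<lambda>z t. z ^ 1 * poly [:peak_quad_const r, peak_quad_lin r:] t)"
    by (rule weighted_poly) (use alg in \<open>auto simp: coeff_pCons split: nat.splits\<close>)
  then have 1: "weighted 1 (\<lambda>z t. z * (peak_quad_lin r * t + peak_quad_const r))" by (simp add: algebra_simps)
  have "weighted 1 (\<lambda>z t. \<Sum>n=3..K. z ^ (n - 1) * poly (\<Sum>\<rho><nat c.
     smult (lsin_alg_deriv n (peak_point (class_upper r \<rho>))) (bern_polynomial n (- real \<rho> / of_int c) (1 / of_int c))
     - smult (lsin_alg_deriv n (- peak_point (class_lower r \<rho>))) (bern_polynomial n (- (1 + real \<rho>) / of_int c) (- 1 / of_int c))) t)"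
  proof (intro weighted_sum weighted_poly)
    fix n assume n: "n \<in> {3..K}"
    have lsin_alg_deriv_alg: "algebraic (lsin_alg_deriv n x)" if "x \<in> \<rat>" for x
      unfolding lsin_alg_deriv_def by (intro algebraic_poly algebraic_coeff_cotp algebraic_cot that)
    have r: "- peak_point w \<in> \<rat>" for w using peak_point_rat by simp
    show "algebraic (coeff (\<Sum>\<rho><nat c. smult (lsin_alg_deriv n (peak_point (class_upper r \<rho>))) (bern_polynomial n (- real \<rho> / of_int c) (1 / of_int c))
     - smult (lsin_alg_deriv n (- peak_point (class_lower r \<rho>))) (bern_polynomial n (- (1 + real \<rho>) / of_int c) (- 1 / of_int c))) i)" for i
      unfolding coeff_sum coeff_diff coeff_smult
      by (intro algebraic_sum algebraic_diff algebraic_mult lsin_alg_deriv_alg peak_point_rat r algebraic_coeff_embp algebraic_divide algebraic_c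
          algebraic_minus algebraic_add algebraic_of_nat algebraic_1)
    have "degree (\<Sum>\<rho><nat c. smult (lsin_alg_deriv n (peak_point (class_upper r \<rho>))) (bern_polynomial n (- real \<rho> / of_int c) (1 / of_int c))
     - smult (lsin_alg_deriv n (- peak_point (class_lower r \<rho>))) (bern_polynomial n (- (1 + real \<rho>) / of_int c) (- 1 / of_int c))) \<le> n"
      by (intro degree_sum_le degree_diff_le order.trans[OF degree_smult_le degree_embp]) auto
    then show "3 * degree (\<Sum>\<rho><nat c. smult (lsin_alg_deriv n (peak_point (class_upper r \<rho>))) (bern_polynomial n (- real \<rho> / of_int c) (1 / of_int c))
     - smult (lsin_alg_deriv n (- peak_point (class_lower r \<rho>))) (bern_polynomial n (- (1 + real \<rho>) / of_int c) (- 1 / of_int c))) + 1 \<le> 5 * (n - 1)"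
      using n by simp linarith
  qed
  then have 2: "weighted 1 (\<lambda>z t. \<Sum>n=3..K. z ^ (n - 1) * (\<Sum>\<rho><nat c.
     lsin_alg_deriv n (peak_point (class_upper r \<rho>)) * bern_poly n ((t - real \<rho>) / of_int c) - lsin_alg_deriv n (- peak_point (class_lower r \<rho>)) * bern_poly n (- (t + 1 + real \<rho>) / of_int c)))"
  proof (rule back_subst[of "weighted 1"])
    have "- real \<rho> / of_int c + t * (1 / of_int c) = (t - real \<rho>) / real_of_int c"
      "- (1 + real \<rho>) / of_int c + t * (- 1 / of_int c) = - (t + 1 + real \<rho>) / real_of_int c" for t \<rho>
      by (simp_all add: diff_divide_distrib add_divide_distrib)
    then show "(\<lambda>z t. \<Sum>n=3..K. z ^ (n - 1) * poly (\<Sum>\<rho><nat c.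
     smult (lsin_alg_deriv n (peak_point (class_upper r \<rho>))) (bern_polynomial n (- real \<rho> / of_int c) (1 / of_int c))
     - smult (lsin_alg_deriv n (- peak_point (class_lower r \<rho>))) (bern_polynomial n (- (1 + real \<rho>) / of_int c) (- 1 / of_int c))) t)
      = (\<lambda>z t. \<Sum>n=3..K. z ^ (n - 1) * (\<Sum>\<rho><nat c.
     lsin_alg_deriv n (peak_point (class_upper r \<rho>)) * bern_poly n ((t - real \<rho>) / of_int c) - lsin_alg_deriv n (- peak_point (class_lower r \<rho>)) * bern_poly n (- (t + 1 + real \<rho>) / of_int c)))"
      by (simp only: poly_sum poly_diff poly_smult poly_embp)
  qed
  show ?thesis unfolding peak_remainder_def[abs_def] by (rule weighted_plus[OF 2 1])
qed

lemma algebraic_exp_bc: "algebraic (exp (peak_const r))"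
proof -
  have n: "nat c > 0" using c_pos by simp
  have "exp (peak_const r) = (\<Prod>\<rho><nat c. exp (real (\<rho> + 1) * lsin (peak_point (class_lower r \<rho>)) / real (nat c)) * exp (- (real \<rho> * lsin (peak_point (class_upper r \<rho>)) / real (nat c))))"
    unfolding peak_const_def by (simp add: exp_sum exp_diff exp_minus divide_inverse)
  also have "algebraic \<dots>"
    by (intro algebraic_prod algebraic_mult algebraic_exp_lsin peak_point_rat peak_point_nz n)
  finally show ?thesis .
qed

end

lemma abs_exp_minus_one_le: "\<bar>exp x - 1\<bar> \<le> \<bar>x\<bar> * exp \<bar>x::real\<bar>"
proof -
  obtain s where s: "\<bar>s\<bar> \<le> \<bar>x\<bar>" "exp x = (\<Sum>m<1. x ^ m / fact m) + exp s / fact 1 * x ^ 1"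
    using Maclaurin_exp_le by blast
  have "exp s \<le> exp \<bar>x\<bar>" using s(1) by simp
  then have "exp s * \<bar>x\<bar> \<le> exp \<bar>x\<bar> * \<bar>x\<bar>" by (intro mult_right_mono) auto
  then show ?thesis using s(2) by (simp add: abs_mult mult.commute)
qed

lemma abs_sum_diff_le:
  fixes f g h :: "'b \<Rightarrow> real"
  assumes "\<And>i. i \<in> I \<Longrightarrow> \<bar>f i - g i\<bar> \<le> h i"
  shows "\<bar>sum f I - sum g I\<bar> \<le> sum h I"
  unfolding sum_subtractf[symmetric] by (rule order.trans[OF sum_abs], rule sum_mono, rule assms)

lemma powr_small:
  assumes "M \<ge> 1" "e \<le> - real Q"
  shows "M powr e \<le> (1 / M) ^ Q"
proof -
  have "M powr e \<le> M powr (- real Q)" using assms by (intro powr_mono) auto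
  also have "\<dots> = (1 / M) ^ Q" using assms by (simp add: powr_minus powr_realpow power_divide inverse_eq_divide)
  finally show ?thesis .
qed

context sl2_mat
begin

definition ratio_gauss :: "real \<Rightarrow> real" where "ratio_gauss M = sqrt 3 * pi / of_int c / M"

text \<open>The Taylor remainder is of size \<open>M powr (- K + 3/5 (K + 1))\<close> within the window, and \<open>K = 3 Q + 2\<close> makes the
  exponent at most \<open>- Q\<close>.\<close>
lemma log_amplitude_expansion:
  assumes K: "K = 3 * Q + 2"
  obtains C M0 where "C \<ge> 0" "M0 \<ge> 1"
    "\<And>M n m t r. M \<ge> M0 \<Longrightarrow> t = of_int n - (of_int m + 5/6) * M \<Longrightarrow> r = (n * a - m) mod c \<Longrightarrow> \<bar>t\<bar> \<le> M powr (3/5) \<Longrightarrow>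
      \<bar>log_amplitude M K n - (2 * M * lob (5/6) / of_int c + peak_const r - ratio_gauss M * t\<^sup>2 + peak_remainder K r (pi / M) t)\<bar> \<le> C * (1 / M) ^ Q"
proof -
  show ?thesis
  proof (rule lsin_em_taylor_pk[of K], goal_cases)
  case (1 C)
  define C' where "C' = of_nat (nat c) * (2 * C * 3 ^ Suc K)"
  show ?case
  proof (rule that[of C' "max 1 ((24 * of_int c) powr (5/2))"])
    show "C' \<ge> 0" using 1 by (simp add: C'_def)
    show "max 1 ((24 * of_int c) powr (5/2)) \<ge> (1::real)" by simp
    fix M t :: real and n m r :: int
    assume MM: "M \<ge> max 1 ((24 * of_int c) powr (5/2))" and t: "t = of_int n - (of_int m + 5/6) * M"
      and r: "r = (n * a - m) mod c" and tT: "\<bar>t\<bar> \<le> M powr (3/5)"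
    have M: "M \<ge> 1" "M \<ge> (24 * of_int c) powr (5/2)" using MM by auto
    have M0: "M > 0" using M by simp
    define T where "T = M powr (3/5)"
    have T1: "T \<ge> 1" unfolding T_def using M by (simp add: ge_one_powr_ge_zero)
    have TM: "2 * T / M \<le> 1 / (12 * of_int c)"
    proof -
      have "((24 * of_int c) powr (5/2)) powr (2/5) \<le> M powr (2/5)" using M c_real by (intro powr_mono2) auto
      then have "24 * of_int c \<le> M powr (2/5)" unfolding powr_powr using c_real by simp
      moreover have "T * M powr (2/5) = M" unfolding T_def using M0 by (simp add: powr_add[symmetric])
      ultimately have "T * (24 * of_int c) \<le> M" using T1 by (metis mult_left_mono order.trans zero_le_one)
      then show ?thesis using M0 c_real by (simp add: field_simps)
    qed
    define bd where "bd = C * (1 / M) ^ K * (3 * T) ^ Suc K"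
    have pt: "\<bar>lsin_em M K (x + s / M) - (\<Sum>n\<le>K. (1 / M) ^ n * M * lsinD n x * bern_poly n s)\<bar> \<le> bd"
      if "x = peak_point w \<or> x = - peak_point w" "\<bar>s\<bar> \<le> T + 1" for x s w
    proof -
      have s: "\<bar>s\<bar> \<le> 2 * T" "1 + \<bar>s\<bar> \<le> 3 * T" using that T1 by auto
      have "\<bar>s\<bar> / M \<le> 2 * T / M" using s M0 by (intro divide_right_mono) auto
      then have "\<bar>s\<bar> / M \<le> 1 / (12 * of_int c)" using TM by linarith
      from 1(2)[OF M0 this that(1)]
      have "\<bar>lsin_em M K (x + s / M) - (\<Sum>n\<le>K. (1 / M) ^ n * M * lsinD n x * bern_poly n s)\<bar> \<le> C * (1 / M) ^ K * (1 + \<bar>s\<bar>) ^ Suc K" .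
      also have "\<dots> \<le> bd" unfolding bd_def using s 1(1) M0 by (intro mult_left_mono power_mono) auto
      finally show ?thesis .
    qed
    have sb: "\<bar>(t - real \<rho>) / of_int c\<bar> \<le> T + 1" "\<bar>- (t + 1 + real \<rho>) / of_int c\<bar> \<le> T + 1" if "\<rho> < nat c" for \<rho>
    proof -
      have rho: "real \<rho> + 1 \<le> of_int c" using that by linarith
      have "\<bar>t - real \<rho>\<bar> \<le> T * of_int c + of_int c" "\<bar>t + 1 + real \<rho>\<bar> \<le> T * of_int c + of_int c"
      proof -
        have "T * 1 \<le> T * of_int c" using T1 c_real by (intro mult_left_mono) auto
        then show "\<bar>t - real \<rho>\<bar> \<le> T * of_int c + of_int c" "\<bar>t + 1 + real \<rho>\<bar> \<le> T * of_int c + of_int c"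
          using rho tT unfolding T_def[symmetric] by linarith+
      qed
      then show "\<bar>(t - real \<rho>) / of_int c\<bar> \<le> T + 1" "\<bar>- (t + 1 + real \<rho>) / of_int c\<bar> \<le> T + 1"
        using c_real by (simp_all add: abs_divide pos_divide_le_eq distrib_right abs_minus_commute)
    qed
    have swap: "(\<Sum>n\<le>K. (1 / M) ^ n * M * peak_coeff r n t) = (\<Sum>\<rho><nat c.
        (\<Sum>n\<le>K. (1 / M) ^ n * M * lsinD n (peak_point (class_upper r \<rho>)) * bern_poly n ((t - real \<rho>) / of_int c))
      - (\<Sum>n\<le>K. (1 / M) ^ n * M * lsinD n (- peak_point (class_lower r \<rho>)) * bern_poly n (- (t + 1 + real \<rho>) / of_int c)))"
    proof -
      have "(\<Sum>n\<le>K. (1 / M) ^ n * M * peak_coeff r n t) = (\<Sum>n\<le>K. \<Sum>\<rho><nat c.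
          (1 / M) ^ n * M * lsinD n (peak_point (class_upper r \<rho>)) * bern_poly n ((t - real \<rho>) / of_int c)
        - (1 / M) ^ n * M * lsinD n (- peak_point (class_lower r \<rho>)) * bern_poly n (- (t + 1 + real \<rho>) / of_int c))"
        unfolding peak_coeff_def sum_distrib_left right_diff_distrib mult.assoc ..
      also have "\<dots> = (\<Sum>\<rho><nat c. \<Sum>n\<le>K.
          (1 / M) ^ n * M * lsinD n (peak_point (class_upper r \<rho>)) * bern_poly n ((t - real \<rho>) / of_int c)
        - (1 / M) ^ n * M * lsinD n (- peak_point (class_lower r \<rho>)) * bern_poly n (- (t + 1 + real \<rho>) / of_int c))"
        by (rule sum.swap)
      finally show ?thesis unfolding sum_subtractf .
    qed
    have "\<bar>log_amplitude M K n - (\<Sum>n\<le>K. (1 / M) ^ n * M * peak_coeff r n t)\<bar> \<le> (\<Sum>\<rho><nat c. 2 * bd)"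
      unfolding log_amplitude_peak[OF M0 t r] swap
    proof (rule abs_sum_diff_le)
      fix \<rho> assume "\<rho> \<in> {..<nat c}"
      then have \<rho>: "\<rho> < nat c" by simp
      have x1: "peak_point (class_upper r \<rho>) = peak_point (class_upper r \<rho>) \<or> peak_point (class_upper r \<rho>) = - peak_point (class_upper r \<rho>)"
        and x2: "- peak_point (class_lower r \<rho>) = peak_point (class_lower r \<rho>) \<or> - peak_point (class_lower r \<rho>) = - peak_point (class_lower r \<rho>)" by auto
      have ar: "\<bar>x - y\<bar> \<le> q \<Longrightarrow> \<bar>x' - y'\<bar> \<le> q \<Longrightarrow> \<bar>x - x' - (y - y')\<bar> \<le> 2 * q" for x y x' y' q :: real by linarith
      show "\<bar>lsin_em M K (peak_point (class_upper r \<rho>) + ((t - real \<rho>) / of_int c) / M) - lsin_em M K (- peak_point (class_lower r \<rho>) + (- (t + 1 + real \<rho>) / of_int c) / M)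
        - ((\<Sum>n\<le>K. (1 / M) ^ n * M * lsinD n (peak_point (class_upper r \<rho>)) * bern_poly n ((t - real \<rho>) / of_int c))
      - (\<Sum>n\<le>K. (1 / M) ^ n * M * lsinD n (- peak_point (class_lower r \<rho>)) * bern_poly n (- (t + 1 + real \<rho>) / of_int c)))\<bar> \<le> 2 * bd"
        by (rule ar[OF pt[OF x1 sb(1)[OF \<rho>]] pt[OF x2 sb(2)[OF \<rho>]]])
    qed
    also have "(\<Sum>\<rho><nat c. 2 * bd) = C' * (M powr (- real K) * M powr (3/5 * real (Suc K)))"
    proof -
      have "(1 / M) ^ K = M powr (- real K)" using M0 by (simp add: powr_minus powr_realpow power_divide inverse_eq_divide)
      moreover have "T ^ Suc K = M powr (3/5 * real (Suc K))"
        unfolding T_def using M0 powr_power[of M "3/5" "Suc K"] by (simp add: mult.commute)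
      ultimately show ?thesis unfolding bd_def C'_def power_mult_distrib by simp
    qed
    also have "M powr (- real K) * M powr (3/5 * real (Suc K)) = M powr (- real K + 3/5 * real (Suc K))"
      by (simp only: powr_add)
    also have "C' * \<dots> \<le> C' * (1 / M) ^ Q"
    proof (intro mult_left_mono powr_small)
      have "real K = 3 * real Q + 2" by (simp add: K)
      then show "- real K + 3/5 * real (Suc K) \<le> - real Q" by (simp add: field_simps)
    qed (use 1(1) M in \<open>auto simp: C'_def\<close>)
    finally show "\<bar>log_amplitude M K n - (2 * M * lob (5/6) / of_int c + peak_const r - ratio_gauss M * t\<^sup>2 + peak_remainder K r (pi / M) t)\<bar> \<le> C' * (1 / M) ^ Q"
      using sum_Sn[of K M r t] M0 K by (simp add: ratio_gauss_def)
  qed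
  qed
qed

text \<open>The window \<open>M powr (3/5)\<close> is wider than the Gaussian scale \<open>sqrt M\<close>, so that the rest is negligible,
  and narrower than \<open>M powr (2/3)\<close>, so that the cubic term of the exponent tends to 0 on it.\<close>
definition peak_sum :: "nat \<Rightarrow> real \<Rightarrow> int \<Rightarrow> real" where
  "peak_sum K M m = (\<Sum>n\<in>{n. \<bar>of_int n - (of_int m + 5/6) * M\<bar> \<le> M powr (3/5)}. exp (log_amplitude M K n - 2 * M * lob (5/6) / of_int c))"

text \<open>The exponential of the remainder polynomial is cut off after \<open>5 Q\<close> terms, because that polynomial is
  \<open>O(M powr (- 1/5))\<close> on the window.\<close>
lemma near_expansion:
  assumes K: "K = 3 * Q + 2"
  shows "\<exists>F. weighted 0 F \<and> (\<exists>C\<ge>0. \<exists>M0\<ge>1. \<forall>M\<ge>M0. \<forall>n m t. t = of_int n - (of_int m + 5/6) * M \<longrightarrow> r = (n * a - m) mod c \<longrightarrow> \<bar>t\<bar> \<le> M powr (3/5) \<longrightarrow>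
      \<bar>exp (log_amplitude M K n - 2 * M * lob (5/6) / of_int c) - F (pi / M) t * exp (- ratio_gauss M * t\<^sup>2)\<bar> \<le> C * (1 / M) ^ Q)"
proof (rule log_amplitude_expansion[OF K], goal_cases)
  case (1 Ce M0)
  obtain CR where CR: "CR \<ge> 0" "\<And>M t. M \<ge> 1 \<Longrightarrow> \<bar>t\<bar> \<le> M powr (3/5) \<Longrightarrow> \<bar>peak_remainder K r (pi / M) t\<bar> \<le> CR * M powr (- real 1 / 5)"
    using weighted_bound[OF weighted_peak_remainder[of K r]] by blast
  define N where "N = 5 * Q"
  define G where "G z t = (\<Sum>k<N. 1 / fact k * peak_remainder K r z t ^ k)" for z t
  have wpG: "weighted 0 (\<lambda>z t. exp (peak_const r) * G z t)"
    unfolding G_def by (intro weighted_scale weighted_sum weighted_power[OF weighted_peak_remainder] algebraic_exp_bc algebraic_divide algebraic_fact algebraic_1)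
  define C where "C = exp (peak_const r) * (exp CR * (Ce * exp Ce) + exp CR * CR ^ N)"
  have key: "\<bar>exp (log_amplitude M K n - 2 * M * lob (5/6) / of_int c) - exp (peak_const r) * G (pi / M) t * exp (- ratio_gauss M * t\<^sup>2)\<bar> \<le> C * (1 / M) ^ Q"
    if M: "M \<ge> M0" and t: "t = of_int n - (of_int m + 5/6) * M" "r = (n * a - m) mod c" "\<bar>t\<bar> \<le> M powr (3/5)" for M n m t
  proof -
    have M1: "M \<ge> 1" using M 1 by simp
    define R where "R = peak_remainder K r (pi / M) t"
    define e where "e = log_amplitude M K n - (2 * M * lob (5/6) / of_int c + peak_const r - ratio_gauss M * t\<^sup>2 + R)"
    have e: "\<bar>e\<bar> \<le> Ce * (1 / M) ^ Q" unfolding e_def R_def by (rule 1(3)[OF M t])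
    have pw: "(1 / M) ^ Q \<le> 1" using M1 by (intro power_le_one) auto
    have e1: "\<bar>e\<bar> \<le> Ce" using e mult_left_mono[OF pw 1(1)] by simp
    have R: "\<bar>R\<bar> \<le> CR * M powr (- 1 / 5)" using CR(2)[OF M1 t(3)] by (simp add: R_def)
    have "M powr (- 1 / 5) \<le> M powr 0" using M1 by (intro powr_mono) auto
    then have "CR * M powr (- 1 / 5) \<le> CR * 1" using CR(1) M1 by (intro mult_left_mono) auto
    then have R1: "\<bar>R\<bar> \<le> CR" using R by simp
    have d1: "\<bar>exp (R + e) - exp R\<bar> \<le> exp CR * (Ce * exp Ce) * (1 / M) ^ Q"
    proof -
      have "\<bar>exp (R + e) - exp R\<bar> = exp R * \<bar>exp e - 1\<bar>"
      proof -
        have "exp (R + e) - exp R = exp R * (exp e - 1)" by (simp add: exp_add right_diff_distrib)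
        then show ?thesis by (simp add: abs_mult)
      qed
      also have "\<dots> \<le> exp CR * (\<bar>e\<bar> * exp \<bar>e\<bar>)"
        using R1 by (intro mult_mono abs_exp_minus_one_le) auto
      also have "\<bar>e\<bar> * exp \<bar>e\<bar> \<le> (Ce * (1 / M) ^ Q) * exp Ce" using e e1 by (intro mult_mono) auto
      finally show ?thesis by (simp add: mult_ac)
    qed
    have d2: "\<bar>exp R - G (pi / M) t\<bar> \<le> exp CR * CR ^ N * (1 / M) ^ Q"
    proof -
      obtain s where s: "\<bar>s\<bar> \<le> \<bar>R\<bar>" "exp R = (\<Sum>m<N. R ^ m / fact m) + exp s / fact N * R ^ N"
        using Maclaurin_exp_le by blast
      have "G (pi / M) t = (\<Sum>m<N. R ^ m / fact m)" by (simp add: G_def R_def)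
      then have "\<bar>exp R - G (pi / M) t\<bar> = exp s / fact N * \<bar>R\<bar> ^ N" using s(2) by (simp add: abs_mult power_abs)
      also have "\<dots> \<le> exp CR / 1 * (CR * M powr (- 1 / 5)) ^ N"
        using s(1) R R1 CR(1) by (intro mult_mono power_mono frac_le) (auto simp: fact_ge_1)
      also have "(CR * M powr (- 1 / 5)) ^ N = CR ^ N * M powr (- real Q)"
        using M1 powr_power[of M "- 1 / 5" N] by (simp add: power_mult_distrib N_def)
      also have "M powr (- real Q) = (1 / M) ^ Q"
        using M1 by (simp add: powr_minus powr_realpow power_divide inverse_eq_divide)
      finally show ?thesis by simp
    qed
    define g where "g = exp (- ratio_gauss M * t\<^sup>2)"
    have g1: "0 \<le> g" "g \<le> 1" using M1 c_real by (auto simp: g_def ratio_gauss_def)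
    have "log_amplitude M K n - 2 * M * lob (5/6) / of_int c = peak_const r + (- ratio_gauss M * t\<^sup>2) + (R + e)" by (simp add: e_def)
    then have ex: "exp (log_amplitude M K n - 2 * M * lob (5/6) / of_int c) = exp (peak_const r) * g * exp (R + e)"
      by (simp only: exp_add g_def)
    have "exp (peak_const r) * g * exp (R + e) - exp (peak_const r) * G (pi / M) t * g = exp (peak_const r) * (g * (exp (R + e) - G (pi / M) t))"
      by (simp add: algebra_simps)
    also have "\<bar>\<dots>\<bar> = exp (peak_const r) * (g * \<bar>exp (R + e) - G (pi / M) t\<bar>)" using g1 by (simp add: abs_mult)
    also have "\<dots> \<le> exp (peak_const r) * (1 * (exp CR * (Ce * exp Ce) * (1 / M) ^ Q + exp CR * CR ^ N * (1 / M) ^ Q))"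
      using d1 d2 g1 by (intro mult_left_mono mult_mono) auto
    also have "\<dots> = C * (1 / M) ^ Q" by (simp add: C_def distrib_right)
    finally show ?thesis unfolding ex g_def .
  qed
  have C0: "C \<ge> 0" using 1(1) CR(1) by (simp add: C_def)
  show ?case
  proof (rule exI[of _ "\<lambda>z t. exp (peak_const r) * G z t"], rule conjI[OF wpG], rule exI[of _ C], rule conjI[OF C0],
      rule exI[of _ M0], rule conjI[OF 1(2)], intro allI impI)
    fix M n m t
    assume "M \<ge> M0" "t = of_int n - (of_int m + 5/6) * M" "r = (n * a - m) mod c" "\<bar>t\<bar> \<le> M powr (3/5)"
    then show "\<bar>exp (log_amplitude M K n - 2 * M * lob (5/6) / of_int c) - exp (peak_const r) * G (pi / M) t * exp (- ratio_gauss M * t\<^sup>2)\<bar> \<le> C * (1 / M) ^ Q"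
      by (rule key)
  qed
qed

text \<open>The terms are split according to the residue of \<open>n a - m\<close>, which fixes the class of \<open>n\<close> modulo \<open>c\<close>. On each class
  \<open>near_expansion\<close> and \<open>weighted_gauss\<close> apply. One more power of \<open>1 / M\<close> is needed
  in the former, to cover the number of terms.\<close>
lemma peak_sum_expansion:
  assumes K: "K = 3 * Suc Q + 2"
  shows "\<exists>p. (\<forall>i. algebraic (coeff p i)) \<and> (\<exists>C\<ge>0. \<exists>M0\<ge>1. \<forall>M\<ge>M0. \<forall>m.
     \<bar>peak_sum K M m - sqrt M * poly p (pi / M)\<bar> \<le> C * (1 / M) ^ Q)"
proof -
  have "\<forall>r. \<exists>F. weighted 0 F \<and> (\<exists>C\<ge>0. \<exists>M0\<ge>1. \<forall>M\<ge>M0. \<forall>n m t. t = of_int n - (of_int m + 5/6) * M \<longrightarrow> r = (n * a - m) mod c \<longrightarrow> \<bar>t\<bar> \<le> M powr (3/5) \<longrightarrow>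
      \<bar>exp (log_amplitude M K n - 2 * M * lob (5/6) / of_int c) - F (pi / M) t * exp (- ratio_gauss M * t\<^sup>2)\<bar> \<le> C * (1 / M) ^ Suc Q)"
    by (intro allI near_expansion[OF K])
  from choice[OF this] obtain F where "\<forall>r. weighted 0 (F r) \<and> (\<exists>C\<ge>0. \<exists>M0\<ge>1. \<forall>M\<ge>M0. \<forall>n m t. t = of_int n - (of_int m + 5/6) * M \<longrightarrow> r = (n * a - m) mod c \<longrightarrow> \<bar>t\<bar> \<le> M powr (3/5) \<longrightarrow>
      \<bar>exp (log_amplitude M K n - 2 * M * lob (5/6) / of_int c) - F r (pi / M) t * exp (- ratio_gauss M * t\<^sup>2)\<bar> \<le> C * (1 / M) ^ Suc Q)" ..
  note F = this[rule_format, THEN conjunct1] this[rule_format, THEN conjunct2]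
  define B1 where "B1 r C M0 \<longleftrightarrow> (\<forall>M\<ge>M0. \<forall>n m t. t = of_int n - (of_int m + 5/6) * M \<longrightarrow> r = (n * a - m) mod c \<longrightarrow> \<bar>t\<bar> \<le> M powr (3/5) \<longrightarrow>
      \<bar>exp (log_amplitude M K n - 2 * M * lob (5/6) / of_int c) - F r (pi / M) t * exp (- ratio_gauss M * t\<^sup>2)\<bar> \<le> C * (1 / M) ^ Suc Q)"
    for r and C M0 :: real
  from F(2)[folded B1_def] obtain C1 M1 where C1': "\<And>r. C1 r \<ge> 0" "\<And>r. M1 r \<ge> (1::real)" "\<And>r. B1 r (C1 r) (M1 r)"
    by metis
  note C1 = C1'(1,2) C1'(3)[unfolded B1_def, rule_format]
  have "\<forall>r. \<exists>p. (\<forall>i. algebraic (coeff p i)) \<and> (\<forall>Q. \<exists>C\<ge>0. \<exists>M0\<ge>1. \<forall>M\<ge>M0. \<forall>\<theta>.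
     \<bar>(\<Sum>l\<in>{l::int. \<bar>\<theta> + of_int c * of_int l\<bar> \<le> M powr (3/5)}.
        F r (pi / M) (\<theta> + of_int c * of_int l) * exp (- (sqrt 3 * pi / of_int c / M) * (\<theta> + of_int c * of_int l)\<^sup>2))
      - sqrt M * poly p (pi / M)\<bar> \<le> C * (1 / M) ^ Q)"
    by (intro allI weighted_gauss[OF F(1) c_real(1) algebraic_c])
  from choice[OF this] obtain p where "\<forall>r. (\<forall>i. algebraic (coeff (p r) i)) \<and> (\<forall>Q. \<exists>C\<ge>0. \<exists>M0\<ge>1. \<forall>M\<ge>M0. \<forall>\<theta>.
     \<bar>(\<Sum>l\<in>{l::int. \<bar>\<theta> + of_int c * of_int l\<bar> \<le> M powr (3/5)}.
        F r (pi / M) (\<theta> + of_int c * of_int l) * exp (- (sqrt 3 * pi / of_int c / M) * (\<theta> + of_int c * of_int l)\<^sup>2))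
      - sqrt M * poly (p r) (pi / M)\<bar> \<le> C * (1 / M) ^ Q)" ..
  note p = this[rule_format, THEN conjunct1, rule_format] this[rule_format, THEN conjunct2, THEN spec, of _ Q]
  define B2 where "B2 r C M0 \<longleftrightarrow> (\<forall>M\<ge>M0. \<forall>\<theta>.
     \<bar>(\<Sum>l\<in>{l::int. \<bar>\<theta> + of_int c * of_int l\<bar> \<le> M powr (3/5)}.
        F r (pi / M) (\<theta> + of_int c * of_int l) * exp (- (sqrt 3 * pi / of_int c / M) * (\<theta> + of_int c * of_int l)\<^sup>2))
      - sqrt M * poly (p r) (pi / M)\<bar> \<le> C * (1 / M) ^ Q)" for r and C M0 :: real
  from p(2)[folded B2_def] obtain C2 M2 where C2': "\<And>r. C2 r \<ge> 0" "\<And>r. M2 r \<ge> (1::real)" "\<And>r. B2 r (C2 r) (M2 r)"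
    by metis
  note C2 = C2'(1,2) C2'(3)[unfolded B2_def, rule_format, folded ratio_gauss_def]
  define P where "P = (\<Sum>r\<in>{0..<c}. p r)"
  define C where "C = (\<Sum>r\<in>{0..<c}. 3 * C1 r + C2 r)"
  define M0 where "M0 = Max (insert 1 ((M1 ` {0..<c}) \<union> (M2 ` {0..<c})))"
  have "algebraic (coeff P i)" for i unfolding P_def coeff_sum by (intro algebraic_sum p)
  moreover have "C \<ge> 0" unfolding C_def using C1 C2 by (auto intro!: sum_nonneg)
  moreover have "M0 \<ge> 1" unfolding M0_def by (intro Max_ge) auto
  moreover have "\<bar>peak_sum K M m - sqrt M * poly P (pi / M)\<bar> \<le> C * (1 / M) ^ Q" if "M \<ge> M0" for M m
  proof -
    have MM: "M \<ge> 1" "\<And>r. r \<in> {0..<c} \<Longrightarrow> M \<ge> M1 r" "\<And>r. r \<in> {0..<c} \<Longrightarrow> M \<ge> M2 r"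
    proof -
      have "x \<le> M0" if "x \<in> insert 1 ((M1 ` {0..<c}) \<union> (M2 ` {0..<c}))" for x
        unfolding M0_def by (rule Max_ge) (use that in auto)
      then show "M \<ge> 1" "\<And>r. r \<in> {0..<c} \<Longrightarrow> M \<ge> M1 r" "\<And>r. r \<in> {0..<c} \<Longrightarrow> M \<ge> M2 r"
      proof -
        assume le: "\<And>x. x \<in> insert 1 ((M1 ` {0..<c}) \<union> (M2 ` {0..<c})) \<Longrightarrow> x \<le> M0"
        show "M \<ge> 1" using le[of 1] \<open>M \<ge> M0\<close> by simp
        show "M \<ge> M1 r" "M \<ge> M2 r" if "r \<in> {0..<c}" for r
          using le[of "M1 r"] le[of "M2 r"] \<open>M \<ge> M0\<close> that by auto
      qed
    qed
    define T where "T = M powr (3/5)"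
    have T: "T \<ge> 1" "T \<le> M"
      unfolding T_def using MM(1) powr_mono[of "3/5" 1 M] by (auto simp: ge_one_powr_ge_zero)
    define f where "f n = exp (log_amplitude M K n - 2 * M * lob (5/6) / of_int c)" for n
    define S where "S = {n::int. \<bar>of_int n - (of_int m + 5/6) * M\<bar> \<le> T}"
    have "S \<subseteq> {\<lceil>(of_int m + 5/6) * M - T\<rceil>..\<lfloor>(of_int m + 5/6) * M + T\<rfloor>}"
      unfolding S_def by (auto simp: abs_le_iff ceiling_le_iff le_floor_iff)
    then have finS: "finite S" by (rule finite_subset) simp
    define I where "I r = {l::int. \<bar>(of_int (d * (m + r)) - (of_int m + 5/6) * M) + of_int c * of_int l\<bar> \<le> T}" for r
    have bij: "bij_betw (\<lambda>l. d * (m + r) + c * l) (I r) {n\<in>S. (n * a - m) mod c = r}" if r: "r \<in> {0..<c}" for r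
    proof (rule bij_betw_imageI)
      show "inj_on (\<lambda>l. d * (m + r) + c * l) (I r)" using c_pos by (auto simp: inj_on_def)
      have ad: "d * a = 1 + b * c" using det by (simp add: mult.commute)
      show "(\<lambda>l. d * (m + r) + c * l) ` I r = {n\<in>S. (n * a - m) mod c = r}"
      proof (intro equalityI subsetI)
        fix n assume "n \<in> (\<lambda>l. d * (m + r) + c * l) ` I r"
        then obtain l where l: "l \<in> I r" "n = d * (m + r) + c * l" by auto
        have "n * a - m = r + c * (b * (m + r) + l * a)"
        proof -
          have "n * a - m = (d * a) * (m + r) + c * l * a - m" by (simp add: l(2) algebra_simps)
          then show ?thesis unfolding ad by (simp add: algebra_simps)
        qed
        then have "(n * a - m) mod c = r" using r by simp
        moreover have "n \<in> S" using l by (simp add: I_def S_def algebra_simps)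
        ultimately show "n \<in> {n\<in>S. (n * a - m) mod c = r}" by simp
      next
        fix n assume "n \<in> {n\<in>S. (n * a - m) mod c = r}"
        then have n: "n \<in> S" "(n * a - m) mod c = r" by auto
        define k where "k = (n * a - m) div c"
        have nk: "n * a = m + r + c * k" using mult_div_mod_eq[of c "n * a - m"] n(2) by (simp add: k_def)
        define l where "l = d * k - n * b"
        have "n * (d * a) = d * (n * a)" by simp
        then have "n * (1 + b * c) = d * (m + r + c * k)" unfolding ad nk .
        then have nl: "n = d * (m + r) + c * l" by (simp add: l_def algebra_simps)
        then have "l \<in> I r" using n(1) by (simp add: I_def S_def algebra_simps)
        then show "n \<in> (\<lambda>l. d * (m + r) + c * l) ` I r" using nl by auto
      qed
    qed
    have one: "\<bar>(\<Sum>n\<in>{n\<in>S. (n * a - m) mod c = r}. f n) - sqrt M * poly (p r) (pi / M)\<bar> \<le> (3 * C1 r + C2 r) * (1 / M) ^ Q"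
      if r: "r \<in> {0..<c}" for r
    proof -
      define t where "t l = (of_int (d * (m + r)) - (of_int m + 5/6) * M) + of_int c * of_int l" for l :: int
      have Sr: "{n\<in>S. (n * a - m) mod c = r} \<subseteq> S" by auto
      define h where "h l = F r (pi / M) (t l) * exp (- ratio_gauss M * (t l)\<^sup>2)" for l
      have fi: "finite (I r)" using bij_betw_finite[OF bij[OF r]] finite_subset[OF Sr finS] by simp
      have cd: "real (card (I r)) \<le> 3 * M"
      proof -
        have "I r \<subseteq> {\<lceil>(- T - t 0) / of_int c\<rceil>..\<lfloor>(T - t 0) / of_int c\<rfloor>}"
        proof
          fix l assume "l \<in> I r"
          then have "\<bar>t 0 + of_int c * of_int l\<bar> \<le> T" by (simp add: I_def t_def)
          then show "l \<in> {\<lceil>(- T - t 0) / of_int c\<rceil>..\<lfloor>(T - t 0) / of_int c\<rfloor>}"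
            using c_real by (auto simp: ceiling_le_iff le_floor_iff field_simps)
        qed
        then have "card (I r) \<le> nat (\<lfloor>(T - t 0) / of_int c\<rfloor> - \<lceil>(- T - t 0) / of_int c\<rceil> + 1)"
          using card_mono[of "{\<lceil>(- T - t 0) / of_int c\<rceil>..\<lfloor>(T - t 0) / of_int c\<rfloor>}" "I r"] by (simp add: add.commute)
        moreover have "(T - t 0) / of_int c - (- T - t 0) / of_int c = 2 * T / of_int c" by (simp add: diff_divide_distrib[symmetric])
        moreover have "2 * T / of_int c \<le> 2 * T" using c_real T by (simp add: field_simps)
        ultimately show ?thesis using T MM(1) by linarith
      qed
      have "(\<Sum>n\<in>{n\<in>S. (n * a - m) mod c = r}. f n) = (\<Sum>l\<in>I r. f (d * (m + r) + c * l))"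
        by (rule sum.reindex_bij_betw[OF bij[OF r], symmetric])
      moreover have "\<bar>(\<Sum>l\<in>I r. f (d * (m + r) + c * l)) - (\<Sum>l\<in>I r. h l)\<bar> \<le> 3 * C1 r * (1 / M) ^ Q"
      proof -
        have "\<bar>f (d * (m + r) + c * l) - h l\<bar> \<le> C1 r * (1 / M) ^ Suc Q" if "l \<in> I r" for l
          unfolding f_def h_def
        proof (rule C1(3)[OF MM(2)[OF r]])
          show "t l = of_int (d * (m + r) + c * l) - (of_int m + 5/6) * M" by (simp add: t_def)
          show "r = ((d * (m + r) + c * l) * a - m) mod c" using bij_betwE[OF bij[OF r]] that by auto
          show "\<bar>t l\<bar> \<le> M powr (3/5)" using that by (simp add: I_def t_def T_def)
        qed
        then have "\<bar>(\<Sum>l\<in>I r. f (d * (m + r) + c * l)) - (\<Sum>l\<in>I r. h l)\<bar> \<le> of_nat (card (I r)) * (C1 r * (1 / M) ^ Suc Q)"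
          unfolding sum_subtractf[symmetric] by (intro order.trans[OF sum_abs] sum_bounded_above)
        also have "\<dots> \<le> (3 * M) * (C1 r * (1 / M) ^ Suc Q)" using cd C1(1) MM(1) by (intro mult_right_mono) auto
        also have "\<dots> = 3 * C1 r * (1 / M) ^ Q" using MM(1) by simp
        finally show ?thesis .
      qed
      moreover have "\<bar>(\<Sum>l\<in>I r. h l) - sqrt M * poly (p r) (pi / M)\<bar> \<le> C2 r * (1 / M) ^ Q"
        using C2(3)[OF MM(3)[OF r], of "of_int (d * (m + r)) - (of_int m + 5/6) * M"] by (simp add: h_def t_def I_def T_def)
      ultimately show ?thesis unfolding distrib_right by linarith
    qed
    have "peak_sum K M m = (\<Sum>n\<in>S. f n)" by (simp add: peak_sum_def S_def f_def T_def)
    also have "\<dots> = (\<Sum>r\<in>{0..<c}. \<Sum>n\<in>{n\<in>S. (n * a - m) mod c = r}. f n)"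
      by (rule sum.group[symmetric]) (use finS c_pos in auto)
    finally have "peak_sum K M m - sqrt M * poly P (pi / M) = (\<Sum>r\<in>{0..<c}. (\<Sum>n\<in>{n\<in>S. (n * a - m) mod c = r}. f n) - sqrt M * poly (p r) (pi / M))"
      by (simp add: P_def poly_sum sum_distrib_left sum_subtractf)
    also have "\<bar>\<dots>\<bar> \<le> (\<Sum>r\<in>{0..<c}. (3 * C1 r + C2 r) * (1 / M) ^ Q)"
      by (intro order.trans[OF sum_abs] sum_mono one)
    also have "\<dots> = C * (1 / M) ^ Q" by (simp add: C_def sum_distrib_right)
    finally show ?thesis .
  qed
  ultimately show ?thesis by blast
qed

end

section \<open>Bounds away from the peaks\<close>

lemma lsin_concave_bound:
  assumes "2/3 \<le> x" "x < 1"
  shows "(lsin has_real_derivative pi * cot (pi * x)) (at x)" "pi * cot (pi * x) \<le> - (pi / 2)"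
proof -
  have s: "sin (pi * x) > 0" using assms by (intro sin_gt_zero) auto
  then show "(lsin has_real_derivative pi * cot (pi * x)) (at x)" by (intro lsin_deriv) auto
  have "cos (pi * x) \<le> cos (pi * (2/3))" using assms by (intro cos_monotone_0_pi_le) auto
  also have "cos (pi * (2/3)) = cos (pi - pi / 3)" by (rule arg_cong[of _ _ cos]) simp
  also have "\<dots> = - (1 / 2)" unfolding cos_pi_minus cos_60 ..
  finally have "cos (pi * x) / sin (pi * x) \<le> - (1/2) / sin (pi * x)" using s by (intro divide_right_mono) auto
  also have "\<dots> \<le> - (1/2)" using s by (simp add: field_simps)
  finally have "pi * cot (pi * x) \<le> pi * (- (1/2))" unfolding cot_def by (intro mult_left_mono) auto
  then show "pi * cot (pi * x) \<le> - (pi / 2)" by simp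
qed

lemma lob_deriv_01: "0 < x \<Longrightarrow> x < 1 \<Longrightarrow> (lob has_real_derivative lsin x) (at x)"
  by (intro lob_deriv sin_pi_nz) auto

text \<open>On this interval the second derivative \<open>\<pi> cot (\<pi> x)\<close> is at most \<open>- \<pi> / 2\<close>, and the first derivative vanishes at
  \<open>5/6\<close>.\<close>
lemma lob_quadratic_bound:
  assumes v: "2/3 \<le> v" "v < 1"
  shows "lob v \<le> lob (5/6) - pi / 4 * (v - 5/6)\<^sup>2"
proof -
  define h where "h v = lob v + pi / 4 * (v - 5/6)\<^sup>2" for v
  define h' where "h' v = lsin v + pi / 2 * (v - 5/6)" for v
  have hd: "(h has_real_derivative h' x) (at x)" if "2/3 \<le> x" "x < 1" for x
    unfolding h_def[abs_def] h'_def using lob_deriv_01[of x] that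
    by (auto intro!: derivative_eq_intros)
  have hd': "(h' has_real_derivative pi * cot (pi * x) + pi / 2) (at x)" if "2/3 \<le> x" "x < 1" for x
    unfolding h'_def[abs_def] using lsin_concave_bound(1)[OF that]
    by (auto intro!: derivative_eq_intros)
  have anti: "h' y \<le> h' x" if "2/3 \<le> x" "x \<le> y" "y < 1" for x y
  proof (rule DERIV_nonpos_imp_nonincreasing[OF that(2)])
    fix z assume "x \<le> z" "z \<le> y"
    then have z: "2/3 \<le> z" "z < 1" using that by auto
    show "\<exists>w. (h' has_real_derivative w) (at z) \<and> w \<le> 0"
      using hd'[OF z] lsin_concave_bound(2)[OF z] by (intro exI conjI) auto
  qed
  have h'0: "h' (5/6) = 0" by (simp add: h'_def peak_values)
  have "h v \<le> h (5/6)"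
  proof (cases "v \<le> 5/6")
    case True
    show ?thesis
    proof (rule DERIV_nonneg_imp_nondecreasing[OF True])
      fix z assume "v \<le> z" "z \<le> 5/6"
      then show "\<exists>w. (h has_real_derivative w) (at z) \<and> 0 \<le> w"
        using hd[of z] anti[of z "5/6"] h'0 v by (intro exI[of _ "h' z"]) auto
    qed
  next
    case False
    then have le: "5/6 \<le> v" by simp
    show ?thesis
    proof (rule DERIV_nonpos_imp_nonincreasing[OF le])
      fix z assume "5/6 \<le> z" "z \<le> v"
      then show "\<exists>w. (h has_real_derivative w) (at z) \<and> w \<le> 0"
        using hd[of z] anti[of "5/6" z] h'0 v by (intro exI[of _ "h' z"]) auto
    qed
  qed
  then show ?thesis by (simp add: h_def)
qed

lemma lsin_sign:
  shows "1/6 \<le> x \<Longrightarrow> x \<le> 5/6 \<Longrightarrow> lsin x \<ge> 0" and "0 < x \<Longrightarrow> x \<le> 1/6 \<Longrightarrow> lsin x \<le> 0"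
proof -
  have s16: "sin (pi * (1/6)) = 1/2" using sin_30 by simp
  show "lsin x \<ge> 0" if x: "1/6 \<le> x" "x \<le> 5/6"
  proof -
    have "\<bar>sin (pi * x)\<bar> \<ge> sin (pi * (1/6))" by (rule sin_pi_lower[of _ _ 0]) (use x in auto)
    then have "\<bar>2 * sin (pi * x)\<bar> \<ge> 1" using s16 by simp
    then show ?thesis by (simp add: lsin_def)
  qed
  show "lsin x \<le> 0" if x: "0 < x" "x \<le> 1/6"
  proof -
    have p: "sin (pi * x) > 0" using x by (intro sin_gt_zero) auto
    have pos: "0 \<le> pi * x" using x by simp
    have b: "pi * x \<le> pi * (1/6)" using x by (intro mult_left_mono) auto
    have "sin (pi * x) \<le> sin (pi * (1/6))"
    proof (rule sin_monotone_2pi_le)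
      show "- (pi / 2) \<le> pi * x" using pos pi_gt_zero by linarith
      show "pi * x \<le> pi * (1/6)" by (rule b)
      show "pi * (1/6) \<le> pi / 2" by simp
    qed
    then show ?thesis using p s16 by (simp add: lsin_def)
  qed
qed

lemma lob_mono_pos:
  assumes "1/6 \<le> x" "x \<le> y" "y \<le> 5/6"
  shows "lob x \<le> lob y"
  by (rule DERIV_nonneg_imp_nondecreasing[OF assms(2)])
     (use assms in \<open>auto intro!: exI[of _ "lsin _"] lob_deriv_01 lsin_sign(1)\<close>)

lemma lob_0: "lob 0 = 0" using lob_minus[of 0] by simp

text \<open>Since \<open>lsin\<close> is negative up to \<open>1/6\<close> and positive up to \<open>5/6\<close>, on \<open>[0, 2/3)\<close> the function is at most
  \<open>lob (2/3)\<close>, already below the peak by a fixed gap.\<close>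
lemma lob_peak_bound:
  obtains \<kappa> where "\<kappa> > 0" "\<And>v. 0 \<le> v \<Longrightarrow> v < 1 \<Longrightarrow> lob v \<le> lob (5/6) - \<kappa> * (v - 5/6)\<^sup>2" "lob (5/6) > 0"
proof (rule that[of "pi / 100"])
  \<comment> \<open>The constant is chosen such that \<open>\<pi> / 100 (5/6)\<^sup>2\<close> equals the gap \<open>\<pi> / 144\<close> found at \<open>2/3\<close>.\<close>
  show "pi / 100 > (0::real)" by simp
  have half: "lob (1/2) = 0"
    using lob_shift_int[of "-(1/2)" 1] lob_minus[of "1/2"] by simp
  have l23: "0 \<le> lob (2/3)" using lob_mono_pos[of "1/2" "2/3"] half by simp
  have gap: "lob (2/3) \<le> lob (5/6) - pi / 144"
    using lob_quadratic_bound[of "2/3"] by (simp add: power2_eq_square)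
  show "lob (5/6) > 0" using gap l23 pi_gt_zero by linarith
  fix v :: real assume v: "0 \<le> v" "v < 1"
  show "lob v \<le> lob (5/6) - pi / 100 * (v - 5/6)\<^sup>2"
  proof (cases "2/3 \<le> v")
    case True
    have "pi / 100 * (v - 5/6)\<^sup>2 \<le> pi / 4 * (v - 5/6)\<^sup>2" by (intro mult_right_mono) auto
    then show ?thesis using lob_quadratic_bound[OF True v(2)] by linarith
  next
    case False
    have "lob v \<le> lob (2/3)"
    proof (cases "v \<ge> 1/6")
      case True
      then show ?thesis using False by (intro lob_mono_pos) auto
    next
      case False
      show ?thesis
      proof (cases "v = 0")
        case True
        then show ?thesis using l23 lob_0 by simp
      next
        case v0: False
        have "lob 0 \<ge> lob v"
        proof (rule DERIV_nonpos_imp_decreasing_open[of 0 v lob])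
          fix x assume "0 < x" "x < v"
          then show "\<exists>y. (lob has_real_derivative y) (at x) \<and> y \<le> 0"
            using False v lob_deriv_01[of x] lsin_sign(2)[of x] by (intro exI[of _ "lsin x"]) auto
        qed (use v in \<open>auto intro: continuous_on_lob\<close>)
        then show ?thesis using l23 lob_0 by simp
      qed
    qed
    moreover have "(v - 5/6)\<^sup>2 \<le> (5/6)\<^sup>2" using False v abs_le_square_iff[of "v - 5/6" "5/6"] by auto
    then have "pi / 100 * (v - 5/6)\<^sup>2 \<le> pi / 100 * (5/6)\<^sup>2" by (intro mult_left_mono) auto
    moreover have "pi / 100 * (5/6)\<^sup>2 = pi / 144" by (simp add: power2_eq_square)
    ultimately show ?thesis using gap by linarith
  qed
qed

lemma lsin_em_crude:
  assumes "\<sigma> > 0"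
  obtains C where "C \<ge> 0" "\<And>M x. M \<ge> 1 \<Longrightarrow> \<bar>sin (pi * x)\<bar> \<ge> \<sigma> \<Longrightarrow> \<bar>lsin_em M K x - M * lob x\<bar> \<le> C"
proof -
  have "\<forall>p. \<exists>B. B \<ge> 0 \<and> (\<forall>x. \<bar>sin (pi * x)\<bar> \<ge> \<sigma> \<longrightarrow> \<bar>lsinD p x\<bar> \<le> B)"
    using lsinD_bound[OF assms] by blast
  from choice[OF this] obtain B where B: "\<forall>p. B p \<ge> 0 \<and> (\<forall>x. \<bar>sin (pi * x)\<bar> \<ge> \<sigma> \<longrightarrow> \<bar>lsinD p x\<bar> \<le> B p)" ..
  show ?thesis
  proof (rule that[of "\<Sum>p<K. \<bar>bern_coeff (Suc p)\<bar> * B (Suc p)"])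
    show "(\<Sum>p<K. \<bar>bern_coeff (Suc p)\<bar> * B (Suc p)) \<ge> 0" using B by (auto intro!: sum_nonneg)
    fix M x :: real assume M: "M \<ge> 1" and x: "\<bar>sin (pi * x)\<bar> \<ge> \<sigma>"
    have "lsin_em M K x = M * lob x + (\<Sum>p<K. bern_coeff (Suc p) * (1 / M) ^ p * lsinD (Suc p) x)"
      unfolding lsin_em_def em_primitive_def lessThan_Suc_atMost[symmetric] sum.lessThan_Suc_shift using M
      by (simp add: bern_coeff_0)
    moreover have "\<bar>\<Sum>p<K. bern_coeff (Suc p) * (1 / M) ^ p * lsinD (Suc p) x\<bar> \<le> (\<Sum>p<K. \<bar>bern_coeff (Suc p)\<bar> * B (Suc p))"
    proof (rule order.trans[OF sum_abs], rule sum_mono)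
      fix p
      have "(1 / M) ^ p \<le> 1" using M by (intro power_le_one) auto
      then have "\<bar>bern_coeff (Suc p)\<bar> * (1 / M) ^ p * \<bar>lsinD (Suc p) x\<bar> \<le> \<bar>bern_coeff (Suc p)\<bar> * 1 * B (Suc p)"
        using B x M by (intro mult_mono) auto
      then show "\<bar>bern_coeff (Suc p) * (1 / M) ^ p * lsinD (Suc p) x\<bar> \<le> \<bar>bern_coeff (Suc p)\<bar> * B (Suc p)"
        using M by (simp add: abs_mult power_abs)
    qed
    ultimately show "\<bar>lsin_em M K x - M * lob x\<bar> \<le> (\<Sum>p<K. \<bar>bern_coeff (Suc p)\<bar> * B (Suc p))" by simp
  qed
qed

context sl2_mat
begin

text \<open>The leading terms of the \<open>c\<close> classes add up by \<open>lob_distribution\<close>, while all other Euler--Maclaurin terms are bounded.\<close>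
lemma log_amplitude_crude:
  assumes \<eta>: "0 < \<eta>" "\<eta> \<le> 1/4"
  obtains C M0 where "C \<ge> 0" "M0 \<ge> 1"
    "\<And>M n m. M \<ge> M0 \<Longrightarrow> of_int m + \<eta> \<le> of_int n / M \<Longrightarrow> of_int n / M \<le> of_int m + 1 - \<eta> \<Longrightarrow>
      log_amplitude M K n \<le> 2 * M * lob (of_int n / M - of_int m) / of_int c + C"
proof -
  define \<eta>' where "\<eta>' = \<eta> / (2 * of_int c)"
  have \<eta>': "0 < \<eta>'" "\<eta>' < 1" using \<eta> c_real by (auto simp: \<eta>'_def field_simps)
  define \<sigma> where "\<sigma> = sin (pi * \<eta>')"
  have \<sigma>: "\<sigma> > 0" using sin_pi_eta_pos \<eta>' by (simp add: \<sigma>_def)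
  obtain C1 where C1: "C1 \<ge> 0" "\<And>M x. M \<ge> 1 \<Longrightarrow> \<bar>sin (pi * x)\<bar> \<ge> \<sigma> \<Longrightarrow> \<bar>lsin_em M K x - M * lob x\<bar> \<le> C1"
    using lsin_em_crude[OF \<sigma>] by blast
  obtain B where B: "B \<ge> 0" "\<And>x. \<bar>sin (pi * x)\<bar> \<ge> \<sigma> \<Longrightarrow> \<bar>lsinD 1 x\<bar> \<le> B" using lsinD_bound[OF \<sigma>, of 1] by blast
  define C where "C = of_nat (nat c) * (2 * (C1 + B))"
  show ?thesis
  proof (rule that[of C "2 * of_int c / \<eta> + 1"])
    show "C \<ge> 0" using C1 B by (simp add: C_def)
    show "2 * of_int c / \<eta> + 1 \<ge> 1" using \<eta> c_real by simp
    fix M :: real and n m :: int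
    assume MM: "M \<ge> 2 * of_int c / \<eta> + 1" and n: "of_int m + \<eta> \<le> of_int n / M" "of_int n / M \<le> of_int m + 1 - \<eta>"
    have "2 * of_int c / \<eta> \<ge> 0" using \<eta> c_real by simp
    then have M: "M \<ge> 1" "M \<ge> 2 * of_int c / \<eta>" using MM by auto
    have cM: "of_int c / M \<le> \<eta> / 2" using M \<eta> by (simp add: field_simps)
    define y where "y = of_int n / M"
    have ny: "of_int m + \<eta> \<le> y" "y \<le> of_int m + 1 - \<eta>" using n by (simp_all add: y_def)
    have reg: "\<bar>sin (pi * ((y + u + of_int k) / of_int c))\<bar> \<ge> \<sigma>" if u: "\<bar>u\<bar> \<le> \<eta> / 2" for u k
    proof -
      define r where "r = (k + m) mod c"
      have r: "0 \<le> r" "r \<le> c - 1" using c_pos pos_mod_bound[of c "k + m"] by (auto simp: r_def)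
      have r': "0 \<le> real_of_int r" "real_of_int r \<le> of_int c - 1" using r by linarith+
      have km: "of_int (k + m) = of_int c * of_int ((k + m) div c) + (of_int r :: real)"
        unfolding r_def by (metis mult_div_mod_eq of_int_add of_int_mult)
      have e: "(y + u + of_int k) / of_int c - of_int ((k + m) div c) = (y - of_int m + u + of_int r) / of_int c"
      proof -
        have e1: "y + u + of_int k = (y - of_int m + u + of_int r) + of_int c * of_int ((k + m) div c)" using km by simp
        have gen: "(A + of_int c * q) / of_int c - q = A / of_int c" for A q :: real
          using c_real by (simp add: add_divide_distrib)
        show ?thesis unfolding e1 by (rule gen)
      qed
      have "\<eta> / 2 / of_int c \<le> (y - of_int m + u + of_int r) / of_int c"
        by (rule divide_right_mono) (use r' u ny c_real in linarith)+
      moreover have "(y - of_int m + u + of_int r) / of_int c \<le> (of_int c - \<eta> / 2) / of_int c"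
        by (rule divide_right_mono) (use r' u ny c_real in linarith)+
      ultimately show ?thesis unfolding \<sigma>_def
        by (intro sin_pi_lower[of _ _ "(k + m) div c"]) (use \<eta>' c_real e in \<open>auto simp: \<eta>'_def diff_divide_distrib\<close>)
    qed
    have lip: "\<bar>M * lob ((y + u + of_int k) / of_int c) - M * lob ((y + of_int k) / of_int c)\<bar> \<le> B"
      if u: "\<bar>u\<bar> \<le> of_int c / M" for u k
    proof -
      define f where "f u = lob ((y + u + of_int k) / of_int c)" for u
      have uh: "\<bar>u\<bar> \<le> \<eta> / 2" using u cM by linarith
      have "norm (f u - f 0) \<le> (B / of_int c) * norm (u - 0)"
      proof (rule field_differentiable_bound[of "{- (\<eta> / 2)..\<eta> / 2}" f "\<lambda>u. lsin ((y + u + of_int k) / of_int c) * (1 / of_int c)"])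
        fix z assume "z \<in> {- (\<eta> / 2)..\<eta> / 2}"
        then have z: "\<bar>z\<bar> \<le> \<eta> / 2" by auto
        have nz: "sin (pi * ((y + z + of_int k) / of_int c)) \<noteq> 0" using reg[OF z, of k] \<sigma> by auto
        show "(f has_real_derivative lsin ((y + z + of_int k) / of_int c) * (1 / of_int c)) (at z within {- (\<eta> / 2)..\<eta> / 2})"
          unfolding f_def[abs_def]
          by (rule has_field_derivative_at_within, rule DERIV_chain2[where f = lob and g = "\<lambda>u. (y + u + of_int k) / of_int c", OF lob_deriv[OF nz]])
             (use c_real in \<open>auto intro!: derivative_eq_intros\<close>)
        show "norm (lsin ((y + z + of_int k) / of_int c) * (1 / of_int c)) \<le> B / of_int c"
          using B(2)[OF reg[OF z, of k]] c_real by (simp add: abs_mult divide_right_mono)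
      qed (use uh \<eta> in auto)
      then have "M * \<bar>f u - f 0\<bar> \<le> M * ((B / of_int c) * \<bar>u\<bar>)" using M by (intro mult_left_mono) auto
      also have "\<dots> \<le> M * ((B / of_int c) * (of_int c / M))" using u B M c_real by (intro mult_left_mono) auto
      also have "\<dots> = B" using M c_real by simp
      finally have "M * \<bar>f u - f 0\<bar> \<le> B" .
      moreover have "\<bar>M * f u - M * f 0\<bar> = M * \<bar>f u - f 0\<bar>" using M by (simp add: right_diff_distrib[symmetric] abs_mult)
      ultimately show ?thesis by (simp add: f_def)
    qed
    have xie: "xi M (n + e) = (y + of_int e / M + of_int (- ((n + e) * a))) / of_int c" for e
      using M c_real by (simp add: xi_def y_def field_simps)
    have pt: "\<bar>lsin_em M K (xi M (n + e)) - M * lob ((y + of_int (- ((n + e) * a))) / of_int c)\<bar> \<le> C1 + B"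
      "\<bar>lsin_em M K (- xi M (n + e)) + M * lob ((y + of_int (- ((n + e) * a))) / of_int c)\<bar> \<le> C1 + B"
      if e: "\<bar>e\<bar> \<le> c" for e
    proof -
      have "\<bar>real_of_int e\<bar> \<le> of_int c" using e by linarith
      then have u: "\<bar>of_int e / M\<bar> \<le> of_int c / M" using M by (simp add: abs_divide divide_right_mono)
      then have u2: "\<bar>of_int e / M\<bar> \<le> \<eta> / 2" using cM by linarith
      have s1: "\<bar>sin (pi * xi M (n + e))\<bar> \<ge> \<sigma>" unfolding xie by (rule reg[OF u2])
      then have s2: "\<bar>sin (pi * - xi M (n + e))\<bar> \<ge> \<sigma>" by simp
      have 1: "\<bar>lsin_em M K (xi M (n + e)) - M * lob (xi M (n + e))\<bar> \<le> C1" by (rule C1(2)[OF M(1) s1])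
      have 2: "\<bar>lsin_em M K (- xi M (n + e)) + M * lob (xi M (n + e))\<bar> \<le> C1" using C1(2)[OF M(1) s2] by (simp add: lob_minus)
      have 3: "\<bar>M * lob (xi M (n + e)) - M * lob ((y + of_int (- ((n + e) * a))) / of_int c)\<bar> \<le> B"
        unfolding xie by (rule lip[OF u])
      show "\<bar>lsin_em M K (xi M (n + e)) - M * lob ((y + of_int (- ((n + e) * a))) / of_int c)\<bar> \<le> C1 + B"
        "\<bar>lsin_em M K (- xi M (n + e)) + M * lob ((y + of_int (- ((n + e) * a))) / of_int c)\<bar> \<le> C1 + B"
        using 1 2 3 by linarith+
    qed
    define W where "W k = lob ((y + of_int k) / of_int c)" for k :: int
    have Wper: "W (k + int (nat c)) = W k" for k
    proof -
      have "(y + of_int (k + int (nat c))) / of_int c = (y + of_int k) / of_int c + of_int 1"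
        using c_real c_pos by (simp add: field_simps)
      then show ?thesis unfolding W_def by (simp only: lob_shift_int)
    qed
    have Wsum: "(\<Sum>\<rho><nat c. W (class_upper r \<rho>)) = lob y / of_int c" "(\<Sum>\<rho><nat c. W (class_lower r \<rho>)) = lob y / of_int c" for r
    proof -
      have "(\<Sum>k<nat c. W (int k)) = lob y / of_int c"
        using lob_distribution[of "nat c" y] c_pos by (simp add: W_def)
      then show "(\<Sum>\<rho><nat c. W (class_upper r \<rho>)) = lob y / of_int c" "(\<Sum>\<rho><nat c. W (class_lower r \<rho>)) = lob y / of_int c"
        using sum_residues[where F = W and g = "class_upper r" and I = "{..<nat c}" and L = "nat c", OF Wper]
              sum_residues[where F = W and g = "class_lower r" and I = "{..<nat c}" and L = "nat c", OF Wper] inj_classes c_pos by auto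
    qed
    have "log_amplitude M K n = (\<Sum>\<rho><nat c. lsin_em M K (xi M (n - int \<rho>)) - lsin_em M K (xi M (- n - 1 - int \<rho>)))"
      by (simp add: log_amplitude_def em_window_def sum_subtractf)
    also have "\<dots> \<le> (\<Sum>\<rho><nat c. M * W (class_upper (n * a) \<rho>) + M * W (class_lower (n * a) \<rho>) + 2 * (C1 + B))"
    proof (rule sum_mono)
      fix \<rho> assume "\<rho> \<in> {..<nat c}"
      then have \<rho>: "\<bar>- int \<rho>\<bar> \<le> c" "\<bar>1 + int \<rho>\<bar> \<le> c" by auto
      have "lsin_em M K (xi M (n - int \<rho>)) \<le> M * W (class_upper (n * a) \<rho>) + (C1 + B)"
      proof -
        have "- ((n + - int \<rho>) * a) = class_upper (n * a) \<rho>" by (simp add: class_upper_def algebra_simps)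
        then show ?thesis using pt(1)[OF \<rho>(1)] by (simp add: W_def abs_le_iff)
      qed
      moreover have "- lsin_em M K (xi M (- n - 1 - int \<rho>)) \<le> M * W (class_lower (n * a) \<rho>) + (C1 + B)"
      proof -
        have "- ((n + (1 + int \<rho>)) * a) = class_lower (n * a) \<rho>" by (simp add: class_lower_def algebra_simps)
        moreover have "- n - 1 - int \<rho> = - (n + (1 + int \<rho>))" by simp
        then have "xi M (- n - 1 - int \<rho>) = - xi M (n + (1 + int \<rho>))" by (simp only: xi_minus)
        ultimately show ?thesis using pt(2)[OF \<rho>(2)] by (simp add: W_def abs_le_iff)
      qed
      moreover have "p \<le> x + q \<Longrightarrow> - p' \<le> x' + q \<Longrightarrow> p - p' \<le> x + x' + 2 * q" for p p' x x' q :: real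
        by linarith
      ultimately show "lsin_em M K (xi M (n - int \<rho>)) - lsin_em M K (xi M (- n - 1 - int \<rho>)) \<le> M * W (class_upper (n * a) \<rho>) + M * W (class_lower (n * a) \<rho>) + 2 * (C1 + B)"
        by blast
    qed
    also have "\<dots> = 2 * M * lob y / of_int c + C"
      by (simp add: sum.distrib sum_distrib_left[symmetric] Wsum C_def)
    also have "lob y = lob (of_int n / M - of_int m)"
      using lob_shift_int[of y "- m"] by (simp add: y_def)
    finally show "log_amplitude M K n \<le> 2 * M * lob (of_int n / M - of_int m) / of_int c + C" .
  qed
qed

end

section \<open>Adding up all terms\<close>

context sl2_mat
begin

text \<open>The summands of \<open>J\<close> at the image and, below, at \<open>X\<close> itself.\<close>
definition image_term :: "real \<Rightarrow> nat \<Rightarrow> real" where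
  "image_term M n = (\<Prod>j=1..n. (2 * sin (pi * xi M (int j)))\<^sup>2)"

definition source_term :: "real \<Rightarrow> nat \<Rightarrow> real" where
  "source_term X m = (\<Prod>k=1..m. (2 * sin (pi * (real k * X)))\<^sup>2)"

text \<open>Here \<open>s\<close> and \<open>N\<close> are the denominators of \<open>X\<close> and of its image, expressed by what the estimates use: their
  ratio \<open>M\<close> and the fact that the factors of smaller index do not vanish.\<close>
definition admissible :: "real \<Rightarrow> real \<Rightarrow> nat \<Rightarrow> nat \<Rightarrow> bool" where
  "admissible M X s N \<longleftrightarrow> M = of_int c * X + of_int d \<and> s \<ge> 1 \<and> real N = real s * M \<and>
     (\<forall>k\<in>{1..<s}. sin (pi * (real k * X)) \<noteq> 0) \<and> (\<forall>j\<in>{1..<N}. sin (pi * xi M (int j)) \<noteq> 0)"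

lemma square_two_sin_le: "(2 * sin x)\<^sup>2 \<le> (4::real)"
proof -
  have "(sin x)\<^sup>2 \<le> 1" by (simp add: abs_square_le_1)
  then show ?thesis by (simp add: power_mult_distrib)
qed

lemma image_term_nonneg: "image_term M n \<ge> 0" and source_term_nonneg: "source_term X m \<ge> 0"
  by (auto simp: image_term_def source_term_def intro!: prod_nonneg)

text \<open>A trivial bound, but it carries an estimate from regular indices into the short ranges next to the multiples of \<open>M\<close>,
  where \<open>bulk\<close> says nothing.\<close>
lemma image_term_growth:
  assumes "n0 \<le> n"
  shows "image_term M n \<le> image_term M n0 * 4 ^ (n - n0)"
  using assms
proof (induction n rule: dec_induct)
  case (step n)
  have "image_term M (Suc n) = image_term M n * (2 * sin (pi * xi M (int (Suc n))))\<^sup>2" by (simp add: image_term_def)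
  also have "\<dots> \<le> (image_term M n0 * 4 ^ (n - n0)) * 4"
    using step image_term_nonneg by (intro mult_mono square_two_sin_le) auto
  finally show ?case using step by (simp add: Suc_diff_le)
qed simp

lemma source_term_le: "source_term X m \<le> 4 ^ m"
proof (induction m)
  case (Suc m)
  have "source_term X (Suc m) = source_term X m * (2 * sin (pi * (real (Suc m) * X)))\<^sup>2" by (simp add: source_term_def)
  also have "\<dots> \<le> 4 ^ m * 4" using Suc source_term_nonneg by (intro mult_mono square_two_sin_le) auto
  finally show ?case by simp
qed (simp add: source_term_def)

lemma exp_two_lsin: "sin (pi * x) \<noteq> 0 \<Longrightarrow> exp (2 * lsin x) = (2 * sin (pi * x))\<^sup>2"
  by (simp add: lsin_def exp_double abs_mult power_mult_distrib)

lemma image_term_exp: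
  assumes "\<And>j. j \<in> {1..n} \<Longrightarrow> sin (pi * xi M (int j)) \<noteq> 0"
  shows "image_term M n = exp (2 * (\<Sum>j\<in>{0<..int n}. lsin (xi M j)))"
proof -
  have "(\<Sum>j\<in>{0<..int n}. lsin (xi M j)) = (\<Sum>j\<in>{1..n}. lsin (xi M (int j)))"
    by (rule sum.reindex_bij_witness[of _ int nat]) auto
  then show ?thesis using assms exp_two_lsin
    by (simp add: image_term_def sum_distrib_left exp_sum)
qed

lemma source_term_exp:
  assumes "\<And>k. k \<in> {1..m} \<Longrightarrow> sin (pi * (real k * X)) \<noteq> 0"
  shows "source_term X m = exp (2 * (\<Sum>k=1..m. lsin (real k * X)))"
  using assms exp_two_lsin by (simp add: source_term_def sum_distrib_left exp_sum)

text \<open>The exponential form of \<open>bulk\<close>: inside \<open>J\<close> of the image, the summands of \<open>J X\<close> appear as factors.\<close>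
lemma bulk_product:
  assumes \<eta>: "0 < \<eta>" "\<eta> \<le> 1 / 4" and K: "K \<ge> 1"
  obtains C M0 where "C \<ge> 0" "M0 \<ge> 1"
    "\<And>M X s N m n. M \<ge> M0 \<Longrightarrow> admissible M X s N \<Longrightarrow> m < s \<Longrightarrow>
      real m + \<eta> \<le> real n / M \<Longrightarrow> real n / M \<le> real m + 1 - \<eta> \<Longrightarrow>
      \<exists>\<delta>. \<bar>\<delta>\<bar> \<le> real s * C * M * (1 / M) ^ K \<and> image_term M n = M * source_term X m * exp (log_amplitude M K (int n)) * exp \<delta>"
proof -
  show ?thesis
  proof (rule bulk[OF \<eta> K], goal_cases)
    case (1 C M0)
    show ?case
    proof (rule that[of "2 * C" M0])
      show "2 * C \<ge> 0" "M0 \<ge> 1" using 1 by auto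
      fix M X s N m n
      assume M: "M \<ge> M0" and ad: "admissible M X s N" and m: "m < s"
        and n: "real m + \<eta> \<le> real n / M" "real n / M \<le> real m + 1 - \<eta>"
      have M0: "M > 0" using M 1 by simp
      have "real n / M < real s" using n m \<eta> by linarith
      then have "real n < real N" using ad M0 by (simp add: admissible_def field_simps)
      then have nN: "n < N" by simp
      have kX: "sin (pi * (real k * X)) \<noteq> 0" if "k \<in> {1..m}" for k
        using ad that m by (auto simp: admissible_def)
      define \<delta> where "\<delta> = 2 * ((\<Sum>j\<in>{0<..int n}. lsin (xi M j)) - log_amplitude M K (int n) / 2 - ln M / 2 - (\<Sum>k=1..m. lsin (real k * X)))"
      have "\<bar>\<delta>\<bar> \<le> 2 * (real (m + 1) * C * M * (1 / M) ^ K)"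
        unfolding \<delta>_def abs_mult using 1(3)[OF M _ kX n] ad by (simp add: admissible_def)
      also have "\<dots> \<le> 2 * (real s * C * M * (1 / M) ^ K)"
        using m 1 M0 by (intro mult_left_mono mult_right_mono) auto
      finally have d: "\<bar>\<delta>\<bar> \<le> real s * (2 * C) * M * (1 / M) ^ K" by (simp add: mult_ac)
      have "image_term M n = exp (2 * (\<Sum>j\<in>{0<..int n}. lsin (xi M j)))"
        by (rule image_term_exp) (use ad nN in \<open>auto simp: admissible_def\<close>)
      also have "2 * (\<Sum>j\<in>{0<..int n}. lsin (xi M j)) = ln M + 2 * (\<Sum>k=1..m. lsin (real k * X)) + log_amplitude M K (int n) + \<delta>"
        by (simp add: \<delta>_def)
      also have "exp \<dots> = M * source_term X m * exp (log_amplitude M K (int n)) * exp \<delta>"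
        using M0 source_term_exp[OF kX] by (simp add: exp_add)
      finally show "\<exists>\<delta>. \<bar>\<delta>\<bar> \<le> real s * (2 * C) * M * (1 / M) ^ K \<and> image_term M n = M * source_term X m * exp (log_amplitude M K (int n)) * exp \<delta>"
        using d by blast
    qed
  qed
qed

lemma lob_small_near_one:
  assumes "\<epsilon> > 0"
  obtains \<eta> where "\<eta> > 0" "\<And>v. 1 - 2 * \<eta> \<le> v \<Longrightarrow> v \<le> 1 \<Longrightarrow> lob v \<le> \<epsilon>"
proof -
  have l1: "lob 1 = 0" using lob_shift_int[of 0 1] lob_0 by simp
  have "isCont lob 1" using continuous_on_lob[of UNIV] by (simp add: continuous_on_eq_continuous_at)
  then obtain \<delta> where \<delta>: "\<delta> > 0" "\<And>v. \<bar>v - 1\<bar> < \<delta> \<Longrightarrow> \<bar>lob v - lob 1\<bar> < \<epsilon>"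
    unfolding continuous_at_eps_delta using assms by (auto simp: dist_real_def)
  show ?thesis
  proof (rule that[of "\<delta> / 4"])
    show "\<delta> / 4 > 0" using \<delta> by simp
    fix v :: real assume "1 - 2 * (\<delta> / 4) \<le> v" "v \<le> 1"
    then have "\<bar>v - 1\<bar> < \<delta>" using \<delta>(1) by linarith
    from \<delta>(2)[OF this] show "lob v \<le> \<epsilon>" using l1 by linarith
  qed
qed

text \<open>The indices \<open>n < N\<close> are divided into the windows around \<open>(m + 5/6) M\<close> for \<open>m < s\<close> and the rest. A window
  contributes the \<open>m\<close>-th summand of \<open>J X\<close> times the same peak sum. For the rest, let \<open>v = n / M - m\<close>: if \<open>v\<close> is away from 0
  and 1, the quadratic bound for \<open>lob\<close> gives a factor \<open>exp (- const M powr (1/5))\<close>. If \<open>v\<close> is close to 0 or 1, the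
  estimate is transported from a nearby regular index, where \<open>lob\<close> is still small, at the cost of a factor 4 per step.\<close>
lemma total_expansion:
  assumes K: "K = 3 * Suc Q + 2" and D: "D \<ge> 1"
    and p: "\<exists>C\<ge>0. \<exists>M0\<ge>1. \<forall>M\<ge>M0. \<forall>m. \<bar>peak_sum K M m - sqrt M * poly p (pi / M)\<bar> \<le> C * (1 / M) ^ Q"
  shows "\<exists>C\<ge>0. \<exists>M0\<ge>1. \<forall>M\<ge>M0. \<forall>X s N. admissible M X s N \<longrightarrow> s \<le> D \<longrightarrow>
     \<bar>(\<Sum>n<N. image_term M n) - M * sqrt M * exp (2 * M * lob (5/6) / of_int c) * (\<Sum>m<s. source_term X m) * poly p (pi / M)\<bar>
     \<le> C * (M * sqrt M * exp (2 * M * lob (5/6) / of_int c) * (\<Sum>m<s. source_term X m)) * (1 / M) ^ Q"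
proof -
  obtain Cp Mp where Cp: "Cp \<ge> 0" "Mp \<ge> 1" "\<And>M m. M \<ge> Mp \<Longrightarrow> \<bar>peak_sum K M m - sqrt M * poly p (pi / M)\<bar> \<le> Cp * (1 / M) ^ Q"
    using p by blast
  obtain \<kappa> where \<kappa>: "\<kappa> > 0" "\<And>v. 0 \<le> v \<Longrightarrow> v < 1 \<Longrightarrow> lob v \<le> lob (5/6) - \<kappa> * (v - 5/6)\<^sup>2" "lob (5/6) > 0"
    using lob_peak_bound by blast
  define \<Lambda> where "\<Lambda> = lob (5/6)"
  have \<Lambda>: "\<Lambda> > 0" using \<kappa> by (simp add: \<Lambda>_def)
  have "\<Lambda> / 4 > 0" using \<Lambda> by simp
  then obtain \<eta>1 where \<eta>1: "\<eta>1 > 0" "\<And>v. 1 - 2 * \<eta>1 \<le> v \<Longrightarrow> v \<le> 1 \<Longrightarrow> lob v \<le> \<Lambda> / 4"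
    using lob_small_near_one by blast
  \<comment> \<open>The last entry limits the factor 4 per step, over at most \<open>3 \<eta> M\<close> steps, to a quarter of the peak exponent.\<close>
  define \<eta> where "\<eta> = min \<eta>1 (min (1/16) (\<Lambda> / (2 * of_int c) / (3 * ln 4)))"
  have ln4: "ln (4::real) > 0" by simp
  have \<eta>: "\<eta> > 0" "\<eta> \<le> 1/16" "\<eta> \<le> 1/4" "\<eta> \<le> \<eta>1" using \<eta>1 \<Lambda> c_real by (auto simp: \<eta>_def)
  have \<eta>ln: "3 * \<eta> * ln 4 \<le> \<Lambda> / (2 * of_int c)"
  proof -
    have "\<eta> \<le> \<Lambda> / (2 * of_int c) / (3 * ln 4)" by (simp add: \<eta>_def)
    then have "\<eta> * (3 * ln 4) \<le> \<Lambda> / (2 * of_int c) / (3 * ln 4) * (3 * ln 4)" using ln4 by (intro mult_right_mono) auto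
    then show ?thesis using ln4 by simp
  qed
  have K1: "K \<ge> 1" by (simp add: K)
  show ?thesis
  proof (rule bulk_product[OF \<eta>(1,3) K1], goal_cases)
  case (1 Cb Mb)
  note Cb = this
  show ?thesis
  proof (rule log_amplitude_crude[OF \<eta>(1,3), of K], goal_cases)
  case (1 Ca Ma)
  note Ca = this
  have "compact (poly p ` {0..pi})" by (intro compact_continuous_image continuous_intros) auto
  then obtain Bp where Bp: "\<And>z. z \<in> {0..pi} \<Longrightarrow> \<bar>poly p z\<bar> \<le> Bp"
    using compact_imp_bounded bounded_iff by (metis image_eqI real_norm_def)
  have Bp0: "Bp \<ge> 0" using Bp[of 0] by force
  define DC where "DC = real D * Cb"
  have DC: "DC \<ge> 0" using Cb by (simp add: DC_def)
  define \<beta> where "\<beta> = min (2 * \<kappa> / of_int c) (\<Lambda> / of_int c)"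
  have \<beta>: "\<beta> > 0" using \<kappa> \<Lambda> c_real by (simp add: \<beta>_def)
  obtain Ce where Ce: "Ce \<ge> 0" "\<And>M. M \<ge> 1 \<Longrightarrow> exp (- \<beta> * M powr (1/5)) \<le> Ce * (1 / M) ^ (Q + 2)"
    using exp_decay[OF \<beta>] by blast
  define C3 where "C3 = 4 ^ D * exp DC * exp Ca"
  have C3: "C3 \<ge> 1" unfolding C3_def using DC Ca by (intro mult_ge1_I) (auto simp: one_le_power)
  define C4 where "C4 = (Bp + Cp) * (DC * exp DC) + Cp"
  have C4: "C4 \<ge> 0" using Bp0 Cp DC by (simp add: C4_def)
  define C5 where "C5 = real D * C3 * Ce"
  have C5: "C5 \<ge> 0" using C3 Ce by (simp add: C5_def)
  \<comment> \<open>\<open>M \<ge> 16 powr (5/2)\<close> makes the window half-width \<open>M powr (3/5)\<close> at most \<open>M / 16\<close>, so the windows are disjoint and regular.\<close>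
  define M0 where "M0 = max (max Mp (max Mb Ma)) (max (1 / \<eta>) (16 powr (5/2)))"
  show ?case
  proof (rule exI[of _ "C4 + C5"], rule conjI[rotated], rule exI[of _ M0], intro conjI allI impI)
    show "M0 \<ge> 1" using Cp by (simp add: M0_def)
    show "C4 + C5 \<ge> 0" using C4 C5 by simp
    fix M X s N
    assume MM: "M \<ge> M0" and ad: "admissible M X s N" and sD: "s \<le> D"
    have M: "M \<ge> 1" "M \<ge> Mp" "M \<ge> Mb" "M \<ge> Ma" "M \<ge> 1 / \<eta>" "M \<ge> 16 powr (5/2)"
      using MM Cp by (auto simp: M0_def)
    have Mpos: "M > 0" using M by simp
    have iM: "1 / M \<le> \<eta>" using M(5) \<eta>(1) Mpos by (simp add: field_simps)
    have MX: "M = of_int c * X + of_int d" and s1: "s \<ge> 1" and NM: "real N = real s * M"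
      using ad by (auto simp: admissible_def)
    define E0 where "E0 = exp (2 * M * \<Lambda> / of_int c)"
    have E0: "E0 > 0" by (simp add: E0_def)
    define J' where "J' = (\<Sum>m<s. source_term X m)"
    have J1: "J' \<ge> 1"
    proof -
      have "source_term X 0 \<le> J'" unfolding J'_def using s1 source_term_nonneg by (intro member_le_sum) auto
      then show ?thesis by (simp add: source_term_def)
    qed
    have \<mu>: "real s * Cb * M * (1 / M) ^ K \<le> DC * (1 / M) ^ Q"
    proof -
      have "M * (1 / M) ^ K = (1 / M) ^ (K - 1)" using Mpos K1 by (cases K) auto
      also have "\<dots> \<le> (1 / M) ^ Q" using M by (intro power_decreasing) (auto simp: K)
      finally have "(real s * Cb) * (M * (1 / M) ^ K) \<le> (real D * Cb) * (1 / M) ^ Q"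
        using sD Cb Mpos by (intro mult_mono) auto
      then show ?thesis by (simp add: DC_def mult.assoc)
    qed
    have MQ1: "(1 / M) ^ Q \<le> 1" using M by (intro power_le_one) auto
    have \<mu>1: "real s * Cb * M * (1 / M) ^ K \<le> DC"
      using \<mu> mult_left_mono[OF MQ1 DC] by simp
    have upper: "image_term M n \<le> M * C3 * exp (2 * M * lob (real n / M - real m) / of_int c)"
      if m: "m < s" and n: "real m + \<eta> \<le> real n / M" "real n / M \<le> real m + 1 - \<eta>" for m n
    proof -
      obtain \<delta> where \<delta>: "\<bar>\<delta>\<bar> \<le> real s * Cb * M * (1 / M) ^ K" "image_term M n = M * source_term X m * exp (log_amplitude M K (int n)) * exp \<delta>"
        using Cb(3)[OF M(3) ad m n] by blast
      have "log_amplitude M K (int n) \<le> 2 * M * lob (of_int (int n) / M - of_int (int m)) / of_int c + Ca"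
        by (rule Ca(3)[OF M(4)]) (use n in auto)
      then have a: "exp (log_amplitude M K (int n)) \<le> exp Ca * exp (2 * M * lob (real n / M - real m) / of_int c)"
        by (simp add: exp_add[symmetric] add.commute)
      have e: "exp \<delta> \<le> exp DC" using \<delta>(1) \<mu>1 by simp
      have "source_term X m \<le> 4 ^ m" by (rule source_term_le)
      also have "(4::real) ^ m \<le> 4 ^ D" using m sD by (intro power_increasing) auto
      finally have q: "source_term X m \<le> 4 ^ D" .
      have "image_term M n \<le> M * 4 ^ D * (exp Ca * exp (2 * M * lob (real n / M - real m) / of_int c)) * exp DC"
        unfolding \<delta>(2) using q a e Mpos source_term_nonneg by (intro mult_mono) auto
      then show ?thesis by (simp add: C3_def mult_ac)
    qed
    define bd where "bd = M * C3 * (E0 * exp (- \<beta> * M powr (1/5)))"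
    have M15: "M powr (1/5) \<le> M" using M powr_mono[of "1/5" 1 M] by simp
    have half: "exp (2 * M * \<Lambda> / of_int c * (1/2)) \<le> E0 * exp (- \<beta> * M powr (1/5))"
    proof -
      have "\<beta> * M powr (1/5) \<le> (\<Lambda> / of_int c) * M"
        using M15 \<beta> \<Lambda> c_real by (intro mult_mono) (auto simp: \<beta>_def)
      moreover have "2 * M * \<Lambda> / of_int c * (1/2) = (\<Lambda> / of_int c) * M" "2 * M * \<Lambda> / of_int c = 2 * ((\<Lambda> / of_int c) * M)" by simp_all
      ultimately have "2 * M * \<Lambda> / of_int c * (1/2) \<le> 2 * M * \<Lambda> / of_int c + (- \<beta> * M powr (1/5))" by linarith
      then show ?thesis unfolding E0_def exp_add[symmetric] by simp
    qed
    have edge: "image_term M n \<le> bd" if n0: "n0 \<le> n" "m < s" "1 - 2 * \<eta> \<le> real n0 / M - real m" "real n0 / M - real m \<le> 1 - \<eta>"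
      and nn: "real n - real n0 \<le> 3 * \<eta> * M" for n n0 m
    proof -
      have l: "lob (real n0 / M - real m) \<le> \<Lambda> / 4" by (rule \<eta>1(2)) (use n0 \<eta> in auto)
      have "image_term M n0 \<le> M * C3 * exp (2 * M * lob (real n0 / M - real m) / of_int c)"
        by (rule upper[OF n0(2)]) (use n0 \<eta> in auto)
      also have "\<dots> \<le> M * C3 * exp (M * \<Lambda> / (2 * of_int c))"
      proof (intro mult_left_mono)
        have "2 * M * lob (real n0 / M - real m) / of_int c \<le> 2 * M * (\<Lambda> / 4) / of_int c"
          using l Mpos c_real by (intro divide_right_mono mult_left_mono) auto
        then show "exp (2 * M * lob (real n0 / M - real m) / of_int c) \<le> exp (M * \<Lambda> / (2 * of_int c))" by simp
      qed (use Mpos C3 in auto)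
      finally have P0: "image_term M n0 \<le> M * C3 * exp (M * \<Lambda> / (2 * of_int c))" .
      have four: "(4::real) ^ (n - n0) \<le> exp (M * \<Lambda> / (2 * of_int c))"
      proof -
        have "(4::real) ^ (n - n0) = exp (real (n - n0) * ln 4)" by (simp add: exp_of_nat_mult)
        also have "real (n - n0) * ln 4 \<le> (3 * \<eta> * M) * ln 4" using nn n0 ln4 by (intro mult_right_mono) (auto simp: of_nat_diff)
        also have "\<dots> \<le> M * (\<Lambda> / (2 * of_int c))" using mult_left_mono[OF \<eta>ln, of M] Mpos by (simp add: mult_ac)
        finally show ?thesis by simp
      qed
      have "image_term M n \<le> image_term M n0 * 4 ^ (n - n0)" by (rule image_term_growth[OF n0(1)])
      also have "\<dots> \<le> (M * C3 * exp (M * \<Lambda> / (2 * of_int c))) * exp (M * \<Lambda> / (2 * of_int c))"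
        using P0 four Mpos C3 by (intro mult_mono) auto
      also have "\<dots> = M * C3 * exp (2 * M * \<Lambda> / of_int c * (1/2))"
        by (simp add: exp_add[symmetric] mult.assoc)
      also have "\<dots> \<le> bd" unfolding bd_def using half Mpos C3 by (intro mult_left_mono) auto
      finally show ?thesis .
    qed
    have edge0: "image_term M n \<le> bd" if n: "real n \<le> \<eta> * M" for n
    proof -
      have "image_term M n \<le> image_term M 0 * 4 ^ (n - 0)" by (rule image_term_growth) simp
      also have "\<dots> = exp (real n * ln 4)" by (simp add: image_term_def exp_of_nat_mult)
      also have "\<dots> \<le> exp (2 * M * \<Lambda> / of_int c * (1/2))"
      proof -
        have "real n * ln 4 \<le> (3 * \<eta> * M) * ln 4" using n ln4 Mpos \<eta> by (intro mult_right_mono) auto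
        also have "\<dots> \<le> M * (\<Lambda> / (2 * of_int c))" using mult_left_mono[OF \<eta>ln, of M] Mpos by (simp add: mult_ac)
        also have "\<dots> \<le> M * (\<Lambda> / of_int c)" using \<Lambda> c_real Mpos by (intro mult_left_mono divide_left_mono) auto
        finally show ?thesis by simp
      qed
      also have "\<dots> \<le> 1 * (E0 * exp (- \<beta> * M powr (1/5)))" using half by simp
      also have "\<dots> \<le> bd" unfolding bd_def using M C3 mult_mono[of 1 M 1 C3] E0 by (intro mult_right_mono) auto
      finally show ?thesis .
    qed
    define T where "T = M powr (3/5)"
    have TM: "T / M \<le> 1/16"
    proof -
      have "(16 powr (5/2)) powr (2/5) \<le> M powr (2/5)" using M by (intro powr_mono2) auto
      then have "16 \<le> M powr (2/5)" unfolding powr_powr by simp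
      moreover have "T * M powr (2/5) = M" unfolding T_def using Mpos by (simp add: powr_add[symmetric])
      moreover have "T > 0" using Mpos by (simp add: T_def)
      ultimately have "T * 16 \<le> M" by (metis mult_left_mono less_imp_le)
      then show ?thesis using Mpos by (simp add: field_simps)
    qed
    define S where "S m = {n::nat. \<bar>real n - (real m + 5/6) * M\<bar> \<le> T}" for m
    have Sv: "\<bar>real n / M - (real m + 5/6)\<bar> \<le> 1/16" if "n \<in> S m" for n m
    proof -
      have "\<bar>real n / M - (real m + 5/6)\<bar> = \<bar>real n - (real m + 5/6) * M\<bar> / M"
      proof -
        have "real n / M - (real m + 5/6) = (real n - (real m + 5/6) * M) / M" using Mpos by (simp add: diff_divide_distrib)
        then show ?thesis using Mpos by (simp add: abs_divide)
      qed
      also have "\<dots> \<le> T / M" using that Mpos by (intro divide_right_mono) (auto simp: S_def)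
      finally show ?thesis using TM by linarith
    qed
    have far: "image_term M n \<le> bd" if n: "n < N" "\<And>m. m < s \<Longrightarrow> n \<notin> S m" for n
    proof -
      define m where "m = nat \<lfloor>real n / M\<rfloor>"
      have ndiv: "real n / M \<ge> 0" using Mpos by simp
      have m: "real m \<le> real n / M" "real n / M < real m + 1" using ndiv unfolding m_def by linarith+
      have "real n / M < real s" using n(1) NM Mpos by (simp add: field_simps flip: of_nat_less_iff[where 'a = real])
      then have ms: "m < s" using m by linarith
      define v where "v = real n / M - real m"
      have nv: "real n = (real m + v) * M" using Mpos by (simp add: v_def)
      consider "v < \<eta>" "m = 0" | "v < \<eta>" "m \<ge> 1" | "v > 1 - \<eta>" | "\<eta> \<le> v" "v \<le> 1 - \<eta>" by linarith
      then show ?thesis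
      proof cases
        case 1
        then show ?thesis using nv Mpos by (intro edge0) (simp add: mult_right_mono)
      next
        case 2
        \<comment> \<open>The last regular index before \<open>m M\<close>, which lies in the preceding period.\<close>
        define n0 where "n0 = nat \<lfloor>(real m - \<eta>) * M\<rfloor>"
        have "(real m - \<eta>) * M \<ge> 0" using 2 \<eta> Mpos by simp
        then have "real n0 \<le> (real m - \<eta>) * M" "(real m - \<eta>) * M - 1 \<le> real n0" unfolding n0_def by linarith+
        then have b: "real n0 / M \<le> real m - \<eta>" "real m - \<eta> - 1 / M \<le> real n0 / M"
          using Mpos by (simp_all add: divide_le_eq le_divide_eq left_diff_distrib)
        have rm: "real (m - 1) = real m - 1" using 2 by (simp add: of_nat_diff)
        show ?thesis
        proof (rule edge[of n0 n "m - 1"])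
          have "real n0 / M \<le> real n / M" using b m \<eta> by linarith
          then show "n0 \<le> n" using Mpos by (simp add: divide_le_cancel)
          have "real n / M - real n0 / M \<le> 3 * \<eta>" using b 2 iM by (simp add: v_def)
          then show "real n - real n0 \<le> 3 * \<eta> * M" using Mpos by (simp add: diff_divide_distrib[symmetric] divide_le_eq)
        qed (use b rm ms iM in linarith)+
      next
        case 3
        define n0 where "n0 = nat \<lfloor>(real m + 1 - \<eta>) * M\<rfloor>"
        have "(real m + 1 - \<eta>) * M \<ge> 0" using \<eta> Mpos by simp
        then have "real n0 \<le> (real m + 1 - \<eta>) * M" "(real m + 1 - \<eta>) * M - 1 \<le> real n0" unfolding n0_def by linarith+
        then have b: "real n0 / M \<le> real m + 1 - \<eta>" "real m + 1 - \<eta> - 1 / M \<le> real n0 / M"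
          using Mpos by (simp_all add: divide_le_eq le_divide_eq left_diff_distrib)
        show ?thesis
        proof (rule edge[of n0 n m])
          have "real n0 / M \<le> real n / M" using b 3 by (simp add: v_def)
          then show "n0 \<le> n" using Mpos by (simp add: divide_le_cancel)
          have "real n / M - real n0 / M \<le> 3 * \<eta>" using b m iM \<eta> by linarith
          then show "real n - real n0 \<le> 3 * \<eta> * M" using Mpos by (simp add: diff_divide_distrib[symmetric] divide_le_eq)
        qed (use b ms iM in linarith)+
      next
        case 4
        have "n \<notin> S m" using n(2) ms by blast
        then have t: "\<bar>real n - (real m + 5/6) * M\<bar> > T" by (simp add: S_def)
        have "M * (v - 5/6) = real n - (real m + 5/6) * M" using nv by (simp add: algebra_simps)
        then have "(M * (v - 5/6))\<^sup>2 \<ge> T\<^sup>2"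
          using t by (metis T_def abs_le_square_iff abs_of_nonneg less_imp_le powr_ge_zero)
        moreover have "T\<^sup>2 = M * M powr (1/5)" unfolding T_def using Mpos by (simp add: powr_power powr_mult_base)
        ultimately have "M * (M * (v - 5/6)\<^sup>2) \<ge> M * M powr (1/5)" by (simp add: power_mult_distrib power2_eq_square mult_ac)
        then have q: "M * (v - 5/6)\<^sup>2 \<ge> M powr (1/5)" using Mpos by simp
        have "lob v \<le> \<Lambda> - \<kappa> * (v - 5/6)\<^sup>2" unfolding \<Lambda>_def using 4 \<eta> by (intro \<kappa>(2)) auto
        then have "2 * M / of_int c * lob v \<le> 2 * M / of_int c * (\<Lambda> - \<kappa> * (v - 5/6)\<^sup>2)"
          using Mpos c_real by (intro mult_left_mono) auto
        also have "\<dots> = 2 * M * \<Lambda> / of_int c - (2 * \<kappa> / of_int c) * (M * (v - 5/6)\<^sup>2)"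
          by (simp add: right_diff_distrib diff_divide_distrib mult_ac)
        also have "\<dots> \<le> 2 * M * \<Lambda> / of_int c - \<beta> * M powr (1/5)"
          using q \<beta> \<kappa> c_real by (intro diff_left_mono mult_mono) (auto simp: \<beta>_def)
        finally have ex: "exp (2 * M * lob v / of_int c) \<le> E0 * exp (- \<beta> * M powr (1/5))"
          unfolding E0_def exp_add[symmetric] by simp
        have "image_term M n \<le> M * C3 * exp (2 * M * lob (real n / M - real m) / of_int c)"
          by (rule upper[OF ms]) (use 4 in \<open>auto simp: v_def\<close>)
        also have "\<dots> \<le> bd" unfolding bd_def v_def[symmetric] using ex Mpos C3 by (intro mult_left_mono) auto
        finally show ?thesis .
      qed
    qed
    have SN: "S m \<subseteq> {..<N}" if "m < s" for m
    proof
      fix n assume "n \<in> S m"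
      then have "real n / M < real m + 1" using Sv[of n m] by linarith
      also have "real m + 1 \<le> real s" using that by linarith
      finally show "n \<in> {..<N}" using NM Mpos by (simp add: field_simps flip: of_nat_less_iff[where 'a = real])
    qed
    have disj: "S m \<inter> S m' = {}" if "m \<noteq> m'" for m m'
    proof (rule ccontr)
      assume "S m \<inter> S m' \<noteq> {}"
      then obtain n where "n \<in> S m" "n \<in> S m'" by auto
      then have "\<bar>real m - real m'\<bar> \<le> 1/8" using Sv[of n m] Sv[of n m'] by linarith
      then show False using that by linarith
    qed
    define U where "U = (\<Union>m<s. S m)"
    have UN: "U \<subseteq> {..<N}" using SN by (auto simp: U_def)
    have finS: "finite (S m)" if "m < s" for m using SN[OF that] by (rule finite_subset) simp
    have sumU: "(\<Sum>n\<in>U. image_term M n) = (\<Sum>m<s. \<Sum>n\<in>S m. image_term M n)"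
      unfolding U_def by (rule sum.UNION_disjoint) (use finS disj in auto)
    have sumN: "(\<Sum>n<N. image_term M n) = (\<Sum>n\<in>{..<N} - U. image_term M n) + (\<Sum>n\<in>U. image_term M n)"
      by (rule sum.subset_diff[OF UN]) simp
    have rest: "\<bar>\<Sum>n\<in>{..<N} - U. image_term M n\<bar> \<le> C5 * E0 * (1 / M) ^ Q"
    proof -
      have "\<bar>\<Sum>n\<in>{..<N} - U. image_term M n\<bar> \<le> of_nat (card ({..<N} - U)) * bd"
        by (intro order.trans[OF sum_abs] sum_bounded_above) (use far image_term_nonneg in \<open>auto simp: U_def\<close>)
      also have "\<dots> \<le> (real D * M) * (M * C3 * (E0 * (Ce * (1 / M) ^ (Q + 2))))"
      proof (rule mult_mono)
        have "card ({..<N} - U) \<le> N" using card_mono[of "{..<N}" "{..<N} - U"] by simp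
        then have "real (card ({..<N} - U)) \<le> real s * M" using NM by (metis of_nat_mono)
        also have "\<dots> \<le> real D * M" using sD Mpos by (intro mult_right_mono) auto
        finally show "real (card ({..<N} - U)) \<le> real D * M" .
        show "bd \<le> M * C3 * (E0 * (Ce * (1 / M) ^ (Q + 2)))"
          unfolding bd_def using Ce(2)[OF M(1)] Mpos C3 E0 by (intro mult_left_mono) auto
      qed (use Mpos C3 E0 in \<open>auto simp: bd_def\<close>)
      also have "\<dots> = C5 * E0 * (1 / M) ^ Q" using Mpos by (simp add: C5_def power2_eq_square field_simps)
      finally show ?thesis .
    qed
    have near: "\<bar>(\<Sum>n\<in>S m. image_term M n) - source_term X m * (M * sqrt M * E0 * poly p (pi / M))\<bar> \<le> source_term X m * (M * sqrt M * E0 * C4 * (1 / M) ^ Q)"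
      if m: "m < s" for m
    proof -
      define Ps where "Ps = peak_sum K M (int m)"
      have Ps_eq: "(\<Sum>n\<in>S m. exp (log_amplitude M K (int n))) = E0 * Ps"
      proof -
        have "Ps = (\<Sum>n\<in>S m. exp (log_amplitude M K (int n) - 2 * M * \<Lambda> / of_int c))"
          unfolding Ps_def peak_sum_def \<Lambda>_def
        proof -
          have n0: "n \<ge> 0" if "\<bar>of_int n - (of_int (int m) + 5/6) * M\<bar> \<le> M powr (3/5)" for n :: int
          proof -
            have "T \<le> M / 16" using TM Mpos by (simp add: field_simps)
            moreover have "(real m + 5/6) * M \<ge> (5/6) * M" using Mpos by (intro mult_right_mono) auto
            ultimately have "of_int n \<ge> (0::real)" using that Mpos unfolding T_def of_int_of_nat_eq by linarith
            then show ?thesis by simp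
          qed
          show "(\<Sum>n | \<bar>of_int n - (of_int (int m) + 5/6) * M\<bar> \<le> M powr (3/5). exp (log_amplitude M K n - 2 * M * lob (5/6) / of_int c))
            = (\<Sum>n\<in>S m. exp (log_amplitude M K (int n) - 2 * M * lob (5/6) / of_int c))"
            by (rule sum.reindex_bij_witness[of _ int nat]) (use n0 in \<open>auto simp: S_def T_def\<close>)
        qed
        then have "E0 * Ps = (\<Sum>n\<in>S m. E0 * exp (log_amplitude M K (int n) - 2 * M * \<Lambda> / of_int c))" by (simp add: sum_distrib_left)
        then show ?thesis by (simp add: E0_def exp_add[symmetric])
      qed
      have Ps0: "Ps \<ge> 0" unfolding Ps_def peak_sum_def by (intro sum_nonneg) auto
      have Ps1: "\<bar>Ps - sqrt M * poly p (pi / M)\<bar> \<le> Cp * (1 / M) ^ Q" unfolding Ps_def by (rule Cp(3)[OF M(2)])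
      have sM: "sqrt M \<ge> 1" using M by simp
      have Ps2: "Ps \<le> sqrt M * (Bp + Cp)"
      proof -
        have "\<bar>poly p (pi / M)\<bar> \<le> Bp" by (rule Bp) (use M in \<open>auto simp: field_simps\<close>)
        then have "\<bar>sqrt M * poly p (pi / M)\<bar> \<le> sqrt M * Bp" using M by (simp add: abs_mult mult_left_mono)
        moreover have "Cp * (1 / M) ^ Q \<le> sqrt M * Cp" using mult_mono[OF sM MQ1] mult_left_mono[OF MQ1 Cp(1)] mult_right_mono[OF sM Cp(1)] by simp
        ultimately show ?thesis using Ps1 unfolding distrib_left by linarith
      qed
      have dev: "\<bar>(\<Sum>n\<in>S m. image_term M n) - M * source_term X m * (E0 * Ps)\<bar> \<le> M * source_term X m * (E0 * Ps) * (DC * exp DC * (1 / M) ^ Q)"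
      proof -
        have "\<bar>image_term M n - M * source_term X m * exp (log_amplitude M K (int n))\<bar> \<le> M * source_term X m * exp (log_amplitude M K (int n)) * (DC * exp DC * (1 / M) ^ Q)"
          if n: "n \<in> S m" for n
        proof -
          have "real m + \<eta> \<le> real n / M" "real n / M \<le> real m + 1 - \<eta>" using Sv[OF n] \<eta> by linarith+
          then obtain \<delta> where \<delta>: "\<bar>\<delta>\<bar> \<le> real s * Cb * M * (1 / M) ^ K" "image_term M n = M * source_term X m * exp (log_amplitude M K (int n)) * exp \<delta>"
            using Cb(3)[OF M(3) ad m, of n] by blast
          have "\<bar>exp \<delta> - 1\<bar> \<le> \<bar>\<delta>\<bar> * exp \<bar>\<delta>\<bar>" by (rule abs_exp_minus_one_le)
          also have "\<dots> \<le> (DC * (1 / M) ^ Q) * exp DC" using \<delta>(1) \<mu> \<mu>1 DC Mpos by (intro mult_mono) auto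
          finally have e: "\<bar>exp \<delta> - 1\<bar> \<le> DC * exp DC * (1 / M) ^ Q" by (simp add: mult_ac)
          have "image_term M n - M * source_term X m * exp (log_amplitude M K (int n)) = M * source_term X m * exp (log_amplitude M K (int n)) * (exp \<delta> - 1)"
            unfolding \<delta>(2) by (simp add: right_diff_distrib)
          then show ?thesis using mult_left_mono[OF e, of "M * source_term X m * exp (log_amplitude M K (int n))"] Mpos source_term_nonneg by (simp add: abs_mult)
        qed
        then have "\<bar>(\<Sum>n\<in>S m. image_term M n) - (\<Sum>n\<in>S m. M * source_term X m * exp (log_amplitude M K (int n)))\<bar>
          \<le> (\<Sum>n\<in>S m. M * source_term X m * exp (log_amplitude M K (int n)) * (DC * exp DC * (1 / M) ^ Q))" by (rule abs_sum_diff_le)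
        then show ?thesis unfolding Ps_eq[symmetric] sum_distrib_left sum_distrib_right by (simp add: mult.assoc)
      qed
      define F where "F = M * source_term X m * E0"
      have F0: "F \<ge> 0" using Mpos source_term_nonneg E0 by (simp add: F_def)
      have d1: "\<bar>(\<Sum>n\<in>S m. image_term M n) - F * Ps\<bar> \<le> F * (sqrt M * (Bp + Cp)) * (DC * exp DC * (1 / M) ^ Q)"
      proof -
        have "F * Ps * (DC * exp DC * (1 / M) ^ Q) \<le> F * (sqrt M * (Bp + Cp)) * (DC * exp DC * (1 / M) ^ Q)"
          using Ps2 F0 DC Mpos by (intro mult_right_mono mult_left_mono) auto
        then show ?thesis using dev by (simp add: F_def mult_ac)
      qed
      have d2: "\<bar>F * Ps - F * (sqrt M * poly p (pi / M))\<bar> \<le> F * (sqrt M * Cp * (1 / M) ^ Q)"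
      proof -
        have "Cp * (1 / M) ^ Q \<le> sqrt M * Cp * (1 / M) ^ Q" using sM Cp Mpos by (intro mult_right_mono) (auto simp: mult_le_cancel_right1)
        then have "F * \<bar>Ps - sqrt M * poly p (pi / M)\<bar> \<le> F * (sqrt M * Cp * (1 / M) ^ Q)"
          using Ps1 F0 by (intro mult_left_mono) auto
        then show ?thesis using F0 by (simp add: right_diff_distrib[symmetric] abs_mult)
      qed
      have "\<bar>(\<Sum>n\<in>S m. image_term M n) - F * (sqrt M * poly p (pi / M))\<bar> \<le> F * (sqrt M * (Bp + Cp)) * (DC * exp DC * (1 / M) ^ Q) + F * (sqrt M * Cp * (1 / M) ^ Q)"
        using d1 d2 by linarith
      also have "\<dots> = source_term X m * (M * sqrt M * E0 * C4 * (1 / M) ^ Q)" by (simp add: F_def C4_def algebra_simps)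
      finally show ?thesis by (simp add: F_def mult_ac)
    qed
    have "\<bar>(\<Sum>m<s. \<Sum>n\<in>S m. image_term M n) - (\<Sum>m<s. source_term X m * (M * sqrt M * E0 * poly p (pi / M)))\<bar> \<le> (\<Sum>m<s. source_term X m * (M * sqrt M * E0 * C4 * (1 / M) ^ Q))"
      by (rule abs_sum_diff_le) (use near in auto)
    then have nearsum: "\<bar>(\<Sum>n\<in>U. image_term M n) - M * sqrt M * E0 * J' * poly p (pi / M)\<bar> \<le> C4 * (M * sqrt M * E0 * J') * (1 / M) ^ Q"
      unfolding sumU sum_distrib_right[symmetric] J'_def[symmetric] by (simp add: mult_ac)
    have "C5 * E0 * (1 / M) ^ Q \<le> C5 * (M * sqrt M * E0 * J') * (1 / M) ^ Q"
    proof (intro mult_right_mono mult_left_mono)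
      have "1 * E0 \<le> (M * sqrt M * J') * E0"
        using M J1 E0 by (intro mult_right_mono mult_ge1_I) auto
      then show "E0 \<le> M * sqrt M * E0 * J'" by (simp add: mult_ac)
    qed (use C5 Mpos in auto)
    then show "\<bar>(\<Sum>n<N. image_term M n) - M * sqrt M * exp (2 * M * lob (5/6) / of_int c) * (\<Sum>m<s. source_term X m) * poly p (pi / M)\<bar>
     \<le> (C4 + C5) * (M * sqrt M * exp (2 * M * lob (5/6) / of_int c) * (\<Sum>m<s. source_term X m)) * (1 / M) ^ Q"
      using rest nearsum unfolding sumN J'_def[symmetric] \<Lambda>_def[symmetric] E0_def[symmetric] distrib_right by linarith
  qed
  qed
  qed
qed

end

section \<open>The sum J at a rational number and at its image\<close>

lemma root_of_unity_at_cis: "root_of_unity_at x = cis (2 * pi * real_of_rat x)"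
proof -
  have "(of_rat x :: complex) = of_real (real_of_rat x)"
    by (cases x) (simp add: Fract_of_int_quotient of_rat_divide)
  then show ?thesis by (simp add: root_of_unity_at_def cis_conv_exp mult_ac)
qed

lemma cmod_qpoch_square:
  "(cmod (qpoch (root_of_unity_at x) n))\<^sup>2 = (\<Prod>j=1..n. (2 * sin (pi * (real j * real_of_rat x)))\<^sup>2)"
proof -
  have "cmod (1 - root_of_unity_at x ^ j) = \<bar>2 * sin (pi * (real j * real_of_rat x))\<bar>" for j
    using cmod_one_minus_cis[of "real j * real_of_rat x"]
    by (simp add: root_of_unity_at_cis Complex.DeMoivre mult_ac)
  then have "cmod (qpoch (root_of_unity_at x) n) = (\<Prod>j=1..n. \<bar>2 * sin (pi * (real j * real_of_rat x))\<bar>)"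
    unfolding qpoch_def prod_norm[symmetric] by simp
  then show ?thesis by (simp only: prod_power_distrib power2_abs)
qed

text \<open>Any multiple \<open>N\<close> of the denominator may serve as the cut-off, since the factor of index \<open>N\<close> vanishes.\<close>
lemma J_eq_sum:
  assumes N: "N > 0" and x: "real N * real_of_rat x \<in> \<int>"
  shows "J x = (\<Sum>n<N. \<Prod>j=1..n. (2 * sin (pi * (real j * real_of_rat x)))\<^sup>2)"
  unfolding J_def cmod_qpoch_square
proof (rule suminf_finite)
  fix n assume "n \<notin> {..<N}"
  then have "N \<in> {1..n}" using N by auto
  moreover have "sin (pi * (real N * real_of_rat x)) = 0"
    using x by (metis Ints_cases mult.commute sin_npi_int)
  ultimately show "(\<Prod>j=1..n. (2 * sin (pi * (real j * real_of_rat x)))\<^sup>2) = 0"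
    by (intro prod_zero) (auto intro!: bexI[of _ N])
qed simp

lemma J_minus_int: "J (x - of_int t) = J x"
proof -
  have "root_of_unity_at (x - of_int t) = root_of_unity_at x"
    using cis_shift_int[of "real_of_rat x" "- t"] by (simp add: root_of_unity_at_cis of_rat_diff)
  then show ?thesis by (simp add: J_def)
qed

lemma sin_pi_rat_nonzero:
  assumes "coprime r s" "0 < k" "k < s"
  shows "sin (pi * (real_of_int k * (of_int r / of_int s))) \<noteq> 0"
proof
  assume "sin (pi * (real_of_int k * (of_int r / of_int s))) = 0"
  then obtain i where i: "pi * (real_of_int k * (of_int r / of_int s)) = of_int i * pi"
    unfolding sin_zero_iff_int2 by blast
  then have "real_of_int k * of_int r = of_int i * of_int s" using assms by (simp add: field_simps)
  then have "k * r = i * s" by (metis of_int_eq_iff of_int_mult)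
  then have "s dvd k * r" by simp
  then have "s dvd k" using assms(1) by (simp add: coprime_commute coprime_dvd_mult_left_iff)
  then show False using assms zdvd_not_zless by blast
qed

context sl2_mat
begin

text \<open>The determinant condition in the form \<open>(a X + b) / (c X + d) = a / c - 1 / (c M)\<close>.\<close>
lemma xi_moebius:
  assumes "M = of_int c * X + of_int d" "M \<noteq> 0"
  shows "xi M j = - (of_int j * ((of_int a * X + of_int b) / M))"
proof -
  have "of_int c * (of_int a * X + of_int b) = of_int a * M - (of_int (a * d - b * c) :: real)"
    by (simp add: assms(1) algebra_simps)
  then have "of_int c * (of_int a * X + of_int b) = of_int a * M - 1" using det by simp
  moreover define y where "y = of_int a * X + of_int b"
  ultimately have a: "real_of_int a = (1 + of_int c * y) / M" using assms(2) by (simp add: field_simps)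
  have "of_int j * ((1 + of_int c * y) / M) / of_int c = of_int j / (of_int c * M) + of_int j * (y / M)"
    using assms(2) c_real by (simp add: field_simps)
  then show ?thesis unfolding y_def[symmetric] unfolding xi_def a by linarith
qed

text \<open>For \<open>X = r / s\<close> the image is \<open>(a r + b s) / (c r + d s)\<close>, again in lowest terms as the inverse matrix has integral
  entries; so its denominator is \<open>N = s M\<close>.\<close>
lemma J_data:
  fixes X :: rat
  assumes M: "M = of_int c * real_of_rat X + of_int d" "M > 0"
  defines "s \<equiv> nat (rat_denom X)"
  obtains N where "admissible M (real_of_rat X) s N"
    "J X = (\<Sum>m<s. source_term (real_of_rat X) m)"
    "J ((of_int a * X + of_int b) / (of_int c * X + of_int d)) = (\<Sum>n<N. image_term M n)"
proof -
  obtain r s' where q: "quotient_of X = (r, s')" by (cases "quotient_of X")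
  have s': "s' > 0" "coprime r s'" "X = of_int r / of_int s'"
    using quotient_of_denom_pos[OF q] quotient_of_coprime[OF q] quotient_of_div[OF q] by auto
  have ss: "int s = s'" "real s = of_int s'" unfolding s_def rat_denom_def q using s'(1) by simp_all
  have X: "real_of_rat X = of_int r / of_int s'" by (simp add: s'(3) of_rat_divide)
  define N' where "N' = c * r + d * s'"
  have NM: "real_of_int N' = of_int s' * M" using s' by (simp add: N'_def M X field_simps)
  then have "real_of_int N' > 0" using s' M by simp
  then have N'0: "N' > 0" by simp
  define N where "N = nat N'"
  have N: "int N = N'" "real N = of_int N'" using N'0 by (auto simp: N_def)
  define y where "y = real_of_rat ((of_int a * X + of_int b) / (of_int c * X + of_int d))"
  have y: "y = (of_int a * real_of_rat X + of_int b) / M"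
    by (simp add: y_def M of_rat_divide of_rat_add of_rat_mult)
  have yN: "y = of_int (a * r + b * s') / of_int N'"
    unfolding y NM X using s' M(2) by (simp add: field_simps)
  have cop: "coprime (a * r + b * s') N'"
  proof (rule coprimeI)
    fix e assume e: "e dvd a * r + b * s'" "e dvd N'"
    have "e dvd d * (a * r + b * s') - b * N'" "e dvd a * N' - c * (a * r + b * s')"
      using e by simp_all
    moreover have "d * (a * r + b * s') - b * N' = (a * d - b * c) * r"
      "a * N' - c * (a * r + b * s') = (a * d - b * c) * s'" by (simp_all add: N'_def algebra_simps)
    ultimately have "e dvd r" "e dvd s'" using det by simp_all
    then show "is_unit e" using s'(2) by (rule coprime_common_divisor[rotated 1])
  qed
  have xiy: "xi M (int j) = - (real j * y)" for j
    using xi_moebius[OF M(1), of "int j"] M(2) y by simp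
  show ?thesis
  proof (rule that)
    show "J X = (\<Sum>m<s. source_term (real_of_rat X) m)"
      unfolding source_term_def by (rule J_eq_sum) (use s' ss X in auto)
    have "J ((of_int a * X + of_int b) / (of_int c * X + of_int d)) = (\<Sum>n<N. \<Prod>j=1..n. (2 * sin (pi * (real j * y)))\<^sup>2)"
      unfolding y_def by (rule J_eq_sum) (use N N'0 yN y_def in auto)
    also have "\<dots> = (\<Sum>n<N. image_term M n)" unfolding image_term_def xiy by simp
    finally show "J ((of_int a * X + of_int b) / (of_int c * X + of_int d)) = (\<Sum>n<N. image_term M n)" .
    have "sin (pi * (real k * real_of_rat X)) \<noteq> 0" if "k \<in> {1..<s}" for k
      using sin_pi_rat_nonzero[OF s'(2), of "int k"] that ss X by auto
    moreover have "sin (pi * xi M (int j)) \<noteq> 0" if "j \<in> {1..<N}" for j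
      using sin_pi_rat_nonzero[OF cop, of "int j"] that N yN by (auto simp: xiy)
    ultimately show "admissible M (real_of_rat X) s N"
      unfolding admissible_def using M ss s' N NM by auto
  qed
qed

lemma ratio_near_polynomial:
  assumes D: "D \<ge> 1"
    and p: "\<exists>C\<ge>0. \<exists>M0\<ge>1. \<forall>M\<ge>M0. \<forall>m. \<bar>peak_sum (3 * Suc Q + 2) M m - sqrt M * poly p (pi / M)\<bar> \<le> C * (1 / M) ^ Q"
  obtains C M0 where "C \<ge> 0" "M0 \<ge> 1"
    "\<And>X M. M = of_int c * real_of_rat X + of_int d \<Longrightarrow> M \<ge> M0 \<Longrightarrow> rat_denom X \<le> int D \<Longrightarrow>
      \<bar>J ((of_int a * X + of_int b) / (of_int c * X + of_int d)) /
        (M powr (3/2) * J X * exp (vol_figure_eight / (2 * pi) * (real_of_rat X + of_int d / of_int c)))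
       - poly p (pi / M)\<bar> \<le> C * (1 / M) ^ Q"
proof -
  obtain C M0 where C: "C \<ge> 0" "M0 \<ge> 1" and *: "\<forall>M\<ge>M0. \<forall>X s N. admissible M X s N \<longrightarrow> s \<le> D \<longrightarrow>
     \<bar>(\<Sum>n<N. image_term M n) - M * sqrt M * exp (2 * M * lob (5/6) / of_int c) * (\<Sum>m<s. source_term X m) * poly p (pi / M)\<bar>
     \<le> C * (M * sqrt M * exp (2 * M * lob (5/6) / of_int c) * (\<Sum>m<s. source_term X m)) * (1 / M) ^ Q"
    using total_expansion[OF refl D p] by blast
  show ?thesis
  proof (rule that[OF C])
    fix X M assume M: "M = of_int c * real_of_rat X + of_int d" "M \<ge> M0" and den: "rat_denom X \<le> int D"
    have M1: "M > 0" using M C by simp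
    obtain N where N: "admissible M (real_of_rat X) (nat (rat_denom X)) N"
      "J X = (\<Sum>m<nat (rat_denom X). source_term (real_of_rat X) m)"
      "J ((of_int a * X + of_int b) / (of_int c * X + of_int d)) = (\<Sum>n<N. image_term M n)"
      using J_data[OF M(1) M1] by blast
    have J0: "J X > 0"
    proof -
      have "nat (rat_denom X) \<ge> 1" using N(1) by (simp add: admissible_def)
      then have "source_term (real_of_rat X) 0 \<le> J X" unfolding N(2) using source_term_nonneg by (intro member_le_sum) auto
      then show ?thesis by (simp add: source_term_def)
    qed
    define W where "W = M powr (3/2) * J X * exp (vol_figure_eight / (2 * pi) * (real_of_rat X + of_int d / of_int c))"
    have "M powr (3/2) = M * sqrt M"
      using M1 powr_add[of M 1 "1/2"] by (simp add: powr_half_sqrt)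
    moreover have "2 * M * lob (5/6) / of_int c = vol_figure_eight / (2 * pi) * (real_of_rat X + of_int d / of_int c)"
      unfolding lob_peak M(1) using c_real by (simp add: field_simps)
    ultimately have W: "W = M * sqrt M * exp (2 * M * lob (5/6) / of_int c) * J X" by (simp add: W_def mult_ac)
    have W0: "W > 0" using M1 J0 by (simp add: W)
    define Y where "Y = J ((of_int a * X + of_int b) / (of_int c * X + of_int d))"
    have "nat (rat_denom X) \<le> D" using den by simp
    then have "\<bar>Y - W * poly p (pi / M)\<bar> \<le> C * W * (1 / M) ^ Q"
      using * M(2) N(1) unfolding Y_def W N(2,3) by blast
    then have "\<bar>Y - W * poly p (pi / M)\<bar> / W \<le> C * W * (1 / M) ^ Q / W" using W0 by (intro divide_right_mono) auto
    also have "\<dots> = C * (1 / M) ^ Q" using W0 by simp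
    also have "\<bar>Y - W * poly p (pi / M)\<bar> / W = \<bar>(Y - W * poly p (pi / M)) / W\<bar>" using W0 by (simp add: abs_divide)
    also have "(Y - W * poly p (pi / M)) / W = Y / W - poly p (pi / M)" using W0 by (simp add: diff_divide_distrib)
    finally show "\<bar>J ((of_int a * X + of_int b) / (of_int c * X + of_int d)) /
        (M powr (3/2) * J X * exp (vol_figure_eight / (2 * pi) * (real_of_rat X + of_int d / of_int c)))
       - poly p (pi / M)\<bar> \<le> C * (1 / M) ^ Q" unfolding Y_def W_def .
  qed
qed

end

section \<open>Existence and uniqueness of the asymptotic series\<close>

lemma poly_truncate:
  fixes p :: "real poly"
  assumes "B > 0"
  obtains C where "C \<ge> 0" "\<And>z. 0 \<le> z \<Longrightarrow> z \<le> B \<Longrightarrow> \<bar>poly p z - (\<Sum>k\<le>K. coeff p k * z ^ k)\<bar> \<le> C * z ^ Suc K"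
proof
  define g where "g = max K (degree p)"
  define C where "C = (\<Sum>k\<in>{K<..g}. \<bar>coeff p k\<bar> * B ^ (k - Suc K))"
  show "C \<ge> 0" unfolding C_def using assms by (intro sum_nonneg) auto
  fix z :: real assume z: "0 \<le> z" "z \<le> B"
  have "poly p z = (\<Sum>k\<le>g. coeff p k * z ^ k)"
    unfolding g_def poly_altdef by (rule sum.mono_neutral_left) (auto simp: coeff_eq_0)
  also have "{..g} = {..K} \<union> {K<..g}" by (auto simp: g_def)
  also have "(\<Sum>k\<in>\<dots>. coeff p k * z ^ k) = (\<Sum>k\<le>K. coeff p k * z ^ k) + (\<Sum>k\<in>{K<..g}. coeff p k * z ^ k)"
    by (rule sum.union_disjoint) auto
  finally have "\<bar>poly p z - (\<Sum>k\<le>K. coeff p k * z ^ k)\<bar> = \<bar>\<Sum>k\<in>{K<..g}. coeff p k * z ^ k\<bar>" by simp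
  also have "\<dots> \<le> (\<Sum>k\<in>{K<..g}. \<bar>coeff p k\<bar> * B ^ (k - Suc K) * z ^ Suc K)"
  proof (rule order.trans[OF sum_abs sum_mono])
    fix k assume k: "k \<in> {K<..g}"
    then have "k = (k - Suc K) + Suc K" by simp
    then have "z ^ k = z ^ (k - Suc K) * z ^ Suc K" by (metis power_add)
    moreover have "z ^ (k - Suc K) \<le> B ^ (k - Suc K)" using z by (intro power_mono)
    ultimately have "z ^ k \<le> B ^ (k - Suc K) * z ^ Suc K" using z by (metis mult_right_mono zero_le_power)
    then show "\<bar>coeff p k * z ^ k\<bar> \<le> \<bar>coeff p k\<bar> * B ^ (k - Suc K) * z ^ Suc K"
      using z by (simp add: abs_mult mult_left_mono mult.assoc del: power_Suc)
  qed
  also have "\<dots> = C * z ^ Suc K" by (simp only: C_def sum_distrib_right)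
  finally show "\<bar>poly p z - (\<Sum>k\<le>K. coeff p k * z ^ k)\<bar> \<le> C * z ^ Suc K" .
qed

lemma eventually_at_top_denom_le:
  "\<forall>\<^sub>F X in at_top_denom_le D. rat_denom X \<le> int D \<and> B \<le> real_of_rat X"
proof -
  have "\<forall>\<^sub>F X :: rat in at_top. of_int \<lceil>B\<rceil> \<le> X" by (rule eventually_ge_at_top)
  then show ?thesis unfolding at_top_denom_le_def eventually_inf_principal
  proof eventually_elim
    case (elim X)
    then have "real_of_rat (of_int \<lceil>B\<rceil>) \<le> real_of_rat X" by (simp only: of_rat_less_eq)
    then show ?case by simp linarith
  qed
qed

lemma at_top_denom_le_neq_bot:
  assumes "D \<ge> 1"
  shows "at_top_denom_le D \<noteq> bot"
proof
  assume "at_top_denom_le D = bot"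
  then have "\<forall>\<^sub>F X in at_top. X \<notin> {X. rat_denom X \<le> int D}"
    unfolding at_top_denom_le_def trivial_limit_def eventually_inf_principal by simp
  then obtain B where B: "\<And>X. X \<ge> B \<Longrightarrow> rat_denom X > int D"
    unfolding eventually_at_top_linorder by force
  have "rat_denom (of_int \<lceil>B\<rceil>) = 1" by (simp add: rat_denom_def)
  then show False using B[of "of_int \<lceil>B\<rceil>"] assms by simp
qed

lemma bigo_tendsto_zero:
  assumes "f \<in> O[F](g)" "(g \<longlongrightarrow> 0) F"
  shows "(f \<longlongrightarrow> 0) F"
proof -
  obtain C where "\<forall>\<^sub>F x in F. norm (f x) \<le> C * norm (g x)" using assms(1) by (elim landau_o.bigE) auto
  then show ?thesis using assms(2) by (intro tendsto_0_le[of g F f C]) (auto simp: mult.commute)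
qed

text \<open>The limit of the sum is its constant coefficient; once that is known to vanish, a factor \<open>h\<close> cancels from both sides.\<close>
lemma expansion_coeffs_zero:
  fixes h :: "'a \<Rightarrow> complex"
  assumes F: "F \<noteq> bot" and h: "(h \<longlongrightarrow> 0) F" "\<forall>\<^sub>F x in F. h x \<noteq> 0"
    and O: "(\<lambda>x. \<Sum>k<K. A k * h x ^ k) \<in> O[F](\<lambda>x. h x ^ K)"
  shows "\<forall>k<K. A k = 0"
  using O
proof (induction K arbitrary: A)
  case (Suc K)
  have split: "(\<Sum>k<Suc K. A k * h x ^ k) = A 0 + h x * (\<Sum>k<K. A (Suc k) * h x ^ k)" for x
    by (simp only: sum.lessThan_Suc_shift) (simp add: sum_distrib_left mult_ac)
  have "((\<lambda>x. h x ^ Suc K) \<longlongrightarrow> 0 ^ Suc K) F" by (intro tendsto_intros h)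
  then have "((\<lambda>x. \<Sum>k<Suc K. A k * h x ^ k) \<longlongrightarrow> 0) F"
    using bigo_tendsto_zero[OF Suc.prems] by simp
  moreover have "((\<lambda>x. A 0 + h x * (\<Sum>k<K. A (Suc k) * h x ^ k)) \<longlongrightarrow> A 0 + 0 * (\<Sum>k<K. A (Suc k) * 0 ^ k)) F"
    by (intro tendsto_intros h)
  ultimately have A0: "A 0 = 0" using F tendsto_unique unfolding split by force
  have "(\<lambda>x. h x * (\<Sum>k<K. A (Suc k) * h x ^ k)) \<in> O[F](\<lambda>x. h x * h x ^ K)"
    using Suc.prems unfolding split by (simp add: A0)
  then have "(\<lambda>x. \<Sum>k<K. A (Suc k) * h x ^ k) \<in> O[F](\<lambda>x. h x ^ K)"
    by (subst (asm) landau_o.big.mult_cancel_left) (use h in auto)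
  then have "\<forall>k<K. A (Suc k) = 0" by (rule Suc.IH)
  then show ?case using A0 by (metis less_Suc_eq_0_disj)
qed simp

definition modular_ratio :: "int \<Rightarrow> int \<Rightarrow> int \<Rightarrow> int \<Rightarrow> rat \<Rightarrow> complex" where
  "modular_ratio a b c d X = complex_of_real
     (J ((of_int a * X + of_int b) / (of_int c * X + of_int d)) /
       ((real_of_int c * real_of_rat X + real_of_int d) powr (3 / 2) * J X *
         exp (vol_figure_eight / (2 * pi) * (real_of_rat X + real_of_int d / real_of_int c))))"

definition q_param :: "int \<Rightarrow> int \<Rightarrow> rat \<Rightarrow> complex" where
  "q_param c d X = 2 * complex_of_real pi * \<i> / (of_int c * (of_int c * of_rat X + of_int d))"

definition expands :: "int \<Rightarrow> int \<Rightarrow> int \<Rightarrow> int \<Rightarrow> nat \<Rightarrow> nat \<Rightarrow> (nat \<Rightarrow> complex) \<Rightarrow> bool" where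
  "expands a b c d D K A \<longleftrightarrow>
     (\<lambda>X. modular_ratio a b c d X - (\<Sum>k=0..K. A k * q_param c d X ^ k)) \<in> O[at_top_denom_le D](\<lambda>X. 1 / of_rat X ^ (K + 1))"

lemma of_rat_complex: "(of_rat X :: complex) = of_real (real_of_rat X)"
  by (cases X) (simp add: Fract_of_int_quotient of_rat_divide)

lemma q_param_of_real:
  "q_param c d X = of_real (2 * pi / (of_int c * (of_int c * real_of_rat X + of_int d))) * \<i>"
  by (simp add: q_param_def of_rat_complex)

lemma norm_inverse_of_rat_power: "norm (1 / of_rat X ^ n :: complex) = 1 / \<bar>real_of_rat X\<bar> ^ n"
  by (simp add: of_rat_complex norm_divide norm_power)

lemma c_X_d_bounds:
  fixes x :: real
  assumes "c > 0" "x \<ge> 1 + 2 * \<bar>real_of_int d\<bar>"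
  shows "of_int c * x + of_int d \<ge> x / 2" "of_int c * x + of_int d \<le> (of_int c + 1) * x"
proof -
  have "real_of_int c \<ge> 1" using assms by simp
  then have "of_int c * x \<ge> 1 * x" using assms by (intro mult_right_mono) auto
  then show "of_int c * x + of_int d \<ge> x / 2" using assms(2) by linarith
  show "of_int c * x + of_int d \<le> (of_int c + 1) * x" using assms(2) by (simp add: distrib_right)
qed

lemma q_param_bigtheta:
  assumes c: "c > 0"
  shows "q_param c d \<in> \<Theta>[at_top_denom_le D](\<lambda>X. 1 / of_rat X)" "\<forall>\<^sub>F X in at_top_denom_le D. q_param c d X \<noteq> 0"
    "(q_param c d \<longlongrightarrow> 0) (at_top_denom_le D)"
proof -
  let ?F = "at_top_denom_le D"
  have C: "real_of_int c > 0" using c by simp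
  have ev: "\<forall>\<^sub>F X in ?F. 1 + 2 * \<bar>real_of_int d\<bar> \<le> real_of_rat X"
    using eventually_at_top_denom_le by (rule eventually_mono) auto
  have n: "norm (q_param c d X) = 2 * pi / (of_int c * (of_int c * real_of_rat X + of_int d))"
    "norm (1 / of_rat X :: complex) = 1 / real_of_rat X"
    if X: "1 + 2 * \<bar>real_of_int d\<bar> \<le> real_of_rat X" for X
  proof -
    have x: "real_of_rat X > 0" using X by linarith
    then have y: "of_int c * real_of_rat X + of_int d > 0" using c_X_d_bounds(1)[OF c X] by linarith
    show "norm (q_param c d X) = 2 * pi / (of_int c * (of_int c * real_of_rat X + of_int d))"
      unfolding q_param_of_real norm_mult norm_ii norm_of_real mult_1_right
      by (rule abs_of_nonneg) (intro divide_nonneg_nonneg mult_nonneg_nonneg less_imp_le[OF y] less_imp_le[OF C], simp_all)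
    show "norm (1 / of_rat X :: complex) = 1 / real_of_rat X"
      using norm_inverse_of_rat_power[of X 1] x by simp
  qed
  have O1: "q_param c d \<in> O[?F](\<lambda>X. 1 / of_rat X)"
  proof (rule bigoI[of _ "4 * pi / of_int c"])
    show "\<forall>\<^sub>F X in ?F. norm (q_param c d X) \<le> 4 * pi / of_int c * norm (1 / of_rat X :: complex)"
      using ev
    proof eventually_elim
      case (elim X)
      have x: "real_of_rat X > 0" using elim by linarith
      then have y: "of_int c * real_of_rat X + of_int d > 0" using c_X_d_bounds(1)[OF c elim] by linarith
      have "2 * pi / (of_int c * (of_int c * real_of_rat X + of_int d)) \<le> 2 * pi / (of_int c * (real_of_rat X / 2))"
      proof (rule divide_left_mono)
        show "of_int c * (real_of_rat X / 2) \<le> of_int c * (of_int c * real_of_rat X + of_int d)"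
          using c_X_d_bounds(1)[OF c elim] by (rule mult_left_mono) (rule less_imp_le[OF C])
        show "0 < of_int c * (of_int c * real_of_rat X + of_int d) * (of_int c * (real_of_rat X / 2))"
          by (intro mult_pos_pos C y half_gt_zero x)
      qed simp
      then show ?case unfolding n[OF elim] by simp
    qed
  qed
  moreover have O2: "(\<lambda>X. 1 / of_rat X) \<in> O[?F](q_param c d)"
  proof (rule bigoI[of _ "of_int c * (of_int c + 1) / (2 * pi)"])
    show "\<forall>\<^sub>F X in ?F. norm (1 / of_rat X :: complex) \<le> of_int c * (of_int c + 1) / (2 * pi) * norm (q_param c d X)"
      using ev
    proof eventually_elim
      case (elim X)
      define y where "y = of_int c * real_of_rat X + of_int d"
      have x: "real_of_rat X > 0" using elim by linarith
      have y: "y > 0" "y \<le> (of_int c + 1) * real_of_rat X" using c_X_d_bounds[OF c elim] x unfolding y_def by linarith+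
      have "1 / real_of_rat X \<le> (of_int c + 1) / y" using x y by (simp add: field_simps)
      also have "\<dots> = of_int c * (of_int c + 1) / (2 * pi) * (2 * pi / (of_int c * y))" using C y by simp
      finally show ?case unfolding n[OF elim] y_def .
    qed
  qed
  ultimately show "q_param c d \<in> \<Theta>[?F](\<lambda>X. 1 / of_rat X)" by (simp add: bigtheta_def bigomega_iff_bigo)
  show "\<forall>\<^sub>F X in ?F. q_param c d X \<noteq> 0"
    using ev
  proof eventually_elim
    case (elim X)
    have "of_int c * real_of_rat X + of_int d > 0" using c_X_d_bounds(1)[OF c elim] elim by linarith
    then have "0 < norm (q_param c d X)" unfolding n(1)[OF elim] by (intro divide_pos_pos mult_pos_pos C) simp_all
    then show ?case by simp
  qed
  have "filterlim real_of_rat at_top ?F"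
    unfolding filterlim_at_top
  proof
    fix B :: real
    show "\<forall>\<^sub>F X in ?F. B \<le> real_of_rat X" using eventually_at_top_denom_le[of D B] by (rule eventually_mono) simp
  qed
  then have "((\<lambda>X. 1 / real_of_rat X) \<longlongrightarrow> 0) ?F" by (rule real_tendsto_divide_at_top[OF tendsto_const])
  then have "((\<lambda>X. 1 / of_rat X :: complex) \<longlongrightarrow> 0) ?F"
    unfolding of_rat_complex using tendsto_of_real[of "\<lambda>X. 1 / real_of_rat X" 0 ?F, where 'a = complex] by simp
  then show "(q_param c d \<longlongrightarrow> 0) ?F" by (rule bigo_tendsto_zero[OF O1])
qed

lemma q_param_power_bigtheta:
  assumes "c > 0"
  shows "(\<lambda>X. q_param c d X ^ k) \<in> \<Theta>[at_top_denom_le D](\<lambda>X. 1 / of_rat X ^ k)"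
proof -
  have "(\<lambda>X. q_param c d X ^ k) \<in> O[at_top_denom_le D](\<lambda>X. (1 / of_rat X) ^ k)"
    "(\<lambda>X. (1 / of_rat X) ^ k) \<in> O[at_top_denom_le D](\<lambda>X. q_param c d X ^ k)"
    using q_param_bigtheta(1)[OF assms, of d D]
    by (auto intro!: landau_o.big_power simp: bigtheta_def bigomega_iff_bigo)
  then show ?thesis by (simp add: bigtheta_def bigomega_iff_bigo power_one_over)
qed

lemma expands_mono:
  assumes c: "c > 0" and K: "K \<le> K'" and ex: "expands a b c d D K' A"
  shows "expands a b c d D K A"
  using K ex
proof (induction K' rule: dec_induct)
  case (step K')
  let ?F = "at_top_denom_le D"
  have "(\<lambda>X. A (Suc K') * q_param c d X ^ Suc K') \<in> O[?F](\<lambda>X. 1 / of_rat X ^ (K' + 1))"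
    using q_param_power_bigtheta[OF c, of d "Suc K'" D] by (simp add: bigtheta_def del: power_Suc)
  moreover have "(\<lambda>X. 1 / of_rat X ^ (Suc K' + 1) :: complex) \<in> O[?F](\<lambda>X. 1 / of_rat X ^ (K' + 1))"
  proof (rule bigoI[of _ 1])
    show "\<forall>\<^sub>F X in ?F. norm (1 / of_rat X ^ (Suc K' + 1) :: complex) \<le> 1 * norm (1 / of_rat X ^ (K' + 1) :: complex)"
      using eventually_at_top_denom_le[of D 1]
    proof eventually_elim
      case (elim X)
      have "1 / \<bar>real_of_rat X\<bar> ^ (Suc K' + 1) \<le> 1 / \<bar>real_of_rat X\<bar> ^ (K' + 1)"
        using elim by (intro divide_left_mono power_increasing mult_pos_pos zero_less_power) auto
      then show ?case unfolding norm_inverse_of_rat_power by linarith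
    qed
  qed
  moreover have "(\<lambda>X. modular_ratio a b c d X - (\<Sum>k=0..Suc K'. A k * q_param c d X ^ k)) \<in> O[?F](\<lambda>X. 1 / of_rat X ^ (Suc K' + 1))"
    using step.prems unfolding expands_def .
  ultimately have "(\<lambda>X. (modular_ratio a b c d X - (\<Sum>k=0..Suc K'. A k * q_param c d X ^ k)) + A (Suc K') * q_param c d X ^ Suc K')
      \<in> O[?F](\<lambda>X. 1 / of_rat X ^ (K' + 1))"
    using landau_o.big.trans by (intro sum_in_bigo(1)) blast+
  then have "expands a b c d D K' A" by (simp add: expands_def del: power_Suc)
  then show ?case by (rule step.IH)
qed simp

lemma expands_unique:
  assumes c: "c > 0" and D: "D \<ge> 1" and A: "expands a b c d D K A" and B: "expands a b c d D K B" and k: "k \<le> K"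
  shows "A k = B k"
proof -
  let ?F = "at_top_denom_le D"
  have "(\<lambda>X. (modular_ratio a b c d X - (\<Sum>k=0..K. B k * q_param c d X ^ k)) - (modular_ratio a b c d X - (\<Sum>k=0..K. A k * q_param c d X ^ k)))
      \<in> O[?F](\<lambda>X. 1 / of_rat X ^ (K + 1))"
    using A B unfolding expands_def by (rule sum_in_bigo(2)[rotated])
  also have "(\<lambda>X. (modular_ratio a b c d X - (\<Sum>k=0..K. B k * q_param c d X ^ k)) - (modular_ratio a b c d X - (\<Sum>k=0..K. A k * q_param c d X ^ k)))
    = (\<lambda>X. \<Sum>k<Suc K. (A k - B k) * q_param c d X ^ k)"
    by (simp only: lessThan_Suc_atMost atMost_atLeast0 left_diff_distrib sum_subtractf) simp
  also have "O[?F](\<lambda>X. 1 / of_rat X ^ (K + 1)) = O[?F](\<lambda>X. q_param c d X ^ Suc K)"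
    using landau_o.big.cong_bigtheta[OF q_param_power_bigtheta[OF c, of d "Suc K" D]] by simp
  finally have "\<forall>k<Suc K. A k - B k = 0"
    by (rule expansion_coeffs_zero[OF at_top_denom_le_neq_bot[OF D] q_param_bigtheta(3,2)[OF c]])
  then show ?thesis using k by auto
qed

lemma algebraic_of_real:
  assumes "algebraic (x :: real)"
  shows "algebraic (complex_of_real x)"
proof -
  obtain p where p: "\<And>i. coeff p i \<in> \<int>" "p \<noteq> 0" "poly p x = 0" using algebraicE[OF assms] by blast
  let ?p = "map_poly complex_of_real p"
  have co: "coeff ?p i = of_real (coeff p i)" for i by (simp add: coeff_map_poly)
  have of_real_poly: "poly ?p (of_real x) = of_real (poly p x)"
    by (induction p) (auto simp: map_poly_pCons)
  show ?thesis
  proof (rule algebraicI[of ?p])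
    show "coeff ?p i \<in> \<int>" for i using p(1)[of i] by (auto simp: co elim!: Ints_cases)
    show "?p \<noteq> 0" using p(2) co by (metis coeff_0 of_real_eq_0_iff poly_eqI)
    show "poly ?p (of_real x) = 0" using p(3) of_real_poly by simp
  qed
qed

text \<open>The polynomial comes from one matrix with first column \<open>(a, c)\<close> but serves all of them, because the peak sum
  does not involve \<open>b\<close> and \<open>d\<close>.\<close>
lemma expands_exists:
  assumes det0: "a * d0 - b0 * c = 1" and c: "c > 0"
  obtains A where "\<And>k. algebraic (A k)"
    "\<And>b d D. a * d - b * c = 1 \<Longrightarrow> D \<ge> 1 \<Longrightarrow> expands a b c d D K A"
proof -
  interpret g0: sl2_mat a b0 c d0 by unfold_locales (use assms in auto)
  obtain p where p: "\<And>i. algebraic (coeff p i)"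
    and ps: "\<exists>C\<ge>0. \<exists>M0\<ge>1. \<forall>M\<ge>M0. \<forall>m. \<bar>sl2_mat.peak_sum a c (3 * Suc (Suc K) + 2) M m - sqrt M * poly p (pi / M)\<bar> \<le> C * (1 / M) ^ Suc K"
    using g0.peak_sum_expansion[OF refl, of "Suc K"] by blast
  have C: "real_of_int c > 0" using c by simp
  \<comment> \<open>The polynomial is in \<open>\<pi> / M\<close>, whereas the expansion parameter is \<open>2 \<pi> \<i> / (c M)\<close>.\<close>
  define A where "A k = of_real (coeff p k) * (of_int c / (2 * \<i>)) ^ k" for k
  show ?thesis
  proof (rule that)
    show "algebraic (A k)" for k unfolding A_def
      by (intro algebraic_mult algebraic_power algebraic_divide algebraic_of_real p algebraic_of_int algebraic_numeral algebraic_ii)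
    fix b d :: int and D :: nat assume det: "a * d - b * c = 1" and D: "D \<ge> 1"
    interpret g: sl2_mat a b c d by unfold_locales (use det c in auto)
    obtain C1 M1 where C1: "C1 \<ge> 0" "M1 \<ge> 1" and r: "\<And>X M. M = of_int c * real_of_rat X + of_int d \<Longrightarrow> M \<ge> M1 \<Longrightarrow> rat_denom X \<le> int D \<Longrightarrow>
      \<bar>J ((of_int a * X + of_int b) / (of_int c * X + of_int d)) /
        (M powr (3/2) * J X * exp (vol_figure_eight / (2 * pi) * (real_of_rat X + of_int d / of_int c)))
       - poly p (pi / M)\<bar> \<le> C1 * (1 / M) ^ Suc K"
      using g.ratio_near_polynomial[OF D ps] by blast
    obtain C2 where C2: "C2 \<ge> 0" "\<And>z. 0 \<le> z \<Longrightarrow> z \<le> pi \<Longrightarrow> \<bar>poly p z - (\<Sum>k\<le>K. coeff p k * z ^ k)\<bar> \<le> C2 * z ^ Suc K"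
      using poly_truncate[OF pi_gt_zero] by blast
    show "expands a b c d D K A" unfolding expands_def
    proof (rule bigoI[of _ "(C1 + C2 * pi ^ Suc K) * 2 ^ Suc K"])
      show "\<forall>\<^sub>F X in at_top_denom_le D. norm (modular_ratio a b c d X - (\<Sum>k=0..K. A k * q_param c d X ^ k))
          \<le> (C1 + C2 * pi ^ Suc K) * 2 ^ Suc K * norm (1 / of_rat X ^ (K + 1) :: complex)"
        using eventually_at_top_denom_le[of D "max (2 * M1) (1 + 2 * \<bar>real_of_int d\<bar>)"]
      proof eventually_elim
        case (elim X)
        define x where "x = real_of_rat X"
        define M where "M = of_int c * x + of_int d"
        have x: "x \<ge> 2 * M1" "x \<ge> 1 + 2 * \<bar>real_of_int d\<bar>" using elim by (auto simp: x_def)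
        have x0: "x > 0" using x C1 by linarith
        have Mx: "M \<ge> x / 2" unfolding M_def by (rule c_X_d_bounds(1)[OF c x(2)])
        have M: "M \<ge> M1" "M \<ge> 1" "M > 0" using Mx x C1 by linarith+
        define R where "R = J ((of_int a * X + of_int b) / (of_int c * X + of_int d)) /
          (M powr (3/2) * J X * exp (vol_figure_eight / (2 * pi) * (real_of_rat X + of_int d / of_int c)))"
        have R: "modular_ratio a b c d X = of_real R" by (simp add: modular_ratio_def R_def M_def x_def)
        have summand: "A k * q_param c d X ^ k = of_real (coeff p k * (pi / M) ^ k)" for k
        proof -
          have "of_int c / (2 * \<i>) * q_param c d X = of_real (pi / M)"
            unfolding q_param_of_real x_def[symmetric] M_def[symmetric] using C M by (simp add: field_simps)
          then show ?thesis unfolding A_def mult.assoc power_mult_distrib[symmetric] by simp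
        qed
        have "modular_ratio a b c d X - (\<Sum>k=0..K. A k * q_param c d X ^ k) = of_real (R - (\<Sum>k\<le>K. coeff p k * (pi / M) ^ k))"
          unfolding R summand by (simp add: atMost_atLeast0)
        then have "norm (modular_ratio a b c d X - (\<Sum>k=0..K. A k * q_param c d X ^ k)) = \<bar>R - (\<Sum>k\<le>K. coeff p k * (pi / M) ^ k)\<bar>"
          by (simp only: norm_of_real)
        also have "\<dots> \<le> C1 * (1 / M) ^ Suc K + C2 * (pi / M) ^ Suc K"
        proof -
          have "\<bar>R - poly p (pi / M)\<bar> \<le> C1 * (1 / M) ^ Suc K"
            unfolding R_def by (rule r) (use M elim in \<open>auto simp: M_def x_def\<close>)
          moreover have "\<bar>poly p (pi / M) - (\<Sum>k\<le>K. coeff p k * (pi / M) ^ k)\<bar> \<le> C2 * (pi / M) ^ Suc K"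
            by (rule C2(2)) (use M in \<open>auto simp: divide_le_eq\<close>)
          ultimately show ?thesis by linarith
        qed
        also have "\<dots> = (C1 + C2 * pi ^ Suc K) * (1 / M) ^ Suc K"
          by (simp add: power_divide add_divide_distrib del: power_Suc)
        also have "\<dots> \<le> (C1 + C2 * pi ^ Suc K) * (2 / x) ^ Suc K"
        proof (intro mult_left_mono power_mono)
          show "1 / M \<le> 2 / x" using Mx M x0 by (simp add: field_simps)
        qed (use C1 C2 M in auto)
        also have "\<dots> = (C1 + C2 * pi ^ Suc K) * 2 ^ Suc K * norm (1 / of_rat X ^ (K + 1) :: complex)"
          unfolding norm_inverse_of_rat_power x_def[symmetric] using x0 by (simp add: power_divide)
        finally show ?case .
      qed
    qed
  qed
qed

text \<open>By uniqueness the coefficients found for order \<open>K\<close> begin with those found for every smaller order, so the diagonal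
  choice \<open>G k k\<close> works for all orders.\<close>
lemma all_orders_exists:
  assumes det0: "a * d0 - b0 * c = 1" and c: "c > 0"
  obtains \<phi> :: "complex fps" where "\<And>k. algebraic (fps_nth \<phi> k)"
    "\<And>b d D K. a * d - b * c = 1 \<Longrightarrow> D \<ge> 1 \<Longrightarrow> expands a b c d D K (fps_nth \<phi>)"
proof -
  have "\<forall>K. \<exists>A. (\<forall>k. algebraic (A k)) \<and> (\<forall>b d D. a * d - b * c = 1 \<longrightarrow> D \<ge> 1 \<longrightarrow> expands a b c d D K A)"
    using expands_exists[OF assms] by metis
  from choice[OF this] obtain G where G: "\<And>K k. algebraic (G K k)"
    "\<And>K b d D. a * d - b * c = 1 \<Longrightarrow> D \<ge> 1 \<Longrightarrow> expands a b c d D K (G K)" by blast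
  have G_eq: "G k k = G K k" if "k \<le> K" for k K
    by (rule expands_unique[OF c order.refl G(2)[OF det0] expands_mono[OF c that G(2)[OF det0]]]) auto
  show ?thesis
  proof (rule that[of "Abs_fps (\<lambda>k. G k k)"])
    show "algebraic (fps_nth (Abs_fps (\<lambda>k. G k k)) k)" for k using G(1) by simp
    fix b d D K assume "a * d - b * c = 1" "D \<ge> (1::nat)"
    then have "expands a b c d D K (G K)" by (rule G(2))
    then show "expands a b c d D K (fps_nth (Abs_fps (\<lambda>k. G k k)))"
      by (simp add: expands_def G_eq)
  qed
qed

definition modular_series :: "rat \<Rightarrow> complex fps \<Rightarrow> bool" where
  "modular_series x \<phi> \<longleftrightarrow> (\<forall>k. algebraic (fps_nth \<phi> k)) \<and>
     (\<forall>a b c d D K. a * d - b * c = 1 \<longrightarrow> c > 0 \<longrightarrow> of_int a / of_int c = x \<longrightarrow> D \<ge> 1 \<longrightarrow>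
       expands a b c d D K (fps_nth \<phi>))"

text \<open>In lowest terms \<open>x\<close> determines \<open>a\<close> and \<open>c\<close>, so \<open>all_orders_exists\<close> settles all matrices over \<open>x\<close>.\<close>
lemma modular_series_exists: "\<exists>\<phi>. modular_series x \<phi>"
proof (cases "\<exists>a b c d. a * d - b * c = 1 \<and> c > 0 \<and> of_int a / of_int c = x")
  case True
  then obtain a b c d where g: "a * d - b * c = 1" "c > 0" "of_int a / of_int c = x" by blast
  obtain \<phi> :: "complex fps" where \<phi>: "\<And>k. algebraic (fps_nth \<phi> k)"
    "\<And>b d D K. a * d - b * c = 1 \<Longrightarrow> D \<ge> 1 \<Longrightarrow> expands a b c d D K (fps_nth \<phi>)"
    using all_orders_exists[OF g(1,2)] by blast
  have same: "a' = a \<and> c' = c" if g': "a' * d' - b' * c' = 1" "c' > 0" "of_int a' / of_int c' = x" for a' b' c' d'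
  proof -
    have "(of_int a :: rat) * of_int c' = of_int a' * of_int c" using g g' by (auto simp: field_simps)
    then have eq: "a * c' = a' * c" by (metis of_int_eq_iff of_int_mult)
    have "c = c * (a' * d' - b' * c')" using g' by simp
    also have "\<dots> = c' * (a * d' - b' * c)" using eq by (simp add: algebra_simps)
    finally have 1: "c' dvd c" by (metis dvd_triv_left)
    have "c' = c' * (a * d - b * c)" using g by simp
    also have "\<dots> = c * (a' * d - b * c')" using eq by (simp add: algebra_simps)
    finally have "c dvd c'" by (metis dvd_triv_left)
    then have "c' = c" using 1 g g' by (simp add: zdvd_antisym_nonneg)
    then show ?thesis using eq g by simp
  qed
  have "modular_series x \<phi>"
    unfolding modular_series_def
  proof (intro conjI allI impI)
    fix a' b' c' d' :: int and D K :: nat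
    assume g': "a' * d' - b' * c' = 1" "c' > 0" "of_int a' / of_int c' = x" and "D \<ge> 1"
    then show "expands a' b' c' d' D K (fps_nth \<phi>)" using \<phi>(2)[of d' b' D K] same[OF g'] by simp
  qed (rule \<phi>(1))
  then show ?thesis by blast
next
  case False
  then have "modular_series x 0" unfolding modular_series_def by auto
  then show ?thesis by blast
qed

theorem mainTheorem1:
  shows "\<exists>\<Phi> :: rat \<Rightarrow> complex fps.
    (\<forall>\<alpha>. \<Phi> (\<alpha> + 1) = \<Phi> \<alpha>) \<and>
    (\<forall>\<alpha> k. algebraic (fps_nth (\<Phi> \<alpha>) k)) \<and>
    (\<forall>a b c d :: int. a * d - b * c = 1 \<longrightarrow> c > 0 \<longrightarrow>
      (\<forall>D K :: nat. D \<ge> 1 \<longrightarrow>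
        (\<lambda>X :: rat.
            complex_of_real
              (J ((of_int a * X + of_int b) / (of_int c * X + of_int d)) /
               ((real_of_int c * real_of_rat X + real_of_int d) powr (3 / 2) * J X *
                exp (vol_figure_eight / (2 * pi) *
                  (real_of_rat X + real_of_int d / real_of_int c))))
            - (\<Sum>k=0..K. fps_nth (\<Phi> (of_int a / of_int c)) k *
                (2 * complex_of_real pi * \<i> /
                  (of_int c * (of_int c * of_rat X + of_int d))) ^ k))
        \<in> O[at_top_denom_le D](\<lambda>X. 1 / of_rat X ^ (K + 1))))"
proof -
  define \<Psi> :: "rat \<Rightarrow> complex fps" where "\<Psi> x = (SOME \<phi>. modular_series x \<phi>)" for x
  have "modular_series x (\<Psi> x)" for x unfolding \<Psi>_def using modular_series_exists by (rule someI_ex)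
  then have \<Psi>: "\<And>x k. algebraic (fps_nth (\<Psi> x) k)"
    "\<And>x a b c d D K. a * d - b * c = 1 \<Longrightarrow> c > 0 \<Longrightarrow> of_int a / of_int c = x \<Longrightarrow> D \<ge> 1 \<Longrightarrow> expands a b c d D K (fps_nth (\<Psi> x))"
    by (simp_all add: modular_series_def)
  \<comment> \<open>Subtracting a multiple of the lower row from the upper row moves \<open>a / c\<close> into \<open>[0, 1)\<close> and shifts the image of \<open>X\<close> by an
  integer, which \<open>J\<close> does not see.\<close>
  have main: "expands a b c d D K (fps_nth (\<Psi> (frac (of_int a / of_int c))))"
    if g: "a * d - b * c = 1" "c > 0" "D \<ge> 1" for a b c d :: int and D K :: nat
  proof -
    define t where "t = \<lfloor>of_int a / (of_int c :: rat)\<rfloor>"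
    have fr: "of_int (a - t * c) / of_int c = frac (of_int a / (of_int c :: rat))"
      using g by (simp add: frac_def t_def diff_divide_distrib)
    have "expands (a - t * c) (b - t * d) c d D K (fps_nth (\<Psi> (frac (of_int a / of_int c))))"
      by (rule \<Psi>(2)[OF _ g(2) fr g(3)]) (use g in \<open>simp add: algebra_simps\<close>)
    moreover have "\<forall>\<^sub>F X in at_top_denom_le D. modular_ratio (a - t * c) (b - t * d) c d X = modular_ratio a b c d X"
      using eventually_at_top_denom_le[of D "1 + 2 * \<bar>real_of_int d\<bar>"]
    proof eventually_elim
      case (elim X)
      have "of_int c * real_of_rat X + of_int d > 0" using c_X_d_bounds(1)[OF g(2), of d "real_of_rat X"] elim by linarith
      then have "real_of_rat (of_int c * X + of_int d) > 0" by (simp add: of_rat_add of_rat_mult)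
      then have "of_int c * X + of_int d \<noteq> 0" by auto
      then have "(of_int (a - t * c) * X + of_int (b - t * d)) / (of_int c * X + of_int d)
          = (of_int a * X + of_int b) / (of_int c * X + of_int d) - of_int t"
        by (simp add: field_simps)
      then show ?case by (simp only: modular_ratio_def J_minus_int)
    qed
    ultimately show ?thesis unfolding expands_def
      by (subst landau_o.big.in_cong[where g = "\<lambda>X. modular_ratio (a - t * c) (b - t * d) c d X - (\<Sum>k=0..K. fps_nth (\<Psi> (frac (of_int a / of_int c))) k * q_param c d X ^ k)"])
        (auto elim: eventually_mono)
  qed
  show ?thesis
  proof (rule exI[of _ "\<lambda>\<alpha>. \<Psi> (frac \<alpha>)"], intro conjI allI impI)
    show "\<Psi> (frac (\<alpha> + 1)) = \<Psi> (frac \<alpha>)" for \<alpha> by (simp only: frac_1_eq)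
    show "algebraic (fps_nth (\<Psi> (frac \<alpha>)) k)" for \<alpha> k by (rule \<Psi>(1))
  qed (rule main[unfolded expands_def modular_ratio_def q_param_def])
qed

end
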